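(* Let $(M,g)$ be a smooth, compact, connected Riemannian manifold without boundary and let $b_\omega$ be a continuous nonnegative function on $M$ such that $\omega=\{b_\omega>0\}$ has closure $\overline\omega\ne M$. Then there is a potential $V\in C^\infty(M,(0,\infty))$ with $\|V\|_{L^\infty(M)}=1$ such that $$\exists\,\mathsf C_\star>0,\ \forall T>0,\ \forall\lambda\ge1,\qquad \mathfrak C_{\mathrm{obs}}^{\mathrm{opt}}(\lambda,V,T)\ge \mathsf C_\star\,T^{-1}e^{\mathsf C_\star\sqrt\lambda}.$$
   Context: The optimal observability cost is $$\mathfrak C_{\mathrm{obs}}^{\mathrm{opt}}(\lambda,V,T):=\sup_{(u_0,u_1)\in H^1(M)\times L^2(M),\ (u_0,u_1)\neq(0,0)}\ \frac{\mathscr E_{\lambda V}(u_0,u_1)}{\int_0^T\|b_\omega\,\partial_tu_\lambda(t)\|_{L^2(M)}^2\,dt}\ \in(0,\infty]$$ (the quotient being $+\infty$ if the denominator vanishes), where $u_\lambda\in C^0((0,T),H^1(M))\cap C^1((0,T),L^2(M))$ solves $\partial_t^2u-\Delta_gu+\lambda Vu=0$ with $(u,\partial_tu)|_{t=0}=(u_0,u_1)$, $\Delta_g$ is the (nonpositive) Laplace–Beltrami operator, and for a potential $\mathsf V>0$ $$\mathscr E_{\mathsf V}(u_0,u_1)=\tfrac12\Big(\int_M|\nabla_gu_0|_g^2+\mathsf V|u_0|^2\,dx+\int_M|u_1|^2\,dx\Big).$$ *)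

theory Defs
  imports "HOL-Analysis.Analysis" "HOL-Probability.Essential_Supremum"
begin

section \<open>Smooth maps between Euclidean spaces\<close>

text \<open>Meant for open sets \<open>S\<close> only: derivatives are two-sided. As the predicate demands that all
  directional derivatives are again $C^n$, it is the usual notion of $C^{n+1}$ there.\<close>

fun Ck_on :: "nat \<Rightarrow> 'a::real_normed_vector set \<Rightarrow> ('a \<Rightarrow> 'b::real_normed_vector) \<Rightarrow> bool" where
  "Ck_on 0 S f \<longleftrightarrow> continuous_on S f"
| "Ck_on (Suc n) S f \<longleftrightarrow>
     (\<forall>x\<in>S. f differentiable (at x)) \<and>
     (\<forall>v. Ck_on n S (\<lambda>x. frechet_derivative f (at x) v))"

definition smooth_on :: "'a::real_normed_vector set \<Rightarrow> ('a \<Rightarrow> 'b::real_normed_vector) \<Rightarrow> bool" where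
  "smooth_on S f \<longleftrightarrow> (\<forall>n. Ck_on n S f)"

section \<open>Smooth manifolds\<close>

text \<open>The manifold is a whole type \<open>'m\<close>; its dimension is \<open>CARD('n)\<close>. A chart is its
  domain together with the coordinate map, whose values off the domain are irrelevant. The smooth
  structure is given by any smooth atlas, not necessarily a maximal one.\<close>

type_synonym ('m, 'n) chart = "'m set \<times> ('m \<Rightarrow> real ^ 'n)"

definition chart_inv :: "('m, 'n) chart \<Rightarrow> real ^ 'n \<Rightarrow> 'm" where
  "chart_inv c = inv_into (fst c) (snd c)"

definition is_chart :: "('m::topological_space, 'n::finite) chart \<Rightarrow> bool" where
  "is_chart c \<longleftrightarrow> open (fst c) \<and> open (snd c ` fst c) \<and>
     homeomorphism (fst c) (snd c ` fst c) (snd c) (chart_inv c)"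

definition transition :: "('m, 'n) chart \<Rightarrow> ('m, 'n) chart \<Rightarrow> real ^ 'n \<Rightarrow> real ^ 'n" where
  "transition c d = snd d \<circ> chart_inv c"

definition smooth_atlas :: "('m::{t2_space, second_countable_topology}, 'n::finite) chart set \<Rightarrow> bool" where
  "smooth_atlas A \<longleftrightarrow>
     (\<forall>c\<in>A. is_chart c) \<and> (\<Union>c\<in>A. fst c) = UNIV \<and>
     (\<forall>c\<in>A. \<forall>d\<in>A. smooth_on (snd c ` (fst c \<inter> fst d)) (transition c d))"

definition jacobian :: "('m, 'n::finite) chart \<Rightarrow> ('m, 'n) chart \<Rightarrow> 'm \<Rightarrow> real ^ 'n ^ 'n" where
  "jacobian c d p = matrix (frechet_derivative (transition c d) (at (snd c p)))"

definition chart_at :: "('m, 'n) chart set \<Rightarrow> 'm \<Rightarrow> ('m, 'n) chart" where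
  "chart_at A p = (SOME c. c \<in> A \<and> p \<in> fst c)"

definition partial :: "('m, 'n::finite) chart \<Rightarrow> 'n \<Rightarrow> ('m \<Rightarrow> real) \<Rightarrow> 'm \<Rightarrow> real" where
  "partial c i f p = frechet_derivative (\<lambda>y. f (chart_inv c y)) (at (snd c p)) (axis i 1)"

text \<open>Tensor fields are families \<open>F\<close> of components: \<open>F c p\<close> is the value at the point \<open>p\<close> in
  the chart \<open>c\<close> (meaningful for \<open>p \<in> fst c\<close>), subject to the respective transformation law.\<close>

definition smooth_components ::
    "('m, 'n::finite) chart set \<Rightarrow> (('m, 'n) chart \<Rightarrow> 'm \<Rightarrow> 'b::real_normed_vector) \<Rightarrow> bool" where
  "smooth_components A F \<longleftrightarrow> (\<forall>c\<in>A. smooth_on (snd c ` fst c) (\<lambda>y. F c (chart_inv c y)))"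

definition smooth_fun :: "('m, 'n::finite) chart set \<Rightarrow> ('m \<Rightarrow> real) \<Rightarrow> bool" where
  "smooth_fun A f \<longleftrightarrow> smooth_components A (\<lambda>_. f)"

type_synonym ('m, 'n) vfield = "('m, 'n) chart \<Rightarrow> 'm \<Rightarrow> real ^ 'n"

definition vector_field :: "('m, 'n::finite) chart set \<Rightarrow> ('m, 'n) vfield \<Rightarrow> bool" where
  "vector_field A X \<longleftrightarrow>
     (\<forall>c\<in>A. \<forall>d\<in>A. \<forall>p\<in>fst c \<inter> fst d. X d p = jacobian c d p *v X c p)"

type_synonym ('m, 'n) metric = "('m, 'n) chart \<Rightarrow> 'm \<Rightarrow> real ^ 'n ^ 'n"

definition riemannian_metric :: "('m, 'n::finite) chart set \<Rightarrow> ('m, 'n) metric \<Rightarrow> bool" where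
  "riemannian_metric A g \<longleftrightarrow>
     smooth_components A g \<and>
     (\<forall>c\<in>A. \<forall>p\<in>fst c. transpose (g c p) = g c p \<and> (\<forall>v. v \<noteq> 0 \<longrightarrow> v \<bullet> (g c p *v v) > 0)) \<and>
     (\<forall>c\<in>A. \<forall>d\<in>A. \<forall>p\<in>fst c \<inter> fst d.
        g c p = transpose (jacobian c d p) ** g d p ** jacobian c d p)"

section \<open>Riemannian volume, gradient, divergence, Laplace--Beltrami operator\<close>

text \<open>The objects below that are computed in \<open>chart_at A p\<close> do not depend on the choice of that
  chart, by the transformation laws.\<close>

definition riem_inner ::
    "('m, 'n::finite) chart set \<Rightarrow> ('m, 'n) metric \<Rightarrow> ('m, 'n) vfield \<Rightarrow> ('m, 'n) vfield \<Rightarrow> 'm \<Rightarrow> real" where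
  "riem_inner A g X Y p = (let c = chart_at A p in X c p \<bullet> (g c p *v Y c p))"

definition vol_density :: "('m, 'n::finite) metric \<Rightarrow> ('m, 'n) chart \<Rightarrow> 'm \<Rightarrow> real" where
  "vol_density g c p = sqrt (det (g c p))"

definition riem_volume ::
    "('m::{t2_space, second_countable_topology}, 'n::finite) chart set \<Rightarrow> ('m, 'n) metric \<Rightarrow> 'm measure" where
  "riem_volume A g = (THE \<mu>. sets \<mu> = sets borel \<and>
     (\<forall>c\<in>A. \<forall>B\<in>sets borel. B \<subseteq> fst c \<longrightarrow>
        emeasure \<mu> B =
          (\<integral>\<^sup>+ y. ennreal (vol_density g c (chart_inv c y)) * indicator (snd c ` B) y \<partial>lborel)))"

definition gradient :: "('m, 'n::finite) metric \<Rightarrow> ('m \<Rightarrow> real) \<Rightarrow> ('m, 'n) vfield" where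
  "gradient g f = (\<lambda>c p. matrix_inv (g c p) *v (\<chi> i. partial c i f p))"

definition divergence ::
    "('m, 'n::finite) chart set \<Rightarrow> ('m, 'n) metric \<Rightarrow> ('m, 'n) vfield \<Rightarrow> 'm \<Rightarrow> real" where
  "divergence A g X p = (let c = chart_at A p in
     (\<Sum>i\<in>UNIV. partial c i (\<lambda>q. vol_density g c q * X c q $ i) p) / vol_density g c p)"

definition laplace_beltrami ::
    "('m, 'n::finite) chart set \<Rightarrow> ('m, 'n) metric \<Rightarrow> ('m \<Rightarrow> real) \<Rightarrow> 'm \<Rightarrow> real" where
  "laplace_beltrami A g f = divergence A g (gradient g f)"

section \<open>The spaces $L^2(M)$ and $H^1(M)$\<close>

text \<open>Elements are represented by Borel functions, so equality of elements is equality almost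
  everywhere.\<close>

definition L2 ::
    "('m::{t2_space, second_countable_topology}, 'n::finite) chart set \<Rightarrow> ('m, 'n) metric \<Rightarrow> ('m \<Rightarrow> real) \<Rightarrow> bool" where
  "L2 A g u \<longleftrightarrow> u \<in> borel_measurable borel \<and> integrable (riem_volume A g) (\<lambda>x. (u x)\<^sup>2)"

definition L2_norm ::
    "('m::{t2_space, second_countable_topology}, 'n::finite) chart set \<Rightarrow> ('m, 'n) metric \<Rightarrow> ('m \<Rightarrow> real) \<Rightarrow> real" where
  "L2_norm A g u = sqrt (LINT x|riem_volume A g. (u x)\<^sup>2)"

text \<open>\<open>X\<close> is the distributional gradient of \<open>u\<close>, and it is square integrable.\<close>

definition is_weak_gradient ::
    "('m::{t2_space, second_countable_topology}, 'n::finite) chart set \<Rightarrow> ('m, 'n) metric \<Rightarrow>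
      ('m \<Rightarrow> real) \<Rightarrow> ('m, 'n) vfield \<Rightarrow> bool" where
  "is_weak_gradient A g u X \<longleftrightarrow>
     vector_field A X \<and>
     (\<forall>c\<in>A. X c \<in> borel_measurable (restrict_space borel (fst c))) \<and>
     integrable (riem_volume A g) (riem_inner A g X X) \<and>
     (\<forall>Y. vector_field A Y \<longrightarrow> smooth_components A Y \<longrightarrow>
        (LINT x|riem_volume A g. u x * divergence A g Y x) =
          - (LINT x|riem_volume A g. riem_inner A g X Y x))"

definition H1 ::
    "('m::{t2_space, second_countable_topology}, 'n::finite) chart set \<Rightarrow> ('m, 'n) metric \<Rightarrow> ('m \<Rightarrow> real) \<Rightarrow> bool" where
  "H1 A g u \<longleftrightarrow> L2 A g u \<and> (\<exists>X. is_weak_gradient A g u X)"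

text \<open>Determined up to a null set only, which the integrals below do not see.\<close>

definition weak_gradient ::
    "('m::{t2_space, second_countable_topology}, 'n::finite) chart set \<Rightarrow> ('m, 'n) metric \<Rightarrow>
      ('m \<Rightarrow> real) \<Rightarrow> ('m, 'n) vfield" where
  "weak_gradient A g u = (SOME X. is_weak_gradient A g u X)"

definition grad_norm_sq ::
    "('m::{t2_space, second_countable_topology}, 'n::finite) chart set \<Rightarrow> ('m, 'n) metric \<Rightarrow>
      ('m \<Rightarrow> real) \<Rightarrow> 'm \<Rightarrow> real" where
  "grad_norm_sq A g u = riem_inner A g (weak_gradient A g u) (weak_gradient A g u)"

definition H1_norm ::
    "('m::{t2_space, second_countable_topology}, 'n::finite) chart set \<Rightarrow> ('m, 'n) metric \<Rightarrow> ('m \<Rightarrow> real) \<Rightarrow> real" where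
  "H1_norm A g u = sqrt (LINT x|riem_volume A g. (u x)\<^sup>2 + grad_norm_sq A g u x)"

section \<open>The wave equation with potential and the observability cost\<close>

text \<open>\<open>W\<close> is the full potential (later \<open>\<lambda>V\<close>).\<close>

definition energy ::
    "('m::{t2_space, second_countable_topology}, 'n::finite) chart set \<Rightarrow> ('m, 'n) metric \<Rightarrow>
      ('m \<Rightarrow> real) \<Rightarrow> ('m \<Rightarrow> real) \<Rightarrow> ('m \<Rightarrow> real) \<Rightarrow> real" where
  "energy A g W u0 u1 =
     1/2 * ((LINT x|riem_volume A g. grad_norm_sq A g u0 x + W x * (u0 x)\<^sup>2) +
            (LINT x|riem_volume A g. (u1 x)\<^sup>2))"

text \<open>\<open>u\<close> solves $\partial_t^2 u - \Delta_g u + W u = 0$ on \<open>[0,T]\<close> with data \<open>(u0,u1)\<close>, is of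
  class $C^0(H^1) \cap C^1(L^2)$, and \<open>v\<close> is its time derivative. At this regularity
  $\Delta_g u(t)$ is a distribution on $M$, so the equation is tested against smooth \<open>\<phi>\<close>.\<close>

definition wave_solution ::
    "('m::{t2_space, second_countable_topology}, 'n::finite) chart set \<Rightarrow> ('m, 'n) metric \<Rightarrow>
      ('m \<Rightarrow> real) \<Rightarrow> real \<Rightarrow> ('m \<Rightarrow> real) \<Rightarrow> ('m \<Rightarrow> real) \<Rightarrow>
      (real \<Rightarrow> 'm \<Rightarrow> real) \<Rightarrow> (real \<Rightarrow> 'm \<Rightarrow> real) \<Rightarrow> bool" where
  "wave_solution A g W T u0 u1 u v \<longleftrightarrow>
     (\<forall>t\<in>{0..T}. H1 A g (u t) \<and> L2 A g (v t)) \<and>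
     (\<forall>t\<in>{0..T}. ((\<lambda>s. H1_norm A g (\<lambda>x. u s x - u t x)) \<longlongrightarrow> 0) (at t within {0..T})) \<and>
     (\<forall>t\<in>{0..T}. ((\<lambda>s. L2_norm A g (\<lambda>x. (u s x - u t x) / (s - t) - v t x)) \<longlongrightarrow> 0)
        (at t within {0..T})) \<and>
     (\<forall>t\<in>{0..T}. ((\<lambda>s. L2_norm A g (\<lambda>x. v s x - v t x)) \<longlongrightarrow> 0) (at t within {0..T})) \<and>
     (AE x in riem_volume A g. u 0 x = u0 x) \<and>
     (AE x in riem_volume A g. v 0 x = u1 x) \<and>
     (\<forall>\<phi>. smooth_fun A \<phi> \<longrightarrow> (\<forall>t\<in>{0..T}.
        ((\<lambda>s. LINT x|riem_volume A g. v s x * \<phi> x) has_real_derivative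
           (LINT x|riem_volume A g. u t x * laplace_beltrami A g \<phi> x) -
           (LINT x|riem_volume A g. W x * u t x * \<phi> x)) (at t within {0..T})))"

definition observation ::
    "('m::{t2_space, second_countable_topology}, 'n::finite) chart set \<Rightarrow> ('m, 'n) metric \<Rightarrow>
      ('m \<Rightarrow> real) \<Rightarrow> real \<Rightarrow> (real \<Rightarrow> 'm \<Rightarrow> real) \<Rightarrow> ennreal" where
  "observation A g b T v =
     (\<integral>\<^sup>+ t\<in>{0..T}. (\<integral>\<^sup>+ x. ennreal ((b x * v t x)\<^sup>2) \<partial>riem_volume A g) \<partial>lborel)"

text \<open>The supremum runs over the nonzero data; the solution \<open>u\<close> and its time derivative
  \<open>v\<close> are determined by them (almost everywhere, at each time).\<close>

definition obs_cost ::
    "('m::{t2_space, second_countable_topology}, 'n::finite) chart set \<Rightarrow> ('m, 'n) metric \<Rightarrow>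
      ('m \<Rightarrow> real) \<Rightarrow> real \<Rightarrow> ('m \<Rightarrow> real) \<Rightarrow> real \<Rightarrow> ennreal" where
  "obs_cost A g b lam V T = Sup
     {(if observation A g b T v = 0 then \<infinity>
       else ennreal (energy A g (\<lambda>x. lam * V x) u0 u1) / observation A g b T v) | u0 u1 u v.
        H1 A g u0 \<and> L2 A g u1 \<and>
        \<not> ((AE x in riem_volume A g. u0 x = 0) \<and> (AE x in riem_volume A g. u1 x = 0)) \<and>
        wave_solution A g (\<lambda>x. lam * V x) T u0 u1 u v}"

end

theory Submission
  imports Defs "HOL-Computational_Algebra.Polynomial" "HOL-Library.Diagonal_Subsequence"
begin

text \<open>Choose \<open>V = 1 - \<eta>/2\<close> with a bump \<open>\<eta>\<close> supported away from the closure of \<open>\<omega>\<close>, so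
  that \<open>\<lambda> V\<close> has a well of depth proportional to \<open>\<lambda>\<close> off \<open>\<omega>\<close>. The ground state \<open>\<phi>\<close> of
  $-\Delta_g + \lambda V$ has its eigenvalue \<open>\<mu>\<close> below \<open>\<lambda>\<close> by an amount of order \<open>\<lambda>\<close>, so that
  Agmon's estimate makes \<open>\<phi>\<close> of size $e^{-\kappa\sqrt\lambda}$ where \<open>\<eta> = 0\<close>, in particular on \<open>\<omega>\<close>,
  and the standing wave $\cos(\sqrt\mu\,t)\,\phi$ is hardly observed. The ground state is found by
  minimising the Rayleigh quotient over smooth functions: minimising sequences are Cauchy in $L^2$ by
  Rellich's theorem and then in $H^1$ by the parallelogram law for the nonnegative form
  $-\Delta_g + \lambda V - \mu$. Elliptic regularity is never needed, as Agmon's test functions can be applied to the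
  minimising sequence itself.\<close>

text \<open>The rate comes from balancing the two terms of Agmon's inequality: a weight
  \<open>exp (s * (1 - \<eta>))\<close> costs \<open>s\<^sup>2 * Gam \<eta> \<eta>\<close>, which
  may consume part of a spectral gap of order \<open>lam\<close>, so \<open>s\<close> may be of
  order \<open>sqrt lam\<close>. The factor \<open>inverse T\<close> appears because the velocity of
  the standing wave never exceeds sqrt \<mu> times |\<phi>|: the observation is at most T \<mu>
  times the integral of (b \<phi>)^2, while the energy is at least lam / 4. As \<mu> is at most a
  multiple of lam, the powers of lam cancel and only the exponential smallness remains. Much of the
  work is imposed by the definitions. The volume is a definite description, so a measure with the
  required values in all charts must be constructed and shown unique; the divergence is computed in
  an arbitrarily chosen chart, so Green's formula rests on its independence of the chart; the energy
  uses an arbitrarily chosen weak gradient, so the integral of its squared length must be shown not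
  to depend on the choice.\<close>

section \<open>Calculus of C^n and smooth maps on open sets\<close>

lemma Ck_on_cong:
  assumes "open S" "\<And>x. x \<in> S \<Longrightarrow> f x = g x" "Ck_on n S f"
  shows "Ck_on n S g"
  using assms(2,3)
proof (induction n arbitrary: f g)
  case 0
  then show ?case using continuous_on_cong[of S S f g] by simp
next
  case (Suc n)
  have D: "g differentiable (at x)" "frechet_derivative f (at x) = frechet_derivative g (at x)"
    if "x \<in> S" for x
  proof -
    have fx: "f differentiable (at x)" using Suc.prems that by simp
    then have "(f has_derivative frechet_derivative f (at x)) (at x)"
      by (simp add: frechet_derivative_works)
    then have "(g has_derivative frechet_derivative f (at x)) (at x)"
      using has_derivative_transform_within_open[OF _ assms(1) that] Suc.prems(1) by blast
    then show "g differentiable (at x)" "frechet_derivative f (at x) = frechet_derivative g (at x)"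
      by (auto simp: differentiable_def dest: frechet_derivative_at)
  qed
  show ?case
  proof (simp, intro conjI ballI allI)
    fix x assume "x \<in> S" then show "g differentiable (at x)" using D by blast
  next
    fix v
    show "Ck_on n S (\<lambda>x. frechet_derivative g (at x) v)"
      by (rule Suc.IH[of "\<lambda>x. frechet_derivative f (at x) v"]) (use D Suc.prems in auto)
  qed
qed

text \<open>Lets every induction below supply a derivative by a formula instead of handling
  \<open>frechet_derivative\<close>; uniqueness of the two-sided derivative identifies the
  two.\<close>

lemma Ck_on_SucI:
  assumes "open S" "\<And>x. x \<in> S \<Longrightarrow> (f has_derivative f' x) (at x)" "\<And>v. Ck_on n S (\<lambda>x. f' x v)"
  shows "Ck_on (Suc n) S f"
proof (simp, intro conjI ballI allI)
  fix x assume "x \<in> S" then show "f differentiable (at x)"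
    using assms(2) by (auto simp: differentiable_def)
next
  fix v show "Ck_on n S (\<lambda>x. frechet_derivative f (at x) v)"
    by (rule Ck_on_cong[OF assms(1) _ assms(3)]) (simp add: frechet_derivative_at[OF assms(2), symmetric])
qed

lemma Ck_on_SucD:
  assumes "Ck_on (Suc n) S f"
  shows "\<And>x. x \<in> S \<Longrightarrow> (f has_derivative frechet_derivative f (at x)) (at x)"
    "\<And>v. Ck_on n S (\<lambda>x. frechet_derivative f (at x) v)"
  using assms by (auto simp: frechet_derivative_works)

lemma Ck_on_imp_continuous: "Ck_on n S f \<Longrightarrow> continuous_on S f"
  by (cases n) (auto intro!: continuous_at_imp_continuous_on differentiable_imp_continuous_within)

lemma Ck_on_lower: "Ck_on (Suc n) S f \<Longrightarrow> Ck_on n S f"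
proof (induction n arbitrary: f)
  case 0
  then show ?case using Ck_on_imp_continuous[OF 0] by simp
next
  case (Suc n)
  have "\<forall>x\<in>S. f differentiable (at x)" using Suc.prems by simp
  moreover have "Ck_on n S (\<lambda>x. frechet_derivative f (at x) v)" for v
    by (rule Suc.IH[OF Ck_on_SucD(2)[OF Suc.prems]])
  ultimately show ?case by simp
qed

lemma Ck_on_subset: "Ck_on n S f \<Longrightarrow> T \<subseteq> S \<Longrightarrow> Ck_on n T f"
  by (induction n arbitrary: f) (auto intro: continuous_on_subset)

lemma Ck_on_Un:
  assumes "open S" "open T" "Ck_on n S f" "Ck_on n T f"
  shows "Ck_on n (S \<union> T) f"
  using assms by (induction n arbitrary: f) (auto intro: continuous_on_open_Un)

lemma Ck_on_const: "Ck_on n S (\<lambda>x. c)"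
  by (induction n arbitrary: c) auto

lemma Ck_on_bounded_linear:
  assumes "bounded_linear L" "open S" "Ck_on n S f"
  shows "Ck_on n S (\<lambda>x. L (f x))"
  using assms(3)
proof (induction n arbitrary: f)
  case 0
  then show ?case using bounded_linear.continuous_on[OF assms(1)] by simp
next
  case (Suc n)
  show ?case
    by (rule Ck_on_SucI[OF assms(2) bounded_linear.has_derivative[OF assms(1) Ck_on_SucD(1)[OF Suc.prems]]])
       (assumption, rule Suc.IH[OF Ck_on_SucD(2)[OF Suc.prems]])
qed

lemma Ck_on_add:
  assumes "open S" "Ck_on n S f" "Ck_on n S g"
  shows "Ck_on n S (\<lambda>x. f x + g x)"
  using assms(2,3)
proof (induction n arbitrary: f g)
  case 0
  then show ?case by (simp add: continuous_on_add)
next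
  case (Suc n)
  show ?case
    by (rule Ck_on_SucI[OF assms(1) has_derivative_add[OF Ck_on_SucD(1)[OF Suc.prems(1)] Ck_on_SucD(1)[OF Suc.prems(2)]]])
       (assumption, assumption, rule Suc.IH[OF Ck_on_SucD(2)[OF Suc.prems(1)] Ck_on_SucD(2)[OF Suc.prems(2)]])
qed

text \<open>One product rule for multiplication, scaling and inner products. Both terms of the
  derivative pair an undifferentiated factor with a directional derivative of the other; both are
  C^n, the former by \<open>Ck_on_lower\<close>.\<close>

lemma Ck_on_bilinear:
  assumes "bounded_bilinear B" "open S" "Ck_on n S f" "Ck_on n S g"
  shows "Ck_on n S (\<lambda>x. B (f x) (g x))"
  using assms(3,4)
proof (induction n arbitrary: f g)
  case 0
  then show ?case using bounded_bilinear.continuous_on[OF assms(1)] by simp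
next
  case (Suc n)
  show ?case
  proof (rule Ck_on_SucI[OF assms(2) bounded_bilinear.FDERIV[OF assms(1) Ck_on_SucD(1)[OF Suc.prems(1)] Ck_on_SucD(1)[OF Suc.prems(2)]]])
    fix v
    show "Ck_on n S (\<lambda>x. B (f x) (frechet_derivative g (at x) v) + B (frechet_derivative f (at x) v) (g x))"
      by (intro Ck_on_add assms Suc.IH Ck_on_SucD(2)[OF Suc.prems(1)] Ck_on_SucD(2)[OF Suc.prems(2)]
        Ck_on_lower[OF Suc.prems(1)] Ck_on_lower[OF Suc.prems(2)])
  qed
qed

lemma Ck_on_sum:
  assumes "open S" "\<And>i. i \<in> I \<Longrightarrow> Ck_on n S (f i)"
  shows "Ck_on n S (\<lambda>x. \<Sum>i\<in>I. f i x)"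
  using assms(2) by (induction I rule: infinite_finite_induct) (auto intro!: Ck_on_const Ck_on_add assms(1))

text \<open>\<open>Ck_on\<close> only speaks of derivatives in fixed directions, whereas the chain
  rule evaluates the derivative of \<open>h\<close> in a direction that moves with x. Expanding that
  direction in \<open>Basis\<close> leaves fixed directions with scalar C^n coefficients; this is
  why the middle space is Euclidean.\<close>

lemma Ck_on_compose:
  fixes f :: "'a::real_normed_vector \<Rightarrow> 'b::euclidean_space"
  assumes "open S" "open T" "f ` S \<subseteq> T" "Ck_on n S f" "Ck_on n T h"
  shows "Ck_on n S (\<lambda>x. h (f x))"
  using assms(4,5)
proof (induction n arbitrary: h)
  case 0
  then show ?case
    unfolding Ck_on.simps using continuous_on_compose2[OF _ _ assms(3), of h] by blast
next
  case (Suc n)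
  let ?f' = "\<lambda>x. frechet_derivative f (at x)" and ?h' = "\<lambda>y. frechet_derivative h (at y)"
  have D: "((\<lambda>x. h (f x)) has_derivative (\<lambda>v. \<Sum>b\<in>Basis. (?f' x v \<bullet> b) *\<^sub>R ?h' (f x) b)) (at x)"
    if "x \<in> S" for x
  proof -
    have hd: "(h has_derivative ?h' (f x)) (at (f x))"
      using Ck_on_SucD(1)[OF Suc.prems(2)] assms(3) that by blast
    have eq: "?h' (f x) w = (\<Sum>b\<in>Basis. (w \<bullet> b) *\<^sub>R ?h' (f x) b)" for w
    proof -
      have lin: "linear (?h' (f x))" using hd has_derivative_linear by blast
      have "?h' (f x) w = ?h' (f x) (\<Sum>b\<in>Basis. (w \<bullet> b) *\<^sub>R b)"
        by (simp only: euclidean_representation)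
      also have "\<dots> = (\<Sum>b\<in>Basis. (w \<bullet> b) *\<^sub>R ?h' (f x) b)"
        by (simp only: linear_sum[OF lin] linear_scale[OF lin] o_def)
      finally show ?thesis .
    qed
    show ?thesis
      by (rule has_derivative_eq_rhs[OF has_derivative_compose[OF Ck_on_SucD(1)[OF Suc.prems(1) that] hd]])
        (rule ext, rule eq)
  qed
  show ?case
  proof (rule Ck_on_SucI[OF assms(1) D], assumption)
    fix v
    have "Ck_on n S (\<lambda>x. ?f' x v \<bullet> b)" for b
      by (rule Ck_on_bounded_linear[OF bounded_linear_inner_left assms(1) Ck_on_SucD(2)[OF Suc.prems(1)]])
    moreover have "Ck_on n S (\<lambda>x. ?h' (f x) b)" for b
      by (rule Suc.IH[OF Ck_on_lower[OF Suc.prems(1)] Ck_on_SucD(2)[OF Suc.prems(2)]])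
    ultimately show "Ck_on n S (\<lambda>x. \<Sum>b\<in>Basis. (?f' x v \<bullet> b) *\<^sub>R ?h' (f x) b)"
      by (intro Ck_on_sum assms(1) Ck_on_bilinear[OF bounded_bilinear_scaleR assms(1)])
  qed
qed

lemma smooth_onD:
  assumes "smooth_on S f"
  shows "x \<in> S \<Longrightarrow> (f has_derivative frechet_derivative f (at x)) (at x)"
    "smooth_on S (\<lambda>x. frechet_derivative f (at x) v)" "continuous_on S f"
  using assms Ck_on_SucD[of 0 S f] Ck_on_SucD(2)[of _ S f v] Ck_on_imp_continuous[of 0 S f]
  unfolding smooth_on_def by auto

lemma smooth_on_cong: "open S \<Longrightarrow> (\<And>x. x \<in> S \<Longrightarrow> f x = g x) \<Longrightarrow> smooth_on S f \<Longrightarrow> smooth_on S g"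
  unfolding smooth_on_def using Ck_on_cong[of S f g] by simp

lemma smooth_on_subset: "smooth_on S f \<Longrightarrow> T \<subseteq> S \<Longrightarrow> smooth_on T f"
  unfolding smooth_on_def using Ck_on_subset[of _ S f T] by simp

lemma smooth_on_Un: "open S \<Longrightarrow> open T \<Longrightarrow> smooth_on S f \<Longrightarrow> smooth_on T f \<Longrightarrow> smooth_on (S \<union> T) f"
  unfolding smooth_on_def using Ck_on_Un[of S T _ f] by simp

lemma smooth_on_const: "smooth_on S (\<lambda>x. c)"
  unfolding smooth_on_def by (simp add: Ck_on_const)

lemma smooth_on_add: "open S \<Longrightarrow> smooth_on S f \<Longrightarrow> smooth_on S g \<Longrightarrow> smooth_on S (\<lambda>x. f x + g x)"
  unfolding smooth_on_def by (simp add: Ck_on_add)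

lemma smooth_on_sum: "open S \<Longrightarrow> (\<And>i. i \<in> I \<Longrightarrow> smooth_on S (f i)) \<Longrightarrow> smooth_on S (\<lambda>x. \<Sum>i\<in>I. f i x)"
  unfolding smooth_on_def by (simp add: Ck_on_sum)

lemma smooth_on_bounded_linear:
  assumes "bounded_linear L" "open S" "smooth_on S f"
  shows "smooth_on S (\<lambda>x. L (f x))"
  using assms(3) Ck_on_bounded_linear[OF assms(1,2)] unfolding smooth_on_def by blast

lemma smooth_on_mult:
  fixes f g :: "_ \<Rightarrow> real"
  shows "open S \<Longrightarrow> smooth_on S f \<Longrightarrow> smooth_on S g \<Longrightarrow> smooth_on S (\<lambda>x. f x * g x)"
  unfolding smooth_on_def using Ck_on_bilinear[OF bounded_bilinear_mult, of S _ f g] by simp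

lemma smooth_on_scaleR:
  "open S \<Longrightarrow> smooth_on S f \<Longrightarrow> smooth_on S g \<Longrightarrow> smooth_on S (\<lambda>x. f x *\<^sub>R g x)"
  unfolding smooth_on_def using Ck_on_bilinear[OF bounded_bilinear_scaleR, of S _ f g] by simp

lemma smooth_on_inner:
  "open S \<Longrightarrow> smooth_on S f \<Longrightarrow> smooth_on S g \<Longrightarrow> smooth_on S (\<lambda>x. f x \<bullet> g x)"
  unfolding smooth_on_def using Ck_on_bilinear[OF bounded_bilinear_inner, of S _ f g] by simp

lemma smooth_on_prod:
  fixes f :: "'i \<Rightarrow> _ \<Rightarrow> real"
  assumes "open S" "\<And>i. i \<in> I \<Longrightarrow> smooth_on S (f i)"
  shows "smooth_on S (\<lambda>x. \<Prod>i\<in>I. f i x)"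
  using assms(2)
  by (induction I rule: infinite_finite_induct) (auto intro!: smooth_on_const smooth_on_mult assms(1))

lemma smooth_on_compose:
  fixes f :: "'a::real_normed_vector \<Rightarrow> 'b::euclidean_space"
  shows "open S \<Longrightarrow> open T \<Longrightarrow> f ` S \<subseteq> T \<Longrightarrow> smooth_on S f \<Longrightarrow> smooth_on T h \<Longrightarrow> smooth_on S (\<lambda>x. h (f x))"
  unfolding smooth_on_def using Ck_on_compose[of S T f _ h] by simp

lemma smooth_on_ident: "open S \<Longrightarrow> smooth_on S (\<lambda>x. x)"
  unfolding smooth_on_def
proof
  fix n assume "open S" then show "Ck_on n S (\<lambda>x. x)"
    by (cases n) (auto intro!: Ck_on_SucI[where f'="\<lambda>x v. v"] Ck_on_const)
qed

lemma smooth_on_vec_nth: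
  fixes f :: "'a::real_normed_vector \<Rightarrow> 'b::real_normed_vector ^ 'n::finite"
  shows "open S \<Longrightarrow> smooth_on S f \<Longrightarrow> smooth_on S (\<lambda>x. f x $ i)"
  by (rule smooth_on_bounded_linear[OF bounded_linear_vec_nth])

lemma bounded_linear_axis: "bounded_linear (\<lambda>x::'b::real_normed_vector. axis i x :: 'b ^ 'n::finite)"
proof (rule bounded_linear_intro[where K=1])
  fix x y :: 'b and r :: real
  show "axis i (x + y) = axis i x + (axis i y :: 'b ^ 'n)" by (simp add: axis_def vec_eq_iff)
  show "axis i (r *\<^sub>R x) = r *\<^sub>R (axis i x :: 'b ^ 'n)" by (simp add: axis_def vec_eq_iff)
  show "norm (axis i x :: 'b ^ 'n) \<le> norm x * 1"
    by (simp add: norm_vec_def axis_def L2_set_def if_distrib if_distribR cong: if_cong)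
qed

lemma vec_eq_sum_axis: "(x :: 'b::real_normed_vector ^ 'n::finite) = (\<Sum>i\<in>UNIV. axis i (x $ i))"
  by (simp add: vec_eq_iff axis_def if_distrib cong: if_cong)

lemma smooth_on_vec:
  fixes f :: "'a::real_normed_vector \<Rightarrow> 'b::real_normed_vector ^ 'n::finite"
  assumes "open S" "\<And>i. smooth_on S (\<lambda>x. f x $ i)"
  shows "smooth_on S f"
proof -
  have "smooth_on S (\<lambda>x. \<Sum>i\<in>UNIV. axis i (f x $ i))"
    by (intro smooth_on_sum assms smooth_on_bounded_linear[OF bounded_linear_axis])
  then show ?thesis by (simp flip: vec_eq_sum_axis)
qed

section \<open>Smooth elementary functions and a bump function\<close>

lemma smooth_on_exp: "smooth_on UNIV (exp :: real \<Rightarrow> real)"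
proof -
  \<comment> \<open>The factor \<open>c\<close> absorbs the directions of differentiation, which
    accumulate as scalars.\<close>
  have "Ck_on n UNIV (\<lambda>x. c * exp x :: real)" for n c
  proof (induction n arbitrary: c)
    case 0 show ?case unfolding Ck_on.simps by (intro continuous_intros)
  next
    case (Suc n)
    have "((\<lambda>x. c * exp x) has_derivative (\<lambda>v. c * v * exp x)) (at x)" for x :: real
      by (rule has_derivative_eq_rhs, (rule derivative_intros)+) auto
    from Ck_on_SucI[OF open_UNIV this Suc] show ?case .
  qed
  from this[of _ 1] show ?thesis unfolding smooth_on_def by simp
qed

text \<open>Derivatives of \<open>inverse\<close> are multiples of its own square, so the induction
  hypothesis applies to them. For \<open>sqrt\<close> below, the derivative is a multiple of
  \<open>inverse\<close> composed with \<open>sqrt\<close>, and again the hypothesis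
  suffices.\<close>

lemma smooth_on_inverse: "smooth_on {0<..} (inverse :: real \<Rightarrow> real)"
proof -
  have "Ck_on n {0<..} (inverse :: real \<Rightarrow> real)" for n
  proof (induction n)
    case 0 show ?case unfolding Ck_on.simps by (intro continuous_on_inverse continuous_on_id) auto
  next
    case (Suc n)
    have D: "(inverse has_derivative (\<lambda>v. - v * (inverse x * inverse x))) (at x)" if "x \<in> {0<..}" for x :: real
      using that by (auto intro!: derivative_eq_intros)
    have "Ck_on n {0<..} (\<lambda>x. - v * (inverse x * inverse x))" for v :: real
      by (intro Ck_on_bilinear[OF bounded_bilinear_mult] Ck_on_const Suc) auto
    from Ck_on_SucI[OF open_greaterThan D this] show ?case .
  qed
  then show ?thesis by (simp add: smooth_on_def)
qed

lemma smooth_on_sqrt: "smooth_on {0<..} sqrt"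
proof -
  have "Ck_on n {0<..} sqrt" for n
  proof (induction n)
    case 0 show ?case unfolding Ck_on.simps by (intro continuous_on_real_sqrt continuous_on_id)
  next
    case (Suc n)
    have D: "(sqrt has_derivative (\<lambda>v. v / 2 * inverse (sqrt x))) (at x)" if "x \<in> {0<..}" for x :: real
      by (rule has_derivative_eq_rhs[OF DERIV_real_sqrt[unfolded has_field_derivative_def]])
        (use that in \<open>auto simp: fun_eq_iff\<close>)
    have "Ck_on n {0<..} (\<lambda>x. inverse (sqrt x))"
      by (rule Ck_on_compose[OF open_greaterThan open_greaterThan _ Suc, where h=inverse])
        (use smooth_on_inverse in \<open>auto simp: smooth_on_def\<close>)
    then have "Ck_on n {0<..} (\<lambda>x. v / 2 * inverse (sqrt x))" for v :: real
      by (rule Ck_on_bilinear[OF bounded_bilinear_mult open_greaterThan Ck_on_const])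
    from Ck_on_SucI[OF open_greaterThan D this] show ?case .
  qed
  then show ?thesis by (simp add: smooth_on_def)
qed

text \<open>\<open>flat_exp [:1:]\<close> is the usual \<open>exp (- 1 / x)\<close>, flat at 0; the polynomial factor makes the family
  closed under differentiation.\<close>

definition flat_exp :: "real poly \<Rightarrow> real \<Rightarrow> real" where
  "flat_exp p x = (if x > 0 then poly p (inverse x) * exp (- inverse x) else 0)"

lemma flat_exp_tendsto: "((\<lambda>x. poly p (inverse x) * exp (- inverse x)) \<longlongrightarrow> 0) (at_right (0::real))"
proof -
  have "((\<lambda>x::real. \<Sum>k\<le>degree p. coeff p k * (x ^ k / exp x)) \<longlongrightarrow> (\<Sum>k\<le>degree p. coeff p k * 0)) at_top"
    by (intro tendsto_sum tendsto_mult tendsto_const tendsto_power_div_exp_0)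
  moreover have "(\<Sum>k\<le>degree p. coeff p k * (x ^ k / exp x)) = poly p x * exp (- x)" for x :: real
    by (simp add: poly_altdef exp_minus sum_distrib_right divide_inverse mult.assoc)
  ultimately have "((\<lambda>x::real. poly p x * exp (- x)) \<longlongrightarrow> 0) at_top" by simp
  then show ?thesis
    by (rule filterlim_compose[OF _ filterlim_inverse_at_top_right])
qed

text \<open>In the variable y = 1/x the derivative of p(y) exp(-y) is y^2 (p(y) - p'(y)) exp(-y),
  and \<open>[:0,0,1:]\<close> is the monomial y^2. At 0 the derivative exists because exp(-y) beats
  every polynomial as y grows.\<close>

lemma flat_exp_deriv:
  "(flat_exp p has_real_derivative flat_exp ([:0,0,1:] * (p - pderiv p)) x) (at x)"
proof -
  consider "x > 0" | "x < 0" | "x = 0" by linarith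
  then show ?thesis
  proof cases
    case 1
    have "((\<lambda>x. poly p (inverse x) * exp (- inverse x)) has_real_derivative
      flat_exp ([:0,0,1:] * (p - pderiv p)) x) (at x)"
      using 1 by (auto intro!: derivative_eq_intros DERIV_chain2[OF poly_DERIV]
        simp: flat_exp_def algebra_simps power2_eq_square)
    then show ?thesis
      by (rule has_field_derivative_transform_within_open[where S="{0<..}"]) (use 1 in \<open>auto simp: flat_exp_def\<close>)
  next
    case 2
    have "((\<lambda>x. 0) has_real_derivative 0) (at x)" by simp
    then have "(flat_exp p has_real_derivative 0) (at x)"
      by (rule has_field_derivative_transform_within_open[where S="{..<0}"]) (use 2 in \<open>auto simp: flat_exp_def\<close>)
    then show ?thesis using 2 by (simp add: flat_exp_def)
  next
    case 3
    \<comment> \<open>Division by y adds one factor 1/y, so the right difference quotient belongs to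
      the same family, with polynomial \<open>[:0,1:] * p\<close>.\<close>
    have "((\<lambda>y. (flat_exp p y - flat_exp p 0) / (y - 0)) \<longlongrightarrow> 0) (at_right 0)"
    proof (rule Lim_transform_eventually[OF flat_exp_tendsto[of "[:0,1:] * p"]])
      show "\<forall>\<^sub>F y in at_right 0. poly ([:0, 1:] * p) (inverse y) * exp (- inverse y) =
              (flat_exp p y - flat_exp p 0) / (y - 0)"
        unfolding eventually_at_right_field by (intro exI[of _ 1]) (auto simp: flat_exp_def field_simps)
    qed
    moreover have "((\<lambda>y. (flat_exp p y - flat_exp p 0) / (y - 0)) \<longlongrightarrow> 0) (at_left 0)"
    proof (rule Lim_transform_eventually[OF tendsto_const])
      show "\<forall>\<^sub>F y in at_left 0. 0 = (flat_exp p y - flat_exp p 0) / (y - 0)"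
        unfolding eventually_at_left_field by (intro exI[of _ "-1"]) (auto simp: flat_exp_def)
    qed
    ultimately have "((\<lambda>y. (flat_exp p y - flat_exp p 0) / (y - 0)) \<longlongrightarrow> 0) (at 0)"
      by (rule filterlim_split_at[rotated])
    then have "(flat_exp p has_real_derivative 0) (at 0)"
      by (simp add: has_field_derivative_iff)
    then show ?thesis using 3 by (simp add: flat_exp_def)
  qed
qed

lemma smooth_flat_exp: "smooth_on UNIV (flat_exp p)"
  unfolding smooth_on_def
proof
  fix n
  have "Ck_on n UNIV (\<lambda>x. c * flat_exp p x)" for c
  proof (induction n arbitrary: c p)
    case 0
    have "continuous_on UNIV (flat_exp p)"
      using flat_exp_deriv DERIV_isCont continuous_at_imp_continuous_on by blast
    then show ?case unfolding Ck_on.simps by (intro continuous_intros)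
  next
    case (Suc n)
    have "((\<lambda>x. c * flat_exp p x) has_derivative (\<lambda>v. c * v * flat_exp ([:0,0,1:] * (p - pderiv p)) x)) (at x)" for x
      using has_derivative_mult_right[OF flat_exp_deriv[of p x, unfolded has_field_derivative_def], of c]
      by (simp add: mult.assoc mult.commute[of "flat_exp _ _"])
    from Ck_on_SucI[OF open_UNIV this Suc] show ?case .
  qed
  from this[of 1] show "Ck_on n UNIV (flat_exp p)" by simp
qed

definition bump :: "real \<Rightarrow> real" where "bump = flat_exp [:1:]"

lemma smooth_bump: "smooth_on UNIV bump"
  and bump_pos_iff: "bump x > 0 \<longleftrightarrow> x > 0" and bump_nonneg: "bump x \<ge> 0" and bump_le_1: "bump x \<le> 1"
  unfolding bump_def using smooth_flat_exp by (auto simp: flat_exp_def)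

section \<open>Change of variables for nonnegative Borel functions\<close>

text \<open>The change of variables theorem of the library needs a well-ordered index type.\<close>

typedef 'a idx = "{..<CARD('a::finite)}"
  by (rule exI[of _ 0]) simp

instance idx :: (finite) finite
proof
  have "inj_on Rep_idx (UNIV :: 'a idx set)" by (simp add: inj_on_def Rep_idx_inject)
  moreover have "finite (range (Rep_idx :: 'a idx \<Rightarrow> nat))"
    using type_definition.Rep_range[OF type_definition_idx] by (metis finite_lessThan)
  ultimately show "finite (UNIV :: 'a idx set)" using finite_imageD by blast
qed

instantiation idx :: (finite) wellorder
begin
definition less_eq_idx :: "'a idx \<Rightarrow> 'a idx \<Rightarrow> bool" where "less_eq_idx x y \<longleftrightarrow> Rep_idx x \<le> Rep_idx y"
definition less_idx :: "'a idx \<Rightarrow> 'a idx \<Rightarrow> bool" where "less_idx x y \<longleftrightarrow> Rep_idx x < Rep_idx y"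
instance
proof
  fix P :: "'a idx \<Rightarrow> bool" and a
  assume step: "\<And>x. (\<And>y. y < x \<Longrightarrow> P y) \<Longrightarrow> P x"
  show "P a"
  proof (induction a rule: measure_induct_rule[of Rep_idx])
    case (less x)
    show ?case by (rule step, rule less) (simp only: less_idx_def)
  qed
qed (auto simp: less_eq_idx_def less_idx_def Rep_idx_inject)
end

lemma ex_bij_idx: "\<exists>\<pi> :: 'n::finite idx \<Rightarrow> 'n. bij \<pi>"
proof -
  have "CARD('n idx) = CARD('n)"
    using type_definition.card[OF type_definition_idx] by simp
  then show ?thesis using finite_same_card_bij[of "UNIV :: 'n idx set" "UNIV :: 'n set"] by auto
qed

text \<open>Rows and columns are relabelled simultaneously, so each permutation in the expansion of
  the determinant is merely conjugated by \<open>\<pi>\<close>, and conjugation keeps its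
  sign.\<close>

lemma det_reindex:
  fixes A :: "real ^ 'n ^ 'n" and \<pi> :: "'k::finite \<Rightarrow> 'n::finite"
  assumes "bij \<pi>"
  shows "det (\<chi> i j. A $ \<pi> i $ \<pi> j) = det A"
proof -
  let ?m = "map_permutation UNIV \<pi>"
  have inj: "inj \<pi>" and sur: "range \<pi> = UNIV" using assms by (auto simp: bij_def)
  have "bij_betw ?m {p. p permutes UNIV} {p. p permutes UNIV}"
  proof (rule bij_betw_byWitness[where f'="map_permutation UNIV (inv \<pi>)"])
    show "\<forall>p\<in>{p. p permutes UNIV}. map_permutation UNIV (inv \<pi>) (?m p) = p"
      using map_permutation_compose_inv[of \<pi> UNIV UNIV _ "inv \<pi>"] assms inj by auto
    show "\<forall>p\<in>{p. p permutes UNIV}. ?m (map_permutation UNIV (inv \<pi>) p) = p"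
      using map_permutation_compose_inv[of "inv \<pi>" UNIV UNIV _ \<pi>] assms bij_imp_bij_inv[OF assms]
      by (auto simp: surj_f_inv_f[OF sur])
    show "?m ` {p. p permutes UNIV} \<subseteq> {p. p permutes UNIV}"
      using map_permutation_permutes[of \<pi> UNIV UNIV] assms by auto
    show "map_permutation UNIV (inv \<pi>) ` {p. p permutes UNIV} \<subseteq> {p. p permutes UNIV}"
      using map_permutation_permutes[of "inv \<pi>" UNIV UNIV] bij_imp_bij_inv[OF assms] by auto
  qed
  then have "det A = (\<Sum>p\<in>{p. p permutes UNIV}. of_int (sign (?m p)) * (\<Prod>i\<in>UNIV. A $ i $ ?m p i))"
    unfolding det_def
    by (rule sum.reindex_bij_betw[of ?m "{p. p permutes UNIV}" "{p. p permutes UNIV}"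
      "\<lambda>p. of_int (sign p) * (\<Prod>i\<in>UNIV. A $ i $ p i)", symmetric])
  also have "\<dots> = (\<Sum>p\<in>{p. p permutes UNIV}. of_int (sign p) * (\<Prod>i\<in>UNIV. A $ \<pi> i $ \<pi> (p i)))"
  proof (rule sum.cong[OF refl], clarify)
    fix p :: "'k \<Rightarrow> 'k" assume p: "p permutes UNIV"
    have "(\<Prod>i\<in>UNIV. A $ i $ ?m p i) = (\<Prod>i\<in>UNIV. A $ \<pi> i $ ?m p (\<pi> i))"
      by (rule prod.reindex_bij_betw[OF assms, symmetric])
    then show "of_int (sign (?m p)) * (\<Prod>i\<in>UNIV. A $ i $ ?m p i) =
      of_int (sign p) * (\<Prod>i\<in>UNIV. A $ \<pi> i $ \<pi> (p i))"
      using p by (simp add: sign_map_permutation[OF inj p] map_permutation_apply[OF inj])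
  qed
  also have "\<dots> = det (\<chi> i j. A $ \<pi> i $ \<pi> j)"
    by (simp add: det_def)
  finally show ?thesis by simp
qed

text \<open>Bridge to the gauge integral, in which
  \<open>has_absolute_integral_change_of_variables\<close> is stated.\<close>

lemma nn_integral_eq_iff_has_integral:
  fixes f :: "'a::euclidean_space \<Rightarrow> real"
  assumes "f \<in> borel_measurable borel" "\<And>x. 0 \<le> f x" "0 \<le> r"
  shows "(\<integral>\<^sup>+x. f x \<partial>lborel) = ennreal r \<longleftrightarrow> (f has_integral r) UNIV"
  using nn_integral_has_integral[OF assms(1,2), of r] nn_integral_has_integral_lborel[OF assms(1,2), of r] assms(3)
  by auto

text \<open>For a nonnegative function, absolute integrability is the same as integrability, so the
  theorem for absolutely integrable maps shows that both sides take the same finite values; hence if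
  one is infinite, so is the other.\<close>

lemma nn_integral_change_of_variables_wellorder:
  fixes f :: "real^'n::{finite,wellorder} \<Rightarrow> real" and h :: "real^'n::_ \<Rightarrow> real^'n::_"
  assumes S: "S \<in> sets borel" and im: "h ` S \<in> sets borel"
    and h': "\<And>x. x \<in> S \<Longrightarrow> (h has_derivative h' x) (at x)" and inj: "inj_on h S"
    and f: "f \<in> borel_measurable borel" "\<And>x. 0 \<le> f x"
    and meas: "(\<lambda>x. if x \<in> S then \<bar>det (matrix (h' x))\<bar> * f (h x) else 0) \<in> borel_measurable borel"
  shows "(\<integral>\<^sup>+y. ennreal (if y \<in> h ` S then f y else 0) \<partial>lborel) =
    (\<integral>\<^sup>+x. ennreal (if x \<in> S then \<bar>det (matrix (h' x))\<bar> * f (h x) else 0) \<partial>lborel)" (is "?L = ?R")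
proof -
  let ?g = "\<lambda>x. \<bar>det (matrix (h' x))\<bar> * f (h x)"
  have A: "?L = ennreal r \<longleftrightarrow> ?R = ennreal r" if "0 \<le> r" for r
  proof -
    have 1: "?L = ennreal r \<longleftrightarrow> (f has_integral r) (h ` S)"
      using f that im
      by (subst nn_integral_eq_iff_has_integral) (auto simp: has_integral_restrict_UNIV)
    have 2: "?R = ennreal r \<longleftrightarrow> (?g has_integral r) S"
      using f that S meas
      by (subst nn_integral_eq_iff_has_integral) (auto simp: has_integral_restrict_UNIV)
    \<comment> \<open>The theorem concerns vector-valued maps; a real function is read as a map into
      \<open>real^1\<close>.\<close>
    have 3: "(\<lambda>x. \<bar>det (matrix (h' x))\<bar> *\<^sub>R (vec (f (h x)) :: real^1)) absolutely_integrable_on S \<and>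
       integral S (\<lambda>x. \<bar>det (matrix (h' x))\<bar> *\<^sub>R vec (f (h x))) = (vec r :: real^1)
     \<longleftrightarrow> (\<lambda>x. vec (f x) :: real^1) absolutely_integrable_on (h ` S) \<and> integral (h ` S) (\<lambda>x. vec (f x)) = (vec r :: real^1)"
      by (rule has_absolute_integral_change_of_variables)
        (use S inj h' in \<open>auto intro: has_derivative_at_withinI\<close>)
    have 4: "(u has_integral r) T \<longleftrightarrow> (\<lambda>x. vec (u x) :: real^1) absolutely_integrable_on T \<and>
        integral T (\<lambda>x. vec (u x) :: real^1) = vec r" if "\<And>x. x \<in> T \<Longrightarrow> 0 \<le> u x" for u :: "real^'n::_ \<Rightarrow> real" and T
      unfolding absolutely_integrable_on_1_iff integral_on_1_eq integrable_on_1_iff 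
      using that by (auto simp: has_integral_iff absolutely_integrable_on_iff_nonneg)
    have "(\<lambda>x. \<bar>det (matrix (h' x))\<bar> *\<^sub>R (vec (f (h x)) :: real^1)) = (\<lambda>x. vec (?g x))"
      by (simp add: vec_eq_iff fun_eq_iff)
    then show ?thesis using 1 2 3 4[of "h ` S" f] 4[of S ?g] f by simp
  qed
  show ?thesis
  proof (cases "?L = \<infinity>")
    case True
    then have "?R \<noteq> ennreal r" if "0 \<le> r" for r using A[OF that] by simp
    then show ?thesis using True by (cases ?R) auto
  next
    case False
    then obtain r where r: "0 \<le> r" "?L = ennreal r" by (cases ?L) auto
    then have "?R = ennreal r" using A[OF r(1)] by simp
    then show ?thesis using r(2) by simp
  qed
qed

text \<open>Coordinates are relabelled by the well-ordered type \<open>'n idx\<close>. The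
  relabelling \<open>L\<close> preserves Lebesgue measure, and it permutes rows and columns of the
  Jacobian alike, so the determinant stays the same by \<open>det_reindex\<close>.\<close>

lemma nn_integral_change_of_variables:
  fixes f :: "real^'n::finite \<Rightarrow> real" and h :: "real^'n::_ \<Rightarrow> real^'n::_"
  assumes S: "S \<in> sets borel" and im: "h ` S \<in> sets borel"
    and h': "\<And>x. x \<in> S \<Longrightarrow> (h has_derivative h' x) (at x)" and inj: "inj_on h S"
    and f: "f \<in> borel_measurable borel" "\<And>x. 0 \<le> f x"
    and meas: "(\<lambda>x. if x \<in> S then \<bar>det (matrix (h' x))\<bar> * f (h x) else 0) \<in> borel_measurable borel"
  shows "(\<integral>\<^sup>+y. ennreal (if y \<in> h ` S then f y else 0) \<partial>lborel) =
    (\<integral>\<^sup>+x. ennreal (if x \<in> S then \<bar>det (matrix (h' x))\<bar> * f (h x) else 0) \<partial>lborel)"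
proof -
  obtain \<pi> :: "'n idx \<Rightarrow> 'n" where \<pi>: "bij \<pi>" using ex_bij_idx by blast
  have inv1: "inv \<pi> (\<pi> k) = k" and inv2: "\<pi> (inv \<pi> i) = i" for k i
    using \<pi> by (auto simp: bij_def surj_f_inv_f)
  define L :: "real^'n idx \<Rightarrow> real^'n" where "L y = (\<chi> i. y $ inv \<pi> i)" for y
  define K :: "real^'n \<Rightarrow> real^'n idx" where "K z = (\<chi> k. z $ \<pi> k)" for z
  have LK: "L (K z) = z" and KL: "K (L y) = y" for z y
    by (simp_all add: L_def K_def vec_eq_iff inv1 inv2)
  have linL: "bounded_linear L" and linK: "bounded_linear K"
    unfolding linear_conv_bounded_linear[symmetric]
    by (auto intro!: linearI simp: L_def K_def vec_eq_iff)
  have mL[measurable]: "L \<in> borel \<rightarrow>\<^sub>M borel" and mK[measurable]: "K \<in> borel \<rightarrow>\<^sub>M borel"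
    using linL linK by (auto intro!: borel_measurable_continuous_onI linear_continuous_on)
  have pre: "L -` T = K ` T" for T using LK KL by (auto simp: image_iff) metis
  \<comment> \<open>Lebesgue measure is determined by the volumes of boxes, and \<open>L\<close>
    pulls a box back to the box with relabelled sides.\<close>
  have lb: "distr lborel borel L = lborel"
  proof (rule lborel_eqI[symmetric])
    fix l u :: "real^'n" assume lu: "\<And>b. b \<in> Basis \<Longrightarrow> l \<bullet> b \<le> u \<bullet> b"
    have "L -` box l u = box (K l) (K u)"
    proof (intro set_eqI)
      fix y
      have "(\<forall>i. l $ i < y $ inv \<pi> i \<and> y $ inv \<pi> i < u $ i) \<longleftrightarrow> (\<forall>k. l $ \<pi> k < y $ k \<and> y $ k < u $ \<pi> k)"
        using inv1 inv2 by metis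
      then show "y \<in> L -` box l u \<longleftrightarrow> y \<in> box (K l) (K u)"
        by (simp add: mem_box_cart L_def K_def)
    qed
    then have "emeasure (distr lborel borel L) (box l u) = emeasure lborel (box (K l) (K u))"
      by (simp add: emeasure_distr)
    also have "\<dots> = (\<Prod>b\<in>Basis. (K u - K l) \<bullet> b)"
      using lu[OF axis_in_Basis_iff[THEN iffD2], of 1]
      by (intro emeasure_lborel_box) (auto simp: Basis_vec_def K_def inner_axis)
    also have "(\<Prod>b\<in>Basis. (K u - K l) \<bullet> b) = (\<Prod>k\<in>UNIV. (K u - K l) $ k)"
      by (simp add: Basis_vec_def UNION_singleton_eq_range prod.reindex inj_on_def axis_eq_axis inner_axis)
    also have "\<dots> = (\<Prod>k\<in>UNIV. (u - l) $ \<pi> k)" by (simp add: K_def)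
    also have "\<dots> = (\<Prod>i\<in>UNIV. (u - l) $ i)" by (rule prod.reindex_bij_betw[OF \<pi>])
    also have "\<dots> = (\<Prod>b\<in>Basis. (u - l) \<bullet> b)"
      by (simp add: Basis_vec_def UNION_singleton_eq_range prod.reindex inj_on_def axis_eq_axis inner_axis)
    finally show "emeasure (distr lborel borel L) (box l u) = ennreal (\<Prod>b\<in>Basis. (u - l) \<bullet> b)" .
  qed simp
  have nnL: "(\<integral>\<^sup>+y. F (L y) \<partial>lborel) = (\<integral>\<^sup>+z. F z \<partial>lborel)" if [measurable]: "F \<in> borel_measurable borel" for F
    by (subst lb[symmetric]) (simp add: nn_integral_distr)
  let ?h = "\<lambda>y. K (h (L y))" and ?h' = "\<lambda>y v. K (h' (L y) (L v))"
  have detK: "det (matrix (?h' y)) = det (matrix (h' (L y)))" for y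
  proof -
    have "L (axis k 1) = axis (\<pi> k) 1" for k
      using inv1 inv2 by (auto simp: L_def vec_eq_iff axis_def)
    then have "matrix (?h' y) = (\<chi> i j. matrix (h' (L y)) $ \<pi> i $ \<pi> j)"
      by (simp add: matrix_def K_def)
    then show ?thesis using det_reindex[OF \<pi>] by simp
  qed
  have imh: "?h ` (K ` S) = K ` (h ` S)" by (simp add: image_image LK)
  have mem: "y \<in> K ` T \<longleftrightarrow> L y \<in> T" for y T using pre by auto
  have "(\<integral>\<^sup>+y. ennreal (if y \<in> ?h ` (K ` S) then f (L y) else 0) \<partial>lborel) =
    (\<integral>\<^sup>+x. ennreal (if x \<in> K ` S then \<bar>det (matrix (?h' x))\<bar> * f (L (?h x)) else 0) \<partial>lborel)"
  proof (rule nn_integral_change_of_variables_wellorder)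
    show "K ` S \<in> sets borel" using measurable_sets_borel[OF mL S] by (simp add: pre)
    show "?h ` K ` S \<in> sets borel" unfolding imh using measurable_sets_borel[OF mL im] by (simp add: pre)
    show "(?h has_derivative ?h' x) (at x)" if "x \<in> K ` S" for x
      using that mem
      by (intro bounded_linear.has_derivative[OF linK] has_derivative_compose[OF
            bounded_linear.has_derivative[OF linL has_derivative_ident]] h') auto
    show "inj_on ?h (K ` S)"
    proof (rule inj_onI)
      fix x y assume xy: "x \<in> K ` S" "y \<in> K ` S" "K (h (L x)) = K (h (L y))"
      then have "h (L x) = h (L y)" using LK by metis
      then have "L x = L y" using inj xy mem by (auto simp: inj_on_def)
      then show "x = y" using KL by metis
    qed
    show "(\<lambda>x. f (L x)) \<in> borel_measurable borel" using f by measurable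
    show "0 \<le> f (L x)" for x using f by simp
    have "(\<lambda>x. (\<lambda>x. if x \<in> S then \<bar>det (matrix (h' x))\<bar> * f (h x) else 0) (L x)) \<in> borel_measurable borel"
      by (rule measurable_compose[OF mL meas])
    then show "(\<lambda>x. if x \<in> K ` S then \<bar>det (matrix (?h' x))\<bar> * f (L (?h x)) else 0) \<in> borel_measurable borel"
      unfolding mem LK detK .
  qed
  moreover have "(\<integral>\<^sup>+y. ennreal (if y \<in> ?h ` (K ` S) then f (L y) else 0) \<partial>lborel) =
      (\<integral>\<^sup>+y. ennreal (if y \<in> h ` S then f y else 0) \<partial>lborel)"
    unfolding imh mem by (rule nnL[of "\<lambda>y. ennreal (if y \<in> h ` S then f y else 0)"]) (use f im in measurable)
  moreover have "(\<integral>\<^sup>+x. ennreal (if x \<in> K ` S then \<bar>det (matrix (?h' x))\<bar> * f (L (?h x)) else 0) \<partial>lborel) =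
    (\<integral>\<^sup>+x. ennreal (if x \<in> S then \<bar>det (matrix (h' x))\<bar> * f (h x) else 0) \<partial>lborel)"
    unfolding mem LK detK
    by (rule nnL[of "\<lambda>x. ennreal (if x \<in> S then \<bar>det (matrix (h' x))\<bar> * f (h x) else 0)"]) (use meas in measurable)
  ultimately show ?thesis by simp
qed


section \<open>Integration by parts, Cauchy-Schwarz inequalities and diagonal subsequences\<close>

text \<open>Difference quotients of \<open>F\<close> along \<open>v\<close> have integral zero by
  translation invariance of Lebesgue measure. The mean value theorem bounds them by a bound of the
  derivative, so dominated convergence carries the zero over to the derivative.\<close>

lemma integral_deriv_compact_support:
  fixes F :: "'a::euclidean_space \<Rightarrow> real"
  assumes F: "smooth_on UNIV F" and K: "compact K" and supp: "\<And>x. x \<notin> K \<Longrightarrow> F x = 0"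
  shows "integrable lborel (\<lambda>x. frechet_derivative F (at x) v)"
    and "(LINT x|lborel. frechet_derivative F (at x) v) = 0"
proof -
  define D where "D x = frechet_derivative F (at x) v" for x
  have contD: "continuous_on UNIV D" unfolding D_def by (rule smooth_onD(3)[OF smooth_onD(2)[OF F]])
  have contF: "continuous_on UNIV F" by (rule smooth_onD(3)[OF F])
  have D0: "D x = 0" if "x \<notin> K" for x
  proof -
    have "((\<lambda>x. 0) has_derivative (\<lambda>v. 0)) (at x)" by simp
    then have "(F has_derivative (\<lambda>v. 0)) (at x)"
      by (rule has_derivative_transform_within_open[of _ _ _ _ "- K"])
        (use that supp compact_imp_closed[OF K] in \<open>auto simp: open_Compl\<close>)
    then have "frechet_derivative F (at x) = (\<lambda>v. 0)" by (rule frechet_derivative_at[symmetric])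
    then show ?thesis by (simp add: D_def)
  qed
  have intc: "integrable lborel u" if "continuous_on UNIV u" "\<And>x. x \<notin> S \<Longrightarrow> u x = 0" "compact S"
    for u :: "'a \<Rightarrow> real" and S
  proof -
    have "u = (\<lambda>x. indicator S x *\<^sub>R u x)" using that(2) by (auto simp: indicator_def fun_eq_iff)
    then show ?thesis using borel_integrable_compact[OF that(3) continuous_on_subset[OF that(1)]] by simp
  qed
  show "integrable lborel (\<lambda>x. frechet_derivative F (at x) v)"
    using intc[OF contD D0 K] by (simp add: D_def)
  obtain C where C: "\<And>x. \<bar>D x\<bar> \<le> C"
  proof -
    have "bounded (D ` K)" using K contD by (metis compact_continuous_image compact_imp_bounded continuous_on_subset subset_UNIV)
    then obtain C where "\<And>x. x \<in> K \<Longrightarrow> \<bar>D x\<bar> \<le> C" by (auto simp: bounded_iff)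
    then have "\<bar>D x\<bar> \<le> max C 0" for x
      using D0[of x] by (cases "x \<in> K") (auto intro: order.trans[OF _ max.cobounded1])
    then show ?thesis using that by blast
  qed
  obtain R where R: "\<And>x. x \<in> K \<Longrightarrow> norm x \<le> R" using compact_imp_bounded[OF K] by (auto simp: bounded_iff)
  define t where "t n = inverse (real (Suc n))" for n
  have t: "t n > 0" "t n \<le> 1" for n by (auto simp: t_def field_simps)
  have t0: "t \<longlonglongrightarrow> 0" unfolding t_def by (rule LIMSEQ_inverse_real_of_nat)
  have dF: "((\<lambda>s. F (x + s *\<^sub>R v)) has_real_derivative D (x + s *\<^sub>R v)) (at s)" for x s
  proof -
    have d: "(F has_derivative frechet_derivative F (at (x + s *\<^sub>R v))) (at (x + s *\<^sub>R v))"
      using smooth_onD(1)[OF F] by blast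
    have "((\<lambda>s. F (x + s *\<^sub>R v)) has_derivative (\<lambda>h. frechet_derivative F (at (x + s *\<^sub>R v)) (h *\<^sub>R v))) (at s)"
      by (rule has_derivative_compose[of "\<lambda>s. x + s *\<^sub>R v" _ s UNIV F, OF _ d]) (auto intro!: derivative_eq_intros)
    then show ?thesis
      unfolding has_field_derivative_def D_def
      using linear_scale[OF has_derivative_linear[OF d]] by (simp add: mult_commute_abs)
  qed
  define q where "q n x = (F (x + t n *\<^sub>R v) - F x) / t n" for n x
  have qb: "\<bar>q n x\<bar> \<le> C" for n x
  proof -
    obtain z where "F (x + t n *\<^sub>R v) - F (x + 0 *\<^sub>R v) = (t n - 0) * D (x + z *\<^sub>R v)"
      using MVT2[of 0 "t n" "\<lambda>s. F (x + s *\<^sub>R v)" "\<lambda>s. D (x + s *\<^sub>R v)"] dF t(1) by blast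
    then show ?thesis using C t(1)[of n] by (simp add: q_def)
  qed
  have qlim: "(\<lambda>n. q n x) \<longlonglongrightarrow> D x" for x
  proof -
    have 1: "((\<lambda>h. (F (x + (0 + h) *\<^sub>R v) - F (x + 0 *\<^sub>R v)) / h) \<longlongrightarrow> D (x + 0 *\<^sub>R v)) (at 0)"
      using dF[of x 0] by (simp only: DERIV_def)
    have "t n \<noteq> 0" for n using t(1)[of n] by simp
    then have 2: "filterlim t (at 0) sequentially"
      using t0 by (simp add: filterlim_at)
    show ?thesis
      using filterlim_compose[OF 1 2] by (simp add: q_def)
  qed
  have mF[measurable]: "F \<in> borel_measurable borel" and [measurable]: "D \<in> borel_measurable borel"
    using contF contD borel_measurable_continuous_onI by auto
  have iF: "integrable lborel F" by (rule intc[OF contF supp K])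
  have shift: "integrable lborel (\<lambda>x. F (x + w))" "(LINT x|lborel. F (x + w)) = (LINT x|lborel. F x)" for w
  proof -
    have "(\<lambda>x. x + w) = (+) w" by (auto simp: add.commute)
    then have "distr lborel borel (\<lambda>x. x + w) = lborel" using lborel_distr_plus[of w] by simp
    then show "integrable lborel (\<lambda>x. F (x + w))" "(LINT x|lborel. F (x + w)) = (LINT x|lborel. F x)"
      using iF integrable_distr_eq[of "\<lambda>x. x + w" lborel borel F] integral_distr[of "\<lambda>x. x + w" lborel borel F] by auto
  qed
  have "(LINT x|lborel. q n x) = 0" for n
    using shift iF by (simp add: q_def)
  moreover have "(\<lambda>n. LINT x|lborel. q n x) \<longlonglongrightarrow> (LINT x|lborel. D x)"
  proof (rule integral_dominated_convergence)
    show "integrable lborel (\<lambda>x. indicator (cball 0 (R + norm v)) x *\<^sub>R C)"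
      by (rule borel_integrable_compact) auto
    show "AE x in lborel. (\<lambda>n. q n x) \<longlonglongrightarrow> D x" using qlim by simp
    \<comment> \<open>Because \<open>t n \<le> 1\<close>, all quotients vanish outside one ball,
      whose radius exceeds that of the support by \<open>norm v\<close>.\<close>
    show "AE x in lborel. norm (q n x) \<le> indicator (cball 0 (R + norm v)) x *\<^sub>R C" for n
    proof (rule AE_I2)
      fix x
      have "q n x = 0" if "norm x > R + norm v"
      proof -
        have "norm (t n *\<^sub>R v) \<le> norm v" using t[of n] by (simp add: mult_left_le_one_le)
        then have "norm (x + t n *\<^sub>R v) > R" using that norm_triangle_ineq2[of x "- (t n *\<^sub>R v)"] by auto
        moreover have "norm x > R" using that norm_ge_zero[of v] by linarith
        ultimately show ?thesis using supp R by (simp add: q_def) (metis cancel_comm_monoid_add_class.diff_cancel not_le)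
      qed
      then show "norm (q n x) \<le> indicator (cball 0 (R + norm v)) x *\<^sub>R C"
        using qb[of n x] by (auto simp: indicator_def)
    qed
  qed (auto simp: q_def)
  ultimately show "(LINT x|lborel. frechet_derivative F (at x) v) = 0"
    unfolding D_def by (simp add: LIMSEQ_const_iff)
qed

text \<open>Common core of the Cauchy-Schwarz inequalities below, for functions, tangent vectors,
  vector fields and energy forms: the hypothesis is the nonnegativity of a quadratic form at u + t
  v.\<close>

lemma quadratic_nonneg_imp_discriminant_le:
  fixes a b c :: real
  assumes nn: "\<And>t. 0 \<le> a + 2 * t * b + t\<^sup>2 * c" and c: "0 \<le> c"
  shows "b\<^sup>2 \<le> a * c"
proof (cases "c = 0")
  case True
  have "b = 0"
  proof (rule ccontr)
    assume "b \<noteq> 0"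
    \<comment> \<open>With \<open>c = 0\<close> the expression is affine in t; this t gives it the
      value -1.\<close>
    then show False using nn[of "- (a + 1) / (2 * b)"] True by (simp add: field_simps)
  qed
  then show ?thesis using True by simp
next
  case False
  then have "c > 0" using c by simp
  then have "a + 2 * (- b / c) * b + (- b / c)\<^sup>2 * c = a - b\<^sup>2 / c"
    by (simp add: field_simps power2_eq_square)
  then have "b\<^sup>2 / c \<le> a" using nn[of "- b / c"] by linarith
  then show ?thesis using \<open>c > 0\<close> by (simp add: field_simps)
qed

lemma integrable_mult_L2:
  fixes u v :: "'a \<Rightarrow> real"
  assumes [measurable]: "u \<in> borel_measurable M" "v \<in> borel_measurable M"
    and "integrable M (\<lambda>x. (u x)\<^sup>2)" "integrable M (\<lambda>x. (v x)\<^sup>2)"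
  shows "integrable M (\<lambda>x. u x * v x)"
proof (rule Bochner_Integration.integrable_bound)
  show "integrable M (\<lambda>x. (u x)\<^sup>2 + (v x)\<^sup>2)" using assms by simp
  show "AE x in M. norm (u x * v x) \<le> norm ((u x)\<^sup>2 + (v x)\<^sup>2)"
  proof (rule AE_I2)
    fix x
    have "2 * (\<bar>u x\<bar> * \<bar>v x\<bar>) \<le> (u x)\<^sup>2 + (v x)\<^sup>2"
      using sum_squares_bound[of "\<bar>u x\<bar>" "\<bar>v x\<bar>"] by simp
    moreover have "0 \<le> \<bar>u x\<bar> * \<bar>v x\<bar>" by simp
    ultimately have "\<bar>u x\<bar> * \<bar>v x\<bar> \<le> (u x)\<^sup>2 + (v x)\<^sup>2" by linarith
    then show "norm (u x * v x) \<le> norm ((u x)\<^sup>2 + (v x)\<^sup>2)"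
      by (simp add: abs_mult)
  qed
qed measurable

lemma integrable_sum_square:
  fixes u v :: "'a \<Rightarrow> real"
  assumes "u \<in> borel_measurable M" "v \<in> borel_measurable M"
    and "integrable M (\<lambda>x. (u x)\<^sup>2)" "integrable M (\<lambda>x. (v x)\<^sup>2)"
  shows "integrable M (\<lambda>x. (u x + v x)\<^sup>2)" "integrable M (\<lambda>x. (u x - v x)\<^sup>2)"
  using integrable_mult_L2[OF assms] assms(3,4) by (simp_all add: power2_sum power2_diff mult.assoc)

lemma integral_Cauchy_Schwarz:
  fixes u v :: "'a \<Rightarrow> real"
  assumes "u \<in> borel_measurable M" "v \<in> borel_measurable M"
    and "integrable M (\<lambda>x. (u x)\<^sup>2)" "integrable M (\<lambda>x. (v x)\<^sup>2)"
  shows "(LINT x|M. u x * v x)\<^sup>2 \<le> (LINT x|M. (u x)\<^sup>2) * (LINT x|M. (v x)\<^sup>2)"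
proof (rule quadratic_nonneg_imp_discriminant_le)
  fix t :: real
  have "0 \<le> (LINT x|M. (u x + t * v x)\<^sup>2)" by simp
  also have "(\<lambda>x. (u x + t * v x)\<^sup>2) = (\<lambda>x. (u x)\<^sup>2 + 2 * t * (u x * v x) + t\<^sup>2 * (v x)\<^sup>2)"
    by (simp add: fun_eq_iff power2_sum power_mult_distrib algebra_simps)
  also have "(LINT x|M. (u x)\<^sup>2 + 2 * t * (u x * v x) + t\<^sup>2 * (v x)\<^sup>2) =
      (LINT x|M. (u x)\<^sup>2) + 2 * t * (LINT x|M. u x * v x) + t\<^sup>2 * (LINT x|M. (v x)\<^sup>2)"
    using assms(3,4) integrable_mult_L2[OF assms] by simp
  finally show "0 \<le> (LINT x|M. (u x)\<^sup>2) + 2 * t * (LINT x|M. u x * v x) + t\<^sup>2 * (LINT x|M. (v x)\<^sup>2)" .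
qed simp

lemma bounded_diagonal_subsequence:
  fixes x :: "nat \<Rightarrow> nat \<Rightarrow> real"
  assumes "\<And>i. bounded (range (x i))"
  shows "\<exists>r. strict_mono r \<and> (\<forall>i. convergent (\<lambda>k. x i (r k)))"
proof -
  interpret subseqs "\<lambda>n s. convergent (\<lambda>k. x n (s k))"
  proof
    fix n and s :: "nat \<Rightarrow> nat"
    have "bounded (range (\<lambda>k. x n (s k)))"
      by (rule bounded_subset[OF assms[of n]]) auto
    then obtain l r where "strict_mono r" "((\<lambda>k. x n (s k)) \<circ> r) \<longlonglongrightarrow> l"
      using bounded_imp_convergent_subsequence by blast
    then show "\<exists>r'. strict_mono r' \<and> convergent (\<lambda>k. x n ((s \<circ> r') k))"
      by (auto simp: convergent_def o_def)
  qed
  have "convergent (\<lambda>k. x i (diagseq k))" for i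
  proof -
    \<comment> \<open>The diagonal is a subsequence of the one selected for \<open>i\<close> only
      from index \<open>Suc i\<close> on; the shift does not affect convergence.\<close>
    have "convergent (\<lambda>k. x i ((diagseq \<circ> ((+) (Suc i))) k))"
    proof (rule diagseq_holds)
      fix r s :: "nat \<Rightarrow> nat" and n
      assume "strict_mono r" "convergent (\<lambda>k. x n (s k))"
      then show "convergent (\<lambda>k. x n ((s \<circ> r) k))"
        using convergent_subseq_convergent[of "\<lambda>k. x n (s k)" r] by (simp add: o_def)
    qed
    then have "convergent (\<lambda>k. x i (diagseq (k + Suc i)))" by (simp add: add.commute)
    then show ?thesis using convergent_ignore_initial_segment[of "\<lambda>k. x i (diagseq k)" "Suc i"] by simp
  qed
  then show ?thesis using subseq_diagseq by blast
qed

section \<open>Poincare and Rellich inequalities on boxes\<close>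

text \<open>One of the coefficients t and 1 - t is at least 1/2. Substituting in the variable that
  carries it costs a Jacobian factor of at most \<open>2 ^ DIM('a)\<close>, uniformly in t, and the
  other variable contributes the volume of \<open>Q\<close>.\<close>

lemma nn_integral_convex_comb_le:
  fixes F :: "'a::euclidean_space \<Rightarrow> ennreal"
  assumes F[measurable]: "F \<in> borel_measurable borel" and Q[measurable]: "Q \<in> sets borel"
    and t: "0 \<le> t" "t \<le> (1::real)"
  shows "(\<integral>\<^sup>+x. \<integral>\<^sup>+y. F (t *\<^sub>R x + (1 - t) *\<^sub>R y) * indicator Q x * indicator Q y \<partial>lborel \<partial>lborel)
    \<le> 2 ^ DIM('a) * emeasure lborel Q * (\<integral>\<^sup>+z. F z \<partial>lborel)"
proof -
  have scale: "(\<integral>\<^sup>+x. F (c *\<^sub>R x + w) \<partial>lborel) \<le> 2 ^ DIM('a) * (\<integral>\<^sup>+z. F z \<partial>lborel)" if c: "1/2 \<le> c" for c w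
  proof -
    have "(\<integral>\<^sup>+z. F z \<partial>lborel) = ennreal (\<bar>c\<bar> ^ DIM('a)) * (\<integral>\<^sup>+x. F (w + c *\<^sub>R x) \<partial>lborel)"
      using c by (subst lborel_affine[of c w]) (simp_all add: nn_integral_density nn_integral_distr nn_integral_cmult)
    also have "\<dots> \<ge> ennreal ((1/2) ^ DIM('a)) * (\<integral>\<^sup>+x. F (w + c *\<^sub>R x) \<partial>lborel)"
      using c by (intro mult_right_mono ennreal_leI power_mono) auto
    finally have "2 ^ DIM('a) * (ennreal ((1/2) ^ DIM('a)) * (\<integral>\<^sup>+x. F (w + c *\<^sub>R x) \<partial>lborel)) \<le> 2 ^ DIM('a) * (\<integral>\<^sup>+z. F z \<partial>lborel)"
      by (intro mult_left_mono) auto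
    moreover have "2 ^ DIM('a) * ennreal ((1/2) ^ DIM('a)) = 1"
    proof -
      have "(2::ennreal) ^ DIM('a) = ennreal (2 ^ DIM('a))" using ennreal_power[of 2 "DIM('a)"] by simp
      moreover have "2 ^ DIM('a) * (1/2) ^ DIM('a) = (1::real)"
        by (simp only: power_mult_distrib[symmetric]) simp
      moreover have "ennreal (2 ^ DIM('a)) * ennreal ((1/2) ^ DIM('a)) = ennreal (2 ^ DIM('a) * (1/2) ^ DIM('a))"
        by (rule ennreal_mult[symmetric]) auto
      ultimately show ?thesis by simp
    qed
    ultimately show ?thesis by (simp add: mult.assoc[symmetric] add.commute)
  qed
  have cmul: "indicator Q x * (\<integral>\<^sup>+y. G y \<partial>lborel) = (\<integral>\<^sup>+y. indicator Q x * G y \<partial>lborel)"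
    if [measurable]: "G \<in> borel_measurable borel" for x and G :: "'a \<Rightarrow> ennreal"
    by (rule nn_integral_cmult[symmetric]) measurable
  have outer: "(\<integral>\<^sup>+x. indicator Q x * G x \<partial>lborel) \<le> 2 ^ DIM('a) * emeasure lborel Q * (\<integral>\<^sup>+z. F z \<partial>lborel)"
    if "\<And>x. G x \<le> 2 ^ DIM('a) * (\<integral>\<^sup>+z. F z \<partial>lborel)" for G :: "'a \<Rightarrow> ennreal"
  proof -
    have "(\<integral>\<^sup>+x. indicator Q x * G x \<partial>lborel) \<le> (\<integral>\<^sup>+x. 2 ^ DIM('a) * (\<integral>\<^sup>+z. F z \<partial>lborel) * indicator Q x \<partial>lborel)"
      using that by (intro nn_integral_mono) (auto simp: indicator_def)
    also have "\<dots> = 2 ^ DIM('a) * (\<integral>\<^sup>+z. F z \<partial>lborel) * emeasure lborel Q"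
      by (simp add: nn_integral_cmult_indicator)
    finally show ?thesis by (simp add: mult_ac)
  qed
  consider "1/2 \<le> t" | "1/2 \<le> 1 - t" by linarith
  then show ?thesis
  proof cases
    case 1
    have "(\<integral>\<^sup>+x. \<integral>\<^sup>+y. F (t *\<^sub>R x + (1 - t) *\<^sub>R y) * indicator Q x * indicator Q y \<partial>lborel \<partial>lborel) =
      (\<integral>\<^sup>+y. \<integral>\<^sup>+x. F (t *\<^sub>R x + (1 - t) *\<^sub>R y) * indicator Q x * indicator Q y \<partial>lborel \<partial>lborel)"
      by (rule lborel_pair.Fubini') measurable
    also have "\<dots> = (\<integral>\<^sup>+y. indicator Q y * (\<integral>\<^sup>+x. F (t *\<^sub>R x + (1 - t) *\<^sub>R y) * indicator Q x \<partial>lborel) \<partial>lborel)"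
      by (subst cmul) (auto simp: mult_ac)
    also have "\<dots> \<le> 2 ^ DIM('a) * emeasure lborel Q * (\<integral>\<^sup>+z. F z \<partial>lborel)"
    proof (rule outer)
      fix y
      have "(\<integral>\<^sup>+x. F (t *\<^sub>R x + (1 - t) *\<^sub>R y) * indicator Q x \<partial>lborel) \<le> (\<integral>\<^sup>+x. F (t *\<^sub>R x + (1 - t) *\<^sub>R y) \<partial>lborel)"
        by (intro nn_integral_mono) (auto simp: indicator_def)
      also have "\<dots> \<le> 2 ^ DIM('a) * (\<integral>\<^sup>+z. F z \<partial>lborel)" by (rule scale[OF 1])
      finally show "(\<integral>\<^sup>+x. F (t *\<^sub>R x + (1 - t) *\<^sub>R y) * indicator Q x \<partial>lborel) \<le> 2 ^ DIM('a) * (\<integral>\<^sup>+z. F z \<partial>lborel)" .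
    qed
    finally show ?thesis .
  next
    case 2
    have "(\<integral>\<^sup>+x. \<integral>\<^sup>+y. F (t *\<^sub>R x + (1 - t) *\<^sub>R y) * indicator Q x * indicator Q y \<partial>lborel \<partial>lborel) =
      (\<integral>\<^sup>+x. indicator Q x * (\<integral>\<^sup>+y. F (t *\<^sub>R x + (1 - t) *\<^sub>R y) * indicator Q y \<partial>lborel) \<partial>lborel)"
      by (subst cmul) (auto simp: mult_ac)
    also have "\<dots> \<le> 2 ^ DIM('a) * emeasure lborel Q * (\<integral>\<^sup>+z. F z \<partial>lborel)"
    proof (rule outer)
      fix x
      have "(\<integral>\<^sup>+y. F (t *\<^sub>R x + (1 - t) *\<^sub>R y) * indicator Q y \<partial>lborel) \<le> (\<integral>\<^sup>+y. F ((1 - t) *\<^sub>R y + t *\<^sub>R x) \<partial>lborel)"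
        by (intro nn_integral_mono) (auto simp: indicator_def add.commute)
      also have "\<dots> \<le> 2 ^ DIM('a) * (\<integral>\<^sup>+z. F z \<partial>lborel)" by (rule scale[OF 2])
      finally show "(\<integral>\<^sup>+y. F (t *\<^sub>R x + (1 - t) *\<^sub>R y) * indicator Q y \<partial>lborel) \<le> 2 ^ DIM('a) * (\<integral>\<^sup>+z. F z \<partial>lborel)" .
    qed
    finally show ?thesis .
  qed
qed

text \<open>The fundamental theorem of calculus along the segment, followed by Jensen's inequality
  for the square. \<open>N\<close> is any continuous majorant of the squared norm of the derivative,
  so that a Riemannian gradient can take its place later.\<close>

lemma diff_square_le_integral_segment:
  fixes f :: "'a::euclidean_space \<Rightarrow> real"
  assumes "convex Q" "x \<in> Q" "y \<in> Q"
    and f': "\<And>x. x \<in> Q \<Longrightarrow> (f has_derivative f' x) (at x)"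
    and N: "\<And>x v. x \<in> Q \<Longrightarrow> (f' x v)\<^sup>2 \<le> (norm v)\<^sup>2 * N x" and contN: "continuous_on Q N"
  shows "(f x - f y)\<^sup>2 \<le> (norm (x - y))\<^sup>2 * integral {0..1} (\<lambda>t. N (t *\<^sub>R x + (1 - t) *\<^sub>R y))"
    (is "_ \<le> _ * integral _ (\<lambda>t. N (?p t))")
proof -
  have p: "?p t \<in> Q" if "t \<in> {0..1}" for t
    using convexD[OF assms(1-3), of t "1 - t"] that by auto
  have "((\<lambda>t. f' (?p t) (x - y)) has_integral (f (?p 1) - f (?p 0))) {0..1}"
  proof (rule fundamental_theorem_of_calculus)
    fix t :: real assume t: "t \<in> {0..1}"
    have pd: "(?p has_derivative (\<lambda>h. h *\<^sub>R (x - y))) (at t within {0..1})"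
      by (auto intro!: derivative_eq_intros simp: algebra_simps)
    have "((\<lambda>t. f (?p t)) has_derivative (\<lambda>h. f' (?p t) (h *\<^sub>R (x - y)))) (at t within {0..1})"
      by (rule has_derivative_compose[OF pd f'[OF p[OF t]]])
    then show "((\<lambda>t. f (?p t)) has_vector_derivative f' (?p t) (x - y)) (at t within {0..1})"
      unfolding has_vector_derivative_def
      using linear_scale[OF has_derivative_linear[OF f'[OF p[OF t]]]] by simp
  qed simp
  then have I: "((\<lambda>t. f' (?p t) (x - y)) has_integral (f x - f y)) {0..1}" by simp
  have "(\<lambda>t. N (?p t)) integrable_on {0..1}"
    by (intro integrable_continuous_real continuous_on_compose2[OF contN])
      (use p in \<open>auto intro!: continuous_intros\<close>)
  then have J: "((\<lambda>t. (norm (x - y))\<^sup>2 * N (?p t)) has_integral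
      (norm (x - y))\<^sup>2 * integral {0..1} (\<lambda>t. N (?p t))) {0..1}"
    by (intro has_integral_mult_right integrable_integral)
  let ?d = "f x - f y"
  \<comment> \<open>Jensen's inequality by integration of
    \<open>2 * c * w - c\<^sup>2 \<le> w\<^sup>2\<close>, where c is the mean value of w over the
    segment.\<close>
  have "((\<lambda>t. 2 * ?d * f' (?p t) (x - y) - ?d\<^sup>2) has_integral (2 * ?d * ?d - ?d\<^sup>2)) {0..1}"
    using has_integral_diff[OF has_integral_mult_right[OF I, of "2 * ?d"] has_integral_const_real[of "?d\<^sup>2" 0 1]] by simp
  moreover have "2 * ?d * f' (?p t) (x - y) - ?d\<^sup>2 \<le> (norm (x - y))\<^sup>2 * N (?p t)" if "t \<in> {0..1}" for t
  proof -
    have "2 * c * w - c\<^sup>2 \<le> w\<^sup>2" for c w :: real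
      using zero_le_power2[of "c - w"] by (simp add: power2_diff algebra_simps)
    then have "2 * ?d * f' (?p t) (x - y) - ?d\<^sup>2 \<le> (f' (?p t) (x - y))\<^sup>2" .
    also have "\<dots> \<le> (norm (x - y))\<^sup>2 * N (?p t)" by (rule N[OF p[OF that]])
    finally show ?thesis .
  qed
  ultimately have "2 * ?d * ?d - ?d\<^sup>2 \<le> (norm (x - y))\<^sup>2 * integral {0..1} (\<lambda>t. N (?p t))"
    by (rule has_integral_le[OF _ J])
  then show ?thesis by (simp add: power2_eq_square algebra_simps)
qed

text \<open>The integral of (f(x) - f(y))^2 over pairs of points of \<open>Q\<close> is evaluated in
  two ways. Expanding the square gives 2 (|Q| a - b^2), with a and b the integrals of f^2 and f;
  joining x and y by a segment bounds it by the integral of \<open>N\<close>, with the uniform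
  constant of \<open>nn_integral_convex_comb_le\<close>.\<close>

lemma poincare_cbox:
  fixes f :: "'a::euclidean_space \<Rightarrow> real" and a b :: 'a
  defines "Q \<equiv> cbox a b"
  assumes f': "\<And>x. x \<in> Q \<Longrightarrow> (f has_derivative f' x) (at x)"
    and N: "\<And>x v. x \<in> Q \<Longrightarrow> (f' x v)\<^sup>2 \<le> (norm v)\<^sup>2 * N x" and contN: "continuous_on Q N"
    and N0: "\<And>x. x \<in> Q \<Longrightarrow> 0 \<le> N x"
    and d: "\<And>x y. x \<in> Q \<Longrightarrow> y \<in> Q \<Longrightarrow> norm (x - y) \<le> d"
  shows "integral Q (\<lambda>x. (f x)\<^sup>2) \<le> (integral Q f)\<^sup>2 / measure lborel Q + 2 ^ DIM('a) * d\<^sup>2 * integral Q N"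
proof (cases "measure lborel Q = 0")
  case True
  then show ?thesis using integral_null[of a b] N0 by (simp add: Q_def)
next
  case False
  then have m: "measure lborel Q > 0" using measure_nonneg[of lborel Q] by linarith
  have comp: "compact Q" and conv: "convex Q" and Qs[measurable]: "Q \<in> sets borel" by (auto simp: Q_def)
  have contf: "continuous_on Q f"
    using f' by (intro continuous_at_imp_continuous_on ballI has_derivative_continuous) auto
  define I where "I u = integral Q u" for u :: "'a \<Rightarrow> real"
  have nnI: "(\<integral>\<^sup>+x. ennreal (u x) * indicator Q x \<partial>lborel) = ennreal (I u)"
    if "continuous_on Q u" "\<And>x. x \<in> Q \<Longrightarrow> 0 \<le> u x" for u
  proof -
    have i: "integrable lborel (\<lambda>x. indicator Q x *\<^sub>R u x)"
      by (rule borel_integrable_compact[OF comp that(1)])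
    have "(\<integral>\<^sup>+x. ennreal (u x) * indicator Q x \<partial>lborel) = (\<integral>\<^sup>+x. ennreal (indicator Q x *\<^sub>R u x) \<partial>lborel)"
      by (intro nn_integral_cong) (auto simp: indicator_def)
    also have "\<dots> = ennreal (LINT x|lborel. indicator Q x *\<^sub>R u x)"
      using that by (intro nn_integral_eq_integral[OF i]) (auto simp: indicator_def)
    also have "(LINT x|lborel. indicator Q x *\<^sub>R u x) = I u"
      using set_borel_integral_eq_integral(2)[of Q u] i
      by (simp add: I_def set_integrable_def set_lebesgue_integral_def)
    finally show ?thesis .
  qed
  have int: "u integrable_on Q" if "continuous_on Q u" for u :: "'a \<Rightarrow> real"
    using that unfolding Q_def by (rule integrable_continuous)
  have Iadd: "I (\<lambda>x. u x + v x) = I u + I v" if "continuous_on Q u" "continuous_on Q v" for u v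
    unfolding I_def by (rule integral_add[OF int[OF that(1)] int[OF that(2)]])
  have Imul: "I (\<lambda>x. c * u x) = c * I u" and Ic: "I (\<lambda>x. c) = measure lborel Q * c" for u c
    by (simp_all add: I_def Q_def)
  let ?P = "\<lambda>t x y. t *\<^sub>R x + (1 - t) *\<^sub>R y :: 'a"
  have mult_right_mono_indicator: "A t * indicator {0..1} t \<le> B * indicator {0..1} t"
    if "\<And>t. 0 \<le> t \<Longrightarrow> t \<le> 1 \<Longrightarrow> A t \<le> B" for A :: "real \<Rightarrow> ennreal" and B t
    using that[of t] by (simp add: indicator_def)
  define Nt where "Nt z = ennreal (indicator Q z *\<^sub>R N z)" for z
  have Ntm[measurable]: "Nt \<in> borel_measurable borel"
    using borel_integrable_compact[OF comp contN] unfolding Nt_def by (auto dest: borel_measurable_integrable)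
  have NtI: "(\<integral>\<^sup>+z. Nt z \<partial>lborel) = ennreal (I N)"
  proof -
    have "Nt z = ennreal (N z) * indicator Q z" for z by (simp add: Nt_def indicator_def)
    then show ?thesis using nnI[OF contN N0] by simp
  qed
  \<comment> \<open>Multiplying \<open>N\<close> by the indicator of \<open>Q\<close>, as in
    \<open>Nt\<close>, loses nothing since the segment stays in the convex set \<open>Q\<close>, and
    it makes the integrand Borel on the whole space.\<close>
  have point: "ennreal ((f x - f y)\<^sup>2) * indicator Q x * indicator Q y \<le>
     ennreal (d\<^sup>2) * (\<integral>\<^sup>+t. Nt (?P t x y) * indicator Q x * indicator Q y * indicator {0..1} t \<partial>lborel)" for x y
  proof (cases "x \<in> Q \<and> y \<in> Q")
    case True
    let ?u = "\<lambda>t. N (?P t x y)"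
    have p: "?P t x y \<in> Q" if "t \<in> {0..1}" for t
      using convexD[OF conv conjunct1[OF True] conjunct2[OF True], of t "1 - t"] that by auto
    have cu: "continuous_on {0..1} ?u"
      by (intro continuous_on_compose2[OF contN]) (use p in \<open>auto intro!: continuous_intros\<close>)
    have i: "integrable lborel (\<lambda>t. indicator {0..1} t *\<^sub>R ?u t)"
      by (rule borel_integrable_compact[OF compact_Icc cu])
    have "(f x - f y)\<^sup>2 \<le> (norm (x - y))\<^sup>2 * integral {0..1} ?u"
      using diff_square_le_integral_segment[OF conv conjunct1[OF True] conjunct2[OF True] f' N contN] by blast
    also have "\<dots> \<le> d\<^sup>2 * integral {0..1} ?u"
      using d True N0 p by (intro mult_right_mono power_mono integral_nonneg integrable_continuous_real[OF cu]) auto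
    finally have "ennreal ((f x - f y)\<^sup>2) \<le> ennreal (d\<^sup>2) * ennreal (integral {0..1} ?u)"
      by (simp add: ennreal_mult'[symmetric] ennreal_leI)
    also have "integral {0..1} ?u = (LINT t|lborel. indicator {0..1} t *\<^sub>R ?u t)"
      using set_borel_integral_eq_integral(2)[of "{0..1}" ?u] i
      by (simp add: set_integrable_def set_lebesgue_integral_def)
    also have "ennreal \<dots> = (\<integral>\<^sup>+t. ennreal (indicator {0..1} t *\<^sub>R ?u t) \<partial>lborel)"
      using N0 p by (intro nn_integral_eq_integral[OF i, symmetric]) (auto simp: indicator_def)
    also have "\<dots> = (\<integral>\<^sup>+t. Nt (?P t x y) * indicator {0..1} t \<partial>lborel)"
      using p by (intro nn_integral_cong) (auto simp: indicator_def Nt_def)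
    finally show ?thesis using True by simp
  qed (auto simp: indicator_def)
  have "(\<integral>\<^sup>+x. \<integral>\<^sup>+y. ennreal ((f x - f y)\<^sup>2) * indicator Q x * indicator Q y \<partial>lborel \<partial>lborel) \<le>
     (\<integral>\<^sup>+x. \<integral>\<^sup>+y. ennreal (d\<^sup>2) * (\<integral>\<^sup>+t. Nt (?P t x y) * indicator Q x * indicator Q y * indicator {0..1} t \<partial>lborel) \<partial>lborel \<partial>lborel)"
    by (intro nn_integral_mono point)
  also have "\<dots> = ennreal (d\<^sup>2) * (\<integral>\<^sup>+x. \<integral>\<^sup>+y. \<integral>\<^sup>+t. Nt (?P t x y) * indicator Q x * indicator Q y * indicator {0..1} t \<partial>lborel \<partial>lborel \<partial>lborel)"
    by (rule trans[OF nn_integral_cong[OF nn_integral_cmult] nn_integral_cmult]) measurable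
  \<comment> \<open>Two exchanges bring t outermost, since the bound for a convex combination holds
    for each fixed t.\<close>
  also have "(\<integral>\<^sup>+x. \<integral>\<^sup>+y. \<integral>\<^sup>+t. Nt (?P t x y) * indicator Q x * indicator Q y * indicator {0..1::real} t \<partial>lborel \<partial>lborel \<partial>lborel) =
     (\<integral>\<^sup>+x. \<integral>\<^sup>+t. \<integral>\<^sup>+y. Nt (?P t x y) * indicator Q x * indicator Q y * indicator {0..1} t \<partial>lborel \<partial>lborel \<partial>lborel)"
    by (intro nn_integral_cong lborel_pair.Fubini') measurable
  also have "\<dots> = (\<integral>\<^sup>+t. \<integral>\<^sup>+x. \<integral>\<^sup>+y. Nt (?P t x y) * indicator Q x * indicator Q y * indicator {0..1} t \<partial>lborel \<partial>lborel \<partial>lborel)"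
    by (intro lborel_pair.Fubini') measurable
  also have "\<dots> = (\<integral>\<^sup>+t. (\<integral>\<^sup>+x. \<integral>\<^sup>+y. Nt (?P t x y) * indicator Q x * indicator Q y \<partial>lborel \<partial>lborel) * indicator {0..1} t \<partial>lborel)"
    by (intro nn_integral_cong) (auto simp: indicator_def)
  also have "\<dots> \<le> (\<integral>\<^sup>+t. (2 ^ DIM('a) * emeasure lborel Q * (\<integral>\<^sup>+z. Nt z \<partial>lborel)) * indicator {0..1::real} t \<partial>lborel)"
    by (rule nn_integral_mono, rule mult_right_mono_indicator, rule nn_integral_convex_comb_le[OF Ntm Qs])
  also have "\<dots> = 2 ^ DIM('a) * emeasure lborel Q * (\<integral>\<^sup>+z. Nt z \<partial>lborel)"
    by (simp add: nn_integral_cmult_indicator)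
  finally have up: "(\<integral>\<^sup>+x. \<integral>\<^sup>+y. ennreal ((f x - f y)\<^sup>2) * indicator Q x * indicator Q y \<partial>lborel \<partial>lborel) \<le>
     ennreal (d\<^sup>2) * (2 ^ DIM('a) * emeasure lborel Q * ennreal (I N))"
    unfolding NtI by (simp add: mult_left_mono)
  have Iquad: "I (\<lambda>x. \<alpha> * (f x)\<^sup>2 + \<beta> * f x + \<gamma>) = \<alpha> * I (\<lambda>x. (f x)\<^sup>2) + \<beta> * I f + measure lborel Q * \<gamma>" for \<alpha> \<beta> \<gamma>
  proof -
    have "continuous_on Q (\<lambda>x. \<alpha> * (f x)\<^sup>2)" "continuous_on Q (\<lambda>x. \<beta> * f x)" "continuous_on Q (\<lambda>x. \<gamma>)"
      by (intro continuous_intros contf)+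
    then show ?thesis by (simp only: Iadd Imul Ic continuous_on_add)
  qed
  have Iy: "I (\<lambda>y. (f x - f y)\<^sup>2) = measure lborel Q * (f x)\<^sup>2 + (- 2 * I f) * f x + I (\<lambda>x. (f x)\<^sup>2)" for x
  proof -
    have "(\<lambda>y. (f x - f y)\<^sup>2) = (\<lambda>y. 1 * (f y)\<^sup>2 + (- 2 * f x) * f y + (f x)\<^sup>2)"
      by (auto simp: fun_eq_iff power2_diff)
    then show ?thesis by (simp only: Iquad) simp
  qed
  have "(\<integral>\<^sup>+x. \<integral>\<^sup>+y. ennreal ((f x - f y)\<^sup>2) * indicator Q x * indicator Q y \<partial>lborel \<partial>lborel) =
    (\<integral>\<^sup>+x. ennreal (measure lborel Q * (f x)\<^sup>2 + (- 2 * I f) * f x + I (\<lambda>x. (f x)\<^sup>2)) * indicator Q x \<partial>lborel)"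
  proof (intro nn_integral_cong)
    fix x
    have "(\<integral>\<^sup>+y. ennreal ((f x - f y)\<^sup>2) * indicator Q x * indicator Q y \<partial>lborel) =
      (\<integral>\<^sup>+y. ennreal ((f x - f y)\<^sup>2) * indicator Q y \<partial>lborel) * indicator Q x"
      by (auto simp: indicator_def)
    also have "(\<integral>\<^sup>+y. ennreal ((f x - f y)\<^sup>2) * indicator Q y \<partial>lborel) = ennreal (I (\<lambda>y. (f x - f y)\<^sup>2))"
      by (intro nnI continuous_intros contf) auto
    also note Iy
    finally show "(\<integral>\<^sup>+y. ennreal ((f x - f y)\<^sup>2) * indicator Q x * indicator Q y \<partial>lborel) =
      ennreal (measure lborel Q * (f x)\<^sup>2 + (- 2 * I f) * f x + I (\<lambda>x. (f x)\<^sup>2)) * indicator Q x" .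
  qed
  also have "\<dots> = ennreal (I (\<lambda>x. measure lborel Q * (f x)\<^sup>2 + (- 2 * I f) * f x + I (\<lambda>x. (f x)\<^sup>2)))"
  proof (rule nnI)
    show "continuous_on Q (\<lambda>x. measure lborel Q * (f x)\<^sup>2 + (- 2 * I f) * f x + I (\<lambda>x. (f x)\<^sup>2))"
      by (intro continuous_intros contf)
    fix x
    have "I (\<lambda>y. (f x - f y)\<^sup>2) \<ge> 0"
      unfolding I_def by (intro integral_nonneg int continuous_intros contf) auto
    also note Iy
    finally show "0 \<le> measure lborel Q * (f x)\<^sup>2 + (- 2 * I f) * f x + I (\<lambda>x. (f x)\<^sup>2)" .
  qed
  also have "I (\<lambda>x. measure lborel Q * (f x)\<^sup>2 + (- 2 * I f) * f x + I (\<lambda>x. (f x)\<^sup>2)) =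
     2 * (measure lborel Q * I (\<lambda>x. (f x)\<^sup>2) - (I f)\<^sup>2)"
    unfolding Iquad by (simp add: power2_eq_square)
  finally have "ennreal (2 * (measure lborel Q * I (\<lambda>x. (f x)\<^sup>2) - (I f)\<^sup>2)) \<le> ennreal (d\<^sup>2 * (2 ^ DIM('a) * measure lborel Q * I N))"
    using up integral_nonneg[OF int[OF contN]] N0 
    by (simp add: emeasure_lborel_cbox_eq content_cbox_if ennreal_mult I_def Q_def ennreal_power[symmetric] measure_def) 
  then have "2 * (measure lborel Q * I (\<lambda>x. (f x)\<^sup>2) - (I f)\<^sup>2) \<le> d\<^sup>2 * (2 ^ DIM('a) * measure lborel Q * I N)"
    using integral_nonneg[OF int[OF contN]] N0 m by (subst (asm) ennreal_le_iff) (auto simp: I_def)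
  \<comment> \<open>Half of this term would do; its nonnegativity allows the constant without the
    factor 1/2.\<close>
  moreover have "0 \<le> measure lborel Q * (2 ^ DIM('a) * d\<^sup>2 * I N)"
    unfolding I_def using N0 by (intro mult_nonneg_nonneg integral_nonneg[OF int[OF contN]]) auto
  ultimately have "measure lborel Q * I (\<lambda>x. (f x)\<^sup>2) \<le> (I f)\<^sup>2 + measure lborel Q * (2 ^ DIM('a) * d\<^sup>2 * I N)"
    by (simp add: algebra_simps)
  then show ?thesis using m by (simp add: I_def field_simps)
qed

text \<open>Poincare's inequality on the cells of a division so fine that the constant drops to
  \<open>e\<close>. The division is chosen before f, so that the L^2 norm of every f is controlled,
  up to a small multiple of the Dirichlet integral, by the same finitely many integrals; compactness
  is drawn from this.\<close>

lemma rellich_cbox: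
  fixes a b :: "'a::euclidean_space"
  assumes "0 < e"
  shows "\<exists>D. finite D \<and> (\<forall>q\<in>D. q \<subseteq> cbox a b \<and> (\<exists>c d. q = cbox c d)) \<and>
    (\<forall>f f' N. (\<forall>x\<in>cbox a b. (f has_derivative f' x) (at x) \<and> (\<forall>v. (f' x v)\<^sup>2 \<le> (norm v)\<^sup>2 * N x) \<and> 0 \<le> N x) \<longrightarrow>
      continuous_on (cbox a b) N \<longrightarrow>
      integral (cbox a b) (\<lambda>x. (f x)\<^sup>2) \<le> (\<Sum>q\<in>D. (integral q f)\<^sup>2 / measure lborel q) + e * integral (cbox a b) N)"
proof -
  \<comment> \<open>A cell inside a ball of radius \<open>d\<close> has diameter at most
    \<open>2 * d\<close>; with this value the Poincare constant is exactly \<open>e\<close>.\<close>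
  define d where "d = sqrt (e / 2 ^ DIM('a)) / 2"
  have d: "d > 0" and de: "2 ^ DIM('a) * (2 * d)\<^sup>2 = e" using assms by (simp_all add: d_def)
  obtain p where p: "p tagged_division_of cbox a b" "(\<lambda>x. ball x d) fine p"
    using fine_division_exists[OF gauge_ball[OF d]] by blast
  define D where "D = snd ` p"
  have D: "D division_of cbox a b" unfolding D_def by (rule division_of_tagged_division[OF p(1)])
  show ?thesis
  proof (rule exI[of _ D], intro conjI ballI allI impI)
    show "finite D" by (rule division_ofD(1)[OF D])
    show "q \<subseteq> cbox a b" "\<exists>c d. q = cbox c d" if "q \<in> D" for q using division_ofD(2,4)[OF D that] by auto
    fix f :: "'a \<Rightarrow> real" and f' N
    assume A: "\<forall>x\<in>cbox a b. (f has_derivative f' x) (at x) \<and> (\<forall>v. (f' x v)\<^sup>2 \<le> (norm v)\<^sup>2 * N x) \<and> 0 \<le> N x"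
      and contN: "continuous_on (cbox a b) N"
    have contf: "continuous_on (cbox a b) f"
      using A by (intro continuous_at_imp_continuous_on ballI has_derivative_continuous) auto
    have "integral (cbox a b) (\<lambda>x. (f x)\<^sup>2) = (\<Sum>q\<in>D. integral q (\<lambda>x. (f x)\<^sup>2))"
      by (intro integral_combine_division_topdown[OF _ D] integrable_continuous continuous_intros contf)
    also have "\<dots> \<le> (\<Sum>q\<in>D. (integral q f)\<^sup>2 / measure lborel q + e * integral q N)"
    proof (rule sum_mono)
      fix q assume q: "q \<in> D"
      obtain x where x: "(x, q) \<in> p" using q by (auto simp: D_def)
      obtain l u where lu: "q = cbox l u" using division_ofD(4)[OF D q] by blast
      have sub: "q \<subseteq> cbox a b" using division_ofD(2)[OF D q] .
      have qb: "q \<subseteq> ball x d" using fineD[OF p(2) x] .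
      have "norm (y - z) \<le> 2 * d" if "y \<in> q" "z \<in> q" for y z
      proof -
      have "dist x y < d" "dist x z < d" using that qb by auto
      then have "dist y z \<le> 2 * d" using dist_triangle3[of y z x] by linarith
      then show ?thesis by (simp add: dist_norm)
    qed
      then have "integral q (\<lambda>x. (f x)\<^sup>2) \<le> (integral q f)\<^sup>2 / measure lborel q + 2 ^ DIM('a) * (2 * d)\<^sup>2 * integral q N"
        unfolding lu using A sub continuous_on_subset[OF contN sub] 
        by (intro poincare_cbox[where f'=f']) (auto simp: lu)
      then show "integral q (\<lambda>x. (f x)\<^sup>2) \<le> (integral q f)\<^sup>2 / measure lborel q + e * integral q N"
        unfolding de .
    qed
    also have "\<dots> = (\<Sum>q\<in>D. (integral q f)\<^sup>2 / measure lborel q) + e * (\<Sum>q\<in>D. integral q N)"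
      by (simp add: sum.distrib sum_distrib_left)
    also have "(\<Sum>q\<in>D. integral q N) = integral (cbox a b) N"
      by (intro integral_combine_division_topdown[OF _ D, symmetric] integrable_continuous contN)
    finally show "integral (cbox a b) (\<lambda>x. (f x)\<^sup>2) \<le> (\<Sum>q\<in>D. (integral q f)\<^sup>2 / measure lborel q) + e * integral (cbox a b) N" .
  qed
qed

section \<open>Determinants, Cramer's rule and positive definite matrices\<close>

lemma smooth_on_det:
  fixes F :: "'a::real_normed_vector \<Rightarrow> real ^ 'n::finite ^ 'n"
  assumes S: "open S" and F: "\<And>i j. smooth_on S (\<lambda>x. F x $ i $ j)"
  shows "smooth_on S (\<lambda>x. det (F x))"
  unfolding det_def by (intro smooth_on_sum smooth_on_mult smooth_on_prod smooth_on_const F S)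

lemma smooth_on_inverse_pos:
  assumes "open S" "smooth_on S f" "\<And>x. x \<in> S \<Longrightarrow> (0::real) < f x"
  shows "smooth_on S (\<lambda>x. inverse (f x))"
  by (rule smooth_on_compose[OF assms(1) open_greaterThan _ assms(2) smooth_on_inverse]) (use assms(3) in auto)

lemma matrix_inv_inverse:
  assumes "invertible G"
  shows "G ** matrix_inv G = mat 1" "matrix_inv G ** G = mat 1"
  using someI_ex[OF assms[unfolded invertible_def]] by (auto simp: matrix_inv_def)

text \<open>Cramer's rule turns \<open>matrix_inv\<close>, which is defined by choice, into
  quotients of determinants, whose smooth dependence on parameters is evident.\<close>

lemma matrix_inv_mult_eq_Cramer:
  fixes G :: "real ^ 'n::finite ^ 'n"
  assumes "det G \<noteq> 0"
  shows "matrix_inv G *v w = (\<chi> k. det (\<chi> i j. if j = k then w $ i else G $ i $ j) / det G)"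
proof -
  have "invertible G" using assms by (simp add: invertible_det_nz)
  then have "G ** matrix_inv G = mat 1" by (rule matrix_inv_inverse)
  then have "G *v (matrix_inv G *v w) = w" by (simp add: matrix_vector_mul_assoc)
  then show ?thesis using cramer[OF assms] by blast
qed

lemma smooth_on_matrix_inv_mult:
  fixes G :: "'a::real_normed_vector \<Rightarrow> real ^ 'n::finite ^ 'n" and w :: "'a \<Rightarrow> real ^ 'n"
  assumes S: "open S" and G: "\<And>i j. smooth_on S (\<lambda>x. G x $ i $ j)" and w: "\<And>i. smooth_on S (\<lambda>x. w x $ i)"
    and pos: "\<And>x. x \<in> S \<Longrightarrow> 0 < det (G x)"
  shows "smooth_on S (\<lambda>x. matrix_inv (G x) *v w x)"
proof (rule smooth_on_vec[OF S])
  fix k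
  have "smooth_on S (\<lambda>x. det (\<chi> i j. if j = k then w x $ i else G x $ i $ j) * inverse (det (G x)))"
  proof (intro smooth_on_mult[OF S] smooth_on_inverse_pos[OF S] smooth_on_det[OF S] G)
    show "smooth_on S (\<lambda>x. (\<chi> i j. if j = k then w x $ i else G x $ i $ j) $ i $ j)" for i j
      by (cases "j = k") (simp_all add: G w)
  qed (rule pos)
  then show "smooth_on S (\<lambda>x. (matrix_inv (G x) *v w x) $ k)"
    by (rule smooth_on_cong[OF S, rotated]) (use pos in \<open>simp add: matrix_inv_mult_eq_Cramer less_imp_neq[THEN not_sym] divide_inverse\<close>)
qed

text \<open>All matrices on the segment from the identity to \<open>G\<close> are positive definite
  in the same sense, hence invertible; by the intermediate value theorem the determinant keeps the
  sign it has at the identity.\<close>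

lemma det_pos_of_pos_def:
  fixes G :: "real ^ 'n::finite ^ 'n"
  assumes pos: "\<And>v. v \<noteq> 0 \<Longrightarrow> v \<bullet> (G *v v) > 0"
  shows "det G > 0"
proof -
  define H where "H t = (1 - t) *\<^sub>R mat 1 + t *\<^sub>R G" for t :: real
  have Hv: "H t *v v = (1 - t) *\<^sub>R v + t *\<^sub>R (G *v v)" for t v
    by (simp add: H_def matrix_vector_mult_add_rdistrib scaleR_matrix_vector_assoc[symmetric])
  have nz: "det (H t) \<noteq> 0" if "t \<in> {0..1}" for t
  proof
    assume "det (H t) = 0"
    then have "\<not> invertible (H t)" by (simp add: invertible_det_nz)
    then obtain v where v: "v \<noteq> 0" "H t *v v = 0"
      by (metis matrix_left_invertible_ker invertible_left_inverse)
    have "v \<bullet> (H t *v v) = (1 - t) * (v \<bullet> v) + t * (v \<bullet> (G *v v))"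
      by (simp add: Hv inner_add_right)
    moreover have "\<dots> > 0"
    proof (cases "t = 0")
      case True then show ?thesis using v(1) by simp
    next
      case False
      then have "t * (v \<bullet> (G *v v)) > 0" using pos[OF v(1)] that by simp
      moreover have "(1 - t) * (v \<bullet> v) \<ge> 0" using that by simp
      ultimately show ?thesis by linarith
    qed
    ultimately show False using v(2) by simp
  qed
  have cont: "continuous_on {0..1} (\<lambda>t. det (H t))"
    unfolding det_def H_def by (simp, intro continuous_intros)
  have "H 0 = mat 1" "H 1 = G" by (simp_all add: H_def)
  then have ends: "det (H 0) = 1" "det (H 1) = det G" by simp_all
  show ?thesis
  proof (rule ccontr)
    assume "\<not> det G > 0"
    then have "\<exists>t. 0 \<le> t \<and> t \<le> 1 \<and> det (H t) = 0"
      using IVT2'[of "\<lambda>t. det (H t)" 1 0 0] ends cont by auto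
    then show False using nz by auto
  qed
qed

section \<open>Charts on a compact Riemannian manifold\<close>

locale riemannian =
  fixes A :: "('m::{t2_space, second_countable_topology}, 'n::finite) chart set"
    and g :: "('m, 'n) metric"
  assumes atlas: "smooth_atlas A" and metric: "riemannian_metric A g"
    and compact_M: "compact (UNIV :: 'm set)"
begin

abbreviation dom :: "('m, 'n) chart \<Rightarrow> (real ^ 'n) set" where "dom c \<equiv> snd c ` fst c"

abbreviation rho :: "('m, 'n) chart \<Rightarrow> 'm \<Rightarrow> real" where "rho \<equiv> vol_density g"

abbreviation vol :: "'m measure" where "vol \<equiv> riem_volume A g"

lemma chart:
  assumes "c \<in> A"
  shows "open (fst c)" "open (dom c)" "continuous_on (fst c) (snd c)" "continuous_on (dom c) (chart_inv c)"
    "p \<in> fst c \<Longrightarrow> chart_inv c (snd c p) = p" "y \<in> dom c \<Longrightarrow> snd c (chart_inv c y) = y"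
    "y \<in> dom c \<Longrightarrow> chart_inv c y \<in> fst c"
proof -
  have "is_chart c" using atlas assms by (simp add: smooth_atlas_def)
  then have "open (fst c)" "open (dom c)" and h: "homeomorphism (fst c) (dom c) (snd c) (chart_inv c)"
    by (auto simp: is_chart_def)
  then show "open (fst c)" "open (dom c)" "continuous_on (fst c) (snd c)" "continuous_on (dom c) (chart_inv c)"
    "p \<in> fst c \<Longrightarrow> chart_inv c (snd c p) = p" "y \<in> dom c \<Longrightarrow> snd c (chart_inv c y) = y"
    "y \<in> dom c \<Longrightarrow> chart_inv c y \<in> fst c"
    using homeomorphism_apply1[OF h] homeomorphism_apply2[OF h] homeomorphism_cont1[OF h]
      homeomorphism_cont2[OF h] by auto
qed

lemma chart_inj: "c \<in> A \<Longrightarrow> inj_on (snd c) (fst c)"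
  by (rule inj_on_inverseI[where g="chart_inv c"]) (rule chart(5))

lemma ex_chart: obtains c where "c \<in> A" "p \<in> fst c"
  using atlas unfolding smooth_atlas_def by blast

lemma chart_at: "chart_at A p \<in> A" "p \<in> fst (chart_at A p)"
proof -
  have "\<exists>c. c \<in> A \<and> p \<in> fst c" using ex_chart by metis
  from someI_ex[OF this] show "chart_at A p \<in> A" "p \<in> fst (chart_at A p)" by (auto simp: chart_at_def)
qed

lemma open_chart_image:
  assumes "c \<in> A" "open W" "W \<subseteq> fst c"
  shows "open (snd c ` W)"
proof -
  have "snd c ` W = dom c \<inter> chart_inv c -` W"
    using assms chart(5)[OF assms(1)] by (force simp: image_iff)
  then show ?thesis
    using continuous_open_preimage[OF chart(4)[OF assms(1)] chart(2)[OF assms(1)] assms(2)] by simp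
qed

lemma open_chart_inv_image:
  assumes "c \<in> A" "open W" "W \<subseteq> dom c"
  shows "open (chart_inv c ` W)"
proof -
  have "chart_inv c ` W = fst c \<inter> snd c -` W"
    using assms chart(5-7)[OF assms(1)] by (force simp: image_iff)
  then show ?thesis
    using continuous_open_preimage[OF chart(3)[OF assms(1)] chart(1)[OF assms(1)] assms(2)] by simp
qed

subsection \<open>Changes of charts\<close>

lemma transition_deriv:
  assumes "c \<in> A" "d \<in> A" "p \<in> fst c \<inter> fst d"
  shows "(transition c d has_derivative (\<lambda>v. jacobian c d p *v v)) (at (snd c p))"
proof -
  have "smooth_on (snd c ` (fst c \<inter> fst d)) (transition c d)"
    using atlas assms by (simp add: smooth_atlas_def)
  from smooth_onD(1)[OF this] assms(3)
  have D: "(transition c d has_derivative frechet_derivative (transition c d) (at (snd c p))) (at (snd c p))"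
    by blast
  then show ?thesis unfolding jacobian_def by (simp add: matrix_works has_derivative_linear)
qed

lemma smooth_funD:
  "smooth_fun A f \<Longrightarrow> c \<in> A \<Longrightarrow> smooth_on (dom c) (\<lambda>y. f (chart_inv c y))"
  by (simp add: smooth_fun_def smooth_components_def)

text \<open>The differential of \<open>f\<close> in coordinates: a covector, which transforms with
  the transposed Jacobian and gives the gradient after application of the inverse metric.\<close>

definition dpart :: "('m, 'n) chart \<Rightarrow> ('m \<Rightarrow> real) \<Rightarrow> 'm \<Rightarrow> real ^ 'n" where
  "dpart c f p = (\<chi> i. partial c i f p)"

lemma dpart_deriv:
  assumes "c \<in> A" "p \<in> fst c" "(\<lambda>y. f (chart_inv c y)) differentiable (at (snd c p))"
  shows "((\<lambda>y. f (chart_inv c y)) has_derivative (\<lambda>v. v \<bullet> dpart c f p)) (at (snd c p))"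
proof -
  let ?D = "frechet_derivative (\<lambda>y. f (chart_inv c y)) (at (snd c p))"
  have D: "((\<lambda>y. f (chart_inv c y)) has_derivative ?D) (at (snd c p))"
    using assms(3) by (simp add: frechet_derivative_works)
  then have lin: "linear ?D" by (rule has_derivative_linear)
  have "?D v = v \<bullet> dpart c f p" for v
  proof -
    have "v = (\<Sum>i\<in>UNIV. v $ i *\<^sub>R axis i 1)"
      by (simp add: basis_expansion scalar_mult_eq_scaleR[symmetric])
    then have "?D v = ?D (\<Sum>i\<in>UNIV. v $ i *\<^sub>R axis i 1)" by (rule arg_cong)
    also have "\<dots> = (\<Sum>i\<in>UNIV. v $ i * ?D (axis i 1))"
      by (simp only: linear_sum[OF lin] linear_scale[OF lin] o_def real_scaleR_def)
    finally show ?thesis by (simp add: inner_vec_def dpart_def partial_def)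
  qed
  then have "?D = (\<lambda>v. v \<bullet> dpart c f p)" by (rule ext)
  then show ?thesis using D by simp
qed

lemma dpart_unique:
  assumes "c \<in> A" "p \<in> fst c" "((\<lambda>y. f (chart_inv c y)) has_derivative (\<lambda>v. v \<bullet> w)) (at (snd c p))"
  shows "dpart c f p = w"
  unfolding dpart_def partial_def frechet_derivative_at[OF assms(3), symmetric]
  by (simp add: vec_eq_iff inner_axis')

lemma smooth_fun_deriv:
  assumes "smooth_fun A f" "c \<in> A" "p \<in> fst c"
  shows "((\<lambda>y. f (chart_inv c y)) has_derivative (\<lambda>v. v \<bullet> dpart c f p)) (at (snd c p))"
  using assms smooth_onD(1)[OF smooth_funD[OF assms(1,2)]]
  by (intro dpart_deriv) (auto simp: differentiable_def)

lemma dpart_change: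
  assumes f: "smooth_fun A f" and cd: "c \<in> A" "d \<in> A" "p \<in> fst c \<inter> fst d"
  shows "dpart c f p = transpose (jacobian c d p) *v dpart d f p"
proof (rule dpart_unique)
  show "c \<in> A" "p \<in> fst c" using cd by auto
  have tp: "transition c d (snd c p) = snd d p" using cd chart(5)[OF cd(1)] by (simp add: transition_def)
  have "((\<lambda>y. f (chart_inv d (transition c d y))) has_derivative (\<lambda>v. (jacobian c d p *v v) \<bullet> dpart d f p)) (at (snd c p))"
    by (rule has_derivative_compose[OF transition_deriv[OF cd]])
      (use smooth_fun_deriv[OF f cd(2), of p] cd tp in auto)
  then have "((\<lambda>y. f (chart_inv c y)) has_derivative (\<lambda>v. (jacobian c d p *v v) \<bullet> dpart d f p)) (at (snd c p))"
  proof (rule has_derivative_transform_within_open)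
    show "open (snd c ` (fst c \<inter> fst d))" using open_chart_image cd(1) chart(1) cd by (simp add: open_Int)
    show "snd c p \<in> snd c ` (fst c \<inter> fst d)" using cd by auto
    show "f (chart_inv d (transition c d y)) = f (chart_inv c y)" if "y \<in> snd c ` (fst c \<inter> fst d)" for y
      using that chart(5)[OF cd(1)] chart(5)[OF cd(2)] by (auto simp: transition_def)
  qed
  then show "((\<lambda>y. f (chart_inv c y)) has_derivative (\<lambda>v. v \<bullet> (transpose (jacobian c d p) *v dpart d f p))) (at (snd c p))"
    by (simp add: dot_lmul_matrix[symmetric] inner_commute vector_transpose_matrix)
qed

lemma metricD:
  assumes "c \<in> A" "p \<in> fst c"
  shows "transpose (g c p) = g c p" "v \<noteq> 0 \<Longrightarrow> v \<bullet> (g c p *v v) > 0"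
    "d \<in> A \<Longrightarrow> p \<in> fst d \<Longrightarrow> g c p = transpose (jacobian c d p) ** g d p ** jacobian c d p"
    "det (g c p) > 0" "rho c p > 0" "matrix_inv (g c p) ** g c p = mat 1" "g c p ** matrix_inv (g c p) = mat 1"
proof -
  show "transpose (g c p) = g c p" and pos: "\<And>v. v \<noteq> 0 \<Longrightarrow> v \<bullet> (g c p *v v) > 0" and
    "d \<in> A \<Longrightarrow> p \<in> fst d \<Longrightarrow> g c p = transpose (jacobian c d p) ** g d p ** jacobian c d p"
    using metric assms unfolding riemannian_metric_def by blast+
  show d: "det (g c p) > 0" by (rule det_pos_of_pos_def[OF pos])
  then show "rho c p > 0" by (simp add: vol_density_def)
  have "invertible (g c p)" using d by (simp add: invertible_det_nz)
  then show "matrix_inv (g c p) ** g c p = mat 1" "g c p ** matrix_inv (g c p) = mat 1"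
    by (simp_all add: matrix_inv_inverse)
qed

lemma metric_sym:
  assumes "c \<in> A" "p \<in> fst c"
  shows "v \<bullet> (g c p *v w) = w \<bullet> (g c p *v v)"
proof -
  have "v \<bullet> (g c p *v w) = (v v* g c p) \<bullet> w" by (simp add: dot_lmul_matrix)
  also have "v v* g c p = transpose (g c p) *v v" by simp
  finally show ?thesis by (simp add: metricD(1)[OF assms] inner_commute)
qed

lemma metric_Cauchy_Schwarz:
  assumes "c \<in> A" "p \<in> fst c"
  shows "(v \<bullet> (g c p *v w))\<^sup>2 \<le> (v \<bullet> (g c p *v v)) * (w \<bullet> (g c p *v w))"
proof (rule quadratic_nonneg_imp_discriminant_le)
  have nn: "0 \<le> u \<bullet> (g c p *v u)" for u
    using metricD(2)[OF assms, of u] by (cases "u = 0") auto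
  show "0 \<le> w \<bullet> (g c p *v w)" by (rule nn)
  fix t :: real
  have "0 \<le> (v + t *\<^sub>R w) \<bullet> (g c p *v (v + t *\<^sub>R w))" by (rule nn)
  also have "\<dots> = v \<bullet> (g c p *v v) + 2 * t * (v \<bullet> (g c p *v w)) + t\<^sup>2 * (w \<bullet> (g c p *v w))"
    using metric_sym[OF assms, of v w]
    by (simp add: matrix_vector_right_distrib scaleR_matrix_vector_assoc[symmetric] matrix_vector_mult_scaleR inner_add_left inner_add_right
        algebra_simps power2_eq_square)
  finally show "0 \<le> v \<bullet> (g c p *v v) + 2 * t * (v \<bullet> (g c p *v w)) + t\<^sup>2 * (w \<bullet> (g c p *v w))" .
qed

text \<open>Determinants of the transformation law of the metric. Positivity on the left also forces
  the Jacobian of a change of charts to be invertible.\<close>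

lemma rho_change:
  assumes "c \<in> A" "d \<in> A" "p \<in> fst c \<inter> fst d"
  shows "rho c p = \<bar>det (jacobian c d p)\<bar> * rho d p" "det (jacobian c d p) \<noteq> 0"
proof -
  have "det (g c p) = (det (jacobian c d p))\<^sup>2 * det (g d p)"
    using metricD(3)[OF assms(1) _ assms(2), of p] assms(3) by (simp add: det_mul power2_eq_square)
  then show "rho c p = \<bar>det (jacobian c d p)\<bar> * rho d p" "det (jacobian c d p) \<noteq> 0"
    using metricD(4)[OF assms(1), of p] assms(3) by (auto simp: vol_density_def real_sqrt_mult)
qed

lemma smooth_metric:
  assumes "c \<in> A"
  shows "smooth_on (dom c) (\<lambda>y. g c (chart_inv c y))"
  using metric assms by (simp add: riemannian_metric_def smooth_components_def)

lemma smooth_metric_entry: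
  "c \<in> A \<Longrightarrow> smooth_on (dom c) (\<lambda>y. g c (chart_inv c y) $ i $ j)"
  by (intro smooth_on_vec_nth smooth_metric chart(2))

lemma smooth_rho:
  assumes "c \<in> A"
  shows "smooth_on (dom c) (\<lambda>y. rho c (chart_inv c y))"
  unfolding vol_density_def
  by (rule smooth_on_compose[OF chart(2)[OF assms] open_greaterThan _ smooth_on_det[OF chart(2)[OF assms] smooth_metric_entry[OF assms]] smooth_on_sqrt])
    (use metricD(4)[OF assms] chart(7)[OF assms] in auto)


subsection \<open>Riemannian volume\<close>

text \<open>The constant value off the chart image makes the map Borel on the whole space;
  \<open>rho_ext\<close> vanishes there, so the constant never contributes to an integral.\<close>

definition inv_ext :: "('m, 'n) chart \<Rightarrow> real ^ 'n \<Rightarrow> 'm" where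
  "inv_ext c y = (if y \<in> dom c then chart_inv c y else undefined)"

definition rho_ext :: "('m, 'n) chart \<Rightarrow> real ^ 'n \<Rightarrow> real" where
  "rho_ext c y = (if y \<in> dom c then rho c (chart_inv c y) else 0)"

text \<open>The Riemannian volume of one chart domain: the density sqrt (det g) dy carried to the
  manifold. It gives no mass to the complement of the domain, as expressed by
  \<open>emeasure_chart_vol_Int\<close>.\<close>

definition chart_vol :: "('m, 'n) chart \<Rightarrow> 'm measure" where
  "chart_vol c = distr (density lborel (\<lambda>y. ennreal (rho_ext c y))) borel (inv_ext c)"

lemma inv_ext_measurable[measurable]:
  assumes "c \<in> A"
  shows "inv_ext c \<in> borel \<rightarrow>\<^sub>M borel"
proof (rule borel_measurableI)
  fix S :: "'m set" assume "open S"
  have "inv_ext c -` S \<inter> space borel = (dom c \<inter> chart_inv c -` S) \<union> (if undefined \<in> S then - dom c else {})"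
    by (auto simp: inv_ext_def split: if_splits)
  moreover have "open (dom c \<inter> chart_inv c -` S)"
    by (rule continuous_open_preimage[OF chart(4)[OF assms] chart(2)[OF assms] \<open>open S\<close>])
  ultimately show "inv_ext c -` S \<inter> space borel \<in> sets borel"
    using chart(2)[OF assms] by auto
qed

lemma rho_ext_measurable[measurable]:
  assumes "c \<in> A"
  shows "rho_ext c \<in> borel_measurable borel"
proof -
  have "(\<lambda>y. if y \<in> dom c then rho c (chart_inv c y) else 0) \<in> borel_measurable borel"
    by (rule borel_measurable_continuous_on_if)
      (use chart(2)[OF assms] smooth_onD(3)[OF smooth_rho[OF assms]] in auto)
  then show ?thesis unfolding rho_ext_def[abs_def] .
qed

lemma rho_ext_nonneg: "c \<in> A \<Longrightarrow> 0 \<le> rho_ext c y"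
  by (simp add: rho_ext_def metricD(5) chart(7) less_imp_le)

lemma nn_integral_chart_vol:
  assumes [measurable]: "c \<in> A" "f \<in> borel_measurable borel"
  shows "(\<integral>\<^sup>+p. f p \<partial>chart_vol c) = (\<integral>\<^sup>+y. ennreal (rho_ext c y) * f (inv_ext c y) \<partial>lborel)"
  unfolding chart_vol_def by (simp add: nn_integral_distr nn_integral_density)

lemma emeasure_chart_vol:
  assumes [measurable]: "c \<in> A" "B \<in> sets borel"
  shows "emeasure (chart_vol c) B = (\<integral>\<^sup>+y. ennreal (rho_ext c y * indicator B (inv_ext c y)) \<partial>lborel)"
proof -
  have "emeasure (chart_vol c) B = (\<integral>\<^sup>+p. indicator B p \<partial>chart_vol c)"
    by (simp add: chart_vol_def)
  also have "\<dots> = (\<integral>\<^sup>+y. ennreal (rho_ext c y) * indicator B (inv_ext c y) \<partial>lborel)"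
    by (rule nn_integral_chart_vol) (use assms in auto)
  also have "\<dots> = (\<integral>\<^sup>+y. ennreal (rho_ext c y * indicator B (inv_ext c y)) \<partial>lborel)"
    by (intro nn_integral_cong) (auto simp: indicator_def)
  finally show ?thesis .
qed

lemma sets_chart_vol[simp, measurable_cong]: "sets (chart_vol c) = sets borel" and space_chart_vol[simp]: "space (chart_vol c) = UNIV"
  by (simp_all add: chart_vol_def)

lemma emeasure_chart_vol_Int:
  assumes "c \<in> A" "B \<in> sets borel"
  shows "emeasure (chart_vol c) (B \<inter> fst c) = emeasure (chart_vol c) B"
proof -
  have [measurable]: "fst c \<in> sets borel" using chart(1)[OF assms(1)] by simp
  show ?thesis
    using assms chart(7)[OF assms(1)]
    by (subst (1 2) emeasure_chart_vol)
      (auto intro!: nn_integral_cong simp: rho_ext_def inv_ext_def indicator_def)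
qed

text \<open>Change of variables under the transition map; the absolute Jacobian determinant is
  exactly the ratio of the two densities by \<open>rho_change\<close>.\<close>

lemma chart_vol_overlap:
  assumes cd: "c \<in> A" "d \<in> A" and B[measurable]: "B \<in> sets borel" and sub: "B \<subseteq> fst c \<inter> fst d"
  shows "emeasure (chart_vol c) B = emeasure (chart_vol d) B"
proof -
  let ?S = "snd c ` (fst c \<inter> fst d)" and ?h = "transition c d"
  have oS: "open ?S" using open_chart_image[OF cd(1)] chart(1) cd by (simp add: open_Int)
  have imS: "?h ` ?S = snd d ` (fst c \<inter> fst d)"
    using chart(5)[OF cd(1)] by (auto simp: transition_def image_iff)
  have oS': "open (?h ` ?S)" unfolding imS using open_chart_image[OF cd(2)] chart(1) cd by (simp add: open_Int)
  define f where "f z = rho_ext d z * indicator B (inv_ext d z)" for z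
  have fm[measurable]: "f \<in> borel_measurable borel" unfolding f_def using cd by measurable
  \<comment> \<open>On the overlap the transformed integrand is the density of \<open>c\<close> on
    \<open>B\<close>; outside it both sides vanish because \<open>B\<close> lies in the overlap.
    This form also yields measurability.\<close>
  have key: "(if y \<in> ?S then \<bar>det (matrix (\<lambda>v. jacobian c d (inv_ext c y) *v v))\<bar> * f (?h y) else 0) =
     rho_ext c y * indicator B (inv_ext c y)" for y
  proof (cases "y \<in> ?S")
    case True
    then obtain p where p: "p \<in> fst c \<inter> fst d" "y = snd c p" by auto
    then have e: "inv_ext c y = p" "?h y = snd d p" "inv_ext d (snd d p) = p"
        "rho_ext c y = rho c p" "rho_ext d (snd d p) = rho d p"
      using chart(5)[OF cd(1), of p] chart(5)[OF cd(2), of p]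
      by (auto simp: inv_ext_def transition_def rho_ext_def)
    then show ?thesis using True rho_change[OF cd p(1)] by (simp add: f_def)
  next
    case False
    have "rho_ext c y * indicator B (inv_ext c y) = 0"
    proof (cases "y \<in> dom c")
      case True
      have "inv_ext c y \<notin> B"
      proof
        assume "inv_ext c y \<in> B"
        then have "chart_inv c y \<in> fst c \<inter> fst d" using sub True by (simp add: inv_ext_def subset_iff)
        then have "snd c (chart_inv c y) \<in> ?S" by (rule imageI)
        then show False using False chart(6)[OF cd(1) True] by simp
      qed
      then show ?thesis by simp
    qed (simp add: rho_ext_def)
    then show ?thesis using False by simp
  qed
  have "emeasure (chart_vol d) B = (\<integral>\<^sup>+z. ennreal (if z \<in> ?h ` ?S then f z else 0) \<partial>lborel)"
    unfolding emeasure_chart_vol[OF cd(2) B]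
  proof (intro nn_integral_cong arg_cong[of _ _ ennreal])
    fix z
    have "f z = 0" if "z \<notin> ?h ` ?S"
    proof (cases "z \<in> dom d")
      case True
      have "inv_ext d z \<notin> B"
      proof
        assume "inv_ext d z \<in> B"
        then have "chart_inv d z \<in> fst c \<inter> fst d" using sub True by (simp add: inv_ext_def subset_iff)
        then have "snd d (chart_inv d z) \<in> ?h ` ?S" unfolding imS by (rule imageI)
        then show False using that chart(6)[OF cd(2) True] by simp
      qed
      then show ?thesis by (simp add: f_def)
    qed (simp add: rho_ext_def f_def)
    then show "rho_ext d z * indicator B (inv_ext d z) = (if z \<in> ?h ` ?S then f z else 0)"
      by (auto simp: f_def)
  qed
  also have "\<dots> = (\<integral>\<^sup>+y. ennreal (if y \<in> ?S then \<bar>det (matrix (\<lambda>v. jacobian c d (inv_ext c y) *v v))\<bar> * f (?h y) else 0) \<partial>lborel)"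
  proof (rule nn_integral_change_of_variables)
    show "?S \<in> sets borel" "?h ` ?S \<in> sets borel" using oS oS' by auto
    show "(?h has_derivative (\<lambda>v. jacobian c d (inv_ext c y) *v v)) (at y)" if "y \<in> ?S" for y
    proof -
      obtain p where p: "p \<in> fst c \<inter> fst d" "y = snd c p" using \<open>y \<in> ?S\<close> by auto
      then have "inv_ext c y = p" using chart(5)[OF cd(1)] by (simp add: inv_ext_def)
      then show ?thesis using transition_deriv[OF cd p(1)] p(2) by simp
    qed
    show "inj_on ?h ?S"
      using chart(5)[OF cd(1)] chart_inj[OF cd(2)] by (auto simp: inj_on_def transition_def)
    show "f \<in> borel_measurable borel" by (rule fm)
    show "0 \<le> f x" for x using rho_ext_nonneg[OF cd(2)] by (simp add: f_def)
    show "(\<lambda>y. if y \<in> ?S then \<bar>det (matrix (\<lambda>v. jacobian c d (inv_ext c y) *v v))\<bar> * f (?h y) else 0) \<in> borel_measurable borel"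
      unfolding key using cd by measurable
  qed
  also have "\<dots> = emeasure (chart_vol c) B"
    unfolding key emeasure_chart_vol[OF cd(1) B] ..
  finally show ?thesis ..
qed

lemma chart_formula:
  assumes c: "c \<in> A" and B: "B \<in> sets borel" "B \<subseteq> fst c"
  shows "(\<integral>\<^sup>+ y. ennreal (rho c (chart_inv c y)) * indicator (snd c ` B) y \<partial>lborel) = emeasure (chart_vol c) B"
  unfolding emeasure_chart_vol[OF c B(1)]
proof (intro nn_integral_cong)
  fix y
  show "ennreal (rho c (chart_inv c y)) * indicator (snd c ` B) y = ennreal (rho_ext c y * indicator B (inv_ext c y))"
  proof (cases "y \<in> dom c")
    case True
    have "y \<in> snd c ` B \<longleftrightarrow> chart_inv c y \<in> B"
    proof
      assume "y \<in> snd c ` B" then show "chart_inv c y \<in> B" using B(2) chart(5)[OF c] by auto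
    next
      assume "chart_inv c y \<in> B" then have "snd c (chart_inv c y) \<in> snd c ` B" by (rule imageI)
      then show "y \<in> snd c ` B" by (simp only: chart(6)[OF c True])
    qed
    then show ?thesis using True by (auto simp: indicator_def rho_ext_def inv_ext_def)
  next
    case False
    then have "y \<notin> snd c ` B" using B(2) by auto
    then show ?thesis using False by (simp add: rho_ext_def)
  qed
qed

text \<open>\<open>riem_volume\<close> is a definite description, so existence and uniqueness have
  to be shown. By compactness finitely many chart domains cover, and their disjointed pieces
  \<open>D i\<close> each lie in one chart. A measure with the chart formula must be the sum of the
  chart volumes of the pieces, and this sum satisfies the formula in every chart by
  \<open>chart_vol_overlap\<close>.\<close>

lemma riem_volume_characterization:
  "sets vol = sets borel \<and> (\<forall>c\<in>A. \<forall>B\<in>sets borel. B \<subseteq> fst c \<longrightarrow> emeasure vol B = emeasure (chart_vol c) B)"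
proof -
  define Q where "Q \<mu> \<longleftrightarrow> sets \<mu> = sets borel \<and>
    (\<forall>c\<in>A. \<forall>B\<in>sets borel. B \<subseteq> fst c \<longrightarrow> emeasure \<mu> B = emeasure (chart_vol c) B)" for \<mu> :: "'m measure"
  have volQ: "vol = (THE \<mu>. Q \<mu>)"
    unfolding riem_volume_def Q_def
    by (intro arg_cong[of _ _ The] ext conj_cong ball_cong refl imp_cong) (simp add: chart_formula)
  have cover: "UNIV \<subseteq> (\<Union>c\<in>A. fst c)" using ex_chart by blast
  obtain C where C: "C \<subseteq> A" "finite C" "UNIV \<subseteq> (\<Union>c\<in>C. fst c)"
    by (rule compactE_image[OF compact_M _ cover]) (use chart(1) in auto)
  obtain cs where cs: "set cs = C" using finite_list[OF C(2)] by blast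
  define c where "c i = cs ! i" for i
  define N where "N = length cs"
  have cA: "c i \<in> A" if "i < N" for i using that cs C(1) by (auto simp: c_def N_def)
  \<comment> \<open>\<open>disjointed\<close> takes a sequence over all naturals; the sets from
    index \<open>N\<close> on are made empty.\<close>
  define D where "D i = disjointed (\<lambda>i. fst (c i) \<inter> (if i < N then UNIV else {})) i" for i
  have Dsub: "D i \<subseteq> fst (c i)" for i using disjointed_subset[of _ i] unfolding D_def by force
  have Dm: "D i \<in> sets borel" for i
  proof -
    have "fst (c i) \<in> sets borel" if "i < N" for i using chart(1)[OF cA[OF that]] by simp
    then have "range (\<lambda>i. fst (c i) \<inter> (if i < N then UNIV else {})) \<subseteq> sets borel"
      by auto
    then show ?thesis unfolding D_def using sets.range_disjointed_sets by blast
  qed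
  have Ddisj: "disjoint_family_on D I" for I
    unfolding D_def using disjoint_family_disjointed by (rule disjoint_family_on_mono[rotated]) auto
  have Dcov: "(\<Union>i<N. D i) = UNIV"
  proof (rule UNIV_eq_I[symmetric])
    fix p
    obtain d where "d \<in> set cs" "p \<in> fst d" using C(3) cs by blast
    then have "p \<in> (\<Union>i. fst (c i) \<inter> (if i < N then UNIV else {}))"
      by (force simp: in_set_conv_nth c_def N_def)
    then have "p \<in> (\<Union>i. D i)" unfolding D_def by (subst UN_disjointed_eq)
    then obtain i where i: "p \<in> D i" by blast
    then have "p \<in> fst (c i) \<inter> (if i < N then UNIV else {})"
      using disjointed_subset unfolding D_def by (rule subsetD[rotated])
    then have "i < N" by (simp split: if_splits)
    then show "p \<in> (\<Union>i<N. D i)" using i by blast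
  qed
  have split: "emeasure \<mu> B = (\<Sum>i<N. emeasure \<mu> (B \<inter> D i))" if "sets \<mu> = sets borel" "B \<in> sets borel" for \<mu> B
  proof -
    have "(\<Sum>i<N. emeasure \<mu> (B \<inter> D i)) = emeasure \<mu> (\<Union>i<N. B \<inter> D i)"
      by (rule sum_emeasure) (use that Dm in \<open>auto intro: disjoint_family_on_bisimulation[OF Ddisj]\<close>)
    also have "(\<Union>i<N. B \<inter> D i) = B" using Dcov by blast
    finally show ?thesis ..
  qed
  define m where "m B = (\<Sum>i<N. emeasure (chart_vol (c i)) (B \<inter> D i))" for B
  define \<nu> where "\<nu> = measure_of UNIV (sets borel) m"
  have s\<nu>: "sets \<nu> = sets borel" 
    unfolding \<nu>_def using sets.sigma_sets_eq[of "borel :: 'm measure"] by simp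
  have m\<nu>: "emeasure \<nu> B = m B" if "B \<in> sets borel" for B
  proof (rule emeasure_measure_of[OF \<nu>_def])
    show "sets borel \<subseteq> Pow UNIV" by simp
    show "B \<in> sets \<nu>" using that s\<nu> by simp
    show "positive (sets \<nu>) m" by (simp add: positive_def m_def)
    show "countably_additive (sets \<nu>) m"
    proof (rule countably_additiveI)
      fix F :: "nat \<Rightarrow> 'm set" assume F: "range F \<subseteq> sets \<nu>" "disjoint_family F"
      have "(\<Sum>k. m (F k)) = (\<Sum>i<N. \<Sum>k. emeasure (chart_vol (c i)) (F k \<inter> D i))"
        unfolding m_def by (rule suminf_sum) auto
      also have "\<dots> = m (\<Union>(range F))"
        unfolding m_def
      proof (rule sum.cong[OF refl])
        fix i
        have "(\<Sum>k. emeasure (chart_vol (c i)) (F k \<inter> D i)) = emeasure (chart_vol (c i)) (\<Union>k. F k \<inter> D i)"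
          by (rule suminf_emeasure) (use F Dm s\<nu> in \<open>auto intro: disjoint_family_on_bisimulation[OF F(2)]\<close>)
        then show "(\<Sum>k. emeasure (chart_vol (c i)) (F k \<inter> D i)) = emeasure (chart_vol (c i)) (\<Union>(range F) \<inter> D i)"
          by simp
      qed
      finally show "(\<Sum>k. m (F k)) = m (\<Union>(range F))" .
    qed
  qed
  have ov: "emeasure (chart_vol (c i)) (B \<inter> D i) = emeasure (chart_vol d) (B \<inter> D i)"
    if "i < N" "d \<in> A" "B \<subseteq> fst d" "B \<in> sets borel" for i d B
    using that Dsub[of i] Dm by (intro chart_vol_overlap cA) auto
  have Q\<nu>: "Q \<nu>"
    unfolding Q_def
  proof (intro conjI ballI impI)
    show "sets \<nu> = sets borel" by (rule s\<nu>)
    fix d B assume d: "d \<in> A" and B: "B \<in> sets borel" "B \<subseteq> fst d"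
    have "m B = (\<Sum>i<N. emeasure (chart_vol d) (B \<inter> D i))"
      unfolding m_def by (intro sum.cong refl ov) (use d B in auto)
    then show "emeasure \<nu> B = emeasure (chart_vol d) B" using split[of "chart_vol d" B] m\<nu> B by simp
  qed
  have "\<mu> = \<nu>" if "Q \<mu>" for \<mu>
  proof (rule measure_eqI)
    show "sets \<mu> = sets \<nu>" using that s\<nu> by (simp add: Q_def)
    fix B assume "B \<in> sets \<mu>"
    then have B: "B \<in> sets borel" using that by (simp add: Q_def)
    have "emeasure \<mu> B = (\<Sum>i<N. emeasure \<mu> (B \<inter> D i))" using split that B by (simp add: Q_def)
    also have "\<dots> = m B"
      unfolding m_def
    proof (rule sum.cong[OF refl])
      fix i assume "i \<in> {..<N}"
      then have "c i \<in> A" "B \<inter> D i \<in> sets borel" "B \<inter> D i \<subseteq> fst (c i)"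
        using cA B Dm Dsub by auto
      then show "emeasure \<mu> (B \<inter> D i) = emeasure (chart_vol (c i)) (B \<inter> D i)"
        using that unfolding Q_def by blast
    qed
    finally show "emeasure \<mu> B = emeasure \<nu> B" using m\<nu>[OF B] by simp
  qed
  then have "Q vol" unfolding volQ by (rule theI[of Q, OF Q\<nu>])
  then show ?thesis by (simp add: Q_def)
qed

lemma sets_vol[simp, measurable_cong]: "sets vol = sets borel"
  using riem_volume_characterization by blast

lemma space_vol[simp]: "space vol = UNIV"
  using sets_eq_imp_space_eq[OF sets_vol] by simp

lemma measurable_vol[simp]: "measurable vol N = measurable borel N"
  by (rule measurable_cong_sets) auto

lemma density_vol_chart:
  assumes "c \<in> A"
  shows "density vol (indicator (fst c)) = chart_vol c"
proof (rule measure_eqI)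
  fix B assume "B \<in> sets (density vol (indicator (fst c)))"
  then have B: "B \<in> sets borel" by simp
  have U: "fst c \<in> sets borel" using chart(1)[OF assms] by simp
  have "emeasure (density vol (indicator (fst c))) B = (\<integral>\<^sup>+x. indicator (fst c) x * indicator B x \<partial>vol)"
    by (rule emeasure_density) (use B U in auto)
  also have "\<dots> = (\<integral>\<^sup>+x. indicator (B \<inter> fst c) x \<partial>vol)"
    by (rule nn_integral_cong) (auto simp: indicator_def)
  also have "\<dots> = emeasure vol (B \<inter> fst c)" using B U by simp
  also have "\<dots> = emeasure (chart_vol c) (B \<inter> fst c)"
    using riem_volume_characterization assms B U by simp
  also have "\<dots> = emeasure (chart_vol c) B" by (rule emeasure_chart_vol_Int[OF assms B])
  finally show "emeasure (density vol (indicator (fst c))) B = emeasure (chart_vol c) B" .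
qed simp

lemma integral_vol_chart:
  fixes f :: "'m \<Rightarrow> real"
  assumes c: "c \<in> A" and f[measurable]: "f \<in> borel_measurable borel" and supp: "\<And>p. p \<notin> fst c \<Longrightarrow> f p = 0"
  shows "integrable vol f \<longleftrightarrow> integrable lborel (\<lambda>y. rho_ext c y * f (inv_ext c y))"
    "(LINT p|vol. f p) = (LINT y|lborel. rho_ext c y * f (inv_ext c y))"
proof -
  have U[measurable]: "fst c \<in> sets borel" using chart(1)[OF c] by simp
  have [measurable]: "inv_ext c \<in> borel \<rightarrow>\<^sub>M borel" "rho_ext c \<in> borel_measurable borel" using c by auto
  have fe: "f = (\<lambda>p. indicator (fst c) p *\<^sub>R f p)" using supp by (auto simp: indicator_def fun_eq_iff)
  have d: "density vol (\<lambda>p. ennreal (indicator (fst c) p)) = chart_vol c"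
    using density_vol_chart[OF c] by (simp add: ennreal_indicator)
  have "integrable vol f \<longleftrightarrow> integrable (chart_vol c) f"
    unfolding d[symmetric] by (subst fe, subst integrable_density) auto
  also have "\<dots> \<longleftrightarrow> integrable lborel (\<lambda>y. rho_ext c y * f (inv_ext c y))"
    unfolding chart_vol_def using rho_ext_nonneg[OF c]
    by (subst integrable_distr_eq) (auto simp: integrable_density)
  finally show "integrable vol f \<longleftrightarrow> integrable lborel (\<lambda>y. rho_ext c y * f (inv_ext c y))" .
  have "(LINT p|vol. f p) = (LINT p|chart_vol c. f p)"
    unfolding d[symmetric] by (subst fe, subst integral_density) auto
  also have "\<dots> = (LINT y|lborel. rho_ext c y * f (inv_ext c y))"
    unfolding chart_vol_def using rho_ext_nonneg[OF c]
    by (subst integral_distr) (auto simp: integral_density)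
  finally show "(LINT p|vol. f p) = (LINT y|lborel. rho_ext c y * f (inv_ext c y))" .
qed

text \<open>Open boxes give a finite covering by compactness, while the closed boxes still lie in
  the chart images, where all coordinate expressions are bounded and the inequalities on boxes
  apply.\<close>

lemma ex_finite_cell_cover:
  "\<exists>E :: (('m, 'n) chart \<times> (real ^ 'n) \<times> (real ^ 'n)) set.
    finite E \<and> (\<forall>c a b. (c, a, b) \<in> E \<longrightarrow> c \<in> A \<and> cbox a b \<subseteq> dom c) \<and>
    (\<Union>(c, a, b)\<in>E. chart_inv c ` box a b) = UNIV"
proof -
  let ?T = "{(c, a, b). c \<in> A \<and> cbox a b \<subseteq> dom c}" and ?U = "\<lambda>(c, a, b). chart_inv c ` box a b"
  have op: "open (?U t)" if "t \<in> ?T" for t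
    using that open_chart_inv_image box_subset_cbox by (force split: prod.splits)
  have cov: "UNIV \<subseteq> (\<Union>t\<in>?T. ?U t)"
  proof
    fix p :: 'm
    obtain c where c: "c \<in> A" "p \<in> fst c" by (rule ex_chart)
    then obtain a b where ab: "snd c p \<in> box a b" "cbox a b \<subseteq> dom c"
      using open_contains_cbox[OF chart(2)[OF c(1)], of "snd c p"] by (metis imageI)
    then have "p \<in> ?U (c, a, b)" using chart(5)[OF c] by (force simp: image_iff)
    then show "p \<in> (\<Union>t\<in>?T. ?U t)" using c ab by blast
  qed
  obtain E where E: "E \<subseteq> ?T" "finite E" "UNIV \<subseteq> (\<Union>t\<in>E. ?U t)"
    by (rule compactE_image[OF compact_M op cov])
  show ?thesis
    using E(2,3) subsetD[OF E(1)] by (intro exI[of _ E]) (fastforce split: prod.splits)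
qed

lemma rho_bounds_on_cbox:
  assumes c: "c \<in> A" and K: "cbox a b \<subseteq> dom c"
  obtains r R where "0 < r" "\<And>y. y \<in> cbox a b \<Longrightarrow> r \<le> rho_ext c y" "\<And>y. y \<in> cbox a b \<Longrightarrow> rho_ext c y \<le> R"
proof (cases "cbox a b = {}")
  case True then show ?thesis using that[of 1] by simp
next
  case False
  have cont: "continuous_on (cbox a b) (\<lambda>y. rho c (chart_inv c y))"
    using smooth_onD(3)[OF smooth_rho[OF c]] K continuous_on_subset by blast
  have eq: "rho_ext c y = rho c (chart_inv c y)" if "y \<in> cbox a b" for y using that K by (auto simp: rho_ext_def)
  obtain y0 where y0: "y0 \<in> cbox a b" "\<And>y. y \<in> cbox a b \<Longrightarrow> rho c (chart_inv c y0) \<le> rho c (chart_inv c y)"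
    using continuous_attains_inf[OF compact_cbox False cont] by blast
  obtain y1 where y1: "y1 \<in> cbox a b" "\<And>y. y \<in> cbox a b \<Longrightarrow> rho c (chart_inv c y) \<le> rho c (chart_inv c y1)"
    using continuous_attains_sup[OF compact_cbox False cont] by blast
  have "0 < rho c (chart_inv c y0)" using metricD(5)[OF c] chart(7)[OF c] y0(1) K by blast
  then show ?thesis using that[of "rho c (chart_inv c y0)" "rho c (chart_inv c y1)"] y0 y1 eq by simp
qed

lemma finite_vol: "finite_measure vol"
proof (rule finite_measureI)
  obtain E where E: "finite E" "\<And>c a b. (c, a, b) \<in> E \<Longrightarrow> c \<in> A \<and> cbox a b \<subseteq> dom c"
    "(\<Union>(c, a, b)\<in>E. chart_inv c ` box a b) = UNIV"
    using ex_finite_cell_cover by blast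
  let ?U = "\<lambda>t. case t of (c, a, b) \<Rightarrow> chart_inv c ` box a b"
  have fin: "emeasure vol (?U t) < \<infinity>" "?U t \<in> sets borel" if t: "t \<in> E" for t
  proof -
    obtain c a b where [simp]: "t = (c, a, b)" by (cases t)
    have c: "c \<in> A" and K: "cbox a b \<subseteq> dom c" using E(2) t by auto
    have K': "box a b \<subseteq> dom c" using K box_subset_cbox by blast
    have o: "open (chart_inv c ` box a b)" by (rule open_chart_inv_image[OF c open_box K'])
    then show "?U t \<in> sets borel" by simp
    obtain R where R: "\<And>y. y \<in> cbox a b \<Longrightarrow> rho_ext c y \<le> R" using rho_bounds_on_cbox[OF c K] by metis
    have sub: "chart_inv c ` box a b \<subseteq> fst c" using K' chart(7)[OF c] by blast
    have "emeasure vol (chart_inv c ` box a b) = emeasure (chart_vol c) (chart_inv c ` box a b)"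
      using riem_volume_characterization c o sub by auto
    also have "\<dots> = (\<integral>\<^sup>+y. ennreal (rho_ext c y * indicator (chart_inv c ` box a b) (inv_ext c y)) \<partial>lborel)"
      by (rule emeasure_chart_vol) (use c o in auto)
    also have "\<dots> \<le> (\<integral>\<^sup>+y. ennreal R * indicator (cbox a b) y \<partial>lborel)"
    proof (rule nn_integral_mono)
      fix y
      have "rho_ext c y * indicator (chart_inv c ` box a b) (inv_ext c y) \<le> R \<and> y \<in> cbox a b"
        if "rho_ext c y * indicator (chart_inv c ` box a b) (inv_ext c y) \<noteq> 0"
      proof -
        have y: "y \<in> dom c" "chart_inv c y \<in> chart_inv c ` box a b"
          using that by (auto simp: rho_ext_def inv_ext_def indicator_def split: if_splits)
        then obtain z where z: "z \<in> box a b" "chart_inv c y = chart_inv c z" by auto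
        then have "y = z" using chart(6)[OF c y(1)] chart(6)[OF c, of z] K' by auto
        then have "y \<in> cbox a b" using z(1) box_subset_cbox by blast
        then show ?thesis using R[of y] rho_ext_nonneg[OF c, of y] by (auto simp: indicator_def)
      qed
      then show "ennreal (rho_ext c y * indicator (chart_inv c ` box a b) (inv_ext c y)) \<le> ennreal R * indicator (cbox a b) y"
        by (cases "rho_ext c y * indicator (chart_inv c ` box a b) (inv_ext c y) = 0") (auto simp: ennreal_leI)
    qed
    also have "\<dots> < \<infinity>"
      by (simp add: nn_integral_cmult_indicator ennreal_mult_less_top emeasure_lborel_cbox_eq)
    finally show "emeasure vol (?U t) < \<infinity>" by simp
  qed
  have "emeasure vol (space vol) = emeasure vol (\<Union>t\<in>E. ?U t)" using E(3) by simp
  also have "\<dots> \<le> (\<Sum>t\<in>E. emeasure vol (?U t))"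
    by (rule emeasure_subadditive_finite) (use E(1) fin in auto)
  also have "\<dots> < \<infinity>" using fin by (simp add: sum_eq_0_iff E(1) less_top[symmetric])
  finally show "emeasure vol (space vol) \<noteq> \<infinity>" by simp
qed

sublocale finite_measure vol by (rule finite_vol)

lemma integrable_continuous_vol:
  fixes f :: "'m \<Rightarrow> real"
  assumes "continuous_on UNIV f"
  shows "integrable vol f"
proof -
  obtain B where B: "\<And>x. \<bar>f x\<bar> \<le> B"
    using compact_imp_bounded[OF compact_continuous_image[OF assms compact_M]] by (auto simp: bounded_iff)
  show ?thesis
    by (rule integrable_const_bound[of _ B]) (use B assms borel_measurable_continuous_onI in auto)
qed

text \<open>In a chart the density is positive, and a nonempty open set of coordinates is not
  negligible.\<close>

lemma emeasure_vol_open_pos: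
  assumes "open W" "W \<noteq> {}"
  shows "emeasure vol W > 0"
proof -
  obtain p where p: "p \<in> W" using assms(2) by blast
  obtain c where c: "c \<in> A" "p \<in> fst c" by (rule ex_chart)
  let ?B = "W \<inter> fst c"
  have o: "open ?B" using assms(1) chart(1)[OF c(1)] by blast
  have oS: "open (snd c ` ?B)" by (rule open_chart_image[OF c(1) o]) auto
  have [measurable]: "rho_ext c \<in> borel_measurable borel" "inv_ext c \<in> borel \<rightarrow>\<^sub>M borel" "?B \<in> sets borel"
    using c(1) o by auto
  have "emeasure (chart_vol c) ?B \<noteq> 0"
  proof
    assume "emeasure (chart_vol c) ?B = 0"
    then have "AE y in lborel. ennreal (rho_ext c y * indicator ?B (inv_ext c y)) = 0"
      using o c(1) by (subst (asm) emeasure_chart_vol, simp, simp, subst (asm) nn_integral_0_iff_AE) auto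
    moreover have "ennreal (rho_ext c y * indicator ?B (inv_ext c y)) \<noteq> 0" if "y \<in> snd c ` ?B" for y
    proof -
      obtain q where q: "q \<in> ?B" "y = snd c q" using \<open>y \<in> snd c ` ?B\<close> by blast
      then have "inv_ext c y = q" "rho_ext c y = rho c q"
        using chart(5)[OF c(1)] by (simp_all add: inv_ext_def rho_ext_def)
      then show ?thesis using q(1) metricD(5)[OF c(1), of q] by (simp add: indicator_def)
    qed
    ultimately have "AE y in lborel. y \<notin> snd c ` ?B"
      by (elim AE_mp) (intro AE_I2, blast)
    then have "snd c ` ?B \<in> null_sets lborel"
      using oS by (subst AE_iff_null_sets) auto
    then have "negligible (snd c ` ?B)"
      by (simp add: negligible_iff_null_sets null_sets_completionI)
    then show False using open_not_negligible[OF oS] p c(2) by blast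
  qed
  then have "emeasure vol ?B \<noteq> 0" using riem_volume_characterization c o by auto
  then show ?thesis using emeasure_mono[of ?B W vol] assms(1) by (metis borel_open gr_zeroI inf_le1 le_zero_eq sets_vol)
qed


subsection \<open>Smooth functions\<close>

lemma smooth_funI:
  "(\<And>c. c \<in> A \<Longrightarrow> smooth_on (dom c) (\<lambda>y. f (chart_inv c y))) \<Longrightarrow> smooth_fun A f"
  by (simp add: smooth_fun_def smooth_components_def)

lemma smooth_fun_const: "smooth_fun A (\<lambda>p. k)"
  by (intro smooth_funI smooth_on_const)

lemma smooth_fun_add: "smooth_fun A u \<Longrightarrow> smooth_fun A v \<Longrightarrow> smooth_fun A (\<lambda>p. u p + v p)"
  by (rule smooth_funI, rule smooth_on_add[OF chart(2) smooth_funD smooth_funD])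

lemma smooth_fun_mult: "smooth_fun A u \<Longrightarrow> smooth_fun A v \<Longrightarrow> smooth_fun A (\<lambda>p. u p * v p)"
  by (rule smooth_funI, rule smooth_on_mult[OF chart(2) smooth_funD smooth_funD])

lemma smooth_fun_cmult: "smooth_fun A u \<Longrightarrow> smooth_fun A (\<lambda>p. k * u p)"
  by (rule smooth_fun_mult[OF smooth_fun_const])

lemma smooth_fun_diff:
  assumes "smooth_fun A u" "smooth_fun A v"
  shows "smooth_fun A (\<lambda>p. u p - v p)"
  using smooth_fun_add[OF assms(1) smooth_fun_cmult[OF assms(2), of "-1"]] by simp

lemma smooth_fun_sum:
  "(\<And>i. i \<in> I \<Longrightarrow> smooth_fun A (u i)) \<Longrightarrow> smooth_fun A (\<lambda>p. \<Sum>i\<in>I. u i p)"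
  by (rule smooth_funI, rule smooth_on_sum[OF chart(2) smooth_funD])

lemma smooth_fun_compose:
  assumes "smooth_fun A u" "smooth_on T h" "open T" "range u \<subseteq> T"
  shows "smooth_fun A (\<lambda>p. h (u p))"
  by (rule smooth_funI, rule smooth_on_compose[OF chart(2) assms(3) _ smooth_funD[OF assms(1)] assms(2)])
    (use assms(4) in auto)

lemma smooth_fun_continuous:
  assumes "smooth_fun A f"
  shows "continuous_on UNIV f"
proof -
  have "continuous_on (fst c) f" if c: "c \<in> A" for c
  proof -
    have "continuous_on (fst c) (\<lambda>p. f (chart_inv c (snd c p)))"
      by (rule continuous_on_compose2[OF smooth_onD(3)[OF smooth_funD[OF assms c]] chart(3)[OF c]]) auto
    then show ?thesis
      by (rule continuous_on_cong[THEN iffD1, rotated -1]) (auto simp: chart(5)[OF c])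
  qed
  then have "continuous_on (\<Union>c\<in>A. fst c) f"
    by (intro continuous_on_open_UN chart(1))
  moreover have "(\<Union>c\<in>A. fst c) = UNIV" using atlas by (simp add: smooth_atlas_def)
  ultimately show ?thesis by simp
qed

text \<open>In any other chart two open sets cover the image: the overlap with \<open>c\<close>,
  where \<open>h\<close> is composed with the transition map, and the complement of
  \<open>K\<close>, where \<open>h\<close> is zero.\<close>

lemma smooth_fun_extend:
  assumes c: "c \<in> A" and K: "compact K" "K \<subseteq> fst c" and h0: "\<And>p. p \<notin> K \<Longrightarrow> h p = 0"
    and h: "smooth_on (dom c) (\<lambda>y. h (chart_inv c y))"
  shows "smooth_fun A h"
proof (rule smooth_funI)
  fix d assume d: "d \<in> A"
  let ?S = "snd d ` (fst d \<inter> fst c)" and ?T = "snd d ` (fst d - K)"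
  have oS: "open ?S" using open_chart_image[OF d] chart(1) c d by (simp add: open_Int)
  have oT: "open ?T"
    using open_chart_image[OF d, of "fst d - K"] chart(1)[OF d] compact_imp_closed[OF K(1)] by (simp add: open_Diff)
  have "smooth_on ?S (\<lambda>y. h (chart_inv c (transition d c y)))"
  proof (rule smooth_on_compose[OF oS chart(2)[OF c] _ _ h])
    show "transition d c ` ?S \<subseteq> dom c" using chart(5)[OF d] by (auto simp: transition_def)
    show "smooth_on ?S (transition d c)" using atlas c d by (simp add: smooth_atlas_def)
  qed
  then have "smooth_on ?S (\<lambda>y. h (chart_inv d y))"
    by (rule smooth_on_cong[OF oS, rotated]) (auto simp: transition_def chart(5)[OF c] chart(5)[OF d])
  moreover have "smooth_on ?T (\<lambda>y. h (chart_inv d y))"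
    by (rule smooth_on_cong[OF oT _ smooth_on_const[of _ 0]]) (auto simp: chart(5)[OF d] h0)
  ultimately have "smooth_on (?S \<union> ?T) (\<lambda>y. h (chart_inv d y))" by (rule smooth_on_Un[OF oS oT])
  then show "smooth_on (dom d) (\<lambda>y. h (chart_inv d y))"
    by (rule smooth_on_subset) (use K(2) in auto)
qed

text \<open>In a chart, \<open>bump\<close> is applied to r^2 minus the squared distance to the
  centre. That \<open>K\<close> is not the whole manifold is recorded for the potential, which
  equals 1 off \<open>K\<close> and must attain this value on a nonempty open set.\<close>

lemma ex_bump:
  assumes "open W" "p \<in> W"
  shows "\<exists>h K. smooth_fun A h \<and> (\<forall>q. 0 \<le> h q \<and> h q \<le> 1) \<and> h p > 0 \<and> compact K \<and> K \<subseteq> W \<and> K \<noteq> UNIV \<and>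
    (\<forall>q. q \<notin> K \<longrightarrow> h q = 0)"
proof -
  obtain c where c: "c \<in> A" "p \<in> fst c" by (rule ex_chart)
  let ?y = "snd c p" and ?B = "snd c ` (W \<inter> fst c)"
  have oB: "open ?B" by (rule open_chart_image[OF c(1)]) (use assms chart(1)[OF c(1)] in auto)
  \<comment> \<open>The chart image contains a ball of twice the radius of the support; a point at
    distance \<open>2 * r\<close> from the centre will show \<open>K \<noteq> UNIV\<close>.\<close>
  then obtain r where r: "r > 0" "cball ?y (2 * r) \<subseteq> ?B"
  proof -
    obtain e where "e > 0" "cball ?y e \<subseteq> ?B"
      using oB assms(2) c(2) by (metis IntI imageI open_contains_cball)
    then show ?thesis using that[of "e/2"] by simp
  qed
  have Bsub: "?B \<subseteq> dom c" by auto
  have csub: "cball ?y r \<subseteq> ?B" using r by (intro subset_trans[OF subset_cball r(2)]) simp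
  define h where "h q = (if q \<in> fst c then bump (r\<^sup>2 - (snd c q - ?y) \<bullet> (snd c q - ?y)) else 0)" for q
  define K where "K = chart_inv c ` cball ?y r"
  have K: "compact K" unfolding K_def
    by (intro compact_continuous_image[OF continuous_on_subset[OF chart(4)[OF c(1)]]]) (use csub Bsub in auto)
  have KW: "K \<subseteq> W \<inter> fst c"
  proof
    fix q assume "q \<in> K"
    then obtain y where "y \<in> cball ?y r" "q = chart_inv c y" by (auto simp: K_def)
    moreover from this obtain q' where "q' \<in> W \<inter> fst c" "y = snd c q'" using csub by blast
    ultimately show "q \<in> W \<inter> fst c" using chart(5)[OF c(1)] by auto
  qed
  have h0: "h q = 0" if "q \<notin> K" for q
  proof (cases "q \<in> fst c")
    case True
    have "snd c q \<notin> cball ?y r"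
    proof
      assume "snd c q \<in> cball ?y r"
      then have "chart_inv c (snd c q) \<in> K" unfolding K_def by (rule imageI)
      then show False using that chart(5)[OF c(1) True] by simp
    qed
    then have "r < norm (snd c q - ?y)" by (simp add: dist_norm norm_minus_commute)
    then have "r\<^sup>2 < (norm (snd c q - ?y))\<^sup>2" using r(1) by (intro power_strict_mono) auto
    then have "\<not> bump (r\<^sup>2 - (snd c q - ?y) \<bullet> (snd c q - ?y)) > 0"
      by (simp add: bump_pos_iff power2_norm_eq_inner)
    then show ?thesis using bump_nonneg[of "r\<^sup>2 - (snd c q - ?y) \<bullet> (snd c q - ?y)"] by (simp add: h_def)
  qed (simp add: h_def)
  have "smooth_on (dom c) (\<lambda>y. r\<^sup>2 + (- 1) * ((y + (- ?y)) \<bullet> (y + (- ?y))))"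
    by (intro smooth_on_add smooth_on_mult smooth_on_inner smooth_on_ident smooth_on_const chart(2)[OF c(1)])
  then have "smooth_on (dom c) (\<lambda>y. bump (r\<^sup>2 + (- 1) * ((y + (- ?y)) \<bullet> (y + (- ?y)))))"
    using smooth_on_compose[OF chart(2)[OF c(1)] open_UNIV _ _ smooth_bump] by blast
  then have "smooth_on (dom c) (\<lambda>y. h (chart_inv c y))"
    by (rule smooth_on_cong[OF chart(2)[OF c(1)], rotated]) (simp add: h_def chart(6,7)[OF c(1)])
  then have "smooth_fun A h" using KW by (intro smooth_fun_extend[OF c(1) K _ h0]) auto
  moreover have "0 \<le> h q \<and> h q \<le> 1" for q using bump_nonneg bump_le_1 by (auto simp: h_def)
  moreover have "h p > 0" using c r(1) by (simp add: h_def bump_pos_iff)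
  moreover have "K \<noteq> UNIV"
  proof
    assume U: "K = UNIV"
    obtain i :: 'n where True by simp
    let ?z = "?y + (2 * r) *\<^sub>R axis i 1"
    have "?z \<in> cball ?y (2 * r)" using r(1) by (simp add: dist_norm norm_axis_1)
    then have zd: "?z \<in> dom c" using r(2) Bsub by blast
    have "chart_inv c ?z \<in> K" using U by simp
    then obtain y where y: "y \<in> cball ?y r" "chart_inv c ?z = chart_inv c y" by (auto simp: K_def)
    then have "y \<in> dom c" using csub Bsub by blast
    then have "?z = y" using chart(6)[OF c(1)] zd y(2) by metis
    then have "norm ((2 * r) *\<^sub>R (axis i 1 :: real ^ 'n)) \<le> r" using y(1) by (auto simp: dist_norm)
    then show False using r(1) by (simp add: norm_axis_1)
  qed
  ultimately show ?thesis using K KW h0 by (intro exI[of _ h] exI[of _ K]) auto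
qed

lemma continuous_extend:
  fixes f :: "'m \<Rightarrow> real"
  assumes "open U" "continuous_on U f" "compact K" "K \<subseteq> U" "\<And>p. p \<notin> K \<Longrightarrow> f p = 0"
  shows "continuous_on UNIV f"
proof -
  have "continuous_on (- K) f"
    using continuous_on_cong[of "- K" "- K" f "\<lambda>p. 0"] assms(5) by simp
  then have "continuous_on (U \<union> - K) f"
    using assms(1,2) compact_imp_closed[OF assms(3)] by (intro continuous_on_open_Un) auto
  moreover have "U \<union> - K = UNIV" using assms(4) by auto
  ultimately show ?thesis by simp
qed

lemma integral_vol_pos:
  fixes f :: "'m \<Rightarrow> real"
  assumes "continuous_on UNIV f" "\<And>p. 0 \<le> f p" "0 < f p"
  shows "0 < (LINT p|vol. f p)"
proof -
  have W: "open {p. 0 < f p}" using open_Collect_less[OF continuous_on_const assms(1)] .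
  have int: "integrable vol f" by (rule integrable_continuous_vol[OF assms(1)])
  have "(LINT p|vol. f p) \<noteq> 0"
  proof
    assume "(LINT p|vol. f p) = 0"
    then have "AE p in vol. f p = 0" using integral_nonneg_eq_0_iff_AE[OF int] assms(2) by simp
    then have "AE p in vol. p \<notin> {p. 0 < f p}" by (auto elim: AE_mp)
    then have "{p. 0 < f p} \<in> null_sets vol" using W by (subst AE_iff_null_sets) auto
    then show False using emeasure_vol_open_pos[OF W] assms(3) by (auto simp: null_sets_def)
  qed
  then show ?thesis using Bochner_Integration.integral_nonneg[of vol f] assms(2) by (simp add: less_le)
qed

subsection \<open>Gradients\<close>

lemma gradient_eq: "gradient g f c p = matrix_inv (g c p) *v dpart c f p"
  by (simp add: gradient_def dpart_def)

lemma metric_gradient: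
  assumes "c \<in> A" "p \<in> fst c"
  shows "g c p *v gradient g f c p = dpart c f p"
  using metricD(7)[OF assms] by (simp add: gradient_eq matrix_vector_mul_assoc)

lemma smooth_dpart:
  assumes f: "smooth_fun A f" and c: "c \<in> A"
  shows "smooth_on (dom c) (\<lambda>y. dpart c f (chart_inv c y) $ i)"
  by (rule smooth_on_cong[OF chart(2)[OF c] _ smooth_onD(2)[OF smooth_funD[OF f c], of "axis i 1"]])
    (simp add: dpart_def partial_def chart(6)[OF c])

lemma smooth_gradient:
  assumes "smooth_fun A f"
  shows "smooth_components A (gradient g f)"
  unfolding smooth_components_def gradient_eq
proof
  fix c assume c: "c \<in> A"
  show "smooth_on (dom c) (\<lambda>y. matrix_inv (g c (chart_inv c y)) *v dpart c f (chart_inv c y))"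
    by (intro smooth_on_matrix_inv_mult chart(2)[OF c] smooth_metric_entry[OF c] smooth_dpart[OF assms c] metricD(4)[OF c] chart(7)[OF c])
qed

text \<open>Both sides of the transformation law become the differential \<open>dpart c f p\<close>
  after multiplication by the transposed Jacobian and the metric of \<open>d\<close>, and this
  product is invertible.\<close>

lemma vector_field_gradient:
  assumes f: "smooth_fun A f"
  shows "vector_field A (gradient g f)"
  unfolding vector_field_def
proof (intro ballI)
  fix c d p assume cd: "c \<in> A" "d \<in> A" "p \<in> fst c \<inter> fst d"
  let ?J = "jacobian c d p"
  have "transpose ?J *v (g d p *v (?J *v gradient g f c p)) = (transpose ?J ** g d p ** ?J) *v gradient g f c p"
    by (simp add: matrix_vector_mul_assoc matrix_mul_assoc)
  also have "\<dots> = dpart c f p"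
    using metricD(3)[OF cd(1) _ cd(2), of p] cd(3) metric_gradient[OF cd(1), of p f] by simp
  also have "\<dots> = transpose ?J *v (g d p *v gradient g f d p)"
    using dpart_change[OF f cd] metric_gradient[OF cd(2), of p f] cd(3) by simp
  finally have eq: "transpose ?J *v (g d p *v (?J *v gradient g f c p)) = transpose ?J *v (g d p *v gradient g f d p)" .
  have "invertible (transpose ?J ** g d p)"
    using rho_change(2)[OF cd] metricD(4)[OF cd(2), of p] cd(3) by (simp add: invertible_det_nz det_mul)
  then have "matrix_inv (transpose ?J ** g d p) *v ((transpose ?J ** g d p) *v v) = v" for v
    by (simp add: matrix_vector_mul_assoc matrix_inv_inverse)
  then show "gradient g f d p = ?J *v gradient g f c p"
    using eq by (metis matrix_vector_mul_assoc)
qed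

lemma riem_inner_chart:
  assumes X: "vector_field A X" and Y: "vector_field A Y" and c: "c \<in> A" "p \<in> fst c"
  shows "riem_inner A g X Y p = X c p \<bullet> (g c p *v Y c p)"
proof -
  let ?d = "chart_at A p"
  have d: "?d \<in> A" "p \<in> fst ?d" by (rule chart_at)+
  let ?J = "jacobian c ?d p"
  have X': "X ?d p = ?J *v X c p" and Y': "Y ?d p = ?J *v Y c p"
    using X Y c d unfolding vector_field_def by blast+
  have "X c p \<bullet> (g c p *v Y c p) = X c p \<bullet> (transpose ?J *v (g ?d p *v (?J *v Y c p)))"
    using metricD(3)[OF c d] by (simp add: matrix_vector_mul_assoc matrix_mul_assoc)
  also have "\<dots> = (?J *v X c p) \<bullet> (g ?d p *v (?J *v Y c p))"
    by (metis dot_lmul_matrix inner_commute transpose_transpose vector_transpose_matrix)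
  finally show ?thesis by (simp add: riem_inner_def Let_def X' Y')
qed

abbreviation dir :: "('m, 'n) vfield \<Rightarrow> ('m \<Rightarrow> real) \<Rightarrow> 'm \<Rightarrow> real" where
  "dir Y f \<equiv> riem_inner A g Y (gradient g f)"

text \<open>Known as the carre du champ of the Laplacian.\<close>

abbreviation Gam :: "('m \<Rightarrow> real) \<Rightarrow> ('m \<Rightarrow> real) \<Rightarrow> 'm \<Rightarrow> real" where
  "Gam u v \<equiv> riem_inner A g (gradient g u) (gradient g v)"

text \<open>The metric cancels against its inverse in the gradient. What remains is the derivative
  of \<open>f\<close> along \<open>Y\<close>, a derivation, whence the rules below.\<close>

lemma dir_eq:
  assumes "vector_field A Y" "smooth_fun A f" "c \<in> A" "p \<in> fst c"
  shows "dir Y f p = Y c p \<bullet> dpart c f p"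
  using riem_inner_chart[OF assms(1) vector_field_gradient[OF assms(2)] assms(3,4)]
  by (simp add: metric_gradient[OF assms(3,4)])

lemma riem_inner_nonneg: "0 \<le> riem_inner A g X X p"
  using metricD(2)[OF chart_at, of "X (chart_at A p) p" p]
  by (cases "X (chart_at A p) p = 0") (auto simp: riem_inner_def Let_def)

lemma riem_inner_Cauchy_Schwarz:
  "(riem_inner A g X Y p)\<^sup>2 \<le> riem_inner A g X X p * riem_inner A g Y Y p"
  unfolding riem_inner_def Let_def by (rule metric_Cauchy_Schwarz[OF chart_at])

lemma dpart_rules:
  assumes u: "smooth_fun A u" and v: "smooth_fun A v" and c: "c \<in> A" "p \<in> fst c"
  shows "dpart c (\<lambda>p. u p + v p) p = dpart c u p + dpart c v p"
    "dpart c (\<lambda>p. u p * v p) p = u p *\<^sub>R dpart c v p + v p *\<^sub>R dpart c u p"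
    "dpart c (\<lambda>p. k * u p) p = k *\<^sub>R dpart c u p"
    "(\<phi> has_real_derivative m) (at (u p)) \<Longrightarrow> dpart c (\<lambda>p. \<phi> (u p)) p = m *\<^sub>R dpart c u p"
proof -
  note du = smooth_fun_deriv[OF u c] and dv = smooth_fun_deriv[OF v c]
  show "dpart c (\<lambda>p. u p + v p) p = dpart c u p + dpart c v p"
    by (rule dpart_unique[OF c]) (use has_derivative_add[OF du dv] in \<open>simp add: inner_add_right\<close>)
  show "dpart c (\<lambda>p. u p * v p) p = u p *\<^sub>R dpart c v p + v p *\<^sub>R dpart c u p"
    by (rule dpart_unique[OF c]) (use has_derivative_mult[OF du dv] in \<open>simp add: inner_add_right chart(5)[OF c] mult.commute\<close>)
  show "dpart c (\<lambda>p. k * u p) p = k *\<^sub>R dpart c u p"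
    by (rule dpart_unique[OF c]) (use has_derivative_mult_right[OF du] in simp)
  assume "(\<phi> has_real_derivative m) (at (u p))"
  then have "(\<phi> has_derivative (\<lambda>h. m * h)) (at (u (chart_inv c (snd c p))))"
    by (simp add: has_field_derivative_def chart(5)[OF c])
  from has_derivative_compose[OF du this]
  show "dpart c (\<lambda>p. \<phi> (u p)) p = m *\<^sub>R dpart c u p"
    by (intro dpart_unique[OF c]) simp
qed

lemma dir_rules:
  assumes Y: "vector_field A Y" and u: "smooth_fun A u" and v: "smooth_fun A v"
  shows "dir Y (\<lambda>p. u p + v p) p = dir Y u p + dir Y v p"
    "dir Y (\<lambda>p. u p * v p) p = u p * dir Y v p + v p * dir Y u p"
    "dir Y (\<lambda>p. k * u p) p = k * dir Y u p"
    "smooth_fun A (\<lambda>p. \<phi> (u p)) \<Longrightarrow> (\<phi> has_real_derivative m) (at (u p)) \<Longrightarrow> dir Y (\<lambda>p. \<phi> (u p)) p = m * dir Y u p"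
proof -
  show "dir Y (\<lambda>p. u p + v p) p = dir Y u p + dir Y v p"
    by (simp add: dir_eq[OF Y _ chart_at] u v smooth_fun_add dpart_rules(1)[OF u v chart_at] inner_add_right)
  show "dir Y (\<lambda>p. u p * v p) p = u p * dir Y v p + v p * dir Y u p"
    by (simp add: dir_eq[OF Y _ chart_at] u v smooth_fun_mult dpart_rules(2)[OF u v chart_at] inner_add_right)
  show "dir Y (\<lambda>p. k * u p) p = k * dir Y u p"
    by (simp add: dir_eq[OF Y _ chart_at] u smooth_fun_cmult dpart_rules(3)[OF u v chart_at])
  assume "smooth_fun A (\<lambda>p. \<phi> (u p))" "(\<phi> has_real_derivative m) (at (u p))"
  then show "dir Y (\<lambda>p. \<phi> (u p)) p = m * dir Y u p"
    using dpart_rules(4)[OF u v chart_at, of \<phi> m] by (simp add: dir_eq[OF Y _ chart_at] u)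
qed

lemma dir_sum:
  assumes Y: "vector_field A Y" and "finite I" "\<And>i. i \<in> I \<Longrightarrow> smooth_fun A (u i)"
  shows "dir Y (\<lambda>p. \<Sum>i\<in>I. u i p) p = (\<Sum>i\<in>I. dir Y (u i) p)"
  using assms(2,3)
proof (induction I)
  case empty
  show ?case using dir_rules(3)[OF Y smooth_fun_const smooth_fun_const, of 0 0 p] by simp
next
  case (insert i I)
  have "dir Y (\<lambda>p. u i p + (\<Sum>i\<in>I. u i p)) p = dir Y (u i) p + dir Y (\<lambda>p. \<Sum>i\<in>I. u i p) p"
    by (rule dir_rules(1)[OF Y]) (use insert.prems in \<open>auto intro: smooth_fun_sum\<close>)
  then show ?case using insert by simp
qed

lemma continuous_on_charts:
  fixes f :: "'m \<Rightarrow> real"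
  assumes "\<And>c. c \<in> A \<Longrightarrow> continuous_on (dom c) (\<lambda>y. f (chart_inv c y))"
  shows "continuous_on UNIV f"
proof -
  have "continuous_on (fst c) f" if c: "c \<in> A" for c
  proof -
    have "continuous_on (fst c) (\<lambda>p. f (chart_inv c (snd c p)))"
      by (rule continuous_on_compose2[OF assms[OF c] chart(3)[OF c]]) auto
    then show ?thesis
      by (rule continuous_on_cong[THEN iffD1, rotated -1]) (auto simp: chart(5)[OF c])
  qed
  then have "continuous_on (\<Union>c\<in>A. fst c) f"
    by (intro continuous_on_open_UN chart(1))
  moreover have "(\<Union>c\<in>A. fst c) = UNIV" using atlas by (simp add: smooth_atlas_def)
  ultimately show ?thesis by simp
qed

lemma dir_continuous:
  assumes Y: "vector_field A Y" "smooth_components A Y" and f: "smooth_fun A f"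
  shows "continuous_on UNIV (dir Y f)"
proof (rule continuous_on_charts)
  fix c assume c: "c \<in> A"
  have "smooth_on (dom c) (\<lambda>y. dpart c f (chart_inv c y))"
    by (intro smooth_on_vec chart(2)[OF c] smooth_dpart[OF f c])
  moreover have "smooth_on (dom c) (\<lambda>y. Y c (chart_inv c y))"
    using Y(2) c by (simp add: smooth_components_def)
  ultimately have "continuous_on (dom c) (\<lambda>y. Y c (chart_inv c y) \<bullet> dpart c f (chart_inv c y))"
    by (intro continuous_on_inner smooth_onD(3))
  then show "continuous_on (dom c) (\<lambda>y. dir Y f (chart_inv c y))"
    by (rule continuous_on_cong[THEN iffD1, rotated -1]) (auto simp: dir_eq[OF Y(1) f c] chart(7)[OF c])
qed


subsection \<open>Divergence\<close>

text \<open>\<open>divergence\<close> at a point is this expression in an arbitrarily chosen chart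
  there; \<open>divergence_chart\<close> shows that all charts agree.\<close>

definition chart_div :: "('m, 'n) chart \<Rightarrow> ('m, 'n) vfield \<Rightarrow> 'm \<Rightarrow> real" where
  "chart_div c Y p = (\<Sum>i\<in>UNIV. partial c i (\<lambda>q. rho c q * Y c q $ i) p) / rho c p"

lemma divergence_eq: "divergence A g Y p = chart_div (chart_at A p) Y p"
  by (simp add: divergence_def chart_div_def Let_def)

lemma smooth_flux:
  assumes "smooth_components A Y" "c \<in> A"
  shows "smooth_on (dom c) (\<lambda>y. rho c (chart_inv c y) * Y c (chart_inv c y) $ i)"
  by (intro smooth_on_mult smooth_on_vec_nth chart(2) smooth_rho)
    (use assms in \<open>auto simp: smooth_components_def\<close>)

lemma continuous_chart_div:
  assumes Y: "smooth_components A Y" and c: "c \<in> A"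
  shows "continuous_on (fst c) (chart_div c Y)"
proof -
  let ?F = "\<lambda>i y. rho c (chart_inv c y) * Y c (chart_inv c y) $ i"
  have "smooth_on (dom c) (\<lambda>y. frechet_derivative (?F i) (at y) (axis i 1))" for i
    by (rule smooth_onD(2)[OF smooth_flux[OF Y c]])
  then have "continuous_on (dom c) (\<lambda>y. frechet_derivative (?F i) (at y) (axis i 1))" for i
    by (rule smooth_onD(3))
  then have 1: "continuous_on (fst c) (\<lambda>p. frechet_derivative (?F i) (at (snd c p)) (axis i 1))" for i
    by (rule continuous_on_compose2[OF _ chart(3)[OF c]]) auto
  have "continuous_on (fst c) (\<lambda>p. rho c (chart_inv c (snd c p)))"
    by (rule continuous_on_compose2[OF smooth_onD(3)[OF smooth_rho[OF c]] chart(3)[OF c]]) auto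
  then have 2: "continuous_on (fst c) (rho c)"
    by (rule continuous_on_cong[THEN iffD1, rotated -1]) (auto simp: chart(5)[OF c])
  have "rho c p \<noteq> 0" if "p \<in> fst c" for p using metricD(5)[OF c that] by simp
  then show ?thesis
    unfolding chart_div_def partial_def
    by (intro continuous_on_divide continuous_on_sum 1 2) blast
qed

lemma dir_supp:
  assumes Y: "vector_field A Y" and h: "smooth_fun A h" and K: "closed K" and h0: "\<And>q. q \<notin> K \<Longrightarrow> h q = 0"
    and p: "p \<notin> K"
  shows "dir Y h p = 0"
proof -
  obtain c where c: "c \<in> A" "p \<in> fst c" by (rule ex_chart)
  have o: "open (snd c ` (fst c - K))"
    using open_chart_image[OF c(1), of "fst c - K"] chart(1)[OF c(1)] K by (simp add: open_Diff)
  have "((\<lambda>y. 0) has_derivative (\<lambda>v. v \<bullet> 0)) (at (snd c p))" by simp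
  then have "((\<lambda>y. h (chart_inv c y)) has_derivative (\<lambda>v. v \<bullet> 0)) (at (snd c p))"
    by (rule has_derivative_transform_within_open[OF _ o]) (use p c h0 chart(5)[OF c(1)] in auto)
  then have "dpart c h p = 0" by (rule dpart_unique[OF c])
  then show ?thesis using dir_eq[OF Y h c] by simp
qed

text \<open>Read in the chart, the integrand is a Euclidean divergence of a compactly supported field.\<close>

lemma integral_chart_div:
  assumes Y: "vector_field A Y" "smooth_components A Y" and c: "c \<in> A"
    and h: "smooth_fun A h" and K: "compact K" "K \<subseteq> fst c" and h0: "\<And>q. q \<notin> K \<Longrightarrow> h q = 0"
  shows "continuous_on UNIV (\<lambda>p. h p * chart_div c Y p)"
    "(LINT p|vol. h p * chart_div c Y p) = - (LINT p|vol. dir Y h p)"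
proof -
  have "continuous_on (fst c) (\<lambda>p. h p * chart_div c Y p)"
    using continuous_on_subset[OF smooth_fun_continuous[OF h] subset_UNIV]
    by (rule continuous_on_mult[OF _ continuous_chart_div[OF Y(2) c]])
  then show cont: "continuous_on UNIV (\<lambda>p. h p * chart_div c Y p)"
    using continuous_extend[OF chart(1)[OF c] _ K] h0 by simp
  have contD: "continuous_on UNIV (dir Y h)" by (rule dir_continuous[OF Y h])
  let ?f = "\<lambda>p. h p * chart_div c Y p + dir Y h p"
  have contf: "continuous_on UNIV ?f" by (intro continuous_on_add cont contD)
  define F where "F i y = (if y \<in> dom c then rho c (chart_inv c y) * Y c (chart_inv c y) $ i * h (chart_inv c y) else 0)" for i y
  let ?K = "snd c ` K"
  have K': "compact ?K" by (rule compact_continuous_image[OF continuous_on_subset[OF chart(3)[OF c] K(2)] K(1)])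
  have F0: "F i y = 0" if "y \<notin> ?K" for i y
  proof (cases "y \<in> dom c")
    case True
    then have "chart_inv c y \<notin> K" using that chart(6)[OF c True] by (metis imageI)
    then show ?thesis by (simp add: F_def h0)
  qed (simp add: F_def)
  have smF: "smooth_on UNIV (F i)" for i
  proof -
    have "smooth_on (dom c) (\<lambda>y. rho c (chart_inv c y) * Y c (chart_inv c y) $ i * h (chart_inv c y))"
      by (intro smooth_on_mult[OF chart(2)[OF c]] smooth_flux[OF Y(2) c] smooth_funD[OF h c])
    then have "smooth_on (dom c) (F i)"
      by (rule smooth_on_cong[OF chart(2)[OF c], rotated]) (simp add: F_def)
    moreover have oK: "open (- ?K)" using compact_imp_closed[OF K'] by (simp add: open_Compl)
    moreover have "smooth_on (- ?K) (F i)"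
      by (rule smooth_on_cong[OF oK _ smooth_on_const[of _ 0]]) (simp add: F0)
    ultimately have "smooth_on (dom c \<union> - ?K) (F i)"
      by (intro smooth_on_Un chart(2)[OF c])
    moreover have "dom c \<union> - ?K = UNIV" using K(2) by auto
    ultimately show ?thesis by simp
  qed
  let ?D = "\<lambda>i y. frechet_derivative (F i) (at y) (axis i 1)"
  \<comment> \<open>The product rule for the components \<rho> Y_i h; outside the chart image both
    sides are zero.\<close>
  have pt: "rho_ext c y * ?f (inv_ext c y) = (\<Sum>i\<in>UNIV. ?D i y)" for y
  proof (cases "y \<in> dom c")
    case True
    let ?p = "chart_inv c y"
    have p: "?p \<in> fst c" "snd c ?p = y" using chart(6,7)[OF c True] by auto
    have D: "?D i y = partial c i (\<lambda>q. rho c q * Y c q $ i) ?p * h ?p + rho c ?p * Y c ?p $ i * dpart c h ?p $ i" for i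
    proof -
      let ?u = "\<lambda>y. rho c (chart_inv c y) * Y c (chart_inv c y) $ i"
      have du: "(?u has_derivative frechet_derivative ?u (at y)) (at y)"
        by (rule smooth_onD(1)[OF smooth_flux[OF Y(2) c] True])
      have dh: "((\<lambda>y. h (chart_inv c y)) has_derivative (\<lambda>v. v \<bullet> dpart c h ?p)) (at y)"
        using smooth_fun_deriv[OF h c p(1)] p(2) by simp
      have "(F i has_derivative (\<lambda>v. ?u y * (v \<bullet> dpart c h ?p) + frechet_derivative ?u (at y) v * h (chart_inv c y))) (at y)"
        by (rule has_derivative_transform_within_open[OF has_derivative_mult[OF du dh] chart(2)[OF c] True])
          (simp add: F_def)
      from frechet_derivative_at[OF this, symmetric] show ?thesis
        by (simp add: partial_def p(2) inner_axis' add.commute)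
    qed
    have "(\<Sum>i\<in>UNIV. ?D i y) = h ?p * (\<Sum>i\<in>UNIV. partial c i (\<lambda>q. rho c q * Y c q $ i) ?p) + rho c ?p * (Y c ?p \<bullet> dpart c h ?p)"
      unfolding D by (simp add: sum.distrib sum_distrib_left inner_vec_def mult_ac)
    also have "(\<Sum>i\<in>UNIV. partial c i (\<lambda>q. rho c q * Y c q $ i) ?p) = rho c ?p * chart_div c Y ?p"
      using metricD(5)[OF c p(1)] by (simp add: chart_div_def)
    finally show ?thesis
      using True dir_eq[OF Y(1) h c p(1)] by (simp add: rho_ext_def inv_ext_def algebra_simps)
  next
    case False
    have "?D i y = 0" for i
    proof -
      have "((\<lambda>y. 0) has_derivative (\<lambda>v. 0)) (at y)" by simp
      then have "(F i has_derivative (\<lambda>v. 0)) (at y)"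
        by (rule has_derivative_transform_within_open[of _ _ _ _ "- ?K"])
          (use False K(2) compact_imp_closed[OF K'] F0 in auto)
      from frechet_derivative_at[OF this, symmetric] show ?thesis by simp
    qed
    then show ?thesis using False by (simp add: rho_ext_def)
  qed
  have "(LINT p|vol. ?f p) = (LINT y|lborel. rho_ext c y * ?f (inv_ext c y))"
  proof (rule integral_vol_chart(2)[OF c])
    show "?f \<in> borel_measurable borel" by (rule borel_measurable_continuous_onI[OF contf])
    show "?f p = 0" if "p \<notin> fst c" for p
    proof -
      have "p \<notin> K" using that K(2) by blast
      then show ?thesis using h0[of p] dir_supp[OF Y(1) h compact_imp_closed[OF K(1)] h0] by simp
    qed
  qed
  also have "\<dots> = (LINT y|lborel. (\<Sum>i\<in>UNIV. ?D i y))" by (simp only: pt)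
  also have "\<dots> = (\<Sum>i\<in>UNIV. (LINT y|lborel. ?D i y))"
    by (rule Bochner_Integration.integral_sum) (rule integral_deriv_compact_support(1)[OF smF K' F0])
  also have "\<dots> = 0" by (simp add: integral_deriv_compact_support(2)[OF smF K' F0])
  finally have "(LINT p|vol. ?f p) = 0" .
  then show "(LINT p|vol. h p * chart_div c Y p) = - (LINT p|vol. dir Y h p)"
    using integrable_continuous_vol[OF cont] integrable_continuous_vol[OF contD] by simp
qed

text \<open>Both sides have the same integral against every bump function, by the previous lemma.\<close>

lemma chart_div_le:
  assumes Y: "vector_field A Y" "smooth_components A Y" and cd: "c \<in> A" "d \<in> A" and p: "p \<in> fst c \<inter> fst d"
  shows "chart_div c Y p \<le> chart_div d Y p"
proof (rule ccontr)
  assume n: "\<not> chart_div c Y p \<le> chart_div d Y p"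
  let ?U = "fst c \<inter> fst d"
  have oU: "open ?U" using chart(1) cd by blast
  have cont: "continuous_on ?U (\<lambda>q. chart_div c Y q - chart_div d Y q)"
    by (intro continuous_on_diff continuous_on_subset[OF continuous_chart_div[OF Y(2) cd(1)]]
        continuous_on_subset[OF continuous_chart_div[OF Y(2) cd(2)]]) auto
  let ?W = "?U \<inter> (\<lambda>q. chart_div c Y q - chart_div d Y q) -` {0<..}"
  have "open ?W" by (rule continuous_open_preimage[OF cont oU open_greaterThan])
  moreover have "p \<in> ?W" using n p by simp
  ultimately obtain h K where h: "smooth_fun A h" "\<forall>q. 0 \<le> h q \<and> h q \<le> 1" "h p > 0" "compact K" "K \<subseteq> ?W"
    "\<forall>q. q \<notin> K \<longrightarrow> h q = 0"
    using ex_bump by meson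
  have Kc: "K \<subseteq> fst c" and Kd: "K \<subseteq> fst d" and h0: "\<And>q. q \<notin> K \<Longrightarrow> h q = 0" using h by auto
  note C = integral_chart_div[OF Y cd(1) h(1) h(4) Kc h0] and D = integral_chart_div[OF Y cd(2) h(1) h(4) Kd h0]
  let ?f = "\<lambda>q. h q * chart_div c Y q - h q * chart_div d Y q"
  have "0 < (LINT q|vol. ?f q)"
  proof (rule integral_vol_pos)
    show "continuous_on UNIV ?f" by (intro continuous_on_diff C(1) D(1))
    have fe: "?f q = h q * (chart_div c Y q - chart_div d Y q)" for q by (simp add: algebra_simps)
    show "0 \<le> ?f q" for q
      unfolding fe using h(2,5,6) by (cases "q \<in> K") (auto intro!: mult_nonneg_nonneg)
    show "0 < ?f p" unfolding fe using h(3) n by simp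
  qed
  moreover have "(LINT q|vol. ?f q) = 0"
    using C D integrable_continuous_vol[OF C(1)] integrable_continuous_vol[OF D(1)] by simp
  ultimately show False by simp
qed

lemma divergence_chart:
  assumes Y: "vector_field A Y" "smooth_components A Y" and c: "c \<in> A" "p \<in> fst c"
  shows "divergence A g Y p = chart_div c Y p"
  unfolding divergence_eq
  by (intro antisym chart_div_le[OF Y] chart_at c IntI)

lemma continuous_divergence:
  assumes Y: "vector_field A Y" "smooth_components A Y"
  shows "continuous_on UNIV (divergence A g Y)"
proof -
  have "continuous_on (fst c) (divergence A g Y)" if c: "c \<in> A" for c
    using continuous_chart_div[OF Y(2) c]
    by (rule continuous_on_cong[THEN iffD1, rotated -1]) (auto simp: divergence_chart[OF Y c])
  then have "continuous_on (\<Union>c\<in>A. fst c) (divergence A g Y)"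
    by (intro continuous_on_open_UN chart(1))
  moreover have "(\<Union>c\<in>A. fst c) = UNIV" using atlas by (simp add: smooth_atlas_def)
  ultimately show ?thesis by simp
qed

text \<open>A partition of unity before normalisation. \<open>Green\<close> divides by the sum;
  \<open>L2_vf_zero\<close> works on the sets where one of the functions is positive.\<close>

lemma ex_finite_bumps:
  "\<exists>H. finite H \<and> (\<forall>h\<in>H. smooth_fun A h \<and> (\<forall>q. 0 \<le> h q)) \<and> (\<forall>p. \<exists>h\<in>H. h p > 0) \<and>
    (\<forall>h\<in>H. \<exists>c K. c \<in> A \<and> compact K \<and> K \<subseteq> fst c \<and> (\<forall>q. q \<notin> K \<longrightarrow> h q = (0::real)))"
proof -
  define B where "B = {h. smooth_fun A h \<and> (\<forall>q. 0 \<le> h q) \<and>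
    (\<exists>c K. c \<in> A \<and> compact K \<and> K \<subseteq> fst c \<and> (\<forall>q. q \<notin> K \<longrightarrow> h q = 0))}"
  have cov: "UNIV \<subseteq> (\<Union>h\<in>B. {p. 0 < h p})"
  proof
    fix p :: 'm
    obtain c where c: "c \<in> A" "p \<in> fst c" by (rule ex_chart)
    obtain h K where h: "smooth_fun A h" "\<forall>q. 0 \<le> h q \<and> h q \<le> 1" "h p > 0" "compact K" "K \<subseteq> fst c"
      "\<forall>q. q \<notin> K \<longrightarrow> h q = 0"
      using ex_bump[OF chart(1)[OF c(1)] c(2)] by meson
    then have "h \<in> B" using c(1) unfolding B_def by blast
    then show "p \<in> (\<Union>h\<in>B. {p. 0 < h p})" using h(3) by blast
  qed
  have op: "open {p. 0 < h p}" if "h \<in> B" for h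
    using that open_Collect_less[OF continuous_on_const smooth_fun_continuous] by (auto simp: B_def)
  obtain H where H: "H \<subseteq> B" "finite H" "UNIV \<subseteq> (\<Union>h\<in>H. {p. 0 < h p})"
    by (rule compactE_image[OF compact_M op cov])
  show ?thesis
    using H by (intro exI[of _ H]) (auto simp: B_def)
qed

text \<open>The partition of unity cuts \<open>u\<close> into pieces supported in one chart each,
  where \<open>integral_chart_div\<close> applies; both sides are linear in
  \<open>u\<close>.\<close>

theorem Green:
  assumes Y: "vector_field A Y" "smooth_components A Y" and u: "smooth_fun A u"
  shows "(LINT p|vol. u p * divergence A g Y p) = - (LINT p|vol. dir Y u p)"
proof -
  obtain H where H: "finite H" "\<forall>h\<in>H. smooth_fun A h \<and> (\<forall>q. 0 \<le> h q)" "\<forall>p. \<exists>h\<in>H. h p > 0"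
    "\<forall>h\<in>H. \<exists>c K. c \<in> A \<and> compact K \<and> K \<subseteq> fst c \<and> (\<forall>q. q \<notin> K \<longrightarrow> h q = 0)"
    using ex_finite_bumps by blast
  define s where "s p = (\<Sum>h\<in>H. h p)" for p
  have spos: "s p > 0" for p
  proof -
    obtain h where "h \<in> H" "h p > 0" using H(3) by blast
    then show ?thesis unfolding s_def using H(1,2) by (intro sum_pos2[of H h]) auto
  qed
  have sms: "smooth_fun A s" unfolding s_def[abs_def] using H(2) by (intro smooth_fun_sum) auto
  have "smooth_fun A (\<lambda>p. inverse (s p))"
    by (rule smooth_fun_compose[OF sms smooth_on_inverse open_greaterThan]) (use spos in auto)
  then have smw: "smooth_fun A (\<lambda>p. inverse (s p) * u p)" by (rule smooth_fun_mult[OF _ u])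
  define v where "v h p = h p * (inverse (s p) * u p)" for h p
  have smv: "smooth_fun A (v h)" if "h \<in> H" for h
    unfolding v_def[abs_def] using H(2) that by (intro smooth_fun_mult[OF _ smw]) auto
  have ve: "u p = (\<Sum>h\<in>H. v h p)" for p
    using spos[of p] unfolding v_def sum_distrib_right[symmetric] s_def[symmetric] by simp
  have contv: "continuous_on UNIV (\<lambda>p. v h p * divergence A g Y p)" "continuous_on UNIV (dir Y (v h))" if "h \<in> H" for h
    by (intro continuous_on_mult smooth_fun_continuous[OF smv[OF that]] continuous_divergence[OF Y])
      (rule dir_continuous[OF Y smv[OF that]])
  have each: "(LINT p|vol. v h p * divergence A g Y p) = - (LINT p|vol. dir Y (v h) p)" if h: "h \<in> H" for h
  proof -
    obtain c K where cK: "c \<in> A" "compact K" "K \<subseteq> fst c" "\<forall>q. q \<notin> K \<longrightarrow> h q = 0"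
      using bspec[OF H(4) h] by (elim exE conjE)
    have v0: "v h q = 0" if "q \<notin> K" for q using cK(4) that by (simp add: v_def)
    have "v h p * divergence A g Y p = v h p * chart_div c Y p" for p
      using v0[of p] divergence_chart[OF Y cK(1), of p] cK(3) by (cases "p \<in> K") auto
    then have "(LINT p|vol. v h p * divergence A g Y p) = (LINT p|vol. v h p * chart_div c Y p)"
      by (simp only:)
    also have "\<dots> = - (LINT p|vol. dir Y (v h) p)"
      by (rule integral_chart_div(2)[OF Y cK(1) smv[OF h] cK(2,3)]) (rule v0)
    finally show ?thesis .
  qed
  have "(LINT p|vol. u p * divergence A g Y p) = (LINT p|vol. (\<Sum>h\<in>H. v h p * divergence A g Y p))"
    by (subst ve) (simp only: sum_distrib_right)
  also have "\<dots> = (\<Sum>h\<in>H. (LINT p|vol. v h p * divergence A g Y p))"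
    by (intro Bochner_Integration.integral_sum integrable_continuous_vol contv)
  also have "\<dots> = (\<Sum>h\<in>H. - (LINT p|vol. dir Y (v h) p))" by (intro sum.cong refl each)
  also have "\<dots> = - (LINT p|vol. (\<Sum>h\<in>H. dir Y (v h) p))"
    unfolding sum_negf by (subst Bochner_Integration.integral_sum) (auto intro: integrable_continuous_vol contv)
  also have "(\<lambda>p. \<Sum>h\<in>H. dir Y (v h) p) = dir Y (\<lambda>p. \<Sum>h\<in>H. v h p)"
    by (intro ext dir_sum[OF Y(1) H(1) smv, symmetric])
  also have "(\<lambda>p. \<Sum>h\<in>H. v h p) = u" by (rule ext, rule ve[symmetric])
  finally show ?thesis .
qed

end

lemma (in finite_measure) integrable_bounded_mult:
  fixes f h :: "'a \<Rightarrow> real"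
  assumes "integrable M f" "h \<in> borel_measurable M" "\<And>x. \<bar>h x\<bar> \<le> B"
  shows "integrable M (\<lambda>x. h x * f x)"
proof (rule Bochner_Integration.integrable_bound)
  show "integrable M (\<lambda>x. B * f x)" using assms by simp
  show "(\<lambda>x. h x * f x) \<in> borel_measurable M" using assms by auto
  have "\<bar>h x\<bar> * \<bar>f x\<bar> \<le> \<bar>B\<bar> * \<bar>f x\<bar>" for x
    using assms(3)[of x] by (intro mult_right_mono) auto
  then show "AE x in M. norm (h x * f x) \<le> norm (B * f x)" by (simp add: abs_mult)
qed

context riemannian
begin

subsection \<open>Square integrable vector fields\<close>

definition meas_vf :: "('m, 'n) vfield \<Rightarrow> bool" where
  "meas_vf X \<longleftrightarrow> vector_field A X \<and> (\<forall>c\<in>A. X c \<in> borel_measurable (restrict_space borel (fst c)))"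

lemma measurable_on_charts:
  fixes f :: "'m \<Rightarrow> 'b::topological_space"
  assumes "\<And>c. c \<in> A \<Longrightarrow> f \<in> borel_measurable (restrict_space borel (fst c))"
  shows "f \<in> borel_measurable borel"
proof -
  have cover: "UNIV \<subseteq> (\<Union>c\<in>A. fst c)" using ex_chart by blast
  obtain C where C: "C \<subseteq> A" "finite C" "UNIV \<subseteq> (\<Union>c\<in>C. fst c)"
    by (rule compactE_image[OF compact_M _ cover]) (use chart(1) in auto)
  show ?thesis
  proof (rule measurable_piecewise_restrict[of "fst ` C"])
    show "countable (fst ` C)" using C(2) by (simp add: countable_finite)
    show "\<Omega> \<inter> space borel \<in> sets borel" if "\<Omega> \<in> fst ` C" for \<Omega> using that C(1) chart(1) by auto
    show "space borel \<subseteq> \<Union> (fst ` C)" using C(3) by simp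
    show "f \<in> borel_measurable (restrict_space borel \<Omega>)" if "\<Omega> \<in> fst ` C" for \<Omega> using that C(1) assms by auto
  qed
qed

lemma meas_vf_smooth:
  assumes "vector_field A Y" "smooth_components A Y"
  shows "meas_vf Y"
  unfolding meas_vf_def
proof (intro conjI ballI assms(1))
  fix c assume c: "c \<in> A"
  have "smooth_on (dom c) (\<lambda>y. Y c (chart_inv c y))" using assms(2) c by (simp add: smooth_components_def)
  then have "continuous_on (fst c) (\<lambda>p. Y c (chart_inv c (snd c p)))"
    by (rule continuous_on_compose2[OF smooth_onD(3) chart(3)[OF c]]) simp
  then have "continuous_on (fst c) (Y c)"
    by (rule continuous_on_cong[THEN iffD1, rotated -1]) (auto simp: chart(5)[OF c])
  then show "Y c \<in> borel_measurable (restrict_space borel (fst c))"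
    by (rule borel_measurable_continuous_on_restrict)
qed

lemma meas_vf_lincomb:
  assumes "meas_vf X" "meas_vf Y"
  shows "meas_vf (\<lambda>c p. a *\<^sub>R X c p + b *\<^sub>R Y c p)"
  unfolding meas_vf_def vector_field_def
proof (intro conjI ballI)
  fix c d p assume cd: "c \<in> A" "d \<in> A" "p \<in> fst c \<inter> fst d"
  have "X d p = jacobian c d p *v X c p" "Y d p = jacobian c d p *v Y c p"
    using assms cd unfolding meas_vf_def vector_field_def by blast+
  then show "a *\<^sub>R X d p + b *\<^sub>R Y d p = jacobian c d p *v (a *\<^sub>R X c p + b *\<^sub>R Y c p)"
    by (simp only: matrix_vector_right_distrib matrix_vector_mult_scaleR)
next
  fix c assume "c \<in> A"
  then have "X c \<in> borel_measurable (restrict_space borel (fst c))" "Y c \<in> borel_measurable (restrict_space borel (fst c))"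
    using assms unfolding meas_vf_def by blast+
  then show "(\<lambda>p. a *\<^sub>R X c p + b *\<^sub>R Y c p) \<in> borel_measurable (restrict_space borel (fst c))"
    by simp
qed

lemma riem_inner_measurable:
  assumes "meas_vf X" "meas_vf Y"
  shows "riem_inner A g X Y \<in> borel_measurable borel"
proof (rule measurable_on_charts)
  fix c assume c: "c \<in> A"
  let ?M = "restrict_space borel (fst c)"
  have [measurable]: "X c \<in> borel_measurable ?M" "Y c \<in> borel_measurable ?M"
    using assms c by (auto simp: meas_vf_def)
  have comp: "(\<lambda>p. Z p $ i) \<in> borel_measurable ?M" if "Z \<in> borel_measurable ?M" for Z :: "'m \<Rightarrow> real ^ 'n" and i
  proof -
    have "(\<lambda>p. Z p \<bullet> axis i 1) \<in> borel_measurable ?M" using that by measurable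
    then show ?thesis by (simp add: inner_axis)
  qed
  have gm: "(\<lambda>p. g c p $ i $ j) \<in> borel_measurable ?M" for i j
  proof -
    have "continuous_on (fst c) (\<lambda>p. g c (chart_inv c (snd c p)) $ i $ j)"
      by (rule continuous_on_compose2[OF smooth_onD(3)[OF smooth_metric_entry[OF c]] chart(3)[OF c]]) auto
    then have "continuous_on (fst c) (\<lambda>p. g c p $ i $ j)"
      by (rule continuous_on_cong[THEN iffD1, rotated -1]) (auto simp: chart(5)[OF c])
    then show ?thesis by (rule borel_measurable_continuous_on_restrict)
  qed
  have "(\<lambda>p. \<Sum>i\<in>UNIV. X c p $ i * (\<Sum>j\<in>UNIV. g c p $ i $ j * Y c p $ j)) \<in> borel_measurable ?M"
    by (intro borel_measurable_sum borel_measurable_times gm comp[of "X c"] comp[of "Y c"]) auto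
  then show "riem_inner A g X Y \<in> borel_measurable ?M"
  proof (rule measurable_cong[THEN iffD1, rotated])
    fix p assume "p \<in> space ?M"
    then have "p \<in> fst c" using chart(1)[OF c] by (simp add: space_restrict_space)
    then show "(\<Sum>i\<in>UNIV. X c p $ i * (\<Sum>j\<in>UNIV. g c p $ i $ j * Y c p $ j)) = riem_inner A g X Y p"
      using riem_inner_chart[of X Y, OF _ _ c] assms by (simp add: meas_vf_def inner_vec_def matrix_vector_mult_def)
  qed
qed

definition L2_vf :: "('m, 'n) vfield \<Rightarrow> bool" where
  "L2_vf X \<longleftrightarrow> meas_vf X \<and> integrable vol (riem_inner A g X X)"

lemma riem_inner_bilinear:
  "riem_inner A g (\<lambda>c p. a *\<^sub>R X c p + b *\<^sub>R Y c p) Z p = a * riem_inner A g X Z p + b * riem_inner A g Y Z p"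
  "riem_inner A g Z (\<lambda>c p. a *\<^sub>R X c p + b *\<^sub>R Y c p) p = a * riem_inner A g Z X p + b * riem_inner A g Z Y p"
  by (simp_all add: riem_inner_def Let_def inner_add_left inner_add_right matrix_vector_right_distrib matrix_vector_mult_scaleR)

lemma riem_inner_sym: "riem_inner A g X Y p = riem_inner A g Y X p"
  unfolding riem_inner_def Let_def by (rule metric_sym[OF chart_at])

lemma L2_vf_integrable:
  assumes X: "L2_vf X" and Y: "L2_vf Y"
  shows "integrable vol (riem_inner A g X Y)"
proof (rule Bochner_Integration.integrable_bound)
  show "integrable vol (\<lambda>p. riem_inner A g X X p + riem_inner A g Y Y p)"
    using assms by (auto simp: L2_vf_def)
  show "riem_inner A g X Y \<in> borel_measurable vol"
    using assms by (simp add: riem_inner_measurable L2_vf_def)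
  show "AE p in vol. norm (riem_inner A g X Y p) \<le> norm (riem_inner A g X X p + riem_inner A g Y Y p)"
  proof (rule AE_I2)
    fix p
    let ?x = "riem_inner A g X X p" and ?y = "riem_inner A g Y Y p"
    have nn: "0 \<le> ?x" "0 \<le> ?y" by (rule riem_inner_nonneg)+
    have "(riem_inner A g X Y p)\<^sup>2 \<le> ?x * ?y" by (rule riem_inner_Cauchy_Schwarz)
    also have "\<dots> \<le> (?x + ?y)\<^sup>2" using nn by (simp add: power2_eq_square algebra_simps)
    finally show "norm (riem_inner A g X Y p) \<le> norm (?x + ?y)"
      by (simp only: real_norm_def abs_le_square_iff)
  qed
qed

lemma L2_vf_lincomb:
  assumes X: "L2_vf X" and Y: "L2_vf Y"
  shows "L2_vf (\<lambda>c p. a *\<^sub>R X c p + b *\<^sub>R Y c p)"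
proof -
  let ?Z = "\<lambda>c p. a *\<^sub>R X c p + b *\<^sub>R Y c p"
  have "riem_inner A g ?Z ?Z = (\<lambda>p. a * (a * riem_inner A g X X p + b * riem_inner A g X Y p) +
      b * (a * riem_inner A g Y X p + b * riem_inner A g Y Y p))"
    by (rule ext) (simp only: riem_inner_bilinear)
  then show ?thesis
    using L2_vf_integrable[OF X X] L2_vf_integrable[OF X Y] L2_vf_integrable[OF Y X] L2_vf_integrable[OF Y Y] X Y
    by (simp add: L2_vf_def meas_vf_lincomb)
qed

lemma L2_vf_Cauchy_Schwarz:
  assumes X: "L2_vf X" and Y: "L2_vf Y"
  shows "(LINT p|vol. riem_inner A g X Y p)\<^sup>2 \<le> (LINT p|vol. riem_inner A g X X p) * (LINT p|vol. riem_inner A g Y Y p)"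
proof (rule quadratic_nonneg_imp_discriminant_le)
  show "0 \<le> (LINT p|vol. riem_inner A g Y Y p)" by (simp add: riem_inner_nonneg)
  fix t :: real
  let ?Z = "\<lambda>c p. 1 *\<^sub>R X c p + t *\<^sub>R Y c p"
  have "0 \<le> (LINT p|vol. riem_inner A g ?Z ?Z p)" by (simp only: Bochner_Integration.integral_nonneg riem_inner_nonneg)
  also have "riem_inner A g ?Z ?Z = (\<lambda>p. riem_inner A g X X p + 2 * t * riem_inner A g X Y p + t\<^sup>2 * riem_inner A g Y Y p)"
    unfolding fun_eq_iff riem_inner_bilinear using riem_inner_sym[of Y X]
    by (simp add: power2_eq_square algebra_simps)
  also have "(LINT p|vol. riem_inner A g X X p + 2 * t * riem_inner A g X Y p + t\<^sup>2 * riem_inner A g Y Y p) =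
     (LINT p|vol. riem_inner A g X X p) + 2 * t * (LINT p|vol. riem_inner A g X Y p) + t\<^sup>2 * (LINT p|vol. riem_inner A g Y Y p)"
    using L2_vf_integrable[OF X X] L2_vf_integrable[OF X Y] L2_vf_integrable[OF Y Y] by simp
  finally show "0 \<le> (LINT p|vol. riem_inner A g X X p) + 2 * t * (LINT p|vol. riem_inner A g X Y p) + t\<^sup>2 * (LINT p|vol. riem_inner A g Y Y p)" .
qed

lemma riem_inner_smooth_continuous:
  assumes X: "vector_field A X" "smooth_components A X" and Y: "vector_field A Y" "smooth_components A Y"
  shows "continuous_on UNIV (riem_inner A g X Y)"
proof (rule continuous_on_charts)
  fix c assume c: "c \<in> A"
  have x: "continuous_on (dom c) (\<lambda>y. X c (chart_inv c y) $ i)" "continuous_on (dom c) (\<lambda>y. Y c (chart_inv c y) $ i)" for i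
    using X(2) Y(2) c unfolding smooth_components_def
    by (auto intro!: smooth_onD(3) smooth_on_vec_nth chart(2)[OF c])
  have "continuous_on (dom c) (\<lambda>y. g c (chart_inv c y) $ i $ j)" for i j
    by (rule smooth_onD(3)[OF smooth_metric_entry[OF c]])
  with x have "continuous_on (dom c) (\<lambda>y. \<Sum>i\<in>UNIV. X c (chart_inv c y) $ i * (\<Sum>j\<in>UNIV. g c (chart_inv c y) $ i $ j * Y c (chart_inv c y) $ j))"
    by (intro continuous_on_sum continuous_on_mult)
  then show "continuous_on (dom c) (\<lambda>y. riem_inner A g X Y (chart_inv c y))"
    by (rule continuous_on_cong[THEN iffD1, rotated -1])
      (auto simp: riem_inner_chart[OF X(1) Y(1) c] chart(7)[OF c] inner_vec_def matrix_vector_mult_def)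
qed

lemma L2_vf_smooth:
  assumes "vector_field A Y" "smooth_components A Y"
  shows "L2_vf Y"
  unfolding L2_vf_def
  by (intro conjI meas_vf_smooth assms integrable_continuous_vol riem_inner_smooth_continuous)

lemma L2_vf_gradient: "smooth_fun A u \<Longrightarrow> L2_vf (gradient g u)"
  by (rule L2_vf_smooth[OF vector_field_gradient smooth_gradient])

subsection \<open>Uniqueness of the weak gradient\<close>

text \<open>The sets where a smooth nonnegative function is positive are stable under intersection,
  by taking products, and generate the Borel sets. As \<open>f\<close> integrates to zero over each
  of them, it does so over all Borel sets by Dynkin's argument, and thus vanishes almost
  everywhere.\<close>

lemma AE_zero_of_smooth_tests:
  fixes f :: "'m \<Rightarrow> real"
  assumes f: "integrable vol f" and z: "\<And>h. smooth_fun A h \<Longrightarrow> (LINT p|vol. h p * f p) = 0"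
  shows "AE p in vol. f p = 0"
proof -
  define P where "P = {W. \<exists>h. smooth_fun A h \<and> (\<forall>q. 0 \<le> h q) \<and> W = {q. (0::real) < h q}}"
  have PI: "{q. 0 < h q} \<in> P" if "smooth_fun A h" "\<And>q. 0 \<le> h q" for h using that unfolding P_def by blast
  have openP: "open W" if W: "W \<in> P" for W
  proof -
    obtain h where "smooth_fun A h" "W = {q. (0::real) < h q}" using W unfolding P_def by blast
    then show ?thesis using open_Collect_less[OF continuous_on_const smooth_fun_continuous] by simp
  qed
  have stab: "Int_stable P"
  proof (rule Int_stableI)
    fix V W assume "V \<in> P" "W \<in> P"
    then obtain h k where h: "smooth_fun A h" "\<forall>q. 0 \<le> h q" "V = {q. (0::real) < h q}"
      and k: "smooth_fun A k" "\<forall>q. 0 \<le> k q" "W = {q. (0::real) < k q}"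
      unfolding P_def by blast
    have "V \<inter> W = {q. 0 < h q * k q}"
      unfolding h(3) k(3) using h(2) k(2) by (auto simp: zero_less_mult_iff dest: order.strict_implies_not_eq leD)
    then show "V \<inter> W \<in> P" using PI[OF smooth_fun_mult[OF h(1) k(1)]] h(2) k(2) by simp
  qed
  have gen: "sigma_sets UNIV P = sets borel"
  proof
    show "sigma_sets UNIV P \<subseteq> sets borel"
    proof -
      have "P \<subseteq> sets borel" using openP by (auto intro: borel_open)
      then show ?thesis using sets.sigma_sets_subset[of P borel] by simp
    qed
    \<comment> \<open>Bump functions exhibit every open set as a union of such sets, and second
      countability reduces the union to a countable one.\<close>
    have "W \<in> sigma_sets UNIV P" if W: "open W" for W
    proof -
      let ?F = "{V \<in> P. V \<subseteq> W}"
      have "\<Union>?F = W"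
      proof
        show "W \<subseteq> \<Union>?F"
        proof
          fix p assume p: "p \<in> W"
          obtain h K where h: "smooth_fun A h" "\<forall>q. 0 \<le> h q \<and> h q \<le> 1" "h p > 0" "K \<subseteq> W" "\<forall>q. q \<notin> K \<longrightarrow> h q = 0"
            using ex_bump[OF W p] by meson
          have "{q. 0 < h q} \<in> P" using PI h(1,2) by blast
          moreover have "{q. 0 < h q} \<subseteq> W" using h(4,5) by (metis (mono_tags) less_irrefl mem_Collect_eq subset_iff)
          ultimately show "p \<in> \<Union>?F" using h(3) by blast
        qed
      qed blast
      moreover obtain F' where F': "F' \<subseteq> ?F" "countable F'" "\<Union>F' = \<Union>?F"
        by (rule Lindelof[of ?F]) (use openP in auto)
      moreover have "\<Union>F' \<in> sigma_sets UNIV P"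
        using F' by (intro sigma_sets_UNION) (auto intro: sigma_sets.Basic)
      ultimately show ?thesis by simp
    qed
    then have "sigma_sets UNIV {W. open W} \<subseteq> sigma_sets UNIV P"
      by (intro sigma_sets_mono) auto
    then show "sets borel \<subseteq> sigma_sets UNIV P" by (simp add: borel_def)
  qed
  have base: "(LINT p:W|vol. f p) = 0" if W: "W \<in> P" for W
  proof -
    obtain h where h: "smooth_fun A h" "\<forall>q. 0 \<le> h q" "W = {q. (0::real) < h q}" using W unfolding P_def by blast
    \<comment> \<open>n h / (1 + n h) is smooth, bounded by 1 and tends to the indicator of the set
      where h is positive.\<close>
    define k where "k n p = (real n * h p) * inverse (1 + real n * h p)" for n p
    have pos: "1 + real n * h p > 0" for n p using h(2) by (simp add: add_pos_nonneg)
    have smk: "smooth_fun A (k n)" for n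
      unfolding k_def[abs_def]
    proof (intro smooth_fun_mult[OF smooth_fun_cmult[OF h(1)]])
      show "smooth_fun A (\<lambda>p. inverse (1 + real n * h p))"
        by (rule smooth_fun_compose[OF smooth_fun_add[OF smooth_fun_const smooth_fun_cmult[OF h(1)]] smooth_on_inverse open_greaterThan])
          (use pos in auto)
    qed
    have kb: "\<bar>k n p\<bar> \<le> 1" for n p
      using pos[of n p] h(2) by (simp add: k_def divide_inverse[symmetric] abs_mult abs_of_nonneg field_simps)
    have klim: "(\<lambda>n. k n p) \<longlonglongrightarrow> indicator W p" for p
    proof (cases "h p > 0")
      case True
      have "filterlim (\<lambda>n. real n * h p) at_top sequentially"
        by (rule filterlim_at_top_mult_tendsto_pos[OF tendsto_const True filterlim_real_sequentially])
      then have "filterlim (\<lambda>n. 1 + real n * h p) at_top sequentially"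
        by (rule filterlim_tendsto_add_at_top[OF tendsto_const])
      then have "(\<lambda>n. 1 - inverse (1 + real n * h p)) \<longlonglongrightarrow> 1 - 0"
        by (intro tendsto_diff tendsto_const tendsto_inverse_0_at_top)
      moreover have "1 - inverse (1 + real n * h p) = k n p" for n
        using pos[of n p] by (simp add: k_def field_simps)
      ultimately show ?thesis using True h(3) by simp
    next
      case False
      then have "h p = 0" using h(2) by (simp add: order.antisym not_less)
      then show ?thesis using h(3) by (simp add: k_def)
    qed
    have Wm: "W \<in> sets borel" using openP[OF W] by simp
    have "(\<lambda>n. LINT p|vol. k n p * f p) \<longlonglongrightarrow> (LINT p|vol. indicator W p * f p)"
    proof (rule integral_dominated_convergence[where w="\<lambda>p. \<bar>f p\<bar>"])
      show "integrable vol (\<lambda>p. \<bar>f p\<bar>)" using f by simp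
      show "AE p in vol. (\<lambda>n. k n p * f p) \<longlonglongrightarrow> indicator W p * f p"
        by (intro AE_I2 tendsto_mult klim tendsto_const)
      show "AE p in vol. norm (k n p * f p) \<le> \<bar>f p\<bar>" for n
        using mult_right_mono[OF kb abs_ge_zero] by (intro AE_I2) (simp add: abs_mult)
      show "(\<lambda>p. k n p * f p) \<in> borel_measurable vol" for n
        using borel_measurable_continuous_onI[OF smooth_fun_continuous[OF smk]] f by auto
      show "(\<lambda>p. indicator W p * f p) \<in> borel_measurable vol" using Wm f by auto
    qed
    then have "(LINT p|vol. indicator W p * f p) = 0"
      using z[OF smk] by (simp add: LIMSEQ_const_iff)
    then show ?thesis by (simp add: set_lebesgue_integral_def)
  qed
  have U: "UNIV \<in> P" using PI[OF smooth_fun_const[of 1]] by simp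
  have si: "set_integrable vol B f" if "B \<in> sets borel" for B
    using f that unfolding set_integrable_def by (intro integrable_mult_indicator) auto
  have "(LINT p:B|vol. f p) = 0" if "B \<in> sigma_sets UNIV P" for B
    using stab subset_Pow_Union[of P, THEN subset_trans, OF Pow_mono[OF subset_UNIV]] that
  proof (induction rule: sigma_sets_induct_disjoint)
    case (basic B) then show ?case by (rule base)
  next
    case empty show ?case by (simp add: set_lebesgue_integral_def)
  next
    case (compl B)
    then have B: "B \<in> sets borel" using gen by simp
    have "(UNIV - B) \<inter> B = {}" by blast
    then have "(LINT p:UNIV|vol. f p) = (LINT p:(UNIV - B)|vol. f p) + (LINT p:B|vol. f p)"
      using set_integral_Un[of "UNIV - B" B vol f] si B by (simp add: Un_commute)
    then show ?case using base[OF U] compl.IH by simp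
  next
    case (union F)
    then have F: "\<And>i. F i \<in> sets borel" using gen by auto
    have "(LINT p:(\<Union>i. F i)|vol. f p) = (\<Sum>i. (LINT p:F i|vol. f p))"
      by (rule lebesgue_integral_countable_add) (use F union si in \<open>auto simp: disjoint_family_on_def\<close>)
    then show ?case using union by simp
  qed
  then have "\<And>B. B \<in> sets vol \<Longrightarrow> (LINT p:B|vol. f p) = (LINT p:B|vol. 0)"
    using gen by (simp add: set_lebesgue_integral_def)
  then show ?thesis
    by (intro density_unique_real[OF f]) (auto simp: set_lebesgue_integral_def)
qed

lemma vector_field_scale:
  assumes "vector_field A Y"
  shows "vector_field A (\<lambda>c p. h p *\<^sub>R Y c p)"
  unfolding vector_field_def
proof (intro ballI)
  fix c d p assume "c \<in> A" "d \<in> A" "p \<in> fst c \<inter> fst d"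
  then have "Y d p = jacobian c d p *v Y c p" using assms unfolding vector_field_def by blast
  then show "h p *\<^sub>R Y d p = jacobian c d p *v (h p *\<^sub>R Y c p)"
    by (simp only: matrix_vector_mult_scaleR)
qed

lemma smooth_components_scale:
  assumes "smooth_fun A h" "smooth_components A Y"
  shows "smooth_components A (\<lambda>c p. h p *\<^sub>R Y c p)"
  using assms smooth_funD[OF assms(1)] unfolding smooth_components_def
  by (auto intro!: smooth_on_scaleR chart(2))

text \<open>Testing against \<open>h \<nabla>\<psi>\<close> with \<open>\<psi>\<close> a cut-off function, or a cut-off function times a
  coordinate, recovers all components of the field.\<close>

lemma L2_vf_zero:
  assumes Y: "L2_vf Y" and z: "\<And>S. vector_field A S \<Longrightarrow> smooth_components A S \<Longrightarrow> (LINT p|vol. riem_inner A g Y S p) = 0"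
  shows "AE p in vol. riem_inner A g Y Y p = 0"
proof -
  have Yvf: "vector_field A Y" using Y by (simp add: L2_vf_def meas_vf_def)
  have AEd: "AE p in vol. dir Y \<psi> p = 0" if \<psi>: "smooth_fun A \<psi>" for \<psi>
  proof (rule AE_zero_of_smooth_tests)
    show "integrable vol (dir Y \<psi>)" by (rule L2_vf_integrable[OF Y L2_vf_gradient[OF \<psi>]])
    fix h assume h: "smooth_fun A h"
    have "(LINT p|vol. riem_inner A g Y (\<lambda>c p. h p *\<^sub>R gradient g \<psi> c p) p) = 0"
      by (intro z vector_field_scale vector_field_gradient[OF \<psi>] smooth_components_scale[OF h smooth_gradient[OF \<psi>]])
    then show "(LINT p|vol. h p * dir Y \<psi> p) = 0"
      by (simp add: riem_inner_def Let_def matrix_vector_mult_scaleR)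
  qed
  obtain H where H: "finite H" "\<forall>h\<in>H. smooth_fun A h \<and> (\<forall>q. 0 \<le> h q)" "\<forall>p. \<exists>h\<in>H. h p > 0"
    "\<forall>h\<in>H. \<exists>c K. c \<in> A \<and> compact K \<and> K \<subseteq> fst c \<and> (\<forall>q. q \<notin> K \<longrightarrow> h q = 0)"
    using ex_finite_bumps by blast
  have each: "AE p in vol. h p > 0 \<longrightarrow> riem_inner A g Y Y p = 0" if hH: "h \<in> H" for h
  proof -
    have h: "smooth_fun A h" using H(2) hH by blast
    obtain c K where c: "c \<in> A" and K: "compact K" "K \<subseteq> fst c" "\<forall>q. q \<notin> K \<longrightarrow> h q = 0"
      using bspec[OF H(4) hH] by (elim exE conjE)
    define \<psi> where "\<psi> i p = h p * (if p \<in> fst c then snd c p $ i else 0)" for i p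
    have sm1: "smooth_on (dom c) (\<lambda>y. h (chart_inv c y) * y $ i)" for i
      by (intro smooth_on_mult smooth_funD[OF h c] smooth_on_vec_nth smooth_on_ident chart(2)[OF c])
    have sm\<psi>: "smooth_fun A (\<psi> i)" for i
    proof (rule smooth_fun_extend[OF c K(1,2)])
      show "\<psi> i p = 0" if "p \<notin> K" for p using K(3) that by (simp add: \<psi>_def)
      show "smooth_on (dom c) (\<lambda>y. \<psi> i (chart_inv c y))"
        by (rule smooth_on_cong[OF chart(2)[OF c] _ sm1[of i]]) (simp add: \<psi>_def chart(6,7)[OF c])
    qed
    have d\<psi>: "dpart c (\<psi> i) p = h p *\<^sub>R axis i 1 + (snd c p $ i) *\<^sub>R dpart c h p" if p: "p \<in> fst c" for i p
    proof (rule dpart_unique[OF c p])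
      have pd: "snd c p \<in> dom c" using p by simp
      have "((\<lambda>y. y $ i) has_derivative (\<lambda>v. v $ i)) (at (snd c p))"
        by (rule bounded_linear_imp_has_derivative[OF bounded_linear_vec_nth])
      from has_derivative_mult[OF smooth_fun_deriv[OF h c p] this]
      have "((\<lambda>y. h (chart_inv c y) * y $ i) has_derivative (\<lambda>v. v \<bullet> (h p *\<^sub>R axis i 1 + (snd c p $ i) *\<^sub>R dpart c h p))) (at (snd c p))"
        by (simp add: chart(5)[OF c p] inner_add_right inner_axis mult.commute)
      then show "((\<lambda>y. \<psi> i (chart_inv c y)) has_derivative (\<lambda>v. v \<bullet> (h p *\<^sub>R axis i 1 + (snd c p $ i) *\<^sub>R dpart c h p))) (at (snd c p))"
        by (rule has_derivative_transform_within_open[OF _ chart(2)[OF c] pd]) (simp add: \<psi>_def chart(6,7)[OF c])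
    qed
    have "AE p in vol. \<forall>i\<in>UNIV. dir Y (\<psi> i) p = 0"
      by (rule AE_finite_allI) (auto intro: AEd[OF sm\<psi>])
    with AEd[OF h] show ?thesis
    proof eventually_elim
      fix p assume a: "dir Y h p = 0" "\<forall>i\<in>UNIV. dir Y (\<psi> i) p = 0"
      show "h p > 0 \<longrightarrow> riem_inner A g Y Y p = 0"
      proof
        assume hp: "h p > 0"
        then have p: "p \<in> fst c" using K(2,3) by (metis less_irrefl subsetD)
        \<comment> \<open>Along Y, the derivative of h times the i-th coordinate is h Y_i plus the
          coordinate times the derivative of h. Both derivatives vanish here, and h is
          positive.\<close>
        have "Y c p $ i = 0" for i
        proof -
          have "h p * Y c p $ i + snd c p $ i * (Y c p \<bullet> dpart c h p) = 0"
            using a(2) dir_eq[OF Yvf sm\<psi> c p] d\<psi>[OF p] by (simp add: inner_add_right inner_axis)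
          then show ?thesis using a(1) dir_eq[OF Yvf h c p] hp by simp
        qed
        then have "Y c p = 0" by (simp add: vec_eq_iff)
        then show "riem_inner A g Y Y p = 0" using riem_inner_chart[OF Yvf Yvf c p] by simp
      qed
    qed
  qed
  have "AE p in vol. \<forall>h\<in>H. h p > 0 \<longrightarrow> riem_inner A g Y Y p = 0"
    by (rule AE_finite_allI[OF H(1) each])
  then show ?thesis
  proof eventually_elim
    fix p assume "\<forall>h\<in>H. h p > 0 \<longrightarrow> riem_inner A g Y Y p = 0"
    then show "riem_inner A g Y Y p = 0" using H(3) by blast
  qed
qed

lemma is_weak_gradient_iff:
  "is_weak_gradient A g u X \<longleftrightarrow> L2_vf X \<and> (\<forall>Y. vector_field A Y \<longrightarrow> smooth_components A Y \<longrightarrow>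
    (LINT p|vol. u p * divergence A g Y p) = - (LINT p|vol. riem_inner A g X Y p))"
  by (auto simp: is_weak_gradient_def L2_vf_def meas_vf_def)

text \<open>Needed because the energy is built on an arbitrarily chosen weak gradient. The
  difference of two weak gradients is orthogonal to all smooth fields, hence of length zero almost
  everywhere by \<open>L2_vf_zero\<close>; pointwise Cauchy-Schwarz then removes it from the squared
  lengths.\<close>

lemma weak_gradient_unique:
  assumes X: "is_weak_gradient A g u X" and Z: "is_weak_gradient A g u Z"
  shows "(LINT p|vol. riem_inner A g X X p) = (LINT p|vol. riem_inner A g Z Z p)"
proof -
  have LX: "L2_vf X" and LZ: "L2_vf Z" using X Z by (auto simp: is_weak_gradient_iff)
  let ?Y = "\<lambda>c p. 1 *\<^sub>R X c p + (- 1) *\<^sub>R Z c p"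
  have LY: "L2_vf ?Y" by (rule L2_vf_lincomb[OF LX LZ])
  have "AE p in vol. riem_inner A g ?Y ?Y p = 0"
  proof (rule L2_vf_zero[OF LY])
    fix S assume S: "vector_field A S" "smooth_components A S"
    have "- (LINT p|vol. riem_inner A g X S p) = - (LINT p|vol. riem_inner A g Z S p)"
      using X Z S unfolding is_weak_gradient_iff by metis
    then show "(LINT p|vol. riem_inner A g ?Y S p) = 0"
      using L2_vf_integrable[OF LX L2_vf_smooth[OF S]] L2_vf_integrable[OF LZ L2_vf_smooth[OF S]]
      unfolding riem_inner_bilinear by simp
  qed
  then have "AE p in vol. riem_inner A g X X p = riem_inner A g Z Z p"
  proof eventually_elim
    fix p assume y: "riem_inner A g ?Y ?Y p = 0"
    have "(riem_inner A g ?Y X p)\<^sup>2 \<le> 0" "(riem_inner A g ?Y Z p)\<^sup>2 \<le> 0"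
      using riem_inner_Cauchy_Schwarz[of ?Y X p] riem_inner_Cauchy_Schwarz[of ?Y Z p] unfolding y by simp_all
    then have "riem_inner A g ?Y X p = 0" "riem_inner A g ?Y Z p = 0" by simp_all
    then show "riem_inner A g X X p = riem_inner A g Z Z p"
      unfolding riem_inner_bilinear using riem_inner_sym[of X Z p] by simp
  qed
  then show ?thesis
    by (intro integral_cong_AE) (use LX LZ in \<open>auto simp: L2_vf_def\<close>)
qed

end

section \<open>Completeness of the space H^1\<close>

text \<open>Serves the pointwise convergence of rapidly Cauchy sequences: square roots of geometric
  bounds are again geometric, so the telescoping series converges absolutely.\<close>

lemma geometric_increments_convergent:
  fixes a :: "nat \<Rightarrow> real"
  assumes "\<And>k. (a (Suc k) - a k)\<^sup>2 \<le> K * q ^ k" "0 \<le> q" "q < 1"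
  shows "convergent a"
proof -
  have b: "norm (a (Suc k) - a k) \<le> sqrt K * sqrt q ^ k" for k
  proof -
    have "norm (a (Suc k) - a k) = sqrt ((a (Suc k) - a k)\<^sup>2)" by simp
    also have "\<dots> \<le> sqrt (K * q ^ k)" by (rule real_sqrt_le_mono[OF assms(1)])
    finally show ?thesis by (simp add: real_sqrt_mult real_sqrt_power)
  qed
  have "summable (\<lambda>k. sqrt K * sqrt q ^ k)"
    using assms(2,3) by (intro summable_mult summable_geometric) auto
  then have "summable (\<lambda>k. a (Suc k) - a k)"
    by (rule summable_comparison_test'[where N=0]) (rule b)
  then have "convergent (\<lambda>n. \<Sum>k<n. a (Suc k) - a k)" by (simp add: summable_iff_convergent)
  then have "convergent (\<lambda>n. a n - a 0)" by (simp add: sum_lessThan_telescope)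
  then obtain l where "(\<lambda>n. a n - a 0) \<longlonglongrightarrow> l" by (auto simp: convergent_def)
  from tendsto_add[OF this tendsto_const[of "a 0"]] show ?thesis by (auto simp: convergent_def)
qed

context riemannian
begin

lemma gradient_diff:
  assumes u: "smooth_fun A u" and v: "smooth_fun A v" and c: "c \<in> A" "p \<in> fst c"
  shows "dpart c (\<lambda>p. u p - v p) p = dpart c u p - dpart c v p"
    "gradient g (\<lambda>p. u p - v p) c p = gradient g u c p - gradient g v c p"
proof -
  show d: "dpart c (\<lambda>p. u p - v p) p = dpart c u p - dpart c v p"
    using dpart_rules(1)[OF u smooth_fun_cmult[OF v, of "-1"] c] dpart_rules(3)[OF v v c, of "-1"] by simp
  show "gradient g (\<lambda>p. u p - v p) c p = gradient g u c p - gradient g v c p"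
    unfolding gradient_eq d by (rule matrix_vector_mult_diff_distrib)
qed

lemma continuous_Gam:
  "smooth_fun A u \<Longrightarrow> smooth_fun A v \<Longrightarrow> continuous_on UNIV (Gam u v)"
  by (rule dir_continuous[OF vector_field_gradient smooth_gradient])

definition dist_dens :: "('m \<Rightarrow> real) \<Rightarrow> ('m \<Rightarrow> real) \<Rightarrow> 'm \<Rightarrow> real" where
  "dist_dens u v p = (u p - v p)\<^sup>2 + Gam (\<lambda>p. u p - v p) (\<lambda>p. u p - v p) p"

lemma dist_dens_nonneg: "0 \<le> dist_dens u v p"
  by (simp add: dist_dens_def riem_inner_nonneg)

lemma continuous_dist_dens:
  assumes "smooth_fun A u" "smooth_fun A v"
  shows "continuous_on UNIV (dist_dens u v)"
  unfolding dist_dens_def[abs_def]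
  by (intro continuous_on_add continuous_on_power continuous_Gam smooth_fun_continuous smooth_fun_diff assms)

text \<open>The argument of Riesz and Fischer, for functions and gradients at once. Along a rapidly
  Cauchy subsequence the values and the gradient components converge almost everywhere, and Fatou's
  lemma estimates the distance to the limit. Comparing any member \<open>u k\<close> with the
  subsequence yields convergence of the whole sequence.\<close>

lemma H1_complete:
  fixes u :: "nat \<Rightarrow> 'm \<Rightarrow> real"
  assumes sm: "\<And>k. smooth_fun A (u k)"
    and Cau: "\<And>e. 0 < e \<Longrightarrow> \<exists>N. \<forall>k\<ge>N. \<forall>l\<ge>N. (LINT p|vol. dist_dens (u k) (u l) p) < e"
  shows "\<exists>\<phi> X. \<phi> \<in> borel_measurable borel \<and> meas_vf X \<and>
    (\<forall>e>0. \<exists>N. \<forall>k\<ge>N. (\<integral>\<^sup>+p. ennreal ((u k p - \<phi> p)\<^sup>2 +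
      riem_inner A g (\<lambda>c p. 1 *\<^sub>R gradient g (u k) c p + (- 1) *\<^sub>R X c p)
        (\<lambda>c p. 1 *\<^sub>R gradient g (u k) c p + (- 1) *\<^sub>R X c p) p) \<partial>vol) \<le> ennreal e)"
proof -
  let ?N = "\<lambda>k l. dist_dens (u k) (u l)"
  have contN: "continuous_on UNIV (?N k l)" for k l by (rule continuous_dist_dens[OF sm sm])
  have Nm[measurable]: "?N k l \<in> borel_measurable borel" for k l by (rule borel_measurable_continuous_onI[OF contN])
  have Nint: "(\<integral>\<^sup>+p. ennreal (?N k l p) \<partial>vol) = ennreal (LINT p|vol. ?N k l p)" for k l
    by (rule nn_integral_eq_integral[OF integrable_continuous_vol[OF contN]]) (simp add: dist_dens_nonneg)
  have "\<exists>M. \<forall>k\<ge>M. \<forall>l\<ge>M. (LINT p|vol. ?N k l p) < (1/4)^j" for j :: nat by (rule Cau) simp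
  then obtain M where M: "\<And>j k l. k \<ge> M j \<Longrightarrow> l \<ge> M j \<Longrightarrow> (LINT p|vol. ?N k l p) < (1/4)^j" by metis
  \<comment> \<open>Summing makes \<open>r\<close> nondecreasing, so that both \<open>r k\<close>
    and \<open>r (Suc k)\<close> are at least \<open>M k\<close>; the summand \<open>k\<close> makes
    it unbounded.\<close>
  define r where "r k = (\<Sum>j\<le>k. M j) + k" for k
  have rM: "r k \<ge> M k" for k unfolding r_def using member_le_sum[of k "{..k}" M] by simp
  have rs: "r (Suc k) \<ge> r k" and rk: "r k \<ge> k" for k by (simp_all add: r_def)
  have Nr: "(LINT p|vol. ?N (r (Suc k)) (r k) p) < (1/4)^k" for k
    using rM[of k] rs[of k] by (intro M) auto
  \<comment> \<open>The weights \<open>2^k\<close> against integrals below 4^(-k) leave a convergent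
    series. Where \<open>F\<close> is finite, the k-th distance density is at most a multiple of
    2^(-k).\<close>
  define F where "F p = (\<Sum>k. ennreal (2^k * ?N (r (Suc k)) (r k) p))" for p
  have Fm[measurable]: "F \<in> borel_measurable borel" unfolding F_def[abs_def] by measurable
  have "(\<integral>\<^sup>+p. F p \<partial>vol) = (\<Sum>k. \<integral>\<^sup>+p. ennreal (2^k * ?N (r (Suc k)) (r k) p) \<partial>vol)"
    unfolding F_def by (rule nn_integral_suminf) simp
  also have "\<dots> = (\<Sum>k. ennreal (2^k * (LINT p|vol. ?N (r (Suc k)) (r k) p)))"
    by (simp add: ennreal_mult' nn_integral_cmult Nint)
  also have "\<dots> \<le> (\<Sum>k. ennreal ((1/2)^k))"
  proof (intro suminf_le ennreal_leI)
    fix k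
    have "2^k * (LINT p|vol. ?N (r (Suc k)) (r k) p) \<le> 2^k * (1/4)^k"
      using Nr[of k] by (intro mult_left_mono) auto
    also have "\<dots> = (1/2::real)^k" by (simp add: power_mult_distrib[symmetric])
    finally show "2^k * (LINT p|vol. ?N (r (Suc k)) (r k) p) \<le> (1/2)^k" .
  qed auto
  also have "\<dots> = ennreal (\<Sum>k. (1/2)^k)" by (rule suminf_ennreal2) auto
  finally have "(\<integral>\<^sup>+p. F p \<partial>vol) \<noteq> \<infinity>" by (auto simp: top_unique)
  then have AEF: "AE p in vol. F p \<noteq> \<infinity>" by (intro nn_integral_PInf_AE) auto
  define Good where "Good = {p. F p \<noteq> \<infinity>}"
  have Goodm[measurable]: "Good \<in> sets borel" unfolding Good_def by measurable
  have bound: "\<exists>C. \<forall>k. ?N (r (Suc k)) (r k) p \<le> C * (1/2)^k" if "p \<in> Good" for p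
  proof -
    have "F p \<noteq> \<infinity>" using that by (simp add: Good_def)
    then obtain C where C: "0 \<le> C" "F p = ennreal C" by (cases "F p") auto
    have "?N (r (Suc k)) (r k) p \<le> C * (1/2)^k" for k
    proof -
      have "ennreal (2^k * ?N (r (Suc k)) (r k) p) \<le> F p"
        unfolding F_def using sum_le_suminf[of "\<lambda>k. ennreal (2^k * ?N (r (Suc k)) (r k) p)" "{k}"] by simp
      then have "2^k * ?N (r (Suc k)) (r k) p \<le> C" using C by simp
      then show ?thesis by (simp add: field_simps power_one_over)
    qed
    then show ?thesis by blast
  qed
  have convu: "convergent (\<lambda>k. u (r k) p)" if p: "p \<in> Good" for p
  proof -
    obtain C where C: "\<And>k. ?N (r (Suc k)) (r k) p \<le> C * (1/2)^k" using bound[OF p] by blast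
    have "(u (r (Suc k)) p - u (r k) p)\<^sup>2 \<le> C * (1/2)^k" for k
      using C[of k] riem_inner_nonneg[of "gradient g (\<lambda>p. u (r (Suc k)) p - u (r k) p)" p]
      unfolding dist_dens_def by linarith
    then show ?thesis by (rule geometric_increments_convergent) auto
  qed
  have convg: "convergent (\<lambda>k. gradient g (u (r k)) c p)" if p: "p \<in> Good" and c: "c \<in> A" "p \<in> fst c" for c p
  proof -
    obtain C where C: "\<And>k. ?N (r (Suc k)) (r k) p \<le> C * (1/2)^k" using bound[OF p] by blast
    \<comment> \<open>Cauchy-Schwarz for the metric with a coordinate vector bounds the increments
      of the differential by the length of the gradient, with a factor depending only on the
      point.\<close>
    have "convergent (\<lambda>k. dpart c (u (r k)) p $ i)" for i
    proof (rule geometric_increments_convergent[where q="1/2"])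
      fix k
      let ?d = "\<lambda>p. u (r (Suc k)) p - u (r k) p" and ?e = "axis i 1 :: real ^ 'n"
      have smd: "smooth_fun A ?d" by (rule smooth_fun_diff[OF sm sm])
      have "dpart c (u (r (Suc k))) p $ i - dpart c (u (r k)) p $ i = ?e \<bullet> (g c p *v gradient g ?d c p)"
        unfolding metric_gradient[OF c] gradient_diff(1)[OF sm sm c] by (simp add: inner_axis')
      then have "(dpart c (u (r (Suc k))) p $ i - dpart c (u (r k)) p $ i)\<^sup>2 \<le>
          (?e \<bullet> (g c p *v ?e)) * (gradient g ?d c p \<bullet> (g c p *v gradient g ?d c p))"
        using metric_Cauchy_Schwarz[OF c] by simp
      also have "gradient g ?d c p \<bullet> (g c p *v gradient g ?d c p) = Gam ?d ?d p"
        by (rule riem_inner_chart[OF vector_field_gradient vector_field_gradient c, symmetric]) (rule smd)+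
      also have "(?e \<bullet> (g c p *v ?e)) * Gam ?d ?d p \<le> (?e \<bullet> (g c p *v ?e)) * (C * (1/2)^k)"
      proof (rule mult_left_mono)
        show "Gam ?d ?d p \<le> C * (1/2)^k"
          using C[of k] zero_le_power2[of "u (r (Suc k)) p - u (r k) p"] unfolding dist_dens_def by linarith
        show "0 \<le> ?e \<bullet> (g c p *v ?e)" using metricD(2)[OF c, of ?e] by simp
      qed
      finally show "(dpart c (u (r (Suc k))) p $ i - dpart c (u (r k)) p $ i)\<^sup>2 \<le> (?e \<bullet> (g c p *v ?e)) * C * (1/2)^k"
        by (simp add: mult.assoc)
    qed auto
    then obtain L where L: "\<And>i. (\<lambda>k. dpart c (u (r k)) p $ i) \<longlonglongrightarrow> L i" unfolding convergent_def by metis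
    have "(\<lambda>k. dpart c (u (r k)) p) \<longlonglongrightarrow> (\<chi> i. L i)" by (rule vec_tendstoI) (simp add: L)
    then have "(\<lambda>k. matrix_inv (g c p) *v dpart c (u (r k)) p) \<longlonglongrightarrow> matrix_inv (g c p) *v (\<chi> i. L i)"
      by (rule bounded_linear.tendsto[OF matrix_vector_mul_bounded_linear])
    then show ?thesis unfolding gradient_eq by (auto simp: convergent_def)
  qed
  \<comment> \<open>Multiplication by the indicator of \<open>Good\<close> makes the limits exist
    off \<open>Good\<close> as well, so that measurability and the transformation law hold at every
    point and not only almost everywhere.\<close>
  define \<phi> where "\<phi> p = lim (\<lambda>k. indicator Good p *\<^sub>R u (r k) p)" for p
  define X where "X c p = lim (\<lambda>k. indicator Good p *\<^sub>R gradient g (u (r k)) c p)" for c p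
  have lim\<phi>: "(\<lambda>k. u (r k) p) \<longlonglongrightarrow> \<phi> p" if "p \<in> Good" for p
    using convu[OF that] that by (simp add: \<phi>_def convergent_LIMSEQ_iff)
  have limX: "(\<lambda>k. indicator Good p *\<^sub>R gradient g (u (r k)) c p) \<longlonglongrightarrow> X c p" if "c \<in> A" "p \<in> fst c" for c p
    using convg[OF _ that] by (cases "p \<in> Good") (simp_all add: X_def convergent_LIMSEQ_iff)
  have \<phi>m: "\<phi> \<in> borel_measurable borel"
    unfolding \<phi>_def[abs_def]
    by (intro borel_measurable_lim_metric borel_measurable_scaleR borel_measurable_indicator Goodm
      borel_measurable_continuous_onI smooth_fun_continuous sm)
  have Xm: "meas_vf X"
    unfolding meas_vf_def vector_field_def
  proof (intro conjI ballI)
    fix c d p assume cd: "c \<in> A" "d \<in> A" "p \<in> fst c \<inter> fst d"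
    have "(\<lambda>k. jacobian c d p *v (indicator Good p *\<^sub>R gradient g (u (r k)) c p)) \<longlonglongrightarrow> jacobian c d p *v X c p"
      by (rule bounded_linear.tendsto[OF matrix_vector_mul_bounded_linear limX]) (use cd in auto)
    moreover have "jacobian c d p *v (indicator Good p *\<^sub>R gradient g (u (r k)) c p) = indicator Good p *\<^sub>R gradient g (u (r k)) d p" for k
    proof -
      have "gradient g (u (r k)) d p = jacobian c d p *v gradient g (u (r k)) c p"
        using vector_field_gradient[OF sm] cd unfolding vector_field_def by blast
      then show ?thesis by (simp only: matrix_vector_mult_scaleR)
    qed
    ultimately have "(\<lambda>k. indicator Good p *\<^sub>R gradient g (u (r k)) d p) \<longlonglongrightarrow> jacobian c d p *v X c p"
      by (simp only:)
    then show "X d p = jacobian c d p *v X c p"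
      using limX[of d p] cd by (auto intro: LIMSEQ_unique)
  next
    fix c assume c: "c \<in> A"
    have [measurable]: "gradient g (u (r k)) c \<in> borel_measurable (restrict_space borel (fst c))" for k
      using meas_vf_smooth[OF vector_field_gradient[OF sm] smooth_gradient[OF sm]] c by (simp add: meas_vf_def)
    have [measurable]: "(\<lambda>p. indicator Good p :: real) \<in> borel_measurable (restrict_space borel (fst c))"
      by (rule measurable_restrict_space1) simp
    show "X c \<in> borel_measurable (restrict_space borel (fst c))"
      unfolding X_def[abs_def] by measurable
  qed
  let ?W = "\<lambda>k c p. 1 *\<^sub>R gradient g (u k) c p + (- 1) *\<^sub>R X c p"
  have lim: "(\<lambda>l. ?N k (r l) p) \<longlonglongrightarrow> (u k p - \<phi> p)\<^sup>2 + riem_inner A g (?W k) (?W k) p" if p: "p \<in> Good" for k p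
  proof -
    let ?c = "chart_at A p"
    have c: "?c \<in> A" "p \<in> fst ?c" by (rule chart_at)+
    have "(\<lambda>l. gradient g (u (r l)) ?c p) \<longlonglongrightarrow> X ?c p" using limX[OF c] p by simp
    then have w: "(\<lambda>l. gradient g (u k) ?c p - gradient g (u (r l)) ?c p) \<longlonglongrightarrow> ?W k ?c p"
      using tendsto_diff[OF tendsto_const] by simp blast
    have "(\<lambda>l. (gradient g (u k) ?c p - gradient g (u (r l)) ?c p) \<bullet> (g ?c p *v (gradient g (u k) ?c p - gradient g (u (r l)) ?c p)))
      \<longlonglongrightarrow> ?W k ?c p \<bullet> (g ?c p *v ?W k ?c p)"
      by (intro tendsto_inner w bounded_linear.tendsto[OF matrix_vector_mul_bounded_linear w])
    then have "(\<lambda>l. Gam (\<lambda>p. u k p - u (r l) p) (\<lambda>p. u k p - u (r l) p) p) \<longlonglongrightarrow> riem_inner A g (?W k) (?W k) p"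
      unfolding riem_inner_def Let_def gradient_diff(2)[OF sm sm c] .
    then show ?thesis
      unfolding dist_dens_def by (intro tendsto_add tendsto_power tendsto_diff tendsto_const lim\<phi>[OF p])
  qed
  have "\<exists>N. \<forall>k\<ge>N. (\<integral>\<^sup>+p. ennreal ((u k p - \<phi> p)\<^sup>2 + riem_inner A g (?W k) (?W k) p) \<partial>vol) \<le> ennreal e" if e: "0 < e" for e
  proof -
    obtain N where N: "\<And>k l. k \<ge> N \<Longrightarrow> l \<ge> N \<Longrightarrow> (LINT p|vol. ?N k l p) < e" using Cau[OF e] by blast
    have "(\<integral>\<^sup>+p. ennreal ((u k p - \<phi> p)\<^sup>2 + riem_inner A g (?W k) (?W k) p) \<partial>vol) \<le> ennreal e" if k: "k \<ge> N" for k
    proof -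
      have "(\<integral>\<^sup>+p. ennreal ((u k p - \<phi> p)\<^sup>2 + riem_inner A g (?W k) (?W k) p) \<partial>vol) =
        (\<integral>\<^sup>+p. liminf (\<lambda>l. ennreal (?N k (r l) p)) \<partial>vol)"
      proof (rule nn_integral_cong_AE)
        show "AE p in vol. ennreal ((u k p - \<phi> p)\<^sup>2 + riem_inner A g (?W k) (?W k) p) = liminf (\<lambda>l. ennreal (?N k (r l) p))"
          using AEF
        proof eventually_elim
          fix p assume "F p \<noteq> \<infinity>"
          then have "p \<in> Good" by (simp add: Good_def)
          from tendsto_ennrealI[OF lim[OF this]]
          show "ennreal ((u k p - \<phi> p)\<^sup>2 + riem_inner A g (?W k) (?W k) p) = liminf (\<lambda>l. ennreal (?N k (r l) p))"
            by (rule lim_imp_Liminf[OF sequentially_bot, symmetric])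
        qed
      qed
      also have "\<dots> \<le> liminf (\<lambda>l. \<integral>\<^sup>+p. ennreal (?N k (r l) p) \<partial>vol)"
        by (rule nn_integral_liminf) simp
      also have "\<dots> \<le> liminf (\<lambda>l. ennreal e)"
      proof (rule Liminf_mono)
        show "\<forall>\<^sub>F l in sequentially. (\<integral>\<^sup>+p. ennreal (?N k (r l) p) \<partial>vol) \<le> ennreal e"
          using eventually_ge_at_top[of N]
        proof eventually_elim
          fix l assume "N \<le> l"
          then have "r l \<ge> N" using rk[of l] by simp
          then show "(\<integral>\<^sup>+p. ennreal (?N k (r l) p) \<partial>vol) \<le> ennreal e"
            unfolding Nint using N[OF k] by (intro ennreal_leI) (simp add: less_imp_le)
        qed
      qed
      also have "\<dots> = ennreal e" by (rule Liminf_const[OF sequentially_bot])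
      finally show ?thesis .
    qed
    then show ?thesis by blast
  qed
  then show ?thesis using \<phi>m Xm by blast
qed

text \<open>Green's formula holds for each \<open>u k\<close>. The errors made in replacing
  \<open>u k\<close> by \<open>\<phi>\<close> and its gradient by \<open>X\<close> tend to zero by
  Cauchy-Schwarz, so \<open>X\<close> is a weak gradient of the limit.\<close>

lemma H1_limit:
  fixes u :: "nat \<Rightarrow> 'm \<Rightarrow> real"
  assumes sm: "\<And>k. smooth_fun A (u k)"
    and Cau: "\<And>e. 0 < e \<Longrightarrow> \<exists>N. \<forall>k\<ge>N. \<forall>l\<ge>N. (LINT p|vol. dist_dens (u k) (u l) p) < e"
  shows "\<exists>\<phi> X. L2 A g \<phi> \<and> is_weak_gradient A g \<phi> X \<and> (\<lambda>k. LINT p|vol. (u k p - \<phi> p)\<^sup>2) \<longlonglongrightarrow> 0"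
proof -
  obtain \<phi> X where \<phi>m[measurable]: "\<phi> \<in> borel_measurable borel" and Xm: "meas_vf X" and
    H: "\<forall>e>0. \<exists>N. \<forall>k\<ge>N. (\<integral>\<^sup>+p. ennreal ((u k p - \<phi> p)\<^sup>2 +
      riem_inner A g (\<lambda>c p. 1 *\<^sub>R gradient g (u k) c p + (- 1) *\<^sub>R X c p)
        (\<lambda>c p. 1 *\<^sub>R gradient g (u k) c p + (- 1) *\<^sub>R X c p) p) \<partial>vol) \<le> ennreal e"
    using H1_complete[OF sm Cau] by blast
  let ?W = "\<lambda>k c p. 1 *\<^sub>R gradient g (u k) c p + (- 1) *\<^sub>R X c p"
  have um[measurable]: "u k \<in> borel_measurable borel" for k
    by (rule borel_measurable_continuous_onI[OF smooth_fun_continuous[OF sm]])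
  have gm: "meas_vf (gradient g (u k))" for k by (rule meas_vf_smooth[OF vector_field_gradient[OF sm] smooth_gradient[OF sm]])
  have Wm: "meas_vf (?W k)" for k by (rule meas_vf_lincomb[OF gm Xm])
  have Wr[measurable]: "riem_inner A g (?W k) (?W k) \<in> borel_measurable borel" for k by (rule riem_inner_measurable[OF Wm Wm])
  have bnd: "integrable vol f \<and> (LINT p|vol. f p) \<le> e"
    if "f \<in> borel_measurable borel" "\<And>p. 0 \<le> f p" "\<And>p. f p \<le> h p" "(\<integral>\<^sup>+p. ennreal (h p) \<partial>vol) \<le> ennreal e" "0 < e"
    for f h :: "'m \<Rightarrow> real" and e
  proof -
    have le: "(\<integral>\<^sup>+p. ennreal (f p) \<partial>vol) \<le> ennreal e"
      using that(3,4) by (meson ennreal_leI nn_integral_mono order_trans)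
    then have int: "integrable vol f"
      using that(1,2) by (intro integrableI_nonneg) (auto simp: le_less_trans)
    then have "ennreal (LINT p|vol. f p) \<le> ennreal e" using le nn_integral_eq_integral[OF int] that(2) by simp
    then show ?thesis using int that(5) by simp
  qed
  have H': "\<exists>N. \<forall>k\<ge>N. integrable vol (\<lambda>p. (u k p - \<phi> p)\<^sup>2) \<and> (LINT p|vol. (u k p - \<phi> p)\<^sup>2) \<le> e \<and>
      integrable vol (riem_inner A g (?W k) (?W k)) \<and> (LINT p|vol. riem_inner A g (?W k) (?W k) p) \<le> e" if e: "0 < e" for e
  proof -
    obtain N where N: "\<And>k. k \<ge> N \<Longrightarrow> (\<integral>\<^sup>+p. ennreal ((u k p - \<phi> p)\<^sup>2 + riem_inner A g (?W k) (?W k) p) \<partial>vol) \<le> ennreal e"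
      using H e by blast
    have "integrable vol (\<lambda>p. (u k p - \<phi> p)\<^sup>2) \<and> (LINT p|vol. (u k p - \<phi> p)\<^sup>2) \<le> e" if "k \<ge> N" for k
      by (rule bnd[OF _ _ _ N[OF that] e]) (simp_all add: riem_inner_nonneg)
    moreover have "integrable vol (riem_inner A g (?W k) (?W k)) \<and> (LINT p|vol. riem_inner A g (?W k) (?W k) p) \<le> e" if "k \<ge> N" for k
      by (rule bnd[OF Wr _ _ N[OF that] e]) (simp_all add: riem_inner_nonneg)
    ultimately show ?thesis by blast
  qed
  have lim0: "f \<longlonglongrightarrow> 0" if nn: "\<And>k. 0 \<le> f k" and ev: "\<And>e. 0 < e \<Longrightarrow> \<exists>N. \<forall>k\<ge>N. f k \<le> e" for f :: "nat \<Rightarrow> real"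
  proof (rule LIMSEQ_I)
    fix e :: real assume "0 < e"
    then obtain N where "\<forall>k\<ge>N. f k \<le> e / 2" using ev[of "e/2"] by auto
    then show "\<exists>N. \<forall>k\<ge>N. norm (f k - 0) < e" using nn \<open>0 < e\<close> by (intro exI[of _ N]) (auto intro: le_less_trans)
  qed
  have L\<phi>: "(\<lambda>k. LINT p|vol. (u k p - \<phi> p)\<^sup>2) \<longlonglongrightarrow> 0"
    by (rule lim0) (use H' in \<open>simp, blast\<close>)
  have LX: "(\<lambda>k. LINT p|vol. riem_inner A g (?W k) (?W k) p) \<longlonglongrightarrow> 0"
    by (rule lim0) (use H' in \<open>simp add: riem_inner_nonneg, blast\<close>)
  obtain N where N: "\<And>k. k \<ge> N \<Longrightarrow> integrable vol (\<lambda>p. (u k p - \<phi> p)\<^sup>2)"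
      "\<And>k. k \<ge> N \<Longrightarrow> integrable vol (riem_inner A g (?W k) (?W k))"
    using H'[OF zero_less_one] by blast
  have uint: "integrable vol (\<lambda>p. (u k p)\<^sup>2)" for k
    by (intro integrable_continuous_vol continuous_on_power smooth_fun_continuous sm)
  have "integrable vol (\<lambda>p. (u N p - (u N p - \<phi> p))\<^sup>2)"
    by (rule integrable_sum_square(2)) (use uint N in auto)
  then have phi2: "integrable vol (\<lambda>p. (\<phi> p)\<^sup>2)" by simp
  have WL: "L2_vf (?W k)" if "k \<ge> N" for k using Wm N(2)[OF that] by (simp add: L2_vf_def)
  have gL: "L2_vf (gradient g (u k))" for k by (rule L2_vf_gradient[OF sm])
  \<comment> \<open>This combination is \<open>X\<close>: the gradient of a smooth function minus a
    field already known to be square integrable.\<close>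
  have "L2_vf (\<lambda>c p. 1 *\<^sub>R gradient g (u N) c p + (- 1) *\<^sub>R ?W N c p)"
    by (rule L2_vf_lincomb[OF gL WL]) simp
  then have XL: "L2_vf X" by simp
  have weak: "(LINT p|vol. \<phi> p * divergence A g Y p) = - (LINT p|vol. riem_inner A g X Y p)"
    if Y: "vector_field A Y" "smooth_components A Y" for Y
  proof -
    have YL: "L2_vf Y" by (rule L2_vf_smooth[OF Y])
    have contd: "continuous_on UNIV (divergence A g Y)" by (rule continuous_divergence[OF Y])
    have dm: "divergence A g Y \<in> borel_measurable vol" using borel_measurable_continuous_onI[OF contd] by simp
    have d2: "integrable vol (\<lambda>p. (divergence A g Y p)\<^sup>2)" by (intro integrable_continuous_vol continuous_on_power contd)
    let ?a = "\<lambda>k. LINT p|vol. (u k p - \<phi> p) * divergence A g Y p"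
    let ?b = "\<lambda>k. LINT p|vol. riem_inner A g (?W k) Y p"
    have sq: "f \<longlonglongrightarrow> 0" if "\<And>k. k \<ge> N \<Longrightarrow> (f k)\<^sup>2 \<le> h k * K" "h \<longlonglongrightarrow> 0" for f h :: "nat \<Rightarrow> real" and K
    proof -
      have "(\<lambda>k. h k * K) \<longlonglongrightarrow> 0" using tendsto_mult_left_zero[OF that(2)] .
      then have "(\<lambda>k. (f k)\<^sup>2) \<longlonglongrightarrow> 0"
        by (rule tendsto_sandwich[OF _ _ tendsto_const, rotated -1])
          (use that(1) in \<open>auto simp: eventually_sequentially\<close>)
      then show ?thesis by simp
    qed
    have a0: "?a \<longlonglongrightarrow> 0"
      by (rule sq[OF _ L\<phi>], rule integral_Cauchy_Schwarz) (use dm d2 N in auto)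
    have b0: "?b \<longlonglongrightarrow> 0"
      by (rule sq[OF _ LX], rule L2_vf_Cauchy_Schwarz[OF WL YL])
    have eqk: "?a k + ?b k = - (LINT p|vol. \<phi> p * divergence A g Y p) - (LINT p|vol. riem_inner A g X Y p)" if k: "k \<ge> N" for k
    proof -
      have i1: "integrable vol (\<lambda>p. \<phi> p * divergence A g Y p)" by (rule integrable_mult_L2) (use phi2 dm d2 in auto)
      have i2: "integrable vol (\<lambda>p. u k p * divergence A g Y p)" by (rule integrable_mult_L2) (use uint dm d2 in auto)
      have "?a k = (LINT p|vol. u k p * divergence A g Y p) - (LINT p|vol. \<phi> p * divergence A g Y p)"
        using i1 i2 by (simp add: left_diff_distrib)
      moreover have "?b k = (LINT p|vol. riem_inner A g (gradient g (u k)) Y p) - (LINT p|vol. riem_inner A g X Y p)"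
        unfolding riem_inner_bilinear using L2_vf_integrable[OF gL YL] L2_vf_integrable[OF XL YL] by simp
      moreover have "(LINT p|vol. riem_inner A g (gradient g (u k)) Y p) = (LINT p|vol. dir Y (u k) p)"
        by (intro Bochner_Integration.integral_cong refl riem_inner_sym)
      ultimately show ?thesis using Green[OF Y sm, of k] by simp
    qed
    have "(\<lambda>k. ?a k + ?b k) \<longlonglongrightarrow> 0" using tendsto_add[OF a0 b0] by simp
    moreover have "(\<lambda>k. ?a k + ?b k) \<longlonglongrightarrow> - (LINT p|vol. \<phi> p * divergence A g Y p) - (LINT p|vol. riem_inner A g X Y p)"
      by (rule tendsto_eventually) (use eqk in \<open>auto simp: eventually_sequentially\<close>)
    ultimately have "0 = - (LINT p|vol. \<phi> p * divergence A g Y p) - (LINT p|vol. riem_inner A g X Y p)"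
      by (rule LIMSEQ_unique)
    then show ?thesis by simp
  qed
  have "L2 A g \<phi>" using phi2 by (simp add: L2_def)
  moreover have "is_weak_gradient A g \<phi> X" unfolding is_weak_gradient_iff using XL weak by blast
  ultimately show ?thesis using L\<phi> by blast
qed

end

lemma integral_cbox_eq_lborel:
  fixes f :: "'a::euclidean_space \<Rightarrow> real"
  assumes "continuous_on (cbox a b) f"
  shows "integrable lborel (\<lambda>x. indicator (cbox a b) x * f x)"
    "integral (cbox a b) f = (LINT x|lborel. indicator (cbox a b) x * f x)"
  using borel_integrable_compact[OF compact_cbox assms] set_borel_integral_eq_integral(2)[of "cbox a b" f]
  by (simp_all add: set_integrable_def set_lebesgue_integral_def)

lemma square_integral_cbox_le:
  fixes f :: "'a::euclidean_space \<Rightarrow> real"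
  assumes f: "continuous_on (cbox a b) f"
  shows "(integral (cbox a b) f)\<^sup>2 \<le> measure lborel (cbox a b) * integral (cbox a b) (\<lambda>x. (f x)\<^sup>2)"
proof -
  let ?i = "indicator (cbox a b) :: 'a \<Rightarrow> real"
  have f2: "continuous_on (cbox a b) (\<lambda>x. (f x)\<^sup>2)" by (intro continuous_on_power f)
  have sq: "(?i x)\<^sup>2 = ?i x" "(?i x * f x)\<^sup>2 = ?i x * (f x)\<^sup>2" "?i x * (?i x * f x) = ?i x * f x" for x
    by (auto simp: indicator_def)
  have "(LINT x|lborel. ?i x * (?i x * f x))\<^sup>2 \<le> (LINT x|lborel. (?i x)\<^sup>2) * (LINT x|lborel. (?i x * f x)\<^sup>2)"
  proof (rule integral_Cauchy_Schwarz)
    show "(\<lambda>x. ?i x * f x) \<in> borel_measurable lborel"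
      using integral_cbox_eq_lborel(1)[OF f] by (rule borel_measurable_integrable)
    show "integrable lborel (\<lambda>x. (?i x * f x)\<^sup>2)"
      unfolding sq by (rule integral_cbox_eq_lborel(1)[OF f2])
    show "integrable lborel (\<lambda>x. (?i x)\<^sup>2)" unfolding sq by (simp add: emeasure_lborel_cbox_eq)
  qed simp
  then show ?thesis
    unfolding sq by (simp add: integral_cbox_eq_lborel(2)[OF f] integral_cbox_eq_lborel(2)[OF f2])
qed

context riemannian
begin

subsection \<open>Rellich compactness\<close>

lemma cell_integral:
  assumes c: "c \<in> A" and K: "cbox a b \<subseteq> dom c" and w: "continuous_on UNIV w" "\<And>p. 0 \<le> w p"
    and r: "\<And>y. y \<in> cbox a b \<Longrightarrow> r \<le> rho_ext c y" "\<And>y. y \<in> cbox a b \<Longrightarrow> rho_ext c y \<le> R"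
  shows "continuous_on (cbox a b) (\<lambda>y. w (chart_inv c y))"
    "r * integral (cbox a b) (\<lambda>y. w (chart_inv c y)) \<le> (LINT p|vol. w p)"
    "integrable vol (\<lambda>p. indicator (chart_inv c ` cbox a b) p * w p)"
    "(LINT p|vol. indicator (chart_inv c ` cbox a b) p * w p) \<le> R * integral (cbox a b) (\<lambda>y. w (chart_inv c y))"
proof -
  let ?K = "cbox a b" and ?C = "chart_inv c ` cbox a b"
  have ci: "continuous_on ?K (chart_inv c)" by (rule continuous_on_subset[OF chart(4)[OF c] K])
  show wc: "continuous_on ?K (\<lambda>y. w (chart_inv c y))"
    by (rule continuous_on_compose2[OF w(1) ci]) simp
  have rc: "continuous_on ?K (\<lambda>y. rho c (chart_inv c y) * w (chart_inv c y))"
    by (intro continuous_on_mult wc continuous_on_subset[OF smooth_onD(3)[OF smooth_rho[OF c]] K])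
  have re: "rho_ext c y = rho c (chart_inv c y)" if "y \<in> ?K" for y using that K by (auto simp: rho_ext_def)
  have Cm[measurable]: "?C \<in> sets borel"
    using compact_imp_closed[OF compact_continuous_image[OF ci compact_cbox]] by simp
  have wm[measurable]: "w \<in> borel_measurable borel" by (rule borel_measurable_continuous_onI[OF w(1)])
  have Cf: "?C \<subseteq> fst c" using K chart(7)[OF c] by blast
  have pt: "rho_ext c y * (indicator ?C (inv_ext c y) * w (inv_ext c y)) = indicator ?K y * (rho c (chart_inv c y) * w (chart_inv c y))" for y
  proof (cases "y \<in> dom c")
    case True
    have "chart_inv c y \<in> ?C \<longleftrightarrow> y \<in> ?K"
    proof
      assume "chart_inv c y \<in> ?C"
      then obtain z where z: "z \<in> ?K" "chart_inv c y = chart_inv c z" by blast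
      then have "y = z" using chart(6)[OF c True] chart(6)[OF c, of z] K by (metis subsetD)
      then show "y \<in> ?K" using z(1) by simp
    qed simp
    then show ?thesis using True by (simp add: rho_ext_def inv_ext_def indicator_def)
  next
    case False
    then have "y \<notin> ?K" using K by blast
    then show ?thesis using False by (simp add: rho_ext_def)
  qed
  have supp: "indicator ?C p * w p = 0" if "p \<notin> fst c" for p using that Cf by (auto simp: indicator_def)
  show int: "integrable vol (\<lambda>p. indicator ?C p * w p)"
    using integral_vol_chart(1)[OF c, of "\<lambda>p. indicator ?C p * w p"] supp integral_cbox_eq_lborel(1)[OF rc]
    unfolding pt by simp
  have eq: "(LINT p|vol. indicator ?C p * w p) = integral ?K (\<lambda>y. rho c (chart_inv c y) * w (chart_inv c y))"
    using integral_vol_chart(2)[OF c, of "\<lambda>p. indicator ?C p * w p"] supp integral_cbox_eq_lborel(2)[OF rc]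
    unfolding pt by simp
  have "integral ?K (\<lambda>y. rho c (chart_inv c y) * w (chart_inv c y)) \<le> integral ?K (\<lambda>y. R * w (chart_inv c y))"
    by (intro integral_le integrable_continuous rc continuous_on_mult_left wc mult_right_mono w(2)) (use r(2) re in auto)
  then show "(LINT p|vol. indicator ?C p * w p) \<le> R * integral ?K (\<lambda>y. w (chart_inv c y))"
    unfolding eq by simp
  have "integral ?K (\<lambda>y. r * w (chart_inv c y)) \<le> integral ?K (\<lambda>y. rho c (chart_inv c y) * w (chart_inv c y))"
    by (intro integral_le integrable_continuous rc continuous_on_mult_left wc mult_right_mono w(2)) (use r(1) re in auto)
  moreover have "(LINT p|vol. indicator ?C p * w p) \<le> (LINT p|vol. w p)"
    by (intro integral_mono int integrable_continuous_vol w(1)) (use w(2) in \<open>auto simp: indicator_def\<close>)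
  ultimately show "r * integral ?K (\<lambda>y. w (chart_inv c y)) \<le> (LINT p|vol. w p)"
    unfolding eq by simp
qed

lemma metric_bound_on_cbox:
  assumes c: "c \<in> A" and K: "cbox a b \<subseteq> dom c"
  shows "\<exists>G>0. \<forall>y\<in>cbox a b. \<forall>v. v \<bullet> (g c (chart_inv c y) *v v) \<le> G * (norm v)\<^sup>2"
proof -
  let ?s = "\<lambda>y. \<Sum>i\<in>UNIV. \<Sum>j\<in>UNIV. \<bar>g c (chart_inv c y) $ i $ j\<bar>"
  have "continuous_on (cbox a b) ?s"
    by (intro continuous_on_sum continuous_on_rabs continuous_on_subset[OF smooth_onD(3)[OF smooth_metric_entry[OF c]] K])
  from compact_imp_bounded[OF compact_continuous_image[OF this compact_cbox]]
  obtain B where B: "0 < B" "\<And>y. y \<in> cbox a b \<Longrightarrow> \<bar>?s y\<bar> \<le> B"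
    by (auto simp: bounded_pos)
  have "v \<bullet> (g c (chart_inv c y) *v v) \<le> B * (norm v)\<^sup>2" if y: "y \<in> cbox a b" for y v
  proof -
    have "v \<bullet> (g c (chart_inv c y) *v v) = (\<Sum>i\<in>UNIV. \<Sum>j\<in>UNIV. g c (chart_inv c y) $ i $ j * (v $ i * v $ j))"
      by (simp add: inner_vec_def matrix_vector_mult_def sum_distrib_left mult_ac)
    also have "\<dots> \<le> (\<Sum>i\<in>UNIV. \<Sum>j\<in>UNIV. \<bar>g c (chart_inv c y) $ i $ j\<bar> * (norm v * norm v))"
    proof (intro sum_mono)
      fix i j
      have "g c (chart_inv c y) $ i $ j * (v $ i * v $ j) \<le> \<bar>g c (chart_inv c y) $ i $ j\<bar> * (\<bar>v $ i\<bar> * \<bar>v $ j\<bar>)"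
        by (metis abs_ge_self abs_mult)
      also have "\<dots> \<le> \<bar>g c (chart_inv c y) $ i $ j\<bar> * (norm v * norm v)"
        by (intro mult_left_mono mult_mono component_le_norm_cart) auto
      finally show "g c (chart_inv c y) $ i $ j * (v $ i * v $ j) \<le> \<bar>g c (chart_inv c y) $ i $ j\<bar> * (norm v * norm v)" .
    qed
    also have "\<dots> = ?s y * (norm v)\<^sup>2" by (simp add: sum_distrib_right power2_eq_square)
    also have "\<dots> \<le> B * (norm v)\<^sup>2" using B(2)[OF y] by (intro mult_right_mono) auto
    finally show ?thesis .
  qed
  then show ?thesis using B(1) by blast
qed

text \<open>\<open>rellich_cbox\<close> read in a chart. The functionals are normalised so that
  their squares are the cell terms there. Stated through finitely many L^2-bounded functionals that
  respect differences, the inequality can be summed over cells and applied to differences of a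
  sequence.\<close>

lemma rellich_cell:
  assumes c: "c \<in> A" and K: "cbox a b \<subseteq> dom c" and e: "0 < e"
  shows "\<exists>L B. finite L \<and>
    (\<forall>l\<in>L. \<forall>u v. smooth_fun A u \<longrightarrow> smooth_fun A v \<longrightarrow> l (\<lambda>p. u p - v p) = l u - l v) \<and>
    (\<forall>l\<in>L. \<forall>u. smooth_fun A u \<longrightarrow> (l u)\<^sup>2 \<le> B * (LINT p|vol. (u p)\<^sup>2)) \<and>
    (\<forall>u. smooth_fun A u \<longrightarrow> integrable vol (\<lambda>p. indicator (chart_inv c ` cbox a b) p * (u p)\<^sup>2) \<and>
       (LINT p|vol. indicator (chart_inv c ` cbox a b) p * (u p)\<^sup>2) \<le> B * (\<Sum>l\<in>L. (l u)\<^sup>2) + e * (LINT p|vol. Gam u u p))"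
proof -
  let ?K = "cbox a b"
  obtain r R where r: "0 < r" "\<And>y. y \<in> ?K \<Longrightarrow> r \<le> rho_ext c y" "\<And>y. y \<in> ?K \<Longrightarrow> rho_ext c y \<le> R"
    using rho_bounds_on_cbox[OF c K] by metis
  \<comment> \<open>An empty box admits any \<open>R\<close>; the bound is made positive because it
    is divided by below.\<close>
  define R' where "R' = max R 1"
  have R': "1 \<le> R'" "\<And>y. y \<in> ?K \<Longrightarrow> rho_ext c y \<le> R'" using r(3) by (auto simp: R'_def le_max_iff_disj)
  obtain G where G: "0 < G" "\<And>y v. y \<in> ?K \<Longrightarrow> v \<bullet> (g c (chart_inv c y) *v v) \<le> G * (norm v)\<^sup>2"
    using metric_bound_on_cbox[OF c K] by blast
  \<comment> \<open>\<open>G\<close> compensates for the passage from the Euclidean to the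
    Riemannian gradient, \<open>r\<close> and \<open>R'\<close> for the density on the two sides of
    the inequality.\<close>
  define e' where "e' = e * r / (R' * G)"
  have e': "0 < e'" using e r(1) R'(1) G(1) by (simp add: e'_def)
  obtain D where D: "finite D" "\<forall>q\<in>D. q \<subseteq> ?K \<and> (\<exists>c d. q = cbox c d)" and
    P0: "\<forall>f f' N. (\<forall>x\<in>?K. (f has_derivative f' x) (at x) \<and> (\<forall>v. (f' x v)\<^sup>2 \<le> (norm v)\<^sup>2 * N x) \<and> 0 \<le> N x) \<longrightarrow>
      continuous_on ?K N \<longrightarrow>
      integral ?K (\<lambda>x. (f x)\<^sup>2) \<le> (\<Sum>q\<in>D. (integral q f)\<^sup>2 / measure lborel q) + e' * integral ?K N"
    using rellich_cbox[OF e', of a b] by (elim exE conjE)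
  note P = P0[THEN spec, THEN spec, THEN spec, THEN mp, THEN mp]
  define l where "l q u = integral q (\<lambda>y. u (chart_inv c y)) / sqrt (measure lborel q)" for q and u :: "'m \<Rightarrow> real"
  have l2: "(l q u)\<^sup>2 = (integral q (\<lambda>y. u (chart_inv c y)))\<^sup>2 / measure lborel q" for q u
    by (simp add: l_def power_divide)
  have contq: "continuous_on q (\<lambda>y. u (chart_inv c y))" if "smooth_fun A u" "q \<subseteq> ?K" for u q
    by (rule continuous_on_subset[OF smooth_onD(3)[OF smooth_funD[OF that(1) c]]]) (use that(2) K in blast)
  \<comment> \<open>\<open>1 / r\<close> bounds the functionals in L^2. The factor
    \<open>card D\<close> is there because the functionals form a set, which counts those of
    different cells only once if they coincide.\<close>
  define B where "B = max (R' * real (card D)) (1 / r)"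
  have B: "R' * real (card D) \<le> B" "1 / r \<le> B" by (auto simp: B_def)
  show ?thesis
  proof (intro exI conjI ballI allI impI)
    show "finite (l ` D)" using D(1) by simp
  next
    fix k u v assume k: "k \<in> l ` D" and u: "smooth_fun A u" and v: "smooth_fun A v"
    obtain q where q: "q \<in> D" "k = l q" using k by blast
    obtain x y where xy: "q = cbox x y" using bspec[OF D(2) q(1)] by blast
    have "(\<lambda>y. u (chart_inv c y)) integrable_on q" "(\<lambda>y. v (chart_inv c y)) integrable_on q"
      unfolding xy by (intro integrable_continuous contq u v; use bspec[OF D(2) q(1)] xy in blast)+
    then show "k (\<lambda>p. u p - v p) = k u - k v"
      unfolding q(2) l_def by (simp add: integral_diff diff_divide_distrib)
  next
    fix k u assume k: "k \<in> l ` D" and u: "smooth_fun A u"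
    obtain q where q: "q \<in> D" "k = l q" using k by blast
    obtain x y where xy: "q = cbox x y" using bspec[OF D(2) q(1)] by blast
    have qK: "q \<subseteq> ?K" using bspec[OF D(2) q(1)] by blast
    have cq: "continuous_on q (\<lambda>y. (u (chart_inv c y))\<^sup>2)" by (intro continuous_on_power contq u qK)
    have cK: "continuous_on ?K (\<lambda>y. (u (chart_inv c y))\<^sup>2)" by (intro continuous_on_power contq u order_refl)
    have iq: "integral q (\<lambda>y. (u (chart_inv c y))\<^sup>2) \<le> integral ?K (\<lambda>y. (u (chart_inv c y))\<^sup>2)"
      by (intro integral_subset_le qK integrable_continuous[OF cK])
        (use integrable_continuous[OF cq[unfolded xy]] xy in auto)
    have "(l q u)\<^sup>2 \<le> integral q (\<lambda>y. (u (chart_inv c y))\<^sup>2)"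
    proof (cases "measure lborel q = 0")
      case True
      then show ?thesis unfolding l2 by (simp add: integral_nonneg integrable_continuous[OF cq[unfolded xy], folded xy])
    next
      case False
      then have "0 < measure lborel q" using measure_nonneg[of lborel q] by linarith
      then show ?thesis
        unfolding l2 using square_integral_cbox_le[OF contq[OF u qK, unfolded xy], folded xy]
        by (simp add: pos_divide_le_eq mult.commute)
    qed
    also note iq
    also have "integral ?K (\<lambda>y. (u (chart_inv c y))\<^sup>2) \<le> (1 / r) * (LINT p|vol. (u p)\<^sup>2)"
      using cell_integral(2)[OF c K _ _ r(2) r(3), of "\<lambda>p. (u p)\<^sup>2"] smooth_fun_continuous[OF u] r(1)
      by (simp add: continuous_on_power field_simps)
    also have "\<dots> \<le> B * (LINT p|vol. (u p)\<^sup>2)" by (intro mult_right_mono B) simp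
    finally show "(k u)\<^sup>2 \<le> B * (LINT p|vol. (u p)\<^sup>2)" unfolding q(2) .
  next
    fix u assume u: "smooth_fun A u"
    have u2: "continuous_on UNIV (\<lambda>p. (u p)\<^sup>2)" by (intro continuous_on_power smooth_fun_continuous u)
    show "integrable vol (\<lambda>p. indicator (chart_inv c ` ?K) p * (u p)\<^sup>2)"
      by (rule cell_integral(3)[OF c K u2 _ r(2) R'(2)]) simp
    let ?N = "\<lambda>y. G * Gam u u (chart_inv c y)"
    have Gc: "continuous_on UNIV (Gam u u)" by (rule continuous_Gam[OF u u])
    have "integral ?K (\<lambda>y. (u (chart_inv c y))\<^sup>2) \<le> (\<Sum>q\<in>D. (integral q (\<lambda>y. u (chart_inv c y)))\<^sup>2 / measure lborel q) + e' * integral ?K ?N"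
    proof (rule P)
      show "continuous_on ?K ?N"
        by (intro continuous_on_mult_left cell_integral(1)[OF c K Gc _ r(2) r(3)] riem_inner_nonneg)
      show "\<forall>y\<in>?K. ((\<lambda>y. u (chart_inv c y)) has_derivative (\<lambda>v. v \<bullet> dpart c u (chart_inv c y))) (at y) \<and>
        (\<forall>v. (v \<bullet> dpart c u (chart_inv c y))\<^sup>2 \<le> (norm v)\<^sup>2 * ?N y) \<and> 0 \<le> ?N y"
      proof (intro ballI conjI allI)
        fix y assume y: "y \<in> ?K"
        then have yd: "y \<in> dom c" using K by blast
        note p = chart(7)[OF c yd] and sp = chart(6)[OF c yd]
        show "((\<lambda>y. u (chart_inv c y)) has_derivative (\<lambda>v. v \<bullet> dpart c u (chart_inv c y))) (at y)"
          using smooth_fun_deriv[OF u c p] unfolding sp .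
        show "0 \<le> ?N y" using G(1) riem_inner_nonneg by simp
        fix v
        let ?p = "chart_inv c y"
        have "(v \<bullet> dpart c u ?p)\<^sup>2 = (v \<bullet> (g c ?p *v gradient g u c ?p))\<^sup>2"
          by (simp only: metric_gradient[OF c p])
        also have "\<dots> \<le> (v \<bullet> (g c ?p *v v)) * (gradient g u c ?p \<bullet> (g c ?p *v gradient g u c ?p))"
          by (rule metric_Cauchy_Schwarz[OF c p])
        also have "gradient g u c ?p \<bullet> (g c ?p *v gradient g u c ?p) = Gam u u ?p"
          by (rule riem_inner_chart[OF vector_field_gradient[OF u] vector_field_gradient[OF u] c p, symmetric])
        also have "(v \<bullet> (g c ?p *v v)) * Gam u u ?p \<le> (G * (norm v)\<^sup>2) * Gam u u ?p"
          by (intro mult_right_mono G(2) y riem_inner_nonneg)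
        finally show "(v \<bullet> dpart c u ?p)\<^sup>2 \<le> (norm v)\<^sup>2 * ?N y" by (simp add: mult_ac)
      qed
    qed
    also have "(\<Sum>q\<in>D. (integral q (\<lambda>y. u (chart_inv c y)))\<^sup>2 / measure lborel q) = (\<Sum>q\<in>D. (l q u)\<^sup>2)"
      by (simp only: l2)
    also have "\<dots> \<le> real (card D) * (\<Sum>k\<in>l ` D. (k u)\<^sup>2)"
    proof -
      have "(l q u)\<^sup>2 \<le> (\<Sum>k\<in>l ` D. (k u)\<^sup>2)" if "q \<in> D" for q
        using member_le_sum[of "l q" "l ` D" "\<lambda>k. (k u)\<^sup>2"] that D(1) by simp
      from sum_bounded_above[of D, OF this] show ?thesis by simp
    qed
    finally have 1: "integral ?K (\<lambda>y. (u (chart_inv c y))\<^sup>2) \<le> real (card D) * (\<Sum>k\<in>l ` D. (k u)\<^sup>2) + e' * integral ?K ?N"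
      by simp
    have "e' * integral ?K ?N = (e / R') * (r * integral ?K (\<lambda>y. Gam u u (chart_inv c y)))"
      using G(1) R'(1) by (simp add: e'_def)
    also have "\<dots> \<le> (e / R') * (LINT p|vol. Gam u u p)"
      using e R'(1) by (intro mult_left_mono cell_integral(2)[OF c K Gc _ r(2) r(3)] riem_inner_nonneg) auto
    finally have 2: "e' * integral ?K ?N \<le> (e / R') * (LINT p|vol. Gam u u p)" .
    have "(LINT p|vol. indicator (chart_inv c ` ?K) p * (u p)\<^sup>2) \<le> R' * integral ?K (\<lambda>y. (u (chart_inv c y))\<^sup>2)"
      by (rule cell_integral(4)[OF c K u2 _ r(2) R'(2)]) simp
    also have "\<dots> \<le> R' * (real (card D) * (\<Sum>k\<in>l ` D. (k u)\<^sup>2) + (e / R') * (LINT p|vol. Gam u u p))"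
      using 1 2 R'(1) by (intro mult_left_mono) auto
    also have "\<dots> = (R' * real (card D)) * (\<Sum>k\<in>l ` D. (k u)\<^sup>2) + e * (LINT p|vol. Gam u u p)"
      using R'(1) by (simp add: distrib_left)
    also have "\<dots> \<le> B * (\<Sum>k\<in>l ` D. (k u)\<^sup>2) + e * (LINT p|vol. Gam u u p)"
      by (intro add_right_mono mult_right_mono B sum_nonneg) auto
    finally show "(LINT p|vol. indicator (chart_inv c ` ?K) p * (u p)\<^sup>2) \<le> B * (\<Sum>k\<in>l ` D. (k u)\<^sup>2) + e * (LINT p|vol. Gam u u p)" .
  qed
qed

text \<open>Compactness in quantitative form: up to a small multiple of the Dirichlet integral,
  finitely many bounded functionals control the L^2 norm. The cell inequalities are added up over a
  finite cover.\<close>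

lemma rellich:
  assumes e: "0 < e"
  shows "\<exists>L B. finite L \<and>
    (\<forall>l\<in>L. \<forall>u v. smooth_fun A u \<longrightarrow> smooth_fun A v \<longrightarrow> l (\<lambda>p. u p - v p) = l u - l v) \<and>
    (\<forall>l\<in>L. \<forall>u. smooth_fun A u \<longrightarrow> (l u)\<^sup>2 \<le> B * (LINT p|vol. (u p)\<^sup>2)) \<and>
    (\<forall>u. smooth_fun A u \<longrightarrow> (LINT p|vol. (u p)\<^sup>2) \<le> B * (\<Sum>l\<in>L. (l u)\<^sup>2) + e * (LINT p|vol. Gam u u p))"
proof -
  obtain E :: "(('m, 'n) chart \<times> (real ^ 'n) \<times> (real ^ 'n)) set" where E: "finite E"
    "\<forall>c a b. (c, a, b) \<in> E \<longrightarrow> c \<in> A \<and> cbox a b \<subseteq> dom c"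
    "(\<Union>(c, a, b)\<in>E. chart_inv c ` box a b) = UNIV"
    using ex_finite_cell_cover by blast
  define C :: "(('m, 'n) chart \<times> (real ^ 'n) \<times> (real ^ 'n)) \<Rightarrow> 'm set" where "C t = (case t of (c, a, b) \<Rightarrow> chart_inv c ` cbox a b)" for t
  have Ccov: "\<exists>t\<in>E. p \<in> C t" for p
  proof -
    have "p \<in> (\<Union>(c, a, b)\<in>E. chart_inv c ` box a b)" using E(3) by simp
    then obtain c a b y where t: "(c, a, b) \<in> E" "y \<in> box a b" "p = chart_inv c y" by auto
    then have "p \<in> C (c, a, b)" using box_subset_cbox[of a b] by (auto simp: C_def)
    then show ?thesis using t(1) by blast
  qed
  then have "E \<noteq> {}" by blast
  then have cE: "0 < real (card E)" using E(1) by (simp add: card_gt_0_iff)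
  \<comment> \<open>Each of the \<open>card E\<close> cells is charged with the Dirichlet integral
    over the whole manifold.\<close>
  define e' where "e' = e / real (card E)"
  have e': "0 < e'" using e cE by (simp add: e'_def)
  define Q where "Q t LB \<longleftrightarrow> finite (fst LB) \<and>
    (\<forall>l\<in>fst LB. \<forall>u v. smooth_fun A u \<longrightarrow> smooth_fun A v \<longrightarrow> l (\<lambda>p. u p - v p) = l u - l v) \<and>
    (\<forall>l\<in>fst LB. \<forall>u. smooth_fun A u \<longrightarrow> (l u)\<^sup>2 \<le> snd LB * (LINT p|vol. (u p)\<^sup>2)) \<and>
    (\<forall>u. smooth_fun A u \<longrightarrow> integrable vol (\<lambda>p. indicator (C t) p * (u p)\<^sup>2) \<and>
       (LINT p|vol. indicator (C t) p * (u p)\<^sup>2) \<le> snd LB * (\<Sum>l\<in>fst LB. (l u)\<^sup>2) + e' * (LINT p|vol. Gam u u p))"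
    for t and LB :: "(('m \<Rightarrow> real) \<Rightarrow> real) set \<times> real"
  have "\<exists>LB. Q t LB" if t: "t \<in> E" for t
  proof -
    obtain c a b where tt: "t = (c, a, b)" by (cases t)
    have "c \<in> A" "cbox a b \<subseteq> dom c" using E(2) t tt by blast+
    from rellich_cell[OF this e'] obtain L B where "Q t (L, B)"
      unfolding Q_def tt C_def by auto
    then show ?thesis by blast
  qed
  then obtain LB where LB: "\<And>t. t \<in> E \<Longrightarrow> Q t (LB t)" by metis
  define L where "L = (\<Union>t\<in>E. fst (LB t))"
  define B where "B = (\<Sum>t\<in>E. \<bar>snd (LB t)\<bar>)"
  have Bt: "snd (LB t) \<le> B" if "t \<in> E" for t
    using member_le_sum[of t E "\<lambda>t. \<bar>snd (LB t)\<bar>"] that E(1) by (simp add: B_def)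
  have B0: "0 \<le> B" by (simp add: B_def sum_nonneg)
  have finL: "finite L" unfolding L_def using E(1) LB by (auto simp: Q_def)
  show ?thesis
  proof (intro exI[of _ L] exI[of _ "B * real (card E) + B"] conjI ballI allI impI)
    show "finite L" by (rule finL)
    show "l (\<lambda>p. u p - v p) = l u - l v" if "l \<in> L" "smooth_fun A u" "smooth_fun A v" for l u v
      using that LB unfolding L_def Q_def by blast
  next
    fix l u assume l: "l \<in> L" and u: "smooth_fun A u"
    obtain t where t: "t \<in> E" "l \<in> fst (LB t)" using l by (auto simp: L_def)
    have "(l u)\<^sup>2 \<le> snd (LB t) * (LINT p|vol. (u p)\<^sup>2)" using LB[OF t(1)] t(2) u by (auto simp: Q_def)
    also have "\<dots> \<le> (B * real (card E) + B) * (LINT p|vol. (u p)\<^sup>2)"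
      using Bt[OF t(1)] B0 by (intro mult_right_mono) (simp_all add: add_increasing)
    finally show "(l u)\<^sup>2 \<le> (B * real (card E) + B) * (LINT p|vol. (u p)\<^sup>2)" .
  next
    fix u assume u: "smooth_fun A u"
    let ?S = "\<Sum>l\<in>L. (l u)\<^sup>2" and ?I = "LINT p|vol. Gam u u p"
    have S0: "0 \<le> ?S" by (simp add: sum_nonneg)
    have int: "integrable vol (\<lambda>p. indicator (C t) p * (u p)\<^sup>2)" if "t \<in> E" for t
      using LB[OF that] u unfolding Q_def by blast
    have "(LINT p|vol. (u p)\<^sup>2) \<le> (LINT p|vol. (\<Sum>t\<in>E. indicator (C t) p * (u p)\<^sup>2))"
    proof (rule integral_mono)
      show "integrable vol (\<lambda>p. (u p)\<^sup>2)"
        by (intro integrable_continuous_vol continuous_on_power smooth_fun_continuous u)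
      show "integrable vol (\<lambda>p. \<Sum>t\<in>E. indicator (C t) p * (u p)\<^sup>2)"
        by (rule Bochner_Integration.integrable_sum) (rule int)
      fix p
      obtain t where t: "t \<in> E" "p \<in> C t" using Ccov by blast
      then show "(u p)\<^sup>2 \<le> (\<Sum>t\<in>E. indicator (C t) p * (u p)\<^sup>2)"
        using member_le_sum[of t E "\<lambda>t. indicator (C t) p * (u p)\<^sup>2"] E(1) by simp
    qed
    also have "\<dots> = (\<Sum>t\<in>E. (LINT p|vol. indicator (C t) p * (u p)\<^sup>2))"
      by (rule Bochner_Integration.integral_sum) (rule int)
    also have "\<dots> \<le> (\<Sum>t\<in>E. B * ?S + e' * ?I)"
    proof (rule sum_mono)
      fix t assume t: "t \<in> E"
      have "(LINT p|vol. indicator (C t) p * (u p)\<^sup>2) \<le> snd (LB t) * (\<Sum>l\<in>fst (LB t). (l u)\<^sup>2) + e' * ?I"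
        using LB[OF t] u unfolding Q_def by blast
      also have "snd (LB t) * (\<Sum>l\<in>fst (LB t). (l u)\<^sup>2) \<le> B * (\<Sum>l\<in>fst (LB t). (l u)\<^sup>2)"
        by (intro mult_right_mono Bt t sum_nonneg) simp
      also have "\<dots> \<le> B * ?S"
        by (intro mult_left_mono B0 sum_mono2 finL) (use t in \<open>auto simp: L_def\<close>)
      finally show "(LINT p|vol. indicator (C t) p * (u p)\<^sup>2) \<le> B * ?S + e' * ?I" by simp
    qed
    also have "\<dots> = (B * real (card E)) * ?S + e * ?I" using cE by (simp add: e'_def field_simps)
    also have "\<dots> \<le> (B * real (card E) + B) * ?S + e * ?I"
      using mult_nonneg_nonneg[OF B0 S0] by (simp add: algebra_simps)
    finally show "(LINT p|vol. (u p)\<^sup>2) \<le> (B * real (card E) + B) * ?S + e * ?I" .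
  qed
qed


lemma Gam_rules:
  assumes u: "smooth_fun A u" and v: "smooth_fun A v" and w: "smooth_fun A w"
  shows "Gam w (\<lambda>p. u p + v p) p = Gam w u p + Gam w v p" "Gam (\<lambda>p. u p + v p) w p = Gam u w p + Gam v w p"
    "Gam w (\<lambda>p. u p * v p) p = u p * Gam w v p + v p * Gam w u p" "Gam (\<lambda>p. u p * v p) w p = u p * Gam v w p + v p * Gam u w p"
    "Gam w (\<lambda>p. k * u p) p = k * Gam w u p" "Gam (\<lambda>p. k * u p) w p = k * Gam u w p"
proof -
  note Y = vector_field_gradient[OF w] and sym = riem_inner_sym[of _ "gradient g w"]
  show "Gam w (\<lambda>p. u p + v p) p = Gam w u p + Gam w v p" by (rule dir_rules(1)[OF Y u v])
  then show "Gam (\<lambda>p. u p + v p) w p = Gam u w p + Gam v w p" by (simp only: sym)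
  show "Gam w (\<lambda>p. u p * v p) p = u p * Gam w v p + v p * Gam w u p" by (rule dir_rules(2)[OF Y u v])
  then show "Gam (\<lambda>p. u p * v p) w p = u p * Gam v w p + v p * Gam u w p" by (simp only: sym)
  show "Gam w (\<lambda>p. k * u p) p = k * Gam w u p" by (rule dir_rules(3)[OF Y u v])
  then show "Gam (\<lambda>p. k * u p) w p = k * Gam u w p" by (simp only: sym)
qed

lemma Gam_diff_le:
  assumes u: "smooth_fun A u" and v: "smooth_fun A v"
  shows "Gam (\<lambda>p. u p - v p) (\<lambda>p. u p - v p) p \<le> 2 * Gam u u p + 2 * Gam v v p"
proof -
  have e: "Gam (\<lambda>p. u p + k * v p) (\<lambda>p. u p + k * v p) p = Gam u u p + 2 * k * Gam u v p + k\<^sup>2 * Gam v v p" for k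
  proof -
    have kv: "smooth_fun A (\<lambda>p. k * v p)" by (rule smooth_fun_cmult[OF v])
    have s: "smooth_fun A (\<lambda>p. u p + k * v p)" by (rule smooth_fun_add[OF u kv])
    show ?thesis
      unfolding Gam_rules(1)[OF u kv s] Gam_rules(5)[OF v v s] Gam_rules(2)[OF u kv u] Gam_rules(2)[OF u kv v]
        Gam_rules(6)[OF v v u] Gam_rules(6)[OF v v v]
      using riem_inner_sym[of "gradient g v" "gradient g u" p] by (simp add: power2_eq_square algebra_simps)
  qed
  have "0 \<le> Gam (\<lambda>p. u p + 1 * v p) (\<lambda>p. u p + 1 * v p) p" by (rule riem_inner_nonneg)
  then show ?thesis using e[of 1] e[of "-1"] by simp
qed

text \<open>Each precision 1 / (j + 1) in \<open>rellich\<close> comes with finitely many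
  functionals, so there are countably many altogether, and a diagonal subsequence makes all of them
  converge. On differences the sum in \<open>rellich\<close> is then small, and so is the remaining
  term, because Dirichlet integrals of differences are at most \<open>4 * M\<close>.\<close>

lemma rellich_subsequence:
  fixes u :: "nat \<Rightarrow> 'm \<Rightarrow> real"
  assumes sm: "\<And>k. smooth_fun A (u k)" and m: "\<And>k. (LINT p|vol. (u k p)\<^sup>2) \<le> M"
    and G: "\<And>k. (LINT p|vol. Gam (u k) (u k) p) \<le> M"
  shows "\<exists>r :: nat \<Rightarrow> nat. strict_mono r \<and> (\<forall>e>0. \<exists>N. \<forall>k\<ge>N. \<forall>l\<ge>N. (LINT p|vol. (u (r k) p - u (r l) p)\<^sup>2) < e)"
proof -
  define P where "P e LB \<longleftrightarrow> finite (fst LB) \<and>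
    (\<forall>l\<in>fst LB. \<forall>u v. smooth_fun A u \<longrightarrow> smooth_fun A v \<longrightarrow> l (\<lambda>p. u p - v p) = l u - l v) \<and>
    (\<forall>l\<in>fst LB. \<forall>u. smooth_fun A u \<longrightarrow> (l u)\<^sup>2 \<le> snd LB * (LINT p|vol. (u p)\<^sup>2)) \<and>
    (\<forall>u. smooth_fun A u \<longrightarrow> (LINT p|vol. (u p)\<^sup>2) \<le> snd LB * (\<Sum>l\<in>fst LB. (l u)\<^sup>2) + e * (LINT p|vol. Gam u u p))"
    for e and LB :: "(('m \<Rightarrow> real) \<Rightarrow> real) set \<times> real"
  have "\<exists>LB. P (inverse (real (Suc j))) LB" for j
  proof -
    have "0 < inverse (real (Suc j))" by simp
    from rellich[OF this] obtain L B where "P (inverse (real (Suc j))) (L, B)" unfolding P_def by auto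
    then show ?thesis by blast
  qed
  then obtain LB where LB: "\<And>j. P (inverse (real (Suc j))) (LB j)" by metis
  \<comment> \<open>The zero functional keeps \<open>S\<close> nonempty, as the enumeration
    \<open>from_nat_into\<close> requires.\<close>
  define S where "S = insert (\<lambda>_. 0) (\<Union>j. fst (LB j))"
  have S: "countable S" "S \<noteq> {}"
  proof -
    have "countable (fst (LB j))" for j using LB[of j] by (simp add: P_def countable_finite)
    then show "countable S" by (simp add: S_def)
  qed (simp add: S_def)
  define x where "x i k = from_nat_into S i (u k)" for i k
  have M0: "0 \<le> M" using m[of 0] by (rule order.trans[rotated]) simp
  have "bounded (range (x i))" for i
  proof -
    have "from_nat_into S i \<in> S" by (rule from_nat_into[OF S(2)])
    then consider "from_nat_into S i = (\<lambda>_. 0)" | j where "from_nat_into S i \<in> fst (LB j)" unfolding S_def by blast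
    then show ?thesis
    proof cases
      case 1 then show ?thesis by (simp add: x_def)
    next
      case 2
      have "(x i k)\<^sup>2 \<le> \<bar>snd (LB j)\<bar> * M" for k
      proof -
        have "(x i k)\<^sup>2 \<le> snd (LB j) * (LINT p|vol. (u k p)\<^sup>2)"
          using LB[of j] 2 sm unfolding P_def x_def by blast
        also have "\<dots> \<le> \<bar>snd (LB j)\<bar> * (LINT p|vol. (u k p)\<^sup>2)" by (intro mult_right_mono) auto
        also have "\<dots> \<le> \<bar>snd (LB j)\<bar> * M" by (intro mult_left_mono m) simp
        finally show ?thesis .
      qed
      then have "\<bar>x i k\<bar> \<le> sqrt (\<bar>snd (LB j)\<bar> * M)" for k
        using real_le_rsqrt[of "\<bar>x i k\<bar>"] by simp
      then show ?thesis by (intro boundedI[where B="sqrt (\<bar>snd (LB j)\<bar> * M)"]) auto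
    qed
  qed
  then obtain r where r: "strict_mono r" "\<And>i. convergent (\<lambda>k. x i (r k))"
    using bounded_diagonal_subsequence by blast
  have conv: "convergent (\<lambda>k. l (u (r k)))" if lS: "l \<in> S" for l
  proof -
    obtain i where "from_nat_into S i = l" using from_nat_into_surj[OF S(1) lS] by blast
    then show ?thesis using r(2)[of i] by (simp add: x_def)
  qed
  have cau: "\<exists>N. \<forall>k\<ge>N. \<forall>l\<ge>N. (LINT p|vol. (u (r k) p - u (r l) p)\<^sup>2) < e" if e: "0 < e" for e
  proof -
    \<comment> \<open>The Dirichlet term will stay below e / 2; the summand 1 keeps the denominator
      positive.\<close>
    obtain j where j: "inverse (real (Suc j)) < e / (2 * (4 * M + 1))"
      using reals_Archimedean[of "e / (2 * (4 * M + 1))"] e M0 by auto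
    let ?L = "fst (LB j)" and ?B = "\<bar>snd (LB j)\<bar>"
    \<comment> \<open>Likewise the functionals contribute less than e / 2 once each of their squares
      is at most \<open>d\<close>.\<close>
    define d where "d = e / (2 * (?B * real (card ?L) + 1))"
    have d: "0 < d" using e by (simp add: d_def add_nonneg_pos)
    have finL: "finite ?L" using LB[of j] by (simp add: P_def)
    have "\<forall>\<^sub>F N in sequentially. \<forall>k\<ge>N. \<forall>i\<ge>N. (l (u (r k)) - l (u (r i)))\<^sup>2 \<le> d" if "l \<in> ?L" for l
    proof -
      have "l \<in> S" using that by (auto simp: S_def)
      then have "Cauchy (\<lambda>k. l (u (r k)))" using conv convergent_Cauchy by blast
      moreover have "0 < sqrt d" using d by simp
      ultimately obtain N where N: "\<And>k i. k \<ge> N \<Longrightarrow> i \<ge> N \<Longrightarrow> norm (l (u (r k)) - l (u (r i))) < sqrt d"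
        using CauchyD by blast
      have "(l (u (r k)) - l (u (r i)))\<^sup>2 \<le> d" if "k \<ge> N" "i \<ge> N" for k i
      proof -
        have "\<bar>l (u (r k)) - l (u (r i))\<bar>\<^sup>2 \<le> (sqrt d)\<^sup>2"
          using N[OF that] by (intro power_mono) auto
        then show ?thesis using d by simp
      qed
      then show ?thesis unfolding eventually_sequentially by (intro exI[of _ N]) auto
    qed
    then have "\<forall>\<^sub>F N in sequentially. \<forall>l\<in>?L. \<forall>k\<ge>N. \<forall>i\<ge>N. (l (u (r k)) - l (u (r i)))\<^sup>2 \<le> d"
      by (intro eventually_ball_finite finL) blast
    then obtain N where N: "\<And>l k i. l \<in> ?L \<Longrightarrow> k \<ge> N \<Longrightarrow> i \<ge> N \<Longrightarrow> (l (u (r k)) - l (u (r i)))\<^sup>2 \<le> d"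
      unfolding eventually_sequentially by blast
    have "(LINT p|vol. (u (r k) p - u (r i) p)\<^sup>2) < e" if ki: "k \<ge> N" "i \<ge> N" for k i
    proof -
      let ?v = "\<lambda>p. u (r k) p - u (r i) p"
      have v: "smooth_fun A ?v" by (rule smooth_fun_diff[OF sm sm])
      have "(LINT p|vol. Gam ?v ?v p) \<le> (LINT p|vol. 2 * Gam (u (r k)) (u (r k)) p + 2 * Gam (u (r i)) (u (r i)) p)"
        by (intro integral_mono integrable_continuous_vol continuous_on_add continuous_on_mult_left continuous_Gam sm v Gam_diff_le)
      also have "\<dots> = 2 * (LINT p|vol. Gam (u (r k)) (u (r k)) p) + 2 * (LINT p|vol. Gam (u (r i)) (u (r i)) p)"
        using integrable_continuous_vol[OF continuous_Gam[OF sm sm]] by simp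
      also have "\<dots> \<le> 4 * M" using G[of "r k"] G[of "r i"] by linarith
      finally have GM: "(LINT p|vol. Gam ?v ?v p) \<le> 4 * M" .
      have lv: "(l ?v)\<^sup>2 \<le> d" if l: "l \<in> ?L" for l
      proof -
        have "l ?v = l (u (r k)) - l (u (r i))" using LB[of j] l sm unfolding P_def by blast
        then show ?thesis using N[OF l ki] by simp
      qed
      have "(LINT p|vol. (?v p)\<^sup>2) \<le> snd (LB j) * (\<Sum>l\<in>?L. (l ?v)\<^sup>2) + inverse (real (Suc j)) * (LINT p|vol. Gam ?v ?v p)"
        using LB[of j] v unfolding P_def by blast
      also have "snd (LB j) * (\<Sum>l\<in>?L. (l ?v)\<^sup>2) \<le> ?B * (\<Sum>l\<in>?L. (l ?v)\<^sup>2)"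
        by (intro mult_right_mono sum_nonneg) auto
      also have "\<dots> \<le> ?B * (real (card ?L) * d)"
        using sum_bounded_above[of ?L "\<lambda>l. (l ?v)\<^sup>2" d] lv by (intro mult_left_mono) auto
      also have "\<dots> = (?B * real (card ?L)) * d" by simp
      also have "\<dots> < e / 2"
      proof -
        have "(?B * real (card ?L) + 1) * d = e / 2"
        proof -
          have "?B * real (card ?L) + 1 \<noteq> 0" using mult_nonneg_nonneg[of ?B "real (card ?L)"] by linarith
          then show ?thesis unfolding d_def by (simp add: field_simps)
        qed
        then show ?thesis using d by (simp add: distrib_right)
      qed
      also have "inverse (real (Suc j)) * (LINT p|vol. Gam ?v ?v p) \<le> inverse (real (Suc j)) * (4 * M + 1)"
        using GM by (intro mult_left_mono) auto
      also have "\<dots> < e / (2 * (4 * M + 1)) * (4 * M + 1)"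
        using j M0 by (intro mult_strict_right_mono) auto
      also have "\<dots> = e / 2" using M0 by (simp add: field_simps)
      finally show ?thesis by simp
    qed
    then show ?thesis by blast
  qed
  show ?thesis
  proof (intro exI[of _ r] conjI r(1) allI impI)
    fix e :: real assume "0 < e"
    then show "\<exists>N. \<forall>k\<ge>N. \<forall>l\<ge>N. (LINT p|vol. (u (r k) p - u (r l) p)\<^sup>2) < e" by (rule cau)
  qed
qed

subsection \<open>Energy forms\<close>

text \<open>The bilinear form of the operator -\<Delta> + W. With \<open>W p - \<mu>\<close> in
  place of \<open>W\<close> it is the form of the operator shifted by the ground state
  level.\<close>

definition form :: "('m \<Rightarrow> real) \<Rightarrow> ('m \<Rightarrow> real) \<Rightarrow> ('m \<Rightarrow> real) \<Rightarrow> real" where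
  "form W u v = (LINT p|vol. Gam u v p + W p * (u p * v p))"

lemma form_cont:
  assumes "continuous_on UNIV W" "smooth_fun A u" "smooth_fun A v"
  shows "continuous_on UNIV (\<lambda>p. Gam u v p + W p * (u p * v p))"
  by (intro continuous_on_add continuous_on_mult continuous_Gam smooth_fun_continuous assms)

lemma form_combination:
  assumes W: "continuous_on UNIV W" and u: "smooth_fun A u" and v: "smooth_fun A v"
  shows "form W (\<lambda>p. u p + t * v p) (\<lambda>p. u p + t * v p) = form W u u + 2 * t * form W u v + t\<^sup>2 * form W v v"
proof -
  have tv: "smooth_fun A (\<lambda>p. t * v p)" by (rule smooth_fun_cmult[OF v])
  have s: "smooth_fun A (\<lambda>p. u p + t * v p)" by (rule smooth_fun_add[OF u tv])
  have "Gam (\<lambda>p. u p + t * v p) (\<lambda>p. u p + t * v p) p = Gam u u p + 2 * t * Gam u v p + t\<^sup>2 * Gam v v p" for p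
    unfolding Gam_rules(1)[OF u tv s] Gam_rules(5)[OF v v s] Gam_rules(2)[OF u tv u] Gam_rules(2)[OF u tv v]
      Gam_rules(6)[OF v v u] Gam_rules(6)[OF v v v]
    using riem_inner_sym[of "gradient g v" "gradient g u" p] by (simp add: power2_eq_square algebra_simps)
  then have "form W (\<lambda>p. u p + t * v p) (\<lambda>p. u p + t * v p) =
    (LINT p|vol. (Gam u u p + W p * (u p * u p)) + (2 * t) * (Gam u v p + W p * (u p * v p)) + t\<^sup>2 * (Gam v v p + W p * (v p * v p)))"
    unfolding form_def by (intro Bochner_Integration.integral_cong refl) (simp add: power2_eq_square algebra_simps)
  also have "\<dots> = form W u u + (2 * t) * form W u v + t\<^sup>2 * form W v v"
  proof -
    note i = integrable_continuous_vol[OF form_cont[OF W u u]] integrable_continuous_vol[OF form_cont[OF W u v]]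
      integrable_continuous_vol[OF form_cont[OF W v v]]
    note j = Bochner_Integration.integrable_mult_right[OF i(2), of "2 * t"]
      Bochner_Integration.integrable_mult_right[OF i(3), of "t\<^sup>2"]
    show ?thesis
      unfolding form_def Bochner_Integration.integral_add[OF Bochner_Integration.integrable_add[OF i(1) j(1)] j(2)]
        Bochner_Integration.integral_add[OF i(1) j(1)] Bochner_Integration.integral_mult_right_zero ..
  qed
  finally show ?thesis .
qed

lemma form_Cauchy_Schwarz:
  assumes W: "continuous_on UNIV W" and nn: "\<And>u. smooth_fun A u \<Longrightarrow> 0 \<le> form W u u"
    and u: "smooth_fun A u" and v: "smooth_fun A v"
  shows "(form W u v)\<^sup>2 \<le> form W u u * form W v v"
proof (rule quadratic_nonneg_imp_discriminant_le)
  show "0 \<le> form W v v" by (rule nn[OF v])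
  show "0 \<le> form W u u + 2 * t * form W u v + t\<^sup>2 * form W v v" for t
    unfolding form_combination[OF W u v, symmetric]
    by (intro nn smooth_fun_add smooth_fun_cmult u v)
qed

lemma form_shift:
  assumes W: "continuous_on UNIV W" and u: "smooth_fun A u" and v: "smooth_fun A v"
  shows "form (\<lambda>p. W p - m) u v = form W u v - m * (LINT p|vol. u p * v p)"
proof -
  have "form (\<lambda>p. W p - m) u v = (LINT p|vol. (Gam u v p + W p * (u p * v p)) - m * (u p * v p))"
    unfolding form_def by (intro Bochner_Integration.integral_cong refl) (simp add: algebra_simps)
  moreover have "integrable vol (\<lambda>p. m * (u p * v p))"
    by (intro integrable_continuous_vol continuous_on_mult continuous_on_const smooth_fun_continuous u v)
  ultimately show ?thesis
    using integrable_continuous_vol[OF form_cont[OF W u v]] by (simp add: form_def)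
qed

lemma form_scale:
  assumes u: "smooth_fun A u"
  shows "form W (\<lambda>p. k * u p) (\<lambda>p. k * u p) = k\<^sup>2 * form W u u"
proof -
  have ku: "smooth_fun A (\<lambda>p. k * u p)" by (rule smooth_fun_cmult[OF u])
  have "form W (\<lambda>p. k * u p) (\<lambda>p. k * u p) = (LINT p|vol. k\<^sup>2 * (Gam u u p + W p * (u p * u p)))"
    unfolding form_def Gam_rules(5)[OF u u ku] Gam_rules(6)[OF u u u]
    by (intro Bochner_Integration.integral_cong refl) (simp add: power2_eq_square algebra_simps)
  then show ?thesis by (simp add: form_def)
qed

lemma Gam_integral_le_form:
  assumes W: "continuous_on UNIV W" "\<And>p. 0 \<le> W p" and u: "smooth_fun A u"
  shows "(LINT p|vol. Gam u u p) \<le> form W u u"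
  unfolding form_def
  by (intro integral_mono integrable_continuous_vol form_cont[OF W(1) u u] continuous_Gam[OF u u])
    (simp add: W(2))

subsection \<open>Existence of a ground state\<close>

theorem ground_state:
  assumes W: "continuous_on UNIV W" and \<kappa>: "0 < \<kappa>" "\<And>p. \<kappa> \<le> W p"
  shows "\<exists>\<mu> u \<phi> X M. \<kappa> \<le> \<mu> \<and> (\<forall>k::nat. smooth_fun A (u k)) \<and> L2 A g \<phi> \<and> is_weak_gradient A g \<phi> X \<and>
    (\<lambda>k. LINT p|vol. (u k p - \<phi> p)\<^sup>2) \<longlonglongrightarrow> 0 \<and> (\<forall>k. (LINT p|vol. (u k p)\<^sup>2) = 1) \<and>
    (\<forall>k. (LINT p|vol. Gam (u k) (u k) p) \<le> M) \<and>
    (\<forall>\<psi>. smooth_fun A \<psi> \<longrightarrow> 0 \<le> form (\<lambda>p. W p - \<mu>) \<psi> \<psi>) \<and>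
    (\<lambda>k. form (\<lambda>p. W p - \<mu>) (u k) (u k)) \<longlonglongrightarrow> 0"
proof -
  define S where "S = {form W u u | u. smooth_fun A u \<and> (LINT p|vol. (u p)\<^sup>2) = 1}"
  define \<mu> where "\<mu> = Inf S"
  have W0: "0 \<le> W p" for p using \<kappa>(1) \<kappa>(2)[of p] by linarith
  have u2c: "integrable vol (\<lambda>p. (u p)\<^sup>2)" if "smooth_fun A u" for u
    by (intro integrable_continuous_vol continuous_on_power smooth_fun_continuous that)
  have low: "\<kappa> \<le> x" if "x \<in> S" for x
  proof -
    obtain u where u: "smooth_fun A u" "(LINT p|vol. (u p)\<^sup>2) = 1" "x = form W u u" using \<open>x \<in> S\<close> by (auto simp: S_def)
    have "(LINT p|vol. \<kappa> * (u p)\<^sup>2) \<le> form W u u"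
      unfolding form_def
    proof (intro integral_mono integrable_continuous_vol[OF form_cont[OF W u(1) u(1)]])
      show "integrable vol (\<lambda>p. \<kappa> * (u p)\<^sup>2)" using u2c[OF u(1)] by simp
      fix p
      have "\<kappa> * (u p)\<^sup>2 \<le> W p * (u p)\<^sup>2" by (intro mult_right_mono \<kappa>) simp
      then show "\<kappa> * (u p)\<^sup>2 \<le> Gam u u p + W p * (u p * u p)"
        using riem_inner_nonneg[of "gradient g u" p] by (simp add: power2_eq_square)
    qed
    then show ?thesis using u(2,3) by simp
  qed
  have normalize: "form W u u / (LINT p|vol. (u p)\<^sup>2) \<in> S"
    if u: "smooth_fun A u" and m: "(LINT p|vol. (u p)\<^sup>2) > 0" for u
  proof -
    let ?m = "LINT p|vol. (u p)\<^sup>2" and ?k = "1 / sqrt (LINT p|vol. (u p)\<^sup>2)"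
    have k2: "?k\<^sup>2 = 1 / ?m" using m by (simp add: power_divide)
    have "(LINT p|vol. (?k * u p)\<^sup>2) = ?k\<^sup>2 * ?m"
      unfolding power_mult_distrib by (rule Bochner_Integration.integral_mult_right_zero)
    also have "\<dots> = 1" unfolding k2 using m by simp
    finally have n1: "(LINT p|vol. (?k * u p)\<^sup>2) = 1" .
    have "form W (\<lambda>p. ?k * u p) (\<lambda>p. ?k * u p) = form W u u / ?m"
      unfolding form_scale[OF u] k2 by simp
    then show ?thesis
      unfolding S_def mem_Collect_eq
      by (intro exI[of _ "\<lambda>p. ?k * u p"] conjI smooth_fun_cmult[OF u] n1) (rule sym)
  qed
  have "0 < (LINT p|vol. (1::real)\<^sup>2)"
    by (rule integral_vol_pos) auto
  from normalize[OF smooth_fun_const this] have ne: "S \<noteq> {}" by blast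
  have bdd: "bdd_below S" using low by (rule bdd_belowI)
  have \<mu>\<kappa>: "\<kappa> \<le> \<mu>" unfolding \<mu>_def by (rule cInf_greatest[OF ne low])
  have nn: "0 \<le> form (\<lambda>p. W p - \<mu>) \<psi> \<psi>" if \<psi>: "smooth_fun A \<psi>" for \<psi>
  proof -
    have e: "form (\<lambda>p. W p - \<mu>) \<psi> \<psi> = form W \<psi> \<psi> - \<mu> * (LINT p|vol. (\<psi> p)\<^sup>2)"
      using form_shift[OF W \<psi> \<psi>] by (simp add: power2_eq_square)
    \<comment> \<open>The Rayleigh quotient exists only for functions of positive norm; for the
      others the form is at least the Dirichlet integral.\<close>
    show ?thesis
    proof (cases "(LINT p|vol. (\<psi> p)\<^sup>2) = 0")
      case True
      have "0 \<le> (LINT p|vol. Gam \<psi> \<psi> p)" by (simp add: riem_inner_nonneg)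
      also have "\<dots> \<le> form W \<psi> \<psi>" by (rule Gam_integral_le_form[OF W W0 \<psi>])
      finally show ?thesis unfolding e True by simp
    next
      case False
      then have pos: "(LINT p|vol. (\<psi> p)\<^sup>2) > 0"
      proof -
        have "0 \<le> (LINT p|vol. (\<psi> p)\<^sup>2)" by simp
        then show ?thesis using False by linarith
      qed
      have "\<mu> \<le> form W \<psi> \<psi> / (LINT p|vol. (\<psi> p)\<^sup>2)"
        unfolding \<mu>_def by (rule cInf_lower[OF normalize[OF \<psi> pos] bdd])
      then show ?thesis unfolding e using pos by (simp add: pos_le_divide_eq)
    qed
  qed
  have "\<exists>u. smooth_fun A u \<and> (LINT p|vol. (u p)\<^sup>2) = 1 \<and> form W u u < \<mu> + inverse (real (Suc k))" for k :: nat
  proof -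
    have "\<exists>x\<in>S. x < \<mu> + inverse (real (Suc k))"
      using cInf_lessD[OF ne, of "\<mu> + inverse (real (Suc k))"] unfolding \<mu>_def by force
    then show ?thesis by (auto simp: S_def)
  qed
  then obtain v :: "nat \<Rightarrow> 'm \<Rightarrow> real" where v: "\<And>k. smooth_fun A (v k)" "\<And>k. (LINT p|vol. (v k p)\<^sup>2) = 1"
    "\<And>k. form W (v k) (v k) < \<mu> + inverse (real (Suc k))" by metis
  have vG: "(LINT p|vol. Gam (v k) (v k) p) \<le> \<mu> + 1" for k
  proof -
    have "(LINT p|vol. Gam (v k) (v k) p) \<le> form W (v k) (v k)" by (rule Gam_integral_le_form[OF W W0 v(1)])
    also have "\<dots> \<le> \<mu> + inverse (real (Suc k))" using v(3)[of k] by simp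
    also have "\<dots> \<le> \<mu> + 1" by (simp add: inverse_le_1_iff)
    finally show ?thesis .
  qed
  obtain r :: "nat \<Rightarrow> nat" where r: "strict_mono r" "\<forall>e>0. \<exists>N. \<forall>k\<ge>N. \<forall>l\<ge>N. (LINT p|vol. (v (r k) p - v (r l) p)\<^sup>2) < e"
    using rellich_subsequence[of v "\<mu> + 1"] v(1,2) vG \<mu>\<kappa> \<kappa>(1) by auto
  define u where "u k = v (r k)" for k :: nat
  have sm: "smooth_fun A (u k)" and u1: "(LINT p|vol. (u k p)\<^sup>2) = 1" and uG: "(LINT p|vol. Gam (u k) (u k) p) \<le> \<mu> + 1" for k
    using v vG by (auto simp: u_def)
  let ?a = "form (\<lambda>p. W p - \<mu>)"
  have cW: "continuous_on UNIV (\<lambda>p. W p - \<mu>)" by (intro continuous_on_diff W continuous_on_const)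
  have ab: "?a (u k) (u k) \<le> inverse (real (Suc k))" for k
  proof -
    have "?a (u k) (u k) = form W (u k) (u k) - \<mu>"
      using form_shift[OF W sm sm, of \<mu> k k] u1[of k] by (simp add: power2_eq_square)
    also have "\<dots> \<le> inverse (real (Suc (r k)))" using v(3)[of "r k"] by (simp add: u_def)
    also have "\<dots> \<le> inverse (real (Suc k))"
      using seq_suble[OF r(1), of k] by (intro le_imp_inverse_le) auto
    finally show ?thesis .
  qed
  have a0: "(\<lambda>k. ?a (u k) (u k)) \<longlonglongrightarrow> 0"
    by (rule tendsto_sandwich[OF _ _ tendsto_const LIMSEQ_inverse_real_of_nat])
      (use nn sm ab in auto)
  have Cau: "\<exists>N. \<forall>k\<ge>N. \<forall>l\<ge>N. (LINT p|vol. dist_dens (u k) (u l) p) < e" if e: "0 < e" for e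
  proof -
    let ?c = "1 + \<mu>"
    have c: "?c > 0" using \<mu>\<kappa> \<kappa>(1) by simp
    \<comment> \<open>Anticipates the estimate below of the squared H^1 distance by 1 + \<mu> times
      the squared L^2 distance plus the shifted form of the difference; each summand is to stay
      under e / 2.\<close>
    obtain N1 where N1: "\<And>k l. k \<ge> N1 \<Longrightarrow> l \<ge> N1 \<Longrightarrow> (LINT p|vol. (u k p - u l p)\<^sup>2) < e / (2 * ?c)"
      
    proof -
      have "0 < e / (2 * ?c)" using e c by simp
      from r(2)[rule_format, OF this] show ?thesis using that unfolding u_def by blast
    qed
    obtain N2 where N2: "\<And>k. k \<ge> N2 \<Longrightarrow> ?a (u k) (u k) < e / 8"
    proof -
      have "\<forall>\<^sub>F k in sequentially. ?a (u k) (u k) < e / 8" using order_tendstoD(2)[OF a0, of "e/8"] e by simp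
      then show ?thesis using that by (auto simp: eventually_sequentially)
    qed
    have "(LINT p|vol. dist_dens (u k) (u l) p) < e" if kl: "k \<ge> max N1 N2" "l \<ge> max N1 N2" for k l
    proof -
      let ?d = "\<lambda>p. u k p - u l p"
      have d: "smooth_fun A ?d" by (rule smooth_fun_diff[OF sm sm])
      have "?a (\<lambda>p. u k p + (-1) * u l p) (\<lambda>p. u k p + (-1) * u l p) + ?a (\<lambda>p. u k p + 1 * u l p) (\<lambda>p. u k p + 1 * u l p)
        = 2 * ?a (u k) (u k) + 2 * ?a (u l) (u l)"
        unfolding form_combination[OF cW sm sm] by simp
      moreover have "0 \<le> ?a (\<lambda>p. u k p + 1 * u l p) (\<lambda>p. u k p + 1 * u l p)"
        by (intro nn smooth_fun_add smooth_fun_cmult sm)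
      ultimately have "?a ?d ?d \<le> 2 * ?a (u k) (u k) + 2 * ?a (u l) (u l)" by simp
      also have "\<dots> < e / 2" using N2[of k] N2[of l] kl by simp
      finally have ad: "?a ?d ?d < e / 2" .
      have "(LINT p|vol. dist_dens (u k) (u l) p) = (LINT p|vol. (?d p)\<^sup>2) + (LINT p|vol. Gam ?d ?d p)"
        unfolding dist_dens_def
        by (rule Bochner_Integration.integral_add[OF u2c[OF d] integrable_continuous_vol[OF continuous_Gam[OF d d]]])
      also have "(LINT p|vol. Gam ?d ?d p) \<le> form W ?d ?d" by (rule Gam_integral_le_form[OF W W0 d])
      also have "form W ?d ?d = ?a ?d ?d + \<mu> * (LINT p|vol. (?d p)\<^sup>2)"
        using form_shift[OF W d d] by (simp add: power2_eq_square)
      finally have "(LINT p|vol. dist_dens (u k) (u l) p) \<le> ?c * (LINT p|vol. (?d p)\<^sup>2) + ?a ?d ?d"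
        by (simp add: algebra_simps)
      also have "?c * (LINT p|vol. (?d p)\<^sup>2) < ?c * (e / (2 * ?c))"
        using N1[of k l] kl c by (intro mult_strict_left_mono) auto
      also have "?c * (e / (2 * ?c)) = e / 2"
      proof -
        have "?c \<noteq> 0" using c by linarith
        then show ?thesis by (metis mult.commute nonzero_mult_divide_mult_cancel_left2 times_divide_eq_right)
      qed
      finally show ?thesis using ad by simp
    qed
    then show ?thesis by blast
  qed
  obtain \<phi> X where "L2 A g \<phi>" "is_weak_gradient A g \<phi> X" "(\<lambda>k. LINT p|vol. (u k p - \<phi> p)\<^sup>2) \<longlonglongrightarrow> 0"
    using H1_limit[OF sm Cau] by blast
  then show ?thesis using \<mu>\<kappa> sm u1 uG nn a0
    by (intro exI[of _ \<mu>] exI[of _ u] exI[of _ \<phi>] exI[of _ X] exI[of _ "\<mu> + 1"]) simp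
qed

end

lemma tendsto_zero_of_square_le:
  fixes a c :: "nat \<Rightarrow> real"
  assumes "\<And>k. (a k)\<^sup>2 \<le> c k" "c \<longlonglongrightarrow> 0"
  shows "a \<longlonglongrightarrow> 0"
proof -
  have "(\<lambda>k. sqrt (c k)) \<longlonglongrightarrow> sqrt 0" by (intro tendsto_real_sqrt assms(2))
  then have "(\<lambda>k. sqrt (c k)) \<longlonglongrightarrow> 0" by simp
  then show ?thesis
  proof (rule Lim_null_comparison[rotated], intro always_eventually allI)
    fix k show "norm (a k) \<le> sqrt (c k)"
      using real_sqrt_le_mono[OF assms(1)[of k]] by simp
  qed
qed

context riemannian
begin

subsection \<open>Decay of ground states\<close>

lemma continuous_bound:
  fixes h :: "'m \<Rightarrow> real"
  assumes "continuous_on UNIV h"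
  obtains B where "0 < B" "\<And>p. \<bar>h p\<bar> \<le> B"
proof -
  have "bounded (range h)" by (rule compact_imp_bounded[OF compact_continuous_image[OF assms compact_M]])
  then show ?thesis using that unfolding bounded_pos by auto
qed

lemma continuous_measurable:
  fixes h :: "'m \<Rightarrow> real"
  shows "continuous_on UNIV h \<Longrightarrow> h \<in> borel_measurable borel"
  by (rule borel_measurable_continuous_onI)

lemma L2_continuous:
  assumes "continuous_on UNIV h"
  shows "L2 A g h"
  unfolding L2_def by (intro conjI continuous_measurable integrable_continuous_vol continuous_on_power assms)

lemma L2_rules:
  assumes "L2 A g u" "L2 A g v"
  shows "integrable vol (\<lambda>p. u p * v p)" "L2 A g (\<lambda>p. u p - v p)"
  using assms integrable_mult_L2[of u vol v] integrable_sum_square(2)[of u vol v] by (auto simp: L2_def)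

lemma L2_mult_continuous:
  assumes u: "L2 A g u" and h: "continuous_on UNIV h"
  shows "L2 A g (\<lambda>p. h p * u p)"
proof -
  obtain B where B: "\<And>p. \<bar>(h p)\<^sup>2\<bar> \<le> B" using continuous_bound[OF continuous_on_power[OF h]] by metis
  have hm[measurable]: "h \<in> borel_measurable borel" by (rule continuous_measurable[OF h])
  have "integrable vol (\<lambda>p. (h p)\<^sup>2 * (u p)\<^sup>2)"
    by (rule integrable_bounded_mult[OF _ _ B]) (use u in \<open>auto simp: L2_def\<close>)
  moreover have "(\<lambda>p. h p * u p) \<in> borel_measurable borel"
    by (rule borel_measurable_times[OF hm]) (use u in \<open>simp add: L2_def\<close>)
  ultimately show ?thesis by (simp add: L2_def power_mult_distrib)
qed

lemma L2_Cauchy_Schwarz: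
  assumes "L2 A g u" "L2 A g v"
  shows "(LINT p|vol. u p * v p)\<^sup>2 \<le> (LINT p|vol. (u p)\<^sup>2) * (LINT p|vol. (v p)\<^sup>2)"
  by (rule integral_Cauchy_Schwarz) (use assms in \<open>auto simp: L2_def\<close>)

lemma L2_limit_mult:
  fixes u :: "nat \<Rightarrow> 'm \<Rightarrow> real"
  assumes u: "\<And>k. L2 A g (u k)" and f: "L2 A g \<phi>" and w: "L2 A g w"
    and lim: "(\<lambda>k. LINT p|vol. (u k p - \<phi> p)\<^sup>2) \<longlonglongrightarrow> 0"
  shows "(\<lambda>k. LINT p|vol. u k p * w p) \<longlonglongrightarrow> (LINT p|vol. \<phi> p * w p)"
proof (rule LIM_zero_cancel, rule tendsto_zero_of_square_le)
  fix k
  have "(LINT p|vol. u k p * w p) - (LINT p|vol. \<phi> p * w p) = (LINT p|vol. (u k p - \<phi> p) * w p)"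
    using L2_rules(1)[OF u w, of k] L2_rules(1)[OF f w] by (simp add: left_diff_distrib)
  then show "((LINT p|vol. u k p * w p) - (LINT p|vol. \<phi> p * w p))\<^sup>2
    \<le> (LINT p|vol. (u k p - \<phi> p)\<^sup>2) * (LINT p|vol. (w p)\<^sup>2)"
    using L2_Cauchy_Schwarz[OF L2_rules(2)[OF u f] w] by simp
next
  show "(\<lambda>k. (LINT p|vol. (u k p - \<phi> p)\<^sup>2) * (LINT p|vol. (w p)\<^sup>2)) \<longlonglongrightarrow> 0"
    by (rule tendsto_mult_left_zero[OF lim])
qed

lemma L2_limit_square:
  fixes u :: "nat \<Rightarrow> 'm \<Rightarrow> real"
  assumes u: "\<And>k. L2 A g (u k)" and f: "L2 A g \<phi>" and h: "continuous_on UNIV h"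
    and lim: "(\<lambda>k. LINT p|vol. (u k p - \<phi> p)\<^sup>2) \<longlonglongrightarrow> 0"
  shows "(\<lambda>k. LINT p|vol. h p * (u k p)\<^sup>2) \<longlonglongrightarrow> (LINT p|vol. h p * (\<phi> p)\<^sup>2)"
proof -
  obtain B where B: "0 < B" "\<And>p. \<bar>h p\<bar> \<le> B" using continuous_bound[OF h] by blast
  have hm: "h \<in> borel_measurable vol" using continuous_measurable[OF h] by simp
  have hf: "L2 A g (\<lambda>p. h p * \<phi> p)" by (rule L2_mult_continuous[OF f h])
  have d: "L2 A g (\<lambda>p. u k p - \<phi> p)" for k by (rule L2_rules(2)[OF u f])
  have i: "integrable vol (\<lambda>p. h p * (u p)\<^sup>2)" if "L2 A g u" for u
    by (rule integrable_bounded_mult[OF _ hm B(2)]) (use \<open>L2 A g u\<close> in \<open>simp add: L2_def\<close>)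
  have e: "(LINT p|vol. h p * (u k p)\<^sup>2) =
    (LINT p|vol. h p * (u k p - \<phi> p)\<^sup>2) + 2 * (LINT p|vol. u k p * (h p * \<phi> p)) - (LINT p|vol. \<phi> p * (h p * \<phi> p))" for k
  proof -
    have "(\<lambda>p. h p * (u k p)\<^sup>2) = (\<lambda>p. h p * (u k p - \<phi> p)\<^sup>2 + 2 * (u k p * (h p * \<phi> p)) - \<phi> p * (h p * \<phi> p))"
      by (simp add: power2_eq_square algebra_simps)
    then show ?thesis using i[OF d[of k]] L2_rules(1)[OF u hf, of k] L2_rules(1)[OF f hf] by simp
  qed
  have z: "(\<lambda>k. LINT p|vol. h p * (u k p - \<phi> p)\<^sup>2) \<longlonglongrightarrow> 0"
  proof (rule Lim_null_comparison)
    show "(\<lambda>k. B * (LINT p|vol. (u k p - \<phi> p)\<^sup>2)) \<longlonglongrightarrow> 0" by (rule tendsto_mult_right_zero[OF lim])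
    have "norm (LINT p|vol. h p * (u k p - \<phi> p)\<^sup>2) \<le> B * (LINT p|vol. (u k p - \<phi> p)\<^sup>2)" for k
    proof -
      have "norm (LINT p|vol. h p * (u k p - \<phi> p)\<^sup>2) \<le> (LINT p|vol. B * (u k p - \<phi> p)\<^sup>2)"
      proof (rule order_trans[OF integral_norm_bound], rule integral_mono)
        show "integrable vol (\<lambda>p. norm (h p * (u k p - \<phi> p)\<^sup>2))" by (intro integrable_norm i d)
        show "integrable vol (\<lambda>p. B * (u k p - \<phi> p)\<^sup>2)" using d[of k] by (simp add: L2_def)
        show "norm (h p * (u k p - \<phi> p)\<^sup>2) \<le> B * (u k p - \<phi> p)\<^sup>2" for p
          unfolding real_norm_def abs_mult abs_power2 by (intro mult_right_mono B) simp
      qed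
      then show ?thesis by simp
    qed
    then show "\<forall>\<^sub>F k in sequentially. norm (LINT p|vol. h p * (u k p - \<phi> p)\<^sup>2) \<le> B * (LINT p|vol. (u k p - \<phi> p)\<^sup>2)"
      by (intro always_eventually allI)
  qed
  have "(\<lambda>k. LINT p|vol. h p * (u k p)\<^sup>2) \<longlonglongrightarrow>
    0 + 2 * (LINT p|vol. \<phi> p * (h p * \<phi> p)) - (LINT p|vol. \<phi> p * (h p * \<phi> p))"
    unfolding e by (intro tendsto_intros z L2_limit_mult[OF u f hf lim])
  also have "0 + 2 * (LINT p|vol. \<phi> p * (h p * \<phi> p)) - (LINT p|vol. \<phi> p * (h p * \<phi> p)) = (LINT p|vol. h p * (\<phi> p)\<^sup>2)"
    by (simp add: power2_eq_square mult.commute mult.left_commute)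
  finally show ?thesis .
qed

text \<open>Cauchy-Schwarz for a nonnegative form: a sequence whose form tends to zero becomes
  orthogonal to everything. The test functions may vary with k as long as their forms stay bounded,
  as those of Agmon's argument do.\<close>

lemma form_tendsto_zero:
  fixes u y :: "nat \<Rightarrow> 'm \<Rightarrow> real"
  assumes Z: "continuous_on UNIV Z" and nn: "\<And>\<psi>. smooth_fun A \<psi> \<Longrightarrow> 0 \<le> form Z \<psi> \<psi>"
    and u: "\<And>k. smooth_fun A (u k)" and y: "\<And>k. smooth_fun A (y k)"
    and a0: "(\<lambda>k. form Z (u k) (u k)) \<longlonglongrightarrow> 0" and D: "\<And>k. form Z (y k) (y k) \<le> D"
  shows "(\<lambda>k. form Z (u k) (y k)) \<longlonglongrightarrow> 0"
proof (rule tendsto_zero_of_square_le)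
  fix k
  show "(form Z (u k) (y k))\<^sup>2 \<le> form Z (u k) (u k) * D"
    by (rule order_trans[OF form_Cauchy_Schwarz[OF Z nn u y] mult_left_mono[OF D nn[OF u]]])
next
  show "(\<lambda>k. form Z (u k) (u k) * D) \<longlonglongrightarrow> 0" by (rule tendsto_mult_left_zero[OF a0])
qed

text \<open>\<open>form_tendsto_zero\<close> with a fixed test function. Green's formula puts both
  derivatives on \<psi>, after which L^2 convergence of the sequence suffices to pass to the
  limit.\<close>

lemma Euler_Lagrange:
  fixes u :: "nat \<Rightarrow> 'm \<Rightarrow> real"
  assumes Z: "continuous_on UNIV Z" and nn: "\<And>\<psi>. smooth_fun A \<psi> \<Longrightarrow> 0 \<le> form Z \<psi> \<psi>"
    and u: "\<And>k. smooth_fun A (u k)" and a0: "(\<lambda>k. form Z (u k) (u k)) \<longlonglongrightarrow> 0"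
    and f: "L2 A g \<phi>" and lim: "(\<lambda>k. LINT p|vol. (u k p - \<phi> p)\<^sup>2) \<longlonglongrightarrow> 0"
    and s: "smooth_fun A \<psi>"
  shows "(LINT p|vol. \<phi> p * laplace_beltrami A g \<psi> p) = (LINT p|vol. \<phi> p * (Z p * \<psi> p))"
proof -
  let ?L = "laplace_beltrami A g \<psi>"
  have uL: "L2 A g (u k)" for k by (rule L2_continuous[OF smooth_fun_continuous[OF u]])
  have L: "L2 A g ?L" unfolding laplace_beltrami_def
    by (rule L2_continuous[OF continuous_divergence[OF vector_field_gradient[OF s] smooth_gradient[OF s]]])
  have Zs: "L2 A g (\<lambda>p. Z p * \<psi> p)"
    by (intro L2_continuous continuous_on_mult Z smooth_fun_continuous s)
  have e: "form Z (u k) \<psi> = - (LINT p|vol. u k p * ?L p) + (LINT p|vol. u k p * (Z p * \<psi> p))" for k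
  proof -
    have "(LINT p|vol. u k p * ?L p) = - (LINT p|vol. Gam (u k) \<psi> p)"
      unfolding laplace_beltrami_def Green[OF vector_field_gradient[OF s] smooth_gradient[OF s] u]
      by (rule arg_cong[of _ _ uminus], rule Bochner_Integration.integral_cong[OF refl riem_inner_sym])
    moreover have "form Z (u k) \<psi> = (LINT p|vol. Gam (u k) \<psi> p + u k p * (Z p * \<psi> p))"
      by (simp add: form_def mult.left_commute)
    ultimately show ?thesis
      using L2_rules(1)[OF uL Zs, of k] integrable_continuous_vol[OF continuous_Gam[OF u s]] by simp
  qed
  have "(\<lambda>k. form Z (u k) \<psi>) \<longlonglongrightarrow> 0"
    by (rule form_tendsto_zero[OF Z nn u s a0 order_refl])
  moreover have "(\<lambda>k. form Z (u k) \<psi>) \<longlonglongrightarrow>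
    - (LINT p|vol. \<phi> p * ?L p) + (LINT p|vol. \<phi> p * (Z p * \<psi> p))"
    unfolding e by (intro tendsto_intros L2_limit_mult[OF uL f L lim] L2_limit_mult[OF uL f Zs lim])
  ultimately have "- (LINT p|vol. \<phi> p * ?L p) + (LINT p|vol. \<phi> p * (Z p * \<psi> p)) = 0"
    by (rule LIMSEQ_unique[symmetric])
  then show ?thesis by simp
qed

lemma Gam_quadratic_nonneg: "0 \<le> a\<^sup>2 * Gam u u p + 2 * a * b * Gam u v p + b\<^sup>2 * Gam v v p"
proof -
  have "riem_inner A g (\<lambda>c p. a *\<^sub>R gradient g u c p + b *\<^sub>R gradient g v c p)
    (\<lambda>c p. a *\<^sub>R gradient g u c p + b *\<^sub>R gradient g v c p) p
    = a\<^sup>2 * Gam u u p + 2 * a * b * Gam u v p + b\<^sup>2 * Gam v v p"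
    unfolding riem_inner_bilinear using riem_inner_sym[of "gradient g v" "gradient g u" p]
    by (simp add: power2_eq_square algebra_simps)
  from this[symmetric] show ?thesis by (simp only: riem_inner_nonneg)
qed

lemma Gam_mult_self:
  assumes w: "smooth_fun A w" and u: "smooth_fun A u"
  shows "Gam (\<lambda>p. w p * u p) (\<lambda>p. w p * u p) p = (w p)\<^sup>2 * Gam u u p + 2 * w p * u p * Gam u w p + (u p)\<^sup>2 * Gam w w p"
proof -
  note wu = smooth_fun_mult[OF w u]
  show ?thesis
    unfolding Gam_rules(3)[OF w u wu] Gam_rules(4)[OF w u w] Gam_rules(4)[OF w u u]
    using riem_inner_sym[of "gradient g w" "gradient g u" p] by (simp add: power2_eq_square algebra_simps)
qed

text \<open>Agmon's estimate: test the (approximate) eigenvalue equation with \<open>w\<^sup>2 u\<close> and complete the square,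
  $\langle\nabla u, \nabla(w^2 u)\rangle = |\nabla (w u)|^2 - u^2 |\nabla w|^2$.\<close>

lemma Agmon_estimate:
  fixes u :: "nat \<Rightarrow> 'm \<Rightarrow> real"
  assumes Z: "continuous_on UNIV Z" and nn: "\<And>\<psi>. smooth_fun A \<psi> \<Longrightarrow> 0 \<le> form Z \<psi> \<psi>"
    and u: "\<And>k. smooth_fun A (u k)" and a0: "(\<lambda>k. form Z (u k) (u k)) \<longlonglongrightarrow> 0"
    and u1: "\<And>k. (LINT p|vol. (u k p)\<^sup>2) = 1" and G: "\<And>k. (LINT p|vol. Gam (u k) (u k) p) \<le> M"
    and f: "L2 A g \<phi>" and lim: "(\<lambda>k. LINT p|vol. (u k p - \<phi> p)\<^sup>2) \<longlonglongrightarrow> 0"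
    and w: "smooth_fun A w"
  shows "(LINT p|vol. (Z p * (w p)\<^sup>2 - Gam w w p) * (\<phi> p)\<^sup>2) \<le> 0"
proof -
  define z where "z = (\<lambda>p. w p * w p)"
  have z: "smooth_fun A z" unfolding z_def by (rule smooth_fun_mult[OF w w])
  define y where "y k = (\<lambda>p. z p * u k p)" for k
  have y: "smooth_fun A (y k)" for k unfolding y_def by (rule smooth_fun_mult[OF z u])
  let ?H = "\<lambda>p. Z p * (w p)\<^sup>2 - Gam w w p"
  have H: "continuous_on UNIV ?H"
    by (intro continuous_on_diff continuous_on_mult continuous_on_power Z smooth_fun_continuous w continuous_Gam)
  have uL: "L2 A g (u k)" for k by (rule L2_continuous[OF smooth_fun_continuous[OF u]])
  have u2: "integrable vol (\<lambda>p. (u k p)\<^sup>2)" for k using uL[of k] by (simp add: L2_def)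
  have Gi: "integrable vol (Gam (u k) (u k))" for k by (rule integrable_continuous_vol[OF continuous_Gam[OF u u]])
  \<comment> \<open>\<open>B1\<close> and \<open>B2\<close> come from |\<nabla>(z u)|^2 \<le> 2 z^2
    |\<nabla>u|^2 + 2 u^2 |\<nabla>z|^2; they bound the forms of the test functions z u uniformly in
    k.\<close>
  obtain B1 where B1: "0 < B1" "\<And>p. \<bar>2 * (z p)\<^sup>2\<bar> \<le> B1"
  proof -
    have "continuous_on UNIV (\<lambda>p. 2 * (z p)\<^sup>2)"
      by (intro continuous_on_mult_left continuous_on_power smooth_fun_continuous z)
    from continuous_bound[OF this] show ?thesis using that by blast
  qed
  obtain B2 where B2: "0 < B2" "\<And>p. \<bar>2 * Gam z z p + Z p * (z p)\<^sup>2\<bar> \<le> B2"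
  proof -
    have "continuous_on UNIV (\<lambda>p. 2 * Gam z z p + Z p * (z p)\<^sup>2)"
      by (intro continuous_on_add continuous_on_mult[OF Z] continuous_on_mult_left continuous_on_power smooth_fun_continuous z continuous_Gam)
    from continuous_bound[OF this] show ?thesis using that by blast
  qed
  have D: "form Z (y k) (y k) \<le> B1 * M + B2" for k
  proof -
    have "form Z (y k) (y k) \<le> (LINT p|vol. B1 * Gam (u k) (u k) p + B2 * (u k p)\<^sup>2)"
      unfolding form_def
    proof (intro integral_mono integrable_continuous_vol[OF form_cont[OF Z y y]])
      show "integrable vol (\<lambda>p. B1 * Gam (u k) (u k) p + B2 * (u k p)\<^sup>2)" using Gi u2 by simp
      fix p
      have "2 * (z p)\<^sup>2 * Gam (u k) (u k) p \<le> B1 * Gam (u k) (u k) p"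
        using B1(2)[of p] by (intro mult_right_mono riem_inner_nonneg) linarith
      moreover have "(2 * Gam z z p + Z p * (z p)\<^sup>2) * (u k p)\<^sup>2 \<le> B2 * (u k p)\<^sup>2"
        using B2(2)[of p] by (intro mult_right_mono) auto
      \<comment> \<open>The right-hand side is |z \<nabla>u - u \<nabla>z|^2; it turns the mixed
        term into pure squares.\<close>
      moreover have "0 \<le> (z p)\<^sup>2 * Gam (u k) (u k) p + 2 * z p * (- u k p) * Gam (u k) z p + (- u k p)\<^sup>2 * Gam z z p"
        by (rule Gam_quadratic_nonneg)
      ultimately show "Gam (y k) (y k) p + Z p * (y k p * y k p) \<le> B1 * Gam (u k) (u k) p + B2 * (u k p)\<^sup>2"
        unfolding y_def Gam_mult_self[OF z u] by (simp add: power2_eq_square algebra_simps)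
    qed
    also have "\<dots> = B1 * (LINT p|vol. Gam (u k) (u k) p) + B2" using Gi[of k] u2[of k] u1[of k] by simp
    also have "\<dots> \<le> B1 * M + B2" using G[of k] B1(1) by simp
    finally show ?thesis .
  qed
  have lower: "(LINT p|vol. ?H p * (u k p)\<^sup>2) \<le> form Z (u k) (y k)" for k
    unfolding form_def
  proof (intro integral_mono integrable_continuous_vol[OF form_cont[OF Z u y]])
    show "integrable vol (\<lambda>p. ?H p * (u k p)\<^sup>2)"
      by (intro integrable_continuous_vol continuous_on_mult H continuous_on_power smooth_fun_continuous u)
    fix p
    have "Gam (u k) (y k) p = (w p)\<^sup>2 * Gam (u k) (u k) p + 2 * w p * u k p * Gam (u k) w p"
      unfolding y_def z_def Gam_rules(3)[OF smooth_fun_mult[OF w w] u u] Gam_rules(3)[OF w w u]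
      by (simp add: power2_eq_square algebra_simps)
    \<comment> \<open>The right-hand side is |\<nabla>(w u)|^2, the part of the completed square
      that is discarded.\<close>
    moreover have "0 \<le> (w p)\<^sup>2 * Gam (u k) (u k) p + 2 * w p * u k p * Gam (u k) w p + (u k p)\<^sup>2 * Gam w w p"
      by (rule Gam_quadratic_nonneg)
    ultimately show "?H p * (u k p)\<^sup>2 \<le> Gam (u k) (y k) p + Z p * (u k p * y k p)"
      by (simp add: y_def z_def power2_eq_square algebra_simps)
  qed
  show ?thesis
  proof (rule LIMSEQ_le)
    show "(\<lambda>k. LINT p|vol. ?H p * (u k p)\<^sup>2) \<longlonglongrightarrow> (LINT p|vol. ?H p * (\<phi> p)\<^sup>2)"
      by (rule L2_limit_square[OF uL f H lim])
    show "(\<lambda>k. form Z (u k) (y k)) \<longlonglongrightarrow> 0" by (rule form_tendsto_zero[OF Z nn u y a0 D])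
    show "\<exists>N. \<forall>k\<ge>N. (LINT p|vol. ?H p * (u k p)\<^sup>2) \<le> form Z (u k) (y k)" using lower by blast
  qed
qed


subsection \<open>Standing waves\<close>

text \<open>The summand with coefficient 0 gives the field the shape of a linear combination, to
  which \<open>L2_vf_lincomb\<close> and \<open>riem_inner_bilinear\<close> apply.\<close>

lemma is_weak_gradient_cmult:
  assumes "is_weak_gradient A g u X"
  shows "is_weak_gradient A g (\<lambda>p. k * u p) (\<lambda>c p. k *\<^sub>R X c p + 0 *\<^sub>R X c p)"
  using assms L2_vf_lincomb[of X X k 0]
  unfolding is_weak_gradient_iff riem_inner_bilinear by (simp add: mult.assoc)

lemma weak_gradient: "is_weak_gradient A g u X \<Longrightarrow> is_weak_gradient A g u (weak_gradient A g u)"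
  unfolding weak_gradient_def by (rule someI[of "is_weak_gradient A g u"])

text \<open>Lets any explicit weak gradient stand in for the one chosen inside
  \<open>grad_norm_sq\<close>, by \<open>weak_gradient_unique\<close>.\<close>

lemma grad_norm_sq_integral:
  assumes "is_weak_gradient A g u X"
  shows "integrable vol (grad_norm_sq A g u)" "(LINT p|vol. grad_norm_sq A g u p) = (LINT p|vol. riem_inner A g X X p)"
  using weak_gradient[OF assms] weak_gradient_unique[OF weak_gradient[OF assms] assms]
  by (auto simp: grad_norm_sq_def is_weak_gradient_def)

lemma H1_cmult:
  assumes f: "L2 A g \<phi>" and X: "is_weak_gradient A g \<phi> X"
  shows "H1 A g (\<lambda>p. k * \<phi> p)"
    "H1_norm A g (\<lambda>p. k * \<phi> p) = \<bar>k\<bar> * sqrt ((LINT p|vol. (\<phi> p)\<^sup>2) + (LINT p|vol. riem_inner A g X X p))"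
proof -
  note kX = is_weak_gradient_cmult[OF X, of k]
  have kf: "L2 A g (\<lambda>p. k * \<phi> p)" by (rule L2_mult_continuous[OF f continuous_on_const])
  show "H1 A g (\<lambda>p. k * \<phi> p)" unfolding H1_def using kf kX by blast
  have "(LINT p|vol. (k * \<phi> p)\<^sup>2 + grad_norm_sq A g (\<lambda>p. k * \<phi> p) p) =
    (LINT p|vol. (k * \<phi> p)\<^sup>2) + (LINT p|vol. grad_norm_sq A g (\<lambda>p. k * \<phi> p) p)"
    using kf grad_norm_sq_integral(1)[OF kX] by (intro Bochner_Integration.integral_add) (auto simp: L2_def)
  also have "(LINT p|vol. grad_norm_sq A g (\<lambda>p. k * \<phi> p) p) = k\<^sup>2 * (LINT p|vol. riem_inner A g X X p)"
    unfolding grad_norm_sq_integral(2)[OF kX] riem_inner_bilinear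
    by (simp add: power2_eq_square mult.assoc)
  also have "(LINT p|vol. (k * \<phi> p)\<^sup>2) = k\<^sup>2 * (LINT p|vol. (\<phi> p)\<^sup>2)" by (simp add: power_mult_distrib)
  finally show "H1_norm A g (\<lambda>p. k * \<phi> p) = \<bar>k\<bar> * sqrt ((LINT p|vol. (\<phi> p)\<^sup>2) + (LINT p|vol. riem_inner A g X X p))"
    unfolding H1_norm_def by (simp flip: distrib_left add: real_sqrt_mult)
qed

lemma L2_norm_cmult: "L2_norm A g (\<lambda>p. k * \<phi> p) = \<bar>k\<bar> * L2_norm A g \<phi>"
  unfolding L2_norm_def by (simp add: power_mult_distrib real_sqrt_mult)

text \<open>Every difference in time is a scalar times \<phi>, so all norms factor and the
  regularity conditions reduce to limits of cosine and sine. The equation is \<open>eig\<close>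
  multiplied by \<open>cos (sqrt \<mu> * t)\<close>.\<close>

lemma standing_wave:
  assumes f: "L2 A g \<phi>" and X: "is_weak_gradient A g \<phi> X" and W: "continuous_on UNIV W" and m: "0 \<le> \<mu>"
    and eig: "\<And>\<psi>. smooth_fun A \<psi> \<Longrightarrow>
      (LINT p|vol. \<phi> p * laplace_beltrami A g \<psi> p) = (LINT p|vol. \<phi> p * ((W p - \<mu>) * \<psi> p))"
  shows "wave_solution A g W T \<phi> (\<lambda>_. 0) (\<lambda>t p. cos (sqrt \<mu> * t) * \<phi> p) (\<lambda>t p. - (sqrt \<mu> * sin (sqrt \<mu> * t)) * \<phi> p)"
  unfolding wave_solution_def
proof (intro conjI ballI allI impI)
  let ?c = "\<lambda>t. cos (sqrt \<mu> * t)" and ?s = "\<lambda>t. - (sqrt \<mu> * sin (sqrt \<mu> * t))"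
  fix t
  show "H1 A g (\<lambda>p. ?c t * \<phi> p)" by (rule H1_cmult(1)[OF f X])
  show "L2 A g (\<lambda>p. ?s t * \<phi> p)" by (rule L2_mult_continuous[OF f continuous_on_const])
  have lim_at: "((\<lambda>s. \<bar>h s\<bar> * K) \<longlongrightarrow> 0) (at t within {0..T})" if "(h \<longlongrightarrow> 0) (at t within {0..T})" for h :: "real \<Rightarrow> real" and K
    using tendsto_mult_left_zero[OF tendsto_rabs_zero[OF that]] by blast
  have "((\<lambda>s. ?c s - ?c t) \<longlongrightarrow> ?c t - ?c t) (at t within {0..T})"
    by (intro tendsto_intros)
  then show "((\<lambda>s. H1_norm A g (\<lambda>p. ?c s * \<phi> p - ?c t * \<phi> p)) \<longlongrightarrow> 0) (at t within {0..T})"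
    unfolding left_diff_distrib[symmetric] H1_cmult(2)[OF f X] by (intro lim_at) simp
  have "((\<lambda>s. ?s s - ?s t) \<longlongrightarrow> ?s t - ?s t) (at t within {0..T})"
    by (intro tendsto_intros)
  then show "((\<lambda>s. L2_norm A g (\<lambda>p. ?s s * \<phi> p - ?s t * \<phi> p)) \<longlongrightarrow> 0) (at t within {0..T})"
    unfolding left_diff_distrib[symmetric] L2_norm_cmult by (intro lim_at) simp
  have "(?c has_real_derivative ?s t) (at t within {0..T})"
    by (auto intro!: derivative_eq_intros)
  then have "((\<lambda>s. (?c s - ?c t) / (s - t) - ?s t) \<longlongrightarrow> 0) (at t within {0..T})"
    unfolding has_field_derivative_iff by (rule LIM_zero)
  moreover have "(\<lambda>p. (?c s * \<phi> p - ?c t * \<phi> p) / (s - t) - ?s t * \<phi> p) = (\<lambda>p. ((?c s - ?c t) / (s - t) - ?s t) * \<phi> p)" for s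
    by (simp add: algebra_simps diff_divide_distrib)
  ultimately show "((\<lambda>s. L2_norm A g (\<lambda>p. (?c s * \<phi> p - ?c t * \<phi> p) / (s - t) - ?s t * \<phi> p)) \<longlongrightarrow> 0) (at t within {0..T})"
    unfolding L2_norm_cmult by (simp only: L2_norm_cmult lim_at)
next
  fix \<psi> t assume s: "smooth_fun A \<psi>"
  have sL: "L2 A g \<psi>" by (rule L2_continuous[OF smooth_fun_continuous[OF s]])
  have Ws: "L2 A g (\<lambda>p. W p * \<psi> p)" by (intro L2_continuous continuous_on_mult W smooth_fun_continuous s)
  let ?I = "LINT p|vol. \<phi> p * \<psi> p"
  have "(LINT p|vol. \<phi> p * laplace_beltrami A g \<psi> p) = (LINT p|vol. \<phi> p * (W p * \<psi> p) - \<mu> * (\<phi> p * \<psi> p))"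
    unfolding eig[OF s] by (intro Bochner_Integration.integral_cong refl) (simp add: algebra_simps)
  also have "\<dots> = (LINT p|vol. \<phi> p * (W p * \<psi> p)) - \<mu> * ?I"
    using L2_rules(1)[OF f Ws] L2_rules(1)[OF f sL] by simp
  finally have e: "(LINT p|vol. \<phi> p * laplace_beltrami A g \<psi> p) = (LINT p|vol. \<phi> p * (W p * \<psi> p)) - \<mu> * ?I" .
  have "(LINT p|vol. cos (sqrt \<mu> * t) * \<phi> p * laplace_beltrami A g \<psi> p) - (LINT p|vol. W p * (cos (sqrt \<mu> * t) * \<phi> p) * \<psi> p)
    = - \<mu> * cos (sqrt \<mu> * t) * ?I"
  proof -
    have "(LINT p|vol. W p * (cos (sqrt \<mu> * t) * \<phi> p) * \<psi> p) = (LINT p|vol. cos (sqrt \<mu> * t) * (\<phi> p * (W p * \<psi> p)))"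
      by (intro Bochner_Integration.integral_cong refl) (simp add: mult_ac)
    then show ?thesis by (simp add: mult.assoc e right_diff_distrib)
  qed
  moreover have "((\<lambda>s. - (sqrt \<mu> * sin (sqrt \<mu> * s)) * ?I) has_real_derivative - \<mu> * cos (sqrt \<mu> * t) * ?I) (at t within {0..T})"
    using m by (auto intro!: derivative_eq_intros simp: power2_eq_square[symmetric] mult.assoc[symmetric])
  ultimately show "((\<lambda>s. LINT p|vol. - (sqrt \<mu> * sin (sqrt \<mu> * s)) * \<phi> p * \<psi> p) has_real_derivative
      (LINT p|vol. cos (sqrt \<mu> * t) * \<phi> p * laplace_beltrami A g \<psi> p) - (LINT p|vol. W p * (cos (sqrt \<mu> * t) * \<phi> p) * \<psi> p))
      (at t within {0..T})"
    by (simp add: mult.assoc)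
qed auto

text \<open>Replacing sin^2 by 1 makes the bound linear in T for all T at once, whence the factor
  \<open>inverse T\<close> in the cost.\<close>

lemma standing_wave_observation:
  assumes f: "L2 A g \<phi>" and b: "continuous_on UNIV b" and m: "0 \<le> \<mu>" and T: "0 < T"
    and I: "(LINT p|vol. (b p)\<^sup>2 * (\<phi> p)\<^sup>2) \<le> I"
  shows "observation A g b T (\<lambda>t p. - (sqrt \<mu> * sin (sqrt \<mu> * t)) * \<phi> p) \<le> ennreal (T * (\<mu> * I))"
proof -
  have bf: "L2 A g (\<lambda>p. b p * \<phi> p)" by (rule L2_mult_continuous[OF f b])
  have I0: "0 \<le> I" by (rule order_trans[OF _ I]) simp
  have inner: "(\<integral>\<^sup>+p. ennreal ((b p * (- (sqrt \<mu> * sin (sqrt \<mu> * t)) * \<phi> p))\<^sup>2) \<partial>vol) \<le> ennreal (\<mu> * I)" for t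
  proof -
    have "(\<integral>\<^sup>+p. ennreal ((b p * (- (sqrt \<mu> * sin (sqrt \<mu> * t)) * \<phi> p))\<^sup>2) \<partial>vol) \<le> (\<integral>\<^sup>+p. ennreal (\<mu> * (b p * \<phi> p)\<^sup>2) \<partial>vol)"
    proof (intro nn_integral_mono ennreal_leI)
      fix p
      have "(b p * (- (sqrt \<mu> * sin (sqrt \<mu> * t)) * \<phi> p))\<^sup>2 = (\<mu> * (b p * \<phi> p)\<^sup>2) * (sin (sqrt \<mu> * t))\<^sup>2"
        using m by (simp add: power_mult_distrib)
      also have "\<dots> \<le> (\<mu> * (b p * \<phi> p)\<^sup>2) * 1"
        using m by (intro mult_left_mono) (auto simp: abs_square_le_1)
      finally show "(b p * (- (sqrt \<mu> * sin (sqrt \<mu> * t)) * \<phi> p))\<^sup>2 \<le> \<mu> * (b p * \<phi> p)\<^sup>2" by simp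
    qed
    also have "\<dots> = ennreal (LINT p|vol. \<mu> * (b p * \<phi> p)\<^sup>2)"
      using bf m by (intro nn_integral_eq_integral) (auto simp: L2_def)
    also have "(LINT p|vol. \<mu> * (b p * \<phi> p)\<^sup>2) = \<mu> * (LINT p|vol. (b p)\<^sup>2 * (\<phi> p)\<^sup>2)"
      by (simp add: power_mult_distrib)
    also have "ennreal (\<mu> * (LINT p|vol. (b p)\<^sup>2 * (\<phi> p)\<^sup>2)) \<le> ennreal (\<mu> * I)"
      using m I by (intro ennreal_leI mult_left_mono)
    finally show ?thesis .
  qed
  have "observation A g b T (\<lambda>t p. - (sqrt \<mu> * sin (sqrt \<mu> * t)) * \<phi> p) \<le> (\<integral>\<^sup>+t\<in>{0..T}. ennreal (\<mu> * I) \<partial>lborel)"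
    unfolding observation_def by (intro nn_integral_mono mult_right_mono inner) simp
  also have "\<dots> = ennreal (\<mu> * I) * ennreal T"
    using T by (simp add: nn_integral_cmult_indicator)
  also have "\<dots> = ennreal (T * (\<mu> * I))"
    using m I0 T by (simp add: mult.commute flip: ennreal_mult)
  finally show ?thesis .
qed

text \<open>The standing wave is one competitor in the supremum. Its initial velocity is zero, and
  its energy is at least \<open>\<kappa> / 2\<close> by the potential term alone, as \<phi> is
  normalised.\<close>

lemma obs_cost_ge:
  assumes f: "L2 A g \<phi>" and X: "is_weak_gradient A g \<phi> X" and n: "(LINT p|vol. (\<phi> p)\<^sup>2) = 1"
    and V: "continuous_on UNIV V" and m: "0 < \<mu>" and k: "0 < \<kappa>" "\<And>p. \<kappa> \<le> lam * V p"
    and b: "continuous_on UNIV b" and T: "0 < T"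
    and I: "(LINT p|vol. (b p)\<^sup>2 * (\<phi> p)\<^sup>2) \<le> I" "0 < I"
    and eig: "\<And>\<psi>. smooth_fun A \<psi> \<Longrightarrow>
      (LINT p|vol. \<phi> p * laplace_beltrami A g \<psi> p) = (LINT p|vol. \<phi> p * ((lam * V p - \<mu>) * \<psi> p))"
  shows "ennreal (\<kappa> / (2 * T * \<mu> * I)) \<le> obs_cost A g b lam V T"
proof -
  let ?W = "\<lambda>p. lam * V p"
  let ?v = "\<lambda>t p. - (sqrt \<mu> * sin (sqrt \<mu> * t)) * \<phi> p"
  have W: "continuous_on UNIV ?W" by (intro continuous_on_mult_left V)
  obtain B where B: "\<And>p. \<bar>?W p\<bar> \<le> B" using continuous_bound[OF W] by blast
  have f2: "integrable vol (\<lambda>p. (\<phi> p)\<^sup>2)" using f by (simp add: L2_def)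
  have "\<kappa> = (LINT p|vol. \<kappa> * (\<phi> p)\<^sup>2)" using n by simp
  also have "\<dots> \<le> (LINT p|vol. grad_norm_sq A g \<phi> p + ?W p * (\<phi> p)\<^sup>2)"
  proof (rule integral_mono)
    show "integrable vol (\<lambda>p. \<kappa> * (\<phi> p)\<^sup>2)" using f2 by simp
    show "integrable vol (\<lambda>p. grad_norm_sq A g \<phi> p + ?W p * (\<phi> p)\<^sup>2)"
      using continuous_measurable[OF W]
      by (intro Bochner_Integration.integrable_add grad_norm_sq_integral(1)[OF X] integrable_bounded_mult[OF f2 _ B]) simp
    show "\<kappa> * (\<phi> p)\<^sup>2 \<le> grad_norm_sq A g \<phi> p + ?W p * (\<phi> p)\<^sup>2" for p
      using mult_right_mono[OF k(2)[of p], of "(\<phi> p)\<^sup>2"] riem_inner_nonneg[of "weak_gradient A g \<phi>" p]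
      by (simp add: grad_norm_sq_def)
  qed
  finally have en: "\<kappa> / 2 \<le> energy A g ?W \<phi> (\<lambda>_. 0)" by (simp add: energy_def)
  have ob: "observation A g b T ?v \<le> ennreal (T * (\<mu> * I))"
    using m by (intro standing_wave_observation f b T I) simp
  have nz: "\<not> (AE p in vol. \<phi> p = 0)"
  proof
    assume "AE p in vol. \<phi> p = 0"
    then have "(LINT p|vol. (\<phi> p)\<^sup>2) = 0" by (intro integral_eq_zero_AE) auto
    then show False using n by simp
  qed
  have "ennreal (\<kappa> / (2 * T * \<mu> * I)) \<le> (if observation A g b T ?v = 0 then \<infinity>
       else ennreal (energy A g ?W \<phi> (\<lambda>_. 0)) / observation A g b T ?v)"
  proof (cases "observation A g b T ?v = 0")
    case False
    obtain r where r: "observation A g b T ?v = ennreal r" "0 < r" "r \<le> T * (\<mu> * I)"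
    proof -
      have "observation A g b T ?v < top" by (rule le_less_trans[OF ob ennreal_less_top])
      then obtain r where r: "0 \<le> r" "observation A g b T ?v = ennreal r"
        by (cases "observation A g b T ?v") auto
      moreover have "0 \<le> T * (\<mu> * I)" using T m I(2) by simp
      ultimately show ?thesis using that[of r] False ob by (cases "r = 0") auto
    qed
    have e0: "0 < energy A g ?W \<phi> (\<lambda>_. 0)" using en k(1) by linarith
    have "\<kappa> / (2 * T * \<mu> * I) = (\<kappa> / 2) / (T * (\<mu> * I))" by (simp add: mult.assoc)
    also have "\<dots> \<le> energy A g ?W \<phi> (\<lambda>_. 0) / r"
      by (rule frac_le) (use e0 en r in auto)
    finally have "ennreal (\<kappa> / (2 * T * \<mu> * I)) \<le> ennreal (energy A g ?W \<phi> (\<lambda>_. 0) / r)" by (rule ennreal_leI)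
    also have "\<dots> = ennreal (energy A g ?W \<phi> (\<lambda>_. 0)) / observation A g b T ?v"
      unfolding r(1) using e0 r(2) by (simp add: divide_ennreal)
    finally show ?thesis using False by simp
  qed simp
  also have "\<dots> \<le> obs_cost A g b lam V T"
    unfolding obs_cost_def
  proof (rule Sup_upper, unfold mem_Collect_eq, intro exI conjI)
    show "H1 A g \<phi>" unfolding H1_def using f X by blast
    show "L2 A g (\<lambda>_. 0)" by (intro L2_continuous continuous_on_const)
    show "wave_solution A g ?W T \<phi> (\<lambda>_. 0) (\<lambda>t p. cos (sqrt \<mu> * t) * \<phi> p) ?v"
      using m by (intro standing_wave[OF f X W _ eig]) auto
  qed (use nz in simp_all)
  finally show ?thesis .
qed


section \<open>Exponential concentration of the ground state in the well\<close>

lemma smooth_fun_exp: "smooth_fun A u \<Longrightarrow> smooth_fun A (\<lambda>p. exp (u p))"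
  by (rule smooth_fun_compose[OF _ smooth_on_exp]) auto

lemma Gam_exp:
  assumes u: "smooth_fun A u"
  shows "Gam (\<lambda>p. exp (k * (1 - u p))) (\<lambda>p. exp (k * (1 - u p))) p = (k * exp (k * (1 - u p)))\<^sup>2 * Gam u u p"
proof -
  let ?w = "\<lambda>p. exp (k * (1 - u p))"
  have w: "smooth_fun A ?w"
    by (intro smooth_fun_exp smooth_fun_cmult smooth_fun_diff smooth_fun_const u)
  have d: "((\<lambda>x. exp (k * (1 - x))) has_real_derivative - k * exp (k * (1 - u p))) (at (u p))"
    by (auto intro!: derivative_eq_intros)
  have "Gam v ?w p = - k * ?w p * Gam v u p" if "smooth_fun A v" for v
    by (rule dir_rules(4)[OF vector_field_gradient[OF \<open>smooth_fun A v\<close>] u u w d])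
  from this[OF w] this[OF u] show ?thesis
    using riem_inner_sym[of "gradient g ?w" "gradient g u" p] by (simp add: power2_eq_square)
qed

lemma integrable_indicator_square:
  assumes "smooth_fun A \<eta>" "L2 A g \<phi>"
  shows "integrable vol (\<lambda>p. indicator {p. \<eta> p = 0} p * (\<phi> p)\<^sup>2)"
proof (rule integrable_bounded_mult)
  have "closed {p. \<eta> p = 0}"
    by (rule closed_Collect_eq[OF smooth_fun_continuous[OF assms(1)] continuous_on_const])
  then have "{p. \<eta> p = 0} \<in> sets vol" by simp
  then show "indicator {p. \<eta> p = 0} \<in> borel_measurable vol" by (rule borel_measurable_indicator)
  show "integrable vol (\<lambda>p. (\<phi> p)\<^sup>2)" using assms(2) by (simp add: L2_def)
qed (rule indicator_abs_le_1)

text \<open>\<open>\<theta>\<close> is the fraction by which the well \<open>\<eta>/2\<close> lowers the bottom of the spectrum.\<close>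

lemma ground_state_level:
  assumes chi: "smooth_fun A \<eta>" and pos: "\<eta> p0 > 0" and rng: "\<And>p. 0 \<le> \<eta> p" "\<And>p. \<eta> p \<le> 1"
  obtains \<theta> C0 where "0 < \<theta>" "\<theta> \<le> 1" "0 \<le> C0"
    "\<And>lam \<mu>. 0 \<le> form (\<lambda>p. lam * (1 - \<eta> p / 2) - \<mu>) \<eta> \<eta> \<Longrightarrow> \<mu> \<le> C0 + lam * (1 - \<theta> / 2)"
proof -
  have c: "continuous_on UNIV \<eta>" by (rule smooth_fun_continuous[OF chi])
  let ?I2 = "LINT p|vol. (\<eta> p)\<^sup>2" and ?I3 = "LINT p|vol. (\<eta> p)^3" and ?G = "LINT p|vol. Gam \<eta> \<eta> p"
  have i: "integrable vol (\<lambda>p. (\<eta> p)^n)" for n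
    by (intro integrable_continuous_vol continuous_on_power c)
  have Gi: "integrable vol (Gam \<eta> \<eta>)" by (rule integrable_continuous_vol[OF continuous_Gam[OF chi chi]])
  have I: "0 < ?I2" "0 < ?I3"
    by (rule integral_vol_pos[OF continuous_on_power[OF c] zero_le_power[OF rng(1)] zero_less_power[OF pos]])+
  have le: "?I3 \<le> ?I2"
    by (intro integral_mono i power_decreasing) (auto intro: rng)
  show ?thesis
  \<comment> \<open>The form is tested with the bump itself: \<open>\<theta>\<close> is the quotient
    of the integrals of \<eta>^3 and \<eta>^2, at most 1 since \<eta> is, and \<open>C0\<close> is
    the Rayleigh quotient of \<eta> for -\<Delta>.\<close>
  proof (rule that[of "?I3 / ?I2" "?G / ?I2"])
    show "0 < ?I3 / ?I2" "?I3 / ?I2 \<le> 1" using I le by auto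
    show "0 \<le> ?G / ?I2" using I by (intro divide_nonneg_pos Bochner_Integration.integral_nonneg riem_inner_nonneg)
    fix lam \<mu> assume nn: "0 \<le> form (\<lambda>p. lam * (1 - \<eta> p / 2) - \<mu>) \<eta> \<eta>"
    have "form (\<lambda>p. lam * (1 - \<eta> p / 2) - \<mu>) \<eta> \<eta> = (LINT p|vol. Gam \<eta> \<eta> p + (lam - \<mu>) * (\<eta> p)\<^sup>2 - (lam / 2) * (\<eta> p)^3)"
      unfolding form_def
      by (intro Bochner_Integration.integral_cong refl) (simp add: power2_eq_square power3_eq_cube algebra_simps)
    also have "\<dots> = ?G + (lam - \<mu>) * ?I2 - (lam / 2) * ?I3"
      using Gi i[of 2] i[of 3] by simp
    finally have "\<mu> * ?I2 \<le> ?G + lam * ?I2 - (lam / 2) * ?I3" using nn by (simp add: left_diff_distrib)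
    then have "\<mu> \<le> (?G + lam * ?I2 - (lam / 2) * ?I3) / ?I2" using I by (simp add: pos_le_divide_eq)
    also have "\<dots> = ?G / ?I2 + lam * (1 - (?I3 / ?I2) / 2)" using I by (simp add: field_simps)
    finally show "\<mu> \<le> ?G / ?I2 + lam * (1 - (?I3 / ?I2) / 2)" .
  qed
qed

text \<open>Agmon's estimate with the weight exp (s (1 - \<eta>)), which is largest where \<eta> =
  0. A gap of lam \<theta> / 2 less two losses of lam \<theta> / 8, for the level and for the
  gradient of the weight, leaves a coefficient of at least lam (\<theta> / 4 - \<eta> / 2). This
  lower bound is negative only where \<eta> > \<theta> / 2, and there the squared weight is at most
  exp (2 s (1 - \<theta> / 2)). Comparison with exp (2 s), its value on \<eta> = 0, gives the
  decay.\<close>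

lemma ground_state_decay:
  assumes chi: "smooth_fun A \<eta>" and rng: "\<And>p. 0 \<le> \<eta> p" "\<And>p. \<eta> p \<le> 1" and f: "L2 A g \<phi>" and n: "(LINT p|vol. (\<phi> p)\<^sup>2) = 1"
    and th: "0 < \<theta>" and lam: "0 < lam"
    and s: "\<And>p. s\<^sup>2 * Gam \<eta> \<eta> p \<le> lam * (\<theta> / 8)" "0 \<le> s"
    and \<mu>: "\<mu> \<le> lam * (1 - \<theta> / 2) + lam * (\<theta> / 8)"
    and Ag: "\<And>w. smooth_fun A w \<Longrightarrow> (LINT p|vol. ((lam * (1 - \<eta> p / 2) - \<mu>) * (w p)\<^sup>2 - Gam w w p) * (\<phi> p)\<^sup>2) \<le> 0"
  shows "(LINT p|vol. indicator {p. \<eta> p = 0} p * (\<phi> p)\<^sup>2) \<le> 2 / \<theta> * exp (- (s * \<theta>))"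
proof -
  let ?w = "\<lambda>p. exp (s * (1 - \<eta> p))"
  let ?H = "\<lambda>p. (lam * (1 - \<eta> p / 2) - \<mu>) * (?w p)\<^sup>2 - Gam ?w ?w p"
  have w: "smooth_fun A ?w"
    by (intro smooth_fun_exp smooth_fun_cmult smooth_fun_diff smooth_fun_const chi)
  have c: "continuous_on UNIV \<eta>" by (rule smooth_fun_continuous[OF chi])
  have cH: "continuous_on UNIV ?H"
    by (intro continuous_on_diff continuous_on_mult continuous_on_power continuous_on_const
        continuous_on_divide c smooth_fun_continuous[OF w] continuous_Gam[OF w w]) simp
  let ?E = "{p. \<eta> p = 0}"
  have f2: "integrable vol (\<lambda>p. (\<phi> p)\<^sup>2)" using f by (simp add: L2_def)
  have i: "integrable vol (\<lambda>p. indicator ?E p * (\<phi> p)\<^sup>2)"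
    by (rule integrable_indicator_square[OF chi f])
  have j: "integrable vol (\<lambda>p. ?H p * (\<phi> p)\<^sup>2)"
  proof -
    obtain B where "\<And>p. \<bar>?H p\<bar> \<le> B" using continuous_bound[OF cH] by blast
    then show ?thesis
      by (rule integrable_bounded_mult[OF f2, rotated]) (use continuous_measurable[OF cH] in simp)
  qed
  \<comment> \<open>Bound for the negative part: \<theta> / 4 - \<eta> / 2 is at least -1/2 because
    \<eta> \<le> 1, and the squared weight is bounded as on \<eta> \<ge> \<theta> / 2.\<close>
  let ?q = "exp (2 * s * (1 - \<theta> / 2)) / 2"
  have low: "lam * (\<theta> / 4 * exp (2 * s) * indicator ?E p - ?q) \<le> ?H p" for p
  proof -
    have w2: "(?w p)\<^sup>2 = exp (2 * s * (1 - \<eta> p))"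
      by (simp add: exp_double[symmetric] mult.assoc)
    have "\<theta> / 4 * exp (2 * s) * indicator ?E p - ?q \<le> (?w p)\<^sup>2 * (\<theta> / 4 - \<eta> p / 2)"
    proof (cases "\<eta> p = 0")
      case True then show ?thesis unfolding w2 by simp
    next
      case False
      show ?thesis
      proof (cases "\<eta> p \<le> \<theta> / 2")
        case True
        then have "0 \<le> (?w p)\<^sup>2 * (\<theta> / 4 - \<eta> p / 2)" by (intro mult_nonneg_nonneg) auto
        moreover have "- ?q \<le> 0" by simp
        ultimately have "- ?q \<le> (?w p)\<^sup>2 * (\<theta> / 4 - \<eta> p / 2)" by (rule order_trans[rotated])
        then show ?thesis using False by simp
      next
        case large: False
        have "(?w p)\<^sup>2 \<le> exp (2 * s * (1 - \<theta> / 2))"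
          unfolding w2 exp_le_cancel_iff using large s(2) by (intro mult_left_mono) auto
        moreover have "(?w p)\<^sup>2 * (- (1 / 2)) \<le> (?w p)\<^sup>2 * (\<theta> / 4 - \<eta> p / 2)"
          using rng(2)[of p] th by (intro mult_left_mono) auto
        ultimately show ?thesis using False by simp
      qed
    qed
    then have "lam * (\<theta> / 4 * exp (2 * s) * indicator ?E p - ?q) \<le> lam * ((?w p)\<^sup>2 * (\<theta> / 4 - \<eta> p / 2))"
      using lam by (intro mult_left_mono) auto
    also have "\<dots> = (?w p)\<^sup>2 * (lam * (\<theta> / 4 - \<eta> p / 2))" by (simp add: mult_ac)
    also have "\<dots> \<le> (?w p)\<^sup>2 * (lam * (1 - \<eta> p / 2) - \<mu> - s\<^sup>2 * Gam \<eta> \<eta> p)"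
    proof (rule mult_left_mono)
      have "lam * (\<theta> / 4 - \<eta> p / 2) = lam * (1 - \<eta> p / 2) - (lam * (1 - \<theta> / 2) + lam * (\<theta> / 8)) - lam * (\<theta> / 8)"
        by (simp add: algebra_simps)
      then show "lam * (\<theta> / 4 - \<eta> p / 2) \<le> lam * (1 - \<eta> p / 2) - \<mu> - s\<^sup>2 * Gam \<eta> \<eta> p"
        using s(1)[of p] \<mu> by linarith
    qed simp
    also have "\<dots> = ?H p" unfolding Gam_exp[OF chi] power_mult_distrib by (simp add: algebra_simps)
    finally show ?thesis .
  qed
  have "lam * (\<theta> / 4 * exp (2 * s) * (LINT p|vol. indicator ?E p * (\<phi> p)\<^sup>2) - ?q) =
    (LINT p|vol. lam * (\<theta> / 4 * exp (2 * s) * (indicator ?E p * (\<phi> p)\<^sup>2) - ?q * (\<phi> p)\<^sup>2))"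
    using i f2 n by simp
  also have "\<dots> \<le> (LINT p|vol. ?H p * (\<phi> p)\<^sup>2)"
  proof (rule integral_mono[OF _ j])
    show "integrable vol (\<lambda>p. lam * (\<theta> / 4 * exp (2 * s) * (indicator ?E p * (\<phi> p)\<^sup>2) - ?q * (\<phi> p)\<^sup>2))"
      using i f2 by simp
    show "lam * (\<theta> / 4 * exp (2 * s) * (indicator ?E p * (\<phi> p)\<^sup>2) - ?q * (\<phi> p)\<^sup>2) \<le> ?H p * (\<phi> p)\<^sup>2" for p
    proof -
      have "lam * (\<theta> / 4 * exp (2 * s) * (indicator ?E p * (\<phi> p)\<^sup>2) - ?q * (\<phi> p)\<^sup>2) =
        lam * (\<theta> / 4 * exp (2 * s) * indicator ?E p - ?q) * (\<phi> p)\<^sup>2"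
        by (simp only: left_diff_distrib mult.assoc)
      also have "\<dots> \<le> ?H p * (\<phi> p)\<^sup>2" by (intro mult_right_mono low) simp
      finally show ?thesis .
    qed
  qed
  also have "\<dots> \<le> 0" by (rule Ag[OF w])
  finally have "\<theta> / 4 * exp (2 * s) * (LINT p|vol. indicator ?E p * (\<phi> p)\<^sup>2) \<le> ?q"
    using lam by (simp add: mult_le_0_iff)
  then have "(LINT p|vol. indicator ?E p * (\<phi> p)\<^sup>2) \<le> ?q / (\<theta> / 4 * exp (2 * s))"
    using th by (simp add: pos_le_divide_eq mult.commute)
  also have "?q / (\<theta> / 4 * exp (2 * s)) = 2 / \<theta> * (exp (2 * s * (1 - \<theta> / 2)) / exp (2 * s))"
    using th by (simp add: field_simps)
  also have "exp (2 * s * (1 - \<theta> / 2)) / exp (2 * s) = exp (- (s * \<theta>))"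
    unfolding exp_diff[symmetric] by (simp add: algebra_simps)
  finally show ?thesis .
qed

theorem concentrated_ground_states:
  assumes chi: "smooth_fun A \<eta>" and pos: "\<eta> p0 > 0" and rng: "\<And>p. 0 \<le> \<eta> p" "\<And>p. \<eta> p \<le> 1"
  shows "\<exists>K \<kappa> D. 0 < K \<and> 0 < \<kappa> \<and> 0 < D \<and> (\<forall>lam\<ge>1. \<exists>\<mu> \<phi> X. 0 < \<mu> \<and> \<mu> \<le> D * lam \<and>
    L2 A g \<phi> \<and> is_weak_gradient A g \<phi> X \<and> (LINT p|vol. (\<phi> p)\<^sup>2) = 1 \<and>
    (\<forall>\<psi>. smooth_fun A \<psi> \<longrightarrow> (LINT p|vol. \<phi> p * laplace_beltrami A g \<psi> p) =
      (LINT p|vol. \<phi> p * ((lam * (1 - \<eta> p / 2) - \<mu>) * \<psi> p))) \<and>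
    (LINT p|vol. indicator {p. \<eta> p = 0} p * (\<phi> p)\<^sup>2) \<le> K * exp (- (\<kappa> * sqrt lam)))"
proof -
  obtain \<theta> C0 where th: "0 < \<theta>" "\<theta> \<le> 1" "0 \<le> C0"
    and level: "\<And>lam \<mu>. 0 \<le> form (\<lambda>p. lam * (1 - \<eta> p / 2) - \<mu>) \<eta> \<eta> \<Longrightarrow> \<mu> \<le> C0 + lam * (1 - \<theta> / 2)"
    using ground_state_level[OF chi pos rng] by metis
  obtain G where G: "0 < G" "\<And>p. \<bar>Gam \<eta> \<eta> p\<bar> \<le> G" using continuous_bound[OF continuous_Gam[OF chi chi]] by blast
  \<comment> \<open>With s = c0 sqrt lam, the bound \<open>G\<close> on |\<nabla>\<eta>|^2 makes the
    weight spend exactly lam \<theta> / 8.\<close>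
  define c0 where "c0 = sqrt (\<theta> / (8 * G))"
  have c0: "0 < c0" "c0\<^sup>2 = \<theta> / (8 * G)" using th G by (auto simp: c0_def)
  define \<kappa> where "\<kappa> = c0 * \<theta>"
  \<comment> \<open>From this value on, \<open>C0\<close> is at most lam \<theta> / 8, the part of
    the gap reserved for it.\<close>
  define lam0 where "lam0 = 8 * C0 / \<theta>"
  \<comment> \<open>Below \<open>lam0\<close> the normalisation of \<phi> replaces the decay: the
    second entry makes the claimed bound at least 1 there.\<close>
  define K where "K = max (2 / \<theta>) (exp (\<kappa> * sqrt lam0))"
  have kap: "0 < \<kappa>" using c0 th by (simp add: \<kappa>_def)
  have K: "0 < K" unfolding K_def by (rule less_le_trans[OF exp_gt_zero max.cobounded2])
  have "\<exists>\<mu> \<phi> X. 0 < \<mu> \<and> \<mu> \<le> (C0 + 1) * lam \<and>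
    L2 A g \<phi> \<and> is_weak_gradient A g \<phi> X \<and> (LINT p|vol. (\<phi> p)\<^sup>2) = 1 \<and>
    (\<forall>\<psi>. smooth_fun A \<psi> \<longrightarrow> (LINT p|vol. \<phi> p * laplace_beltrami A g \<psi> p) =
      (LINT p|vol. \<phi> p * ((lam * (1 - \<eta> p / 2) - \<mu>) * \<psi> p))) \<and>
    (LINT p|vol. indicator {p. \<eta> p = 0} p * (\<phi> p)\<^sup>2) \<le> K * exp (- (\<kappa> * sqrt lam))" if lam: "1 \<le> lam" for lam
  proof -
    let ?W = "\<lambda>p. lam * (1 - \<eta> p / 2)"
    have W: "continuous_on UNIV ?W"
      by (intro continuous_on_mult_left continuous_on_diff continuous_on_divide continuous_on_const smooth_fun_continuous chi) simp
    have Wl: "lam * (1 / 2) \<le> ?W p" for p using rng(2)[of p] lam by (intro mult_left_mono) auto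
    have l: "0 < lam * (1 / 2)" using lam by simp
    obtain \<mu> u \<phi> X M where \<mu>l: "lam * (1 / 2) \<le> \<mu>" and sm: "\<forall>k::nat. smooth_fun A (u k)"
      and f: "L2 A g \<phi>" and X: "is_weak_gradient A g \<phi> X"
      and lim: "(\<lambda>k. LINT p|vol. (u k p - \<phi> p)\<^sup>2) \<longlonglongrightarrow> 0" and u1': "\<forall>k. (LINT p|vol. (u k p)\<^sup>2) = 1"
      and M': "\<forall>k. (LINT p|vol. Gam (u k) (u k) p) \<le> M"
      and nn': "\<forall>\<psi>. smooth_fun A \<psi> \<longrightarrow> 0 \<le> form (\<lambda>p. ?W p - \<mu>) \<psi> \<psi>"
      and a0: "(\<lambda>k. form (\<lambda>p. ?W p - \<mu>) (u k) (u k)) \<longlonglongrightarrow> 0"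
      using ground_state[OF W l Wl] by (elim exE conjE)
    note gs = \<mu>l sm[rule_format] and u1 = u1'[rule_format] and M = M'[rule_format] and nn = nn'[rule_format]
    have Z: "continuous_on UNIV (\<lambda>p. ?W p - \<mu>)" by (intro continuous_on_diff W continuous_on_const)
    have n: "(LINT p|vol. (\<phi> p)\<^sup>2) = 1"
    proof -
      have "(\<lambda>k. LINT p|vol. 1 * (u k p)\<^sup>2) \<longlonglongrightarrow> (LINT p|vol. 1 * (\<phi> p)\<^sup>2)"
        by (rule L2_limit_square[OF L2_continuous[OF smooth_fun_continuous[OF gs(2)]] f continuous_on_const lim])
      then have "(\<lambda>k. 1) \<longlonglongrightarrow> (LINT p|vol. (\<phi> p)\<^sup>2)" by (simp add: u1)
      then show ?thesis using LIMSEQ_const_iff by metis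
    qed
    have mu: "\<mu> \<le> C0 + lam * (1 - \<theta> / 2)" by (rule level[OF nn[OF chi]])
    let ?I = "LINT p|vol. indicator {p. \<eta> p = 0} p * (\<phi> p)\<^sup>2"
    have dec: "?I \<le> K * exp (- (\<kappa> * sqrt lam))"
    proof (cases "lam0 \<le> lam")
      case True
      have "?I \<le> 2 / \<theta> * exp (- (sqrt lam * c0 * \<theta>))"
      proof (rule ground_state_decay[OF chi rng f n th(1)])
        show "0 < lam" using lam by simp
        show "(sqrt lam * c0)\<^sup>2 * Gam \<eta> \<eta> p \<le> lam * (\<theta> / 8)" for p
        proof -
          have "(sqrt lam * c0)\<^sup>2 * Gam \<eta> \<eta> p \<le> (sqrt lam * c0)\<^sup>2 * G"
            using G(2)[of p] by (intro mult_left_mono) auto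
          also have "\<dots> = lam * (\<theta> / 8)" using lam G(1) by (simp add: power_mult_distrib c0(2))
          finally show ?thesis .
        qed
        show "0 \<le> sqrt lam * c0" using lam c0 by simp
        have "C0 \<le> lam * (\<theta> / 8)" using True th by (simp add: lam0_def field_simps)
        then show "\<mu> \<le> lam * (1 - \<theta> / 2) + lam * (\<theta> / 8)" using mu by linarith
        show "(LINT p|vol. ((?W p - \<mu>) * (w p)\<^sup>2 - Gam w w p) * (\<phi> p)\<^sup>2) \<le> 0" if "smooth_fun A w" for w
          by (rule Agmon_estimate[OF Z nn gs(2) a0 u1 M f lim that])
      qed
      also have "\<dots> \<le> K * exp (- (sqrt lam * c0 * \<theta>))"
        unfolding K_def by (intro mult_right_mono max.cobounded1) simp
      finally show ?thesis by (simp add: \<kappa>_def mult_ac)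
    next
      case False
      have "?I \<le> (LINT p|vol. (\<phi> p)\<^sup>2)"
      proof (rule integral_mono)
        show "integrable vol (\<lambda>p. (\<phi> p)\<^sup>2)" using f by (simp add: L2_def)
        show "integrable vol (\<lambda>p. indicator {p. \<eta> p = 0} p * (\<phi> p)\<^sup>2)"
          by (rule integrable_indicator_square[OF chi f])
      qed (simp add: indicator_def)
      also have "\<dots> = exp (\<kappa> * sqrt lam) * exp (- (\<kappa> * sqrt lam))" by (simp add: n flip: exp_add)
      also have "\<dots> \<le> exp (\<kappa> * sqrt lam0) * exp (- (\<kappa> * sqrt lam))"
        using False kap by (intro mult_right_mono) auto
      also have "\<dots> \<le> K * exp (- (\<kappa> * sqrt lam))"
        unfolding K_def by (intro mult_right_mono max.cobounded2) simp
      finally show ?thesis .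
    qed
    have "\<mu> \<le> (C0 + 1) * lam"
    proof -
      have "lam * (1 - \<theta> / 2) \<le> lam * 1" using lam th by (intro mult_left_mono) auto
      moreover have "C0 * 1 \<le> C0 * lam" using lam th by (intro mult_left_mono) auto
      ultimately show ?thesis using mu by (simp add: distrib_right)
    qed
    moreover have "0 < \<mu>" using gs(1) lam by simp
    ultimately show ?thesis
      using f X n dec Euler_Lagrange[OF Z nn gs(2) a0 f lim] by (intro exI[of _ \<mu>] exI[of _ \<phi>] exI[of _ X]) simp
  qed
  then show ?thesis using K kap th
    by (intro exI[of _ K] exI[of _ \<kappa>] exI[of _ "C0 + 1"]) simp
qed

section \<open>The potential and the lower bound for the cost\<close>

text \<open>A nonempty open set has positive volume, so a value attained on all of it cannot be
  missed by the essential supremum.\<close>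

lemma esssup_eq_max:
  fixes f :: "'m \<Rightarrow> real"
  assumes f: "continuous_on UNIV f" and le: "\<And>p. \<bar>f p\<bar> \<le> c" and U: "open U" "U \<noteq> {}" "\<And>p. p \<in> U \<Longrightarrow> f p = c"
  shows "esssup vol (\<lambda>p. ereal \<bar>f p\<bar>) = ereal c"
proof (rule antisym)
  have m: "(\<lambda>p. ereal \<bar>f p\<bar>) \<in> borel_measurable vol"
    using continuous_measurable[OF f] by simp
  show "esssup vol (\<lambda>p. ereal \<bar>f p\<bar>) \<le> ereal c"
    by (rule esssup_I[OF m]) (simp add: le)
  show "ereal c \<le> esssup vol (\<lambda>p. ereal \<bar>f p\<bar>)"
  proof (rule ccontr)
    assume "\<not> ereal c \<le> esssup vol (\<lambda>p. ereal \<bar>f p\<bar>)"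
    moreover have "AE p in vol. ereal \<bar>f p\<bar> \<le> esssup vol (\<lambda>p. ereal \<bar>f p\<bar>)" by (rule esssup_AE)
    ultimately have "AE p in vol. ereal \<bar>f p\<bar> < ereal c"
      unfolding not_le by (elim eventually_mono) (rule le_less_trans)
    then have "AE p in vol. p \<notin> U"
    proof (rule eventually_mono)
      fix p assume "ereal \<bar>f p\<bar> < ereal c"
      then show "p \<notin> U" using U(3)[of p] by auto
    qed
    then have "emeasure vol U = 0"
      using U(1) by (subst (asm) AE_iff_measurable[of U]) auto
    then show False using emeasure_vol_open_pos[OF U(1,2)] by simp
  qed
qed

lemma observability_cost_lower_bound:
  assumes b: "continuous_on UNIV b" and b0: "\<And>x. b x \<ge> 0" and cl: "closure {x. b x > 0} \<noteq> (UNIV :: 'm set)"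
  shows "\<exists>V :: 'm \<Rightarrow> real.
    smooth_fun A V \<and> (\<forall>x. V x > 0) \<and> esssup vol (\<lambda>x. ereal \<bar>V x\<bar>) = 1 \<and>
    (\<exists>C>0. \<forall>T>0. \<forall>lam\<ge>1. obs_cost A g b lam V T \<ge> ennreal (C * inverse T * exp (C * sqrt lam)))"
proof -
  obtain p0 where p0: "p0 \<in> - closure {x. b x > 0}" using cl by blast
  have "open (- closure {x. b x > 0})" by (rule open_Compl[OF closed_closure])
  from ex_bump[OF this p0] obtain \<eta> Q where chi: "smooth_fun A \<eta>" and rng: "\<And>p. 0 \<le> \<eta> p" "\<And>p. \<eta> p \<le> 1"
    and pos: "\<eta> p0 > 0" and Q: "compact Q" "Q \<subseteq> - closure {x. b x > 0}" "Q \<noteq> UNIV" "\<And>p. p \<notin> Q \<Longrightarrow> \<eta> p = 0"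
    by (elim exE conjE) blast
  \<comment> \<open>Depth at most 1/2 keeps \<open>V\<close> above 1/2, so the energy is at least
    lam / 4; off the support of the bump \<open>V\<close> is 1, which gives the norm.\<close>
  define V where "V p = 1 - \<eta> p / 2" for p
  have V: "smooth_fun A V"
  proof -
    have "smooth_fun A (\<lambda>p. 1 - (1/2) * \<eta> p)" by (intro smooth_fun_diff smooth_fun_const smooth_fun_cmult chi)
    then show ?thesis unfolding V_def by simp
  qed
  have cV: "continuous_on UNIV V" by (rule smooth_fun_continuous[OF V])
  have Vh: "1 / 2 \<le> V p" "V p \<le> 1" for p using rng[of p] by (auto simp: V_def)
  obtain K \<kappa> D where K: "0 < K" "0 < \<kappa>" "0 < D" and gs: "\<forall>lam\<ge>1. \<exists>\<mu> \<phi> X. 0 < \<mu> \<and> \<mu> \<le> D * lam \<and>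
    L2 A g \<phi> \<and> is_weak_gradient A g \<phi> X \<and> (LINT p|vol. (\<phi> p)\<^sup>2) = 1 \<and>
    (\<forall>\<psi>. smooth_fun A \<psi> \<longrightarrow> (LINT p|vol. \<phi> p * laplace_beltrami A g \<psi> p) =
      (LINT p|vol. \<phi> p * ((lam * V p - \<mu>) * \<psi> p))) \<and>
    (LINT p|vol. indicator {p. \<eta> p = 0} p * (\<phi> p)\<^sup>2) \<le> K * exp (- (\<kappa> * sqrt lam))"
    using concentrated_ground_states[OF chi pos rng] unfolding V_def by (elim exE conjE) blast
  obtain B where B: "0 < B" "\<And>p. \<bar>(b p)\<^sup>2\<bar> \<le> B" using continuous_bound[OF continuous_on_power[OF b]] by blast
  \<comment> \<open>One constant serves both as factor and as rate, hence the minimum. 1 / (4 D B K)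
    is the factor that is left when lam cancels between the energy and the observation.\<close>
  define C where "C = min \<kappa> (1 / (4 * D * B * K))"
  have C: "0 < C" using K B by (simp add: C_def)
  have "ennreal (C * inverse T * exp (C * sqrt lam)) \<le> obs_cost A g b lam V T" if T: "0 < T" and lam: "1 \<le> lam" for T lam
  proof -
    obtain \<mu> \<phi> X where m: "0 < \<mu>" "\<mu> \<le> D * lam" and f: "L2 A g \<phi>" and X: "is_weak_gradient A g \<phi> X"
      and n: "(LINT p|vol. (\<phi> p)\<^sup>2) = 1"
      and eig: "\<forall>\<psi>. smooth_fun A \<psi> \<longrightarrow> (LINT p|vol. \<phi> p * laplace_beltrami A g \<psi> p) =
        (LINT p|vol. \<phi> p * ((lam * V p - \<mu>) * \<psi> p))"
      and dec: "(LINT p|vol. indicator {p. \<eta> p = 0} p * (\<phi> p)\<^sup>2) \<le> K * exp (- (\<kappa> * sqrt lam))"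
      using gs[rule_format, OF lam] by (elim exE conjE)
    let ?I = "B * (K * exp (- (\<kappa> * sqrt lam)))"
    have I: "(LINT p|vol. (b p)\<^sup>2 * (\<phi> p)\<^sup>2) \<le> ?I"
    proof -
      have f2: "integrable vol (\<lambda>p. (\<phi> p)\<^sup>2)" using f by (simp add: L2_def)
      have i: "integrable vol (\<lambda>p. indicator {p. \<eta> p = 0} p * (\<phi> p)\<^sup>2)"
        by (rule integrable_indicator_square[OF chi f])
      have "(LINT p|vol. (b p)\<^sup>2 * (\<phi> p)\<^sup>2) \<le> (LINT p|vol. B * (indicator {p. \<eta> p = 0} p * (\<phi> p)\<^sup>2))"
      proof (rule integral_mono)
        show "integrable vol (\<lambda>p. (b p)\<^sup>2 * (\<phi> p)\<^sup>2)"
          by (rule integrable_bounded_mult[OF f2 _ B(2)])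
            (use continuous_measurable[OF continuous_on_power[OF b]] in simp)
        show "integrable vol (\<lambda>p. B * (indicator {p. \<eta> p = 0} p * (\<phi> p)\<^sup>2))" using i by simp
        fix p
        \<comment> \<open>Where \<eta> is nonzero the point lies in \<open>Q\<close>, off the
          closure of the observed set, so \<open>b\<close> vanishes; elsewhere the bound of
          \<open>b\<close> is used.\<close>
        show "(b p)\<^sup>2 * (\<phi> p)\<^sup>2 \<le> B * (indicator {p. \<eta> p = 0} p * (\<phi> p)\<^sup>2)"
        proof (cases "\<eta> p = 0")
          case True
          then show ?thesis using mult_right_mono[of "(b p)\<^sup>2" B "(\<phi> p)\<^sup>2"] B(2)[of p] by simp
        next
          case False
          then have "p \<in> Q" using Q(4) by blast
          then have "\<not> b p > 0" using Q(2) closure_subset[of "{x. b x > 0}"] by blast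
          then have "b p = 0" using b0[of p] by simp
          then show ?thesis using B by simp
        qed
      qed
      also have "\<dots> \<le> ?I" using dec B by simp
      finally show ?thesis .
    qed
    have e: "0 < ?I" using B K by simp
    have "ennreal ((lam / 2) / (2 * T * \<mu> * ?I)) \<le> obs_cost A g b lam V T"
    proof (rule obs_cost_ge[OF f X n cV m(1) _ _ b T I e])
      show "0 < lam / 2" using lam by simp
      show "lam / 2 \<le> lam * V p" for p using mult_left_mono[OF Vh(1)[of p], of lam] lam by simp
      show "(LINT p|vol. \<phi> p * laplace_beltrami A g \<psi> p) = (LINT p|vol. \<phi> p * ((lam * V p - \<mu>) * \<psi> p))"
        if "smooth_fun A \<psi>" for \<psi> using eig that by blast
    qed
    moreover have "C * inverse T * exp (C * sqrt lam) \<le> (lam / 2) / (2 * T * \<mu> * ?I)"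
    proof -
      have "C * inverse T * exp (C * sqrt lam) \<le> 1 / (4 * D * B * K) * inverse T * exp (\<kappa> * sqrt lam)"
        using T lam C K B by (intro mult_mono) (auto simp: C_def mult_right_mono)
      also have "\<dots> = (lam / 2) / (2 * T * (D * lam) * ?I)"
        using T lam K B by (simp add: field_simps exp_minus)
      also have "\<dots> \<le> (lam / 2) / (2 * T * \<mu> * ?I)"
        using m T lam e K B by (intro divide_left_mono mult_right_mono mult_left_mono mult_pos_pos) auto
      finally show ?thesis .
    qed
    ultimately show ?thesis using ennreal_leI order_trans by blast
  qed
  moreover have "esssup vol (\<lambda>x. ereal \<bar>V x\<bar>) = ereal 1"
  proof (rule esssup_eq_max[OF cV])
    show "\<bar>V p\<bar> \<le> 1" for p using Vh[of p] by simp
    show "open (- Q)" by (rule open_Compl[OF compact_imp_closed[OF Q(1)]])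
    show "- Q \<noteq> {}" using Q(3) by blast
    show "V p = 1" if "p \<in> - Q" for p using Q(4)[of p] that by (simp add: V_def)
  qed
  moreover have "0 < V p" for p using Vh(1)[of p] by linarith
  ultimately show ?thesis using V C by (intro exI[of _ V] conjI allI exI[of _ C] impI) (auto simp: one_ereal_def)
qed

end

theorem proposition1p11:
  fixes A :: "('m::{t2_space, second_countable_topology}, 'n::finite) chart set"
    and g :: "('m, 'n) metric"
    and b :: "'m \<Rightarrow> real"
  assumes "smooth_atlas A"
    and "riemannian_metric A g"
    and "compact (UNIV :: 'm set)"
    and "connected (UNIV :: 'm set)"
    and "continuous_on UNIV b"
    and "\<And>x. b x \<ge> 0"
    and "closure {x. b x > 0} \<noteq> UNIV"
  shows "\<exists>V :: 'm \<Rightarrow> real.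
    smooth_fun A V \<and> (\<forall>x. V x > 0) \<and>
    esssup (riem_volume A g) (\<lambda>x. ereal \<bar>V x\<bar>) = 1 \<and>
    (\<exists>C>0. \<forall>T>0. \<forall>lam\<ge>1.
       obs_cost A g b lam V T \<ge> ennreal (C * inverse T * exp (C * sqrt lam)))"
proof -
  interpret riemannian A g by unfold_locales (rule assms)+
  show ?thesis by (rule observability_cost_lower_bound[OF assms(5-7)])
qed

end
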